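(* Let $p$ be an odd prime, $k$ a perfect ring of characteristic $p$, and $A = W(k)$. View $W_{n+1}\Omega^1_A$ as an $A$-module using the ring homomorphism $s_\varphi: A\to W(A)$. Let $M_0 = \Omega^1_A$, and for every $j \geq 1$ let $M_j = (\Omega^1_A\oplus A)/h_j(A)$ be the cokernel of the $A$-module homomorphism $h_j: A \to \Omega^1_A \oplus A$, $a\mapsto(-da, p^ja)$, with the $A$-module structures given in the context. For every integer $n\geq 2$, the map \[ \prod_{j=0}^{n} M_j \to W_{n+1}\Omega^1_A \] induced by \[ M_0\to W_{n+1}\Omega^1_A,\qquad \alpha_0\mapsto s_\varphi(\alpha_0), \] and, for $1 \le j \le n$, \[ M_j\to W_{n+1}\Omega^1_A,\qquad (\alpha_j,a_j)\mapsto V^j(s_\varphi(\alpha_j)) + dV^j(s_\varphi(a_j)), \] is an isomorphism of $A$-modules.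
   Context: $W$, $W_n$ denote $p$-typical Witt vectors; $\varphi: A\to A$ is the Witt vector Frobenius of $A=W(k)$ (an automorphism). There is a unique ring homomorphism $s_\varphi: A\to W(A)$ with $F\circ s_\varphi = s_\varphi\circ\varphi$ and such that $s_\varphi(a)$ has ghost components $(a,\varphi(a),\varphi^2(a),\ldots)$. Composing with restriction gives $s_\varphi: A\to W_m(A)$ for every $m\ge1$, and hence $A$-module maps $s_\varphi:\Omega^1_A\to\Omega^1_{W_m(A)}\to W_m\Omega^1_A$. $\Omega^1_A$ denotes absolute Kähler differentials; multiplication by $p$ is bijective on $\Omega^1_A$, so $\frac1{p^j}z$ makes sense for $z\in\Omega^1_A$. The $A$-module structure on $\Omega^1_A\oplus A$ used to define $M_j$ ($j\ge1$) has componentwise addition and \[ x\cdot(\alpha,a) = \left(\varphi^j(x)\alpha - \tfrac{1}{p^j}\,a\,d\varphi^j(x),\ \varphi^j(x)a\right); \] the source $A$ of $h_j$ is an $A$-module via $\varphi^j$. $M_0=\Omega^1_A$ has its usual structure. A Witt complex over a $\mathbf{Z}_{(p)}$-algebra $R$ ($p$ odd) consists of: (i) a pro-differential graded ring $E^{\bullet}_{\cdot} = (E_n^{\bullet})_{n \ge 1}$ (each $E_n^\bullet$ a graded-commutative differential graded ring in non-negative degrees, with restriction maps $E_{n+1}^\bullet \to E_n^\bullet$) and a strict map of pro-rings $\lambda: W_{\cdot}(R) \to E^0_{\cdot}$; (ii) a strict map of pro-graded rings $F: E_{\cdot}^{\bullet} \to E_{\cdot-1}^{\bullet}$ with $F\lambda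 = \lambda F$ and $F d\lambda([r]) = \lambda([r]^{p-1})\, d\lambda([r])$ for all $r \in R$; (iii) a strict map of graded $E_{\cdot}^{\bullet}$-modules $V: F_*E_{\cdot-1}^{\bullet} \to E_{\cdot}^{\bullet}$ (i.e. additive with $V(F(\omega)\eta) = \omega V(\eta)$, and similarly on the right) with $V\lambda = \lambda V$, $FdV = d$, $FV = p$. "Strict" means commuting with the restriction maps. The de Rham-Witt complex $W_{\cdot}\Omega^{\bullet}_R$ is the initial object in the category of Witt complexes over $R$; $W_n\Omega^d_R$ is its level $n$, degree $d$ component, and $W_n\Omega^0_R = W_n(R)$. *)

theory Defs
  imports
    "HOL-Algebra.Module"
    "HOL-Algebra.AbelCoset"
    "HOL-Library.Poly_Mapping"
    "HOL-Computational_Algebra.Primes"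
begin

section \<open>Witt vectors\<close>

text \<open>
  Integer polynomials in variables of type \<open>'v\<close>: monomials are finitely supported exponent
  functions.
\<close>

type_synonym 'v zpoly = "('v \<Rightarrow>\<^sub>0 nat) \<Rightarrow>\<^sub>0 int"

definition zvar :: "'v \<Rightarrow> 'v zpoly" where
  "zvar v = Poly_Mapping.single (Poly_Mapping.single v 1) 1"

definition zeval :: "('a, 'm) ring_scheme \<Rightarrow> ('v \<Rightarrow> 'a) \<Rightarrow> 'v zpoly \<Rightarrow> 'a" where
  "zeval R v P =
     (\<Oplus>\<^bsub>R\<^esub>m\<in>Poly_Mapping.keys P.
        add_pow R (Poly_Mapping.lookup P m)
          (\<Otimes>\<^bsub>R\<^esub>i\<in>Poly_Mapping.keys m. v i [^]\<^bsub>R\<^esub> Poly_Mapping.lookup m i))"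

definition ghost_poly :: "nat \<Rightarrow> nat \<Rightarrow> (nat \<Rightarrow> 'v zpoly) \<Rightarrow> 'v zpoly" where
  "ghost_poly p n X = (\<Sum>i\<le>n. of_nat (p ^ i) * X i ^ (p ^ (n - i)))"

text \<open>The unique sequence of integer polynomials with prescribed ghost components.\<close>

definition witt_polys :: "nat \<Rightarrow> (nat \<Rightarrow> 'v zpoly) \<Rightarrow> nat \<Rightarrow> 'v zpoly" where
  "witt_polys p \<Phi> = (THE S. \<forall>n. ghost_poly p n S = \<Phi> n)"

definition witt_add_polys :: "nat \<Rightarrow> nat \<Rightarrow> (nat + nat) zpoly" where
  "witt_add_polys p =
     witt_polys p (\<lambda>n. ghost_poly p n (\<lambda>i. zvar (Inl i)) + ghost_poly p n (\<lambda>i. zvar (Inr i)))"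

definition witt_mult_polys :: "nat \<Rightarrow> nat \<Rightarrow> (nat + nat) zpoly" where
  "witt_mult_polys p =
     witt_polys p (\<lambda>n. ghost_poly p n (\<lambda>i. zvar (Inl i)) * ghost_poly p n (\<lambda>i. zvar (Inr i)))"

definition witt_frob_polys :: "nat \<Rightarrow> nat \<Rightarrow> nat zpoly" where
  "witt_frob_polys p = witt_polys p (\<lambda>n. ghost_poly p (Suc n) zvar)"

text \<open>
  \<open>witt_ring p J R\<close> is \<open>W(R)\<close> for \<open>J = UNIV\<close> and \<open>W\<^sub>n(R)\<close> for \<open>J = {..<n}\<close>; in particular
  \<open>W\<^sub>0(R)\<close> is the zero ring. Restriction maps are given by \<^const>\<open>restrict\<close>.
\<close>

definition witt_ring :: "nat \<Rightarrow> nat set \<Rightarrow> ('a, 'm) ring_scheme \<Rightarrow> (nat \<Rightarrow> 'a) ring" where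
  "witt_ring p J R =
     \<lparr>carrier = J \<rightarrow>\<^sub>E carrier R,
      monoid.mult = (\<lambda>x y. \<lambda>i\<in>J. zeval R (case_sum x y) (witt_mult_polys p i)),
      one = (\<lambda>i\<in>J. if i = 0 then \<one>\<^bsub>R\<^esub> else \<zero>\<^bsub>R\<^esub>),
      zero = (\<lambda>i\<in>J. \<zero>\<^bsub>R\<^esub>),
      add = (\<lambda>x y. \<lambda>i\<in>J. zeval R (case_sum x y) (witt_add_polys p i))\<rparr>"

definition witt_ghost :: "nat \<Rightarrow> ('a, 'm) ring_scheme \<Rightarrow> nat \<Rightarrow> (nat \<Rightarrow> 'a) \<Rightarrow> 'a" where
  "witt_ghost p R n x = (\<Oplus>\<^bsub>R\<^esub>i\<in>{..n}. add_pow R (p ^ i) (x i [^]\<^bsub>R\<^esub> (p ^ (n - i))))"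

definition teichmueller :: "nat set \<Rightarrow> ('a, 'm) ring_scheme \<Rightarrow> 'a \<Rightarrow> nat \<Rightarrow> 'a" where
  "teichmueller J R r = (\<lambda>i\<in>J. if i = 0 then r else \<zero>\<^bsub>R\<^esub>)"

text \<open>
  In the next two definitions \<open>J\<close> is the index set of the result: \<open>F\<close> maps \<open>W\<^sub>n\<^sub>+\<^sub>1(R)\<close> to
  \<open>W\<^sub>n(R)\<close> (\<open>J = {..<n}\<close>) and \<open>V\<close> maps \<open>W\<^sub>n(R)\<close> to \<open>W\<^sub>n\<^sub>+\<^sub>1(R)\<close> (\<open>J = {..<Suc n}\<close>).
\<close>

definition witt_frob :: "nat \<Rightarrow> nat set \<Rightarrow> ('a, 'm) ring_scheme \<Rightarrow> (nat \<Rightarrow> 'a) \<Rightarrow> nat \<Rightarrow> 'a" where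
  "witt_frob p J R x = (\<lambda>i\<in>J. zeval R x (witt_frob_polys p i))"

definition witt_ver :: "nat set \<Rightarrow> ('a, 'm) ring_scheme \<Rightarrow> (nat \<Rightarrow> 'a) \<Rightarrow> nat \<Rightarrow> 'a" where
  "witt_ver J R x = (\<lambda>i\<in>J. if i = 0 then \<zero>\<^bsub>R\<^esub> else x (i - 1))"

text \<open>A perfect ring of characteristic \<open>p\<close>; the zero ring is not excluded.\<close>

definition perfect_ring :: "nat \<Rightarrow> ('a, 'm) ring_scheme \<Rightarrow> bool" where
  "perfect_ring p k \<longleftrightarrow>
     cring k \<and> add_pow k p \<one>\<^bsub>k\<^esub> = \<zero>\<^bsub>k\<^esub> \<and> bij_betw (\<lambda>x. x [^]\<^bsub>k\<^esub> p) (carrier k) (carrier k)"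

text \<open>The homomorphism \<open>s\<^sub>\<phi> : A \<rightarrow> W(A)\<close> attached to an endomorphism \<open>\<phi>\<close> of \<open>A\<close>.\<close>

definition witt_section ::
    "nat \<Rightarrow> ('a, 'm) ring_scheme \<Rightarrow> ('a \<Rightarrow> 'a) \<Rightarrow> 'a \<Rightarrow> nat \<Rightarrow> 'a" where
  "witt_section p A \<phi> =
     (THE s. s \<in> ring_hom A (witt_ring p UNIV A) \<and> s \<in> extensional (carrier A) \<and>
        (\<forall>a\<in>carrier A. witt_frob p UNIV A (s a) = s (\<phi> a)) \<and>
        (\<forall>a\<in>carrier A. \<forall>n. witt_ghost p A n (s a) = (\<phi> ^^ n) a))"


section \<open>Modules and Kaehler differentials\<close>

text \<open>
  As usual in HOL-Algebra, the fields \<^const>\<open>monoid.mult\<close> and \<^const>\<open>monoid.one\<close> of a module record carry no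
  information.
\<close>

definition quot_module :: "('a, 'b, 'm) module_scheme \<Rightarrow> 'b set \<Rightarrow> ('a, 'b set) module" where
  "quot_module M H =
     \<lparr>carrier = a_rcosets\<^bsub>M\<^esub> H, monoid.mult = undefined, one = undefined, zero = H,
      add = set_add M, smult = (\<lambda>x C. \<Union>m\<in>C. H +>\<^bsub>M\<^esub> (x \<odot>\<^bsub>M\<^esub> m))\<rparr>"

definition pair_module ::
    "('a, 'b, 'm) module_scheme \<Rightarrow> ('a, 'c, 'n) module_scheme \<Rightarrow> ('a, 'b \<times> 'c) module" where
  "pair_module M N =
     \<lparr>carrier = carrier M \<times> carrier N, monoid.mult = undefined, one = undefined,
      zero = (\<zero>\<^bsub>M\<^esub>, \<zero>\<^bsub>N\<^esub>),
      add = (\<lambda>x y. (fst x \<oplus>\<^bsub>M\<^esub> fst y, snd x \<oplus>\<^bsub>N\<^esub> snd y)),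
      smult = (\<lambda>r x. (r \<odot>\<^bsub>M\<^esub> fst x, r \<odot>\<^bsub>N\<^esub> snd x))\<rparr>"

definition pi_module ::
    "'i set \<Rightarrow> ('i \<Rightarrow> ('a, 'b, 'm) module_scheme) \<Rightarrow> ('a, 'i \<Rightarrow> 'b) module" where
  "pi_module I M =
     \<lparr>carrier = (\<Pi>\<^sub>E i\<in>I. carrier (M i)), monoid.mult = undefined, one = undefined,
      zero = (\<lambda>i\<in>I. \<zero>\<^bsub>M i\<^esub>),
      add = (\<lambda>x y. \<lambda>i\<in>I. x i \<oplus>\<^bsub>M i\<^esub> y i),
      smult = (\<lambda>r x. \<lambda>i\<in>I. r \<odot>\<^bsub>M i\<^esub> x i)\<rparr>"

definition module_iso ::
    "('a, 'r) ring_scheme \<Rightarrow> ('a, 'b, 'm) module_scheme \<Rightarrow> ('a, 'c, 'n) module_scheme \<Rightarrow>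
     ('b \<Rightarrow> 'c) \<Rightarrow> bool" where
  "module_iso R M N f \<longleftrightarrow>
     module R M \<and> module R N \<and> bij_betw f (carrier M) (carrier N) \<and>
     (\<forall>x\<in>carrier M. \<forall>y\<in>carrier M. f (x \<oplus>\<^bsub>M\<^esub> y) = f x \<oplus>\<^bsub>N\<^esub> f y) \<and>
     (\<forall>r\<in>carrier R. \<forall>x\<in>carrier M. f (r \<odot>\<^bsub>M\<^esub> x) = r \<odot>\<^bsub>N\<^esub> f x)"

definition free_module :: "('a, 'm) ring_scheme \<Rightarrow> 'b set \<Rightarrow> ('a, 'b \<Rightarrow> 'a) module" where
  "free_module R S =
     \<lparr>carrier = {f. (\<forall>b. f b \<in> carrier R) \<and> (\<forall>b. b \<notin> S \<longrightarrow> f b = \<zero>\<^bsub>R\<^esub>) \<and> finite {b. f b \<noteq> \<zero>\<^bsub>R\<^esub>}},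
      monoid.mult = undefined, one = undefined,
      zero = (\<lambda>b. \<zero>\<^bsub>R\<^esub>),
      add = (\<lambda>f g b. f b \<oplus>\<^bsub>R\<^esub> g b),
      smult = (\<lambda>r f b. r \<otimes>\<^bsub>R\<^esub> f b)\<rparr>"

definition free_gen :: "('a, 'm) ring_scheme \<Rightarrow> 'b \<Rightarrow> 'b \<Rightarrow> 'a" where
  "free_gen R b = (\<lambda>c. if c = b then \<one>\<^bsub>R\<^esub> else \<zero>\<^bsub>R\<^esub>)"

definition submodule_span ::
    "('a, 'm) ring_scheme \<Rightarrow> ('a, 'b, 'n) module_scheme \<Rightarrow> 'b set \<Rightarrow> 'b set" where
  "submodule_span R M X = \<Inter>{N. submodule N R M \<and> X \<subseteq> N}"

text \<open>
  Absolute Kaehler differentials: the free \<open>R\<close>-module on symbols \<open>db\<close> (\<open>b \<in> R\<close>) modulo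
  \<open>d(a + b) - da - db\<close> and \<open>d(ab) - a db - b da\<close>.
\<close>

definition kaehler_rels :: "('a, 'm) ring_scheme \<Rightarrow> ('a \<Rightarrow> 'a) set" where
  "kaehler_rels R =
     (let P = free_module R (carrier R); \<delta> = free_gen R in
      {\<delta> (a \<oplus>\<^bsub>R\<^esub> b) \<ominus>\<^bsub>P\<^esub> \<delta> a \<ominus>\<^bsub>P\<^esub> \<delta> b | a b. a \<in> carrier R \<and> b \<in> carrier R} \<union>
      {\<delta> (a \<otimes>\<^bsub>R\<^esub> b) \<ominus>\<^bsub>P\<^esub> a \<odot>\<^bsub>P\<^esub> \<delta> b \<ominus>\<^bsub>P\<^esub> b \<odot>\<^bsub>P\<^esub> \<delta> a | a b. a \<in> carrier R \<and> b \<in> carrier R})"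

definition kaehler_sub :: "('a, 'm) ring_scheme \<Rightarrow> ('a \<Rightarrow> 'a) set" where
  "kaehler_sub R = submodule_span R (free_module R (carrier R)) (kaehler_rels R)"

definition kaehler :: "('a, 'm) ring_scheme \<Rightarrow> ('a, ('a \<Rightarrow> 'a) set) module" where
  "kaehler R = quot_module (free_module R (carrier R)) (kaehler_sub R)"

definition kaehler_d :: "('a, 'm) ring_scheme \<Rightarrow> 'a \<Rightarrow> ('a \<Rightarrow> 'a) set" where
  "kaehler_d R b = kaehler_sub R +>\<^bsub>free_module R (carrier R)\<^esub> free_gen R b"

text \<open>
  For a ring homomorphism \<open>\<rho> : R \<rightarrow> S\<close>, an \<open>S\<close>-module \<open>N\<close> and a derivation \<open>D : R \<rightarrow> N\<close> over
  \<open>\<rho>\<close>, the induced additive map \<open>\<Omega>\<^sup>1\<^sub>R \<rightarrow> N\<close>, \<open>a db \<mapsto> \<rho>(a) D(b)\<close>.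
\<close>

definition kaehler_map ::
    "('a, 'm) ring_scheme \<Rightarrow> ('a \<Rightarrow> 's) \<Rightarrow> ('a \<Rightarrow> 'b) \<Rightarrow> ('s, 'b, 'n) module_scheme \<Rightarrow>
     ('a \<Rightarrow> 'a) set \<Rightarrow> 'b" where
  "kaehler_map R \<rho> D N C =
     the_elem ((\<lambda>f. \<Oplus>\<^bsub>N\<^esub>b\<in>{b\<in>carrier R. f b \<noteq> \<zero>\<^bsub>R\<^esub>}. \<rho> (f b) \<odot>\<^bsub>N\<^esub> D b) ` C)"

text \<open>\<open>(1/m) z\<close> in an abelian group on which multiplication by \<open>m\<close> is bijective.\<close>

definition divide_nat :: "('b, 'm) ring_scheme \<Rightarrow> nat \<Rightarrow> 'b \<Rightarrow> 'b" where
  "divide_nat M m z = (THE y. y \<in> carrier M \<and> add_pow M m y = z)"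


section \<open>Witt complexes\<close>

text \<open>
  The data of a Witt complex over a ring with elements in \<open>'a\<close>. The component \<open>E\<^sub>n\<^sup>q\<close> is
  \<open>cmp E n q\<close>, of which only the additive group is used; \<open>mul E n q r\<close> is the product
  \<open>E\<^sub>n\<^sup>q \<times> E\<^sub>n\<^sup>r \<rightarrow> E\<^sub>n\<^sup>q\<^sup>+\<^sup>r\<close>. The maps \<open>res E n q\<close> and \<open>fro E n q\<close> go from \<open>E\<^sub>n\<^sub>+\<^sub>1\<^sup>q\<close> to \<open>E\<^sub>n\<^sup>q\<close>,
  and \<open>ver E n q\<close> goes from \<open>E\<^sub>n\<^sup>q\<close> to \<open>E\<^sub>n\<^sub>+\<^sub>1\<^sup>q\<close>. A level \<open>E\<^sub>0 = 0\<close> is added to the levels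
  \<open>n \<ge> 1\<close>; this is the convention that gives a meaning to the pro-object \<open>E\<^sub>\<cdot>\<^sub>-\<^sub>1\<close> at level 1.
\<close>

record ('a, 'u) witt_data =
  cmp :: "nat \<Rightarrow> nat \<Rightarrow> 'u ring"
  mul :: "nat \<Rightarrow> nat \<Rightarrow> nat \<Rightarrow> 'u \<Rightarrow> 'u \<Rightarrow> 'u"
  unt :: "nat \<Rightarrow> 'u"
  dif :: "nat \<Rightarrow> nat \<Rightarrow> 'u \<Rightarrow> 'u"
  res :: "nat \<Rightarrow> nat \<Rightarrow> 'u \<Rightarrow> 'u"
  lam :: "nat \<Rightarrow> (nat \<Rightarrow> 'a) \<Rightarrow> 'u"
  fro :: "nat \<Rightarrow> nat \<Rightarrow> 'u \<Rightarrow> 'u"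
  ver :: "nat \<Rightarrow> nat \<Rightarrow> 'u \<Rightarrow> 'u"

abbreviation elts :: "('a, 'u) witt_data \<Rightarrow> nat \<Rightarrow> nat \<Rightarrow> 'u set" where
  "elts E n q \<equiv> carrier (cmp E n q)"

definition deg0_ring :: "('a, 'u) witt_data \<Rightarrow> nat \<Rightarrow> 'u ring" where
  "deg0_ring E n = (cmp E n 0)\<lparr>monoid.mult := mul E n 0 0, one := unt E n\<rparr>"

definition sgn_pow :: "('u, 'm) ring_scheme \<Rightarrow> nat \<Rightarrow> 'u \<Rightarrow> 'u" where
  "sgn_pow G m x = (if even m then x else \<ominus>\<^bsub>G\<^esub> x)"

locale pro_dg_ring =
  fixes E :: "('a, 'u) witt_data"
  assumes abelian_group_cmp: "abelian_group (cmp E n q)"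
    and level0: "elts E 0 q = {\<zero>\<^bsub>cmp E 0 q\<^esub>}"
    and mul_closed: "x \<in> elts E n q \<Longrightarrow> y \<in> elts E n r \<Longrightarrow> mul E n q r x y \<in> elts E n (q + r)"
    and mul_l_distr: "x \<in> elts E n q \<Longrightarrow> y \<in> elts E n q \<Longrightarrow> z \<in> elts E n r \<Longrightarrow>
      mul E n q r (x \<oplus>\<^bsub>cmp E n q\<^esub> y) z = mul E n q r x z \<oplus>\<^bsub>cmp E n (q + r)\<^esub> mul E n q r y z"
    and mul_r_distr: "x \<in> elts E n q \<Longrightarrow> y \<in> elts E n r \<Longrightarrow> z \<in> elts E n r \<Longrightarrow>
      mul E n q r x (y \<oplus>\<^bsub>cmp E n r\<^esub> z) = mul E n q r x y \<oplus>\<^bsub>cmp E n (q + r)\<^esub> mul E n q r x z"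
    and mul_assoc: "x \<in> elts E n q \<Longrightarrow> y \<in> elts E n r \<Longrightarrow> z \<in> elts E n t \<Longrightarrow>
      mul E n (q + r) t (mul E n q r x y) z = mul E n q (r + t) x (mul E n r t y z)"
    and unt_closed: "unt E n \<in> elts E n 0"
    and unt_l: "x \<in> elts E n q \<Longrightarrow> mul E n 0 q (unt E n) x = x"
    and unt_r: "x \<in> elts E n q \<Longrightarrow> mul E n q 0 x (unt E n) = x"
    and graded_comm: "x \<in> elts E n q \<Longrightarrow> y \<in> elts E n r \<Longrightarrow>
      mul E n q r x y = sgn_pow (cmp E n (q + r)) (q * r) (mul E n r q y x)"
    and dif_closed: "x \<in> elts E n q \<Longrightarrow> dif E n q x \<in> elts E n (q + 1)"
    and dif_add: "x \<in> elts E n q \<Longrightarrow> y \<in> elts E n q \<Longrightarrow>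
      dif E n q (x \<oplus>\<^bsub>cmp E n q\<^esub> y) = dif E n q x \<oplus>\<^bsub>cmp E n (q + 1)\<^esub> dif E n q y"
    and dif_mul: "x \<in> elts E n q \<Longrightarrow> y \<in> elts E n r \<Longrightarrow>
      dif E n (q + r) (mul E n q r x y) =
        mul E n (q + 1) r (dif E n q x) y \<oplus>\<^bsub>cmp E n (q + r + 1)\<^esub>
        sgn_pow (cmp E n (q + r + 1)) q (mul E n q (r + 1) x (dif E n r y))"
    and dif_dif: "x \<in> elts E n q \<Longrightarrow> dif E n (q + 1) (dif E n q x) = \<zero>\<^bsub>cmp E n (q + 2)\<^esub>"
    and res_closed: "x \<in> elts E (n + 1) q \<Longrightarrow> res E n q x \<in> elts E n q"
    and res_add: "x \<in> elts E (n + 1) q \<Longrightarrow> y \<in> elts E (n + 1) q \<Longrightarrow>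
      res E n q (x \<oplus>\<^bsub>cmp E (n + 1) q\<^esub> y) = res E n q x \<oplus>\<^bsub>cmp E n q\<^esub> res E n q y"
    and res_mul: "x \<in> elts E (n + 1) q \<Longrightarrow> y \<in> elts E (n + 1) r \<Longrightarrow>
      res E n (q + r) (mul E (n + 1) q r x y) = mul E n q r (res E n q x) (res E n r y)"
    and res_unt: "res E n 0 (unt E (n + 1)) = unt E n"
    and res_dif: "x \<in> elts E (n + 1) q \<Longrightarrow>
      res E n (q + 1) (dif E (n + 1) q x) = dif E n q (res E n q x)"

locale witt_complex = pro_dg_ring E
  for p :: nat and R :: "('a, 'm) ring_scheme" and E :: "('a, 'u) witt_data" +
  assumes cring_R: "cring R"
    and lam_hom: "lam E n \<in> ring_hom (witt_ring p {..<n} R) (deg0_ring E n)"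
    and res_lam: "w \<in> carrier (witt_ring p {..<n + 1} R) \<Longrightarrow>
      res E n 0 (lam E (n + 1) w) = lam E n (restrict w {..<n})"
    and fro_closed: "x \<in> elts E (n + 1) q \<Longrightarrow> fro E n q x \<in> elts E n q"
    and fro_add: "x \<in> elts E (n + 1) q \<Longrightarrow> y \<in> elts E (n + 1) q \<Longrightarrow>
      fro E n q (x \<oplus>\<^bsub>cmp E (n + 1) q\<^esub> y) = fro E n q x \<oplus>\<^bsub>cmp E n q\<^esub> fro E n q y"
    and fro_mul: "x \<in> elts E (n + 1) q \<Longrightarrow> y \<in> elts E (n + 1) r \<Longrightarrow>
      fro E n (q + r) (mul E (n + 1) q r x y) = mul E n q r (fro E n q x) (fro E n r y)"
    and fro_unt: "fro E n 0 (unt E (n + 1)) = unt E n"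
    and fro_res: "x \<in> elts E (n + 2) q \<Longrightarrow>
      fro E n q (res E (n + 1) q x) = res E n q (fro E (n + 1) q x)"
    and fro_lam: "w \<in> carrier (witt_ring p {..<n + 1} R) \<Longrightarrow>
      fro E n 0 (lam E (n + 1) w) = lam E n (witt_frob p {..<n} R w)"
    and fro_dif_teich: "a \<in> carrier R \<Longrightarrow>
      fro E n 1 (dif E (n + 1) 0 (lam E (n + 1) (teichmueller {..<n + 1} R a))) =
        mul E n 0 1 (lam E n (teichmueller {..<n} R a [^]\<^bsub>witt_ring p {..<n} R\<^esub> (p - 1)))
          (dif E n 0 (lam E n (teichmueller {..<n} R a)))"
    and ver_closed: "x \<in> elts E n q \<Longrightarrow> ver E n q x \<in> elts E (n + 1) q"
    and ver_add: "x \<in> elts E n q \<Longrightarrow> y \<in> elts E n q \<Longrightarrow>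
      ver E n q (x \<oplus>\<^bsub>cmp E n q\<^esub> y) = ver E n q x \<oplus>\<^bsub>cmp E (n + 1) q\<^esub> ver E n q y"
    and ver_mul_l: "x \<in> elts E (n + 1) q \<Longrightarrow> y \<in> elts E n r \<Longrightarrow>
      ver E n (q + r) (mul E n q r (fro E n q x) y) = mul E (n + 1) q r x (ver E n r y)"
    and ver_mul_r: "x \<in> elts E n q \<Longrightarrow> y \<in> elts E (n + 1) r \<Longrightarrow>
      ver E n (q + r) (mul E n q r x (fro E n r y)) = mul E (n + 1) q r (ver E n q x) y"
    and ver_res: "x \<in> elts E (n + 1) q \<Longrightarrow>
      ver E n q (res E n q x) = res E (n + 1) q (ver E (n + 1) q x)"
    and ver_lam: "w \<in> carrier (witt_ring p {..<n} R) \<Longrightarrow>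
      ver E n 0 (lam E n w) = lam E (n + 1) (witt_ver {..<n + 1} R w)"
    and fro_dif_ver: "x \<in> elts E n q \<Longrightarrow> fro E n (q + 1) (dif E (n + 1) q (ver E n q x)) = dif E n q x"
    and fro_ver: "x \<in> elts E n q \<Longrightarrow> fro E n q (ver E n q x) = add_pow (cmp E n q) p x"

definition witt_complex_hom ::
    "nat \<Rightarrow> ('a, 'm) ring_scheme \<Rightarrow> ('a, 'u) witt_data \<Rightarrow> ('a, 'v) witt_data \<Rightarrow>
     (nat \<Rightarrow> nat \<Rightarrow> 'u \<Rightarrow> 'v) \<Rightarrow> bool" where
  "witt_complex_hom p R E E' f \<longleftrightarrow>
     (\<forall>n q. \<forall>x\<in>elts E n q. f n q x \<in> elts E' n q) \<and>
     (\<forall>n q. \<forall>x\<in>elts E n q. \<forall>y\<in>elts E n q.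
        f n q (x \<oplus>\<^bsub>cmp E n q\<^esub> y) = f n q x \<oplus>\<^bsub>cmp E' n q\<^esub> f n q y) \<and>
     (\<forall>n q r. \<forall>x\<in>elts E n q. \<forall>y\<in>elts E n r.
        f n (q + r) (mul E n q r x y) = mul E' n q r (f n q x) (f n r y)) \<and>
     (\<forall>n. f n 0 (unt E n) = unt E' n) \<and>
     (\<forall>n q. \<forall>x\<in>elts E n q. f n (q + 1) (dif E n q x) = dif E' n q (f n q x)) \<and>
     (\<forall>n q. \<forall>x\<in>elts E (n + 1) q. f n q (res E n q x) = res E' n q (f (n + 1) q x)) \<and>
     (\<forall>n. \<forall>x\<in>carrier (witt_ring p {..<n} R). f n 0 (lam E n x) = lam E' n x) \<and>
     (\<forall>n q. \<forall>x\<in>elts E (n + 1) q. f n q (fro E n q x) = fro E' n q (f (n + 1) q x)) \<and>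
     (\<forall>n q. \<forall>x\<in>elts E n q. f (n + 1) q (ver E n q x) = ver E' n q (f n q x))"

text \<open>
  \<open>E\<close> is a de Rham-Witt complex of \<open>R\<close>, i.e. initial among the Witt complexes over \<open>R\<close>.
  Since HOL cannot quantify over types inside a formula, initiality is tested on the Witt
  complexes with elements in the type \<open>'u\<close>, which is required to be infinite and at least as
  large as \<open>'a\<close>. Such a type contains a copy of the initial object of the category of all
  Witt complexes (its components are generated by the rings \<open>W\<^sub>n(R)\<close> under countably many
  finitary operations), so that the objects described here are exactly the copies of that
  initial object in \<open>'u\<close>.
\<close>

definition is_de_rham_witt ::
    "nat \<Rightarrow> ('a, 'm) ring_scheme \<Rightarrow> ('a, 'u) witt_data \<Rightarrow> bool" where
  "is_de_rham_witt p R E \<longleftrightarrow>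
     infinite (UNIV :: 'u set) \<and> (\<exists>\<iota> :: 'a \<Rightarrow> 'u. inj \<iota>) \<and>
     witt_complex p R E \<and>
     (\<forall>E' :: ('a, 'u) witt_data. witt_complex p R E' \<longrightarrow>
        (\<exists>f. witt_complex_hom p R E E' f \<and>
          (\<forall>g. witt_complex_hom p R E E' g \<longrightarrow> (\<forall>n q. \<forall>x\<in>elts E n q. g n q x = f n q x))))"

primrec ver_pow :: "('a, 'u) witt_data \<Rightarrow> nat \<Rightarrow> nat \<Rightarrow> nat \<Rightarrow> 'u \<Rightarrow> 'u" where
  "ver_pow E m q 0 x = x"
| "ver_pow E m q (Suc j) x = ver E (m + j) q (ver_pow E m q j x)"

text \<open>\<open>E\<^sub>m\<^sup>1\<close> as a module over a ring \<open>S\<close> by means of a ring homomorphism \<open>\<rho> : S \<rightarrow> E\<^sub>m\<^sup>0\<close>.\<close>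

definition deg1_module :: "('a, 'u) witt_data \<Rightarrow> nat \<Rightarrow> ('s \<Rightarrow> 'u) \<Rightarrow> ('s, 'u) module" where
  "deg1_module E m \<rho> =
     \<lparr>carrier = elts E m 1, monoid.mult = undefined, one = undefined, zero = \<zero>\<^bsub>cmp E m 1\<^esub>,
      add = (\<oplus>\<^bsub>cmp E m 1\<^esub>), smult = (\<lambda>x. mul E m 0 1 (\<rho> x))\<rparr>"


section \<open>The modules and maps for \<open>A = W(k)\<close>\<close>

context
  fixes p :: nat and k :: "('k, 'm) ring_scheme"
begin

definition Wk :: "(nat \<Rightarrow> 'k) ring" where
  "Wk = witt_ring p UNIV k"

definition Wk_frob :: "(nat \<Rightarrow> 'k) \<Rightarrow> nat \<Rightarrow> 'k" where
  "Wk_frob = witt_frob p UNIV k"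

definition Wk_Omega :: "(nat \<Rightarrow> 'k, ((nat \<Rightarrow> 'k) \<Rightarrow> nat \<Rightarrow> 'k) set) module" where
  "Wk_Omega = kaehler Wk"

text \<open>\<open>s\<^sub>\<phi> : A \<rightarrow> W\<^sub>m(A)\<close>\<close>

definition s_phi :: "nat \<Rightarrow> (nat \<Rightarrow> 'k) \<Rightarrow> nat \<Rightarrow> nat \<Rightarrow> 'k" where
  "s_phi m a = restrict (witt_section p Wk Wk_frob a) {..<m}"

text \<open>\<open>s\<^sub>\<phi> : \<Omega>\<^sup>1\<^sub>A \<rightarrow> \<Omega>\<^sup>1\<close> of \<open>W\<^sub>m(A)\<close>, followed by the canonical map to \<open>E\<^sub>m\<^sup>1\<close>\<close>

definition s_phi_Omega ::
    "(nat \<Rightarrow> 'k, 'u) witt_data \<Rightarrow> nat \<Rightarrow> ((nat \<Rightarrow> 'k) \<Rightarrow> nat \<Rightarrow> 'k) set \<Rightarrow> 'u" where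
  "s_phi_Omega E m \<alpha> =
     (let WmA = witt_ring p {..<m} Wk in
      kaehler_map WmA (\<lambda>x. x) (\<lambda>x. dif E m 0 (lam E m x)) (deg1_module E m (lam E m))
        (kaehler_map Wk (s_phi m) (\<lambda>b. kaehler_d WmA (s_phi m b)) (kaehler WmA) \<alpha>))"

text \<open>\<open>\<Omega>\<^sup>1\<^sub>A \<oplus> A\<close> with the twisted \<open>A\<close>-module structure\<close>

definition twisted_module ::
    "nat \<Rightarrow> (nat \<Rightarrow> 'k, ((nat \<Rightarrow> 'k) \<Rightarrow> nat \<Rightarrow> 'k) set \<times> (nat \<Rightarrow> 'k)) module" where
  "twisted_module j =
     \<lparr>carrier = carrier Wk_Omega \<times> carrier Wk, monoid.mult = undefined, one = undefined,
      zero = (\<zero>\<^bsub>Wk_Omega\<^esub>, \<zero>\<^bsub>Wk\<^esub>),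
      add = (\<lambda>u v. (fst u \<oplus>\<^bsub>Wk_Omega\<^esub> fst v, snd u \<oplus>\<^bsub>Wk\<^esub> snd v)),
      smult = (\<lambda>x (\<alpha>, a).
        let y = (Wk_frob ^^ j) x in
        (y \<odot>\<^bsub>Wk_Omega\<^esub> \<alpha> \<ominus>\<^bsub>Wk_Omega\<^esub>
           divide_nat Wk_Omega (p ^ j) (a \<odot>\<^bsub>Wk_Omega\<^esub> kaehler_d Wk y),
         y \<otimes>\<^bsub>Wk\<^esub> a))\<rparr>"

definition h_map :: "nat \<Rightarrow> (nat \<Rightarrow> 'k) \<Rightarrow> ((nat \<Rightarrow> 'k) \<Rightarrow> nat \<Rightarrow> 'k) set \<times> (nat \<Rightarrow> 'k)" where
  "h_map j a = (\<ominus>\<^bsub>Wk_Omega\<^esub> kaehler_d Wk a, add_pow Wk (p ^ j) a)"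

text \<open>\<open>M\<^sub>j\<close> for \<open>j \<ge> 1\<close>, and the class of \<open>(\<alpha>, a)\<close> in it\<close>

definition M_module ::
    "nat \<Rightarrow> (nat \<Rightarrow> 'k, (((nat \<Rightarrow> 'k) \<Rightarrow> nat \<Rightarrow> 'k) set \<times> (nat \<Rightarrow> 'k)) set) module" where
  "M_module j = quot_module (twisted_module j) (h_map j ` carrier Wk)"

definition M_class ::
    "nat \<Rightarrow> ((nat \<Rightarrow> 'k) \<Rightarrow> nat \<Rightarrow> 'k) set \<Rightarrow> (nat \<Rightarrow> 'k) \<Rightarrow>
     (((nat \<Rightarrow> 'k) \<Rightarrow> nat \<Rightarrow> 'k) set \<times> (nat \<Rightarrow> 'k)) set" where
  "M_class j \<alpha> a = h_map j ` carrier Wk +>\<^bsub>twisted_module j\<^esub> (\<alpha>, a)"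

text \<open>\<open>E\<^sub>m\<^sup>1\<close> as an \<open>A\<close>-module by means of \<open>s\<^sub>\<phi>\<close>\<close>

definition drw1_module :: "(nat \<Rightarrow> 'k, 'u) witt_data \<Rightarrow> nat \<Rightarrow> (nat \<Rightarrow> 'k, 'u) module" where
  "drw1_module E m = deg1_module E m (\<lambda>x. lam E m (s_phi m x))"

text \<open>\<open>V\<^sup>j(s\<^sub>\<phi>(\<alpha>)) + dV\<^sup>j(s\<^sub>\<phi>(a))\<close> in \<open>E\<^sub>m\<^sup>1\<close>, for \<open>j \<le> m\<close>\<close>

definition V_dV ::
    "(nat \<Rightarrow> 'k, 'u) witt_data \<Rightarrow> nat \<Rightarrow> nat \<Rightarrow> ((nat \<Rightarrow> 'k) \<Rightarrow> nat \<Rightarrow> 'k) set \<Rightarrow> (nat \<Rightarrow> 'k) \<Rightarrow> 'u" where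
  "V_dV E m j \<alpha> a =
     ver_pow E (m - j) 1 j (s_phi_Omega E (m - j) \<alpha>) \<oplus>\<^bsub>cmp E m 1\<^esub>
     dif E m 0 (ver_pow E (m - j) 0 j (lam E (m - j) (s_phi (m - j) a)))"

end

end

theory Submission
  imports Defs "HOL-Algebra.QuotRing"
begin

text \<open>
  \<open>A\<close> is \<open>p\<close>-torsion free and \<open>\<phi>\<close> lifts the Frobenius, so a Witt vector over \<open>A\<close> is determined by its
  ghost components, and Dwork's lemma says which sequences occur. In particular every element of
  \<open>W\<^sub>n\<^sub>+\<^sub>1(A)\<close> is of the form \<open>s\<^sub>\<phi>(a) + V(y)\<close>.

  Surjectivity: the elements \<open>x dy\<close> generate a Witt subcomplex in degree one, which is everything by
  initiality. The decomposition above and \<open>V(x F(\<omega>)) = V(x) \<omega>\<close> then reduce every \<open>x dy\<close> to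
  the elements \<open>V\<^sup>j(s\<^sub>\<phi>(\<alpha>))\<close> and \<open>dV\<^sup>j(s\<^sub>\<phi>(a))\<close>.

  Injectivity: there is an explicit Witt complex that vanishes in degrees at least two and is
  \<open>\<Prod>\<^sub>m\<^sub><\<^sub>n (\<Omega>\<^sup>1\<^sub>A \<oplus> A/p\<^sup>m)\<close> in degree one and level \<open>n\<close>. If \<open>w\<^sub>m\<close> denotes the ghost components of
  \<open>x\<close>, then \<open>dx\<close> has the components \<open>(dw\<^sub>m / p\<^sup>m, c\<^sub>m)\<close> with \<open>w\<^sub>m = \<phi>(w\<^sub>m\<^sub>-\<^sub>1) + p\<^sup>m c\<^sub>m\<close>. The component \<open>i\<close> of
  the image of \<open>V\<^sup>j(s\<^sub>\<phi>(\<alpha>)) + dV\<^sup>j(s\<^sub>\<phi>(a))\<close> is zero for \<open>i < j\<close> and equal to \<open>(p\<^sup>j \<alpha> + da, a)\<close> for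
  \<open>i = j\<close>, and this pair vanishes only if \<open>(\<alpha>, a)\<close> lies in the image of \<open>h\<^sub>j\<close>.
\<close>

section \<open>Integer polynomials\<close>

text \<open>The twisted action on \<open>M_j\<close> is dictated by the Leibniz rule for
  \<open>s_phi(x) V^j(s_phi(a))\<close>: its second term is
  \<open>V^j(s_phi(a) F^j d s_phi(x))\<close>. A Witt complex only yields
  \<open>p^j F^j d = d F^j\<close>, and its degree one part may have \<open>p\<close>-torsion, so
  the division by \<open>p^j\<close> has to take place in \<Omega>, before \<open>s_phi\<close> is
  applied. This rests on unique \<open>p\<close>-divisibility of \<Omega>, which comes from a
  derivation over \<phi> that is \<open>d \<phi>\<close> divided by \<open>p\<close>, together with
  the bijectivity of \<phi>.

  The modulus \<open>p^m\<close> in the test complex is forced: \<open>x |-> c_m\<close> obeys the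
  Leibniz rule over the ghost component \<open>w_m\<close> only modulo \<open>p^m\<close>. It is
  also fine enough: if \<open>a = p^j c\<close> and \<open>p^j \<alpha> + da = 0\<close>, then
  \<open>\<alpha> = -dc\<close> because \<Omega> is torsion free. Since a term of index
  \<open>j\<close> does not reach the components below \<open>j\<close>, the kernel is computed in
  increasing order of \<open>j\<close>.

  Initiality is used twice, towards a subcomplex of \<open>E\<close> and towards the test
  complex.\<close>

definition zpoly_ring :: "'v zpoly ring" where
  "zpoly_ring = \<lparr>carrier = UNIV, monoid.mult = (*), one = 1, zero = 0, add = (+)\<rparr>"

lemma zpoly_ring_simps [simp]:
  "carrier zpoly_ring = UNIV" "x \<otimes>\<^bsub>zpoly_ring\<^esub> y = x * y" "\<one>\<^bsub>zpoly_ring\<^esub> = 1"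
  "\<zero>\<^bsub>zpoly_ring\<^esub> = 0" "x \<oplus>\<^bsub>zpoly_ring\<^esub> y = x + y"
  by (simp_all add: zpoly_ring_def)

lemma cring_zpoly_ring: "cring (zpoly_ring :: 'v zpoly ring)"
proof (rule cringI)
  show "abelian_group (zpoly_ring :: 'v zpoly ring)"
    by (rule abelian_groupI) (auto simp: add.assoc add.commute intro: exI[of _ "- _"])
  show "Group.comm_monoid (zpoly_ring :: 'v zpoly ring)"
    by (rule comm_monoidI) (auto simp: mult.assoc mult.commute)
qed (simp add: distrib_right)

lemma zpoly_ring_pow [simp]: "x [^]\<^bsub>zpoly_ring\<^esub> (n::nat) = x ^ n"
  by (induction n) (simp_all add: nat_pow_def mult.commute)

lemma zpoly_ring_add_pow [simp]: "[(n::nat)] \<cdot>\<^bsub>zpoly_ring\<^esub> x = of_nat n * x"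
  by (induction n) (simp_all add: add_pow_def nat_pow_def algebra_simps)

lemma zpoly_ring_finsum [simp]: "finite A \<Longrightarrow> finsum zpoly_ring f A = sum f A"
proof (induction A rule: finite_induct)
  case (insert x F)
  interpret cring "zpoly_ring :: 'b zpoly ring" by (rule cring_zpoly_ring)
  show ?case using insert by simp
next
 case empty
  interpret cring "zpoly_ring :: 'b zpoly ring" by (rule cring_zpoly_ring)
  show ?case by simp
qed

lemma zpoly_ring_a_inv [simp]: "\<ominus>\<^bsub>zpoly_ring\<^esub> x = - x"
proof -
  interpret cring "zpoly_ring :: 'a zpoly ring" by (rule cring_zpoly_ring)
  show ?thesis by (rule minus_equality) auto
qed

text \<open>Variables must be tracked because a truncated Witt vector is \<open>undefined\<close>
  outside its index set: a Witt polynomial can be evaluated there only if it mentions no later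
  variable.\<close>

definition zvars :: "'v zpoly \<Rightarrow> 'v set" where
  "zvars P = (\<Union>m\<in>Poly_Mapping.keys P. Poly_Mapping.keys m)"

lemma zvars_add: "zvars (P + Q) \<subseteq> zvars P \<union> zvars Q"
  using keys_add[of P Q] unfolding zvars_def by blast

lemma zvars_mult: "zvars (P * Q) \<subseteq> zvars P \<union> zvars Q"
proof -
  have "Poly_Mapping.keys m \<subseteq> zvars P \<union> zvars Q" if "m \<in> Poly_Mapping.keys (P * Q)" for m
  proof -
    obtain a b where "m = a + b" "a \<in> Poly_Mapping.keys P" "b \<in> Poly_Mapping.keys Q"
      using keys_mult[of P Q] \<open>m \<in> _\<close> by blast
    then show ?thesis using keys_add[of a b] unfolding zvars_def by blast
  qed
  then show ?thesis unfolding zvars_def by blast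
qed

lemma zvars_uminus [simp]: "zvars (- P) = zvars P"
  by (simp add: zvars_def)

lemma zvars_diff: "zvars (P - Q) \<subseteq> zvars P \<union> zvars Q"
  using zvars_add[of P "- Q"] by simp

lemma zvars_zero [simp]: "zvars 0 = {}"
  by (simp add: zvars_def)

lemma zvars_one [simp]: "zvars 1 = {}"
  by (simp add: zvars_def)

lemma zvars_of_nat [simp]: "zvars (of_nat n) = {}"
  by (simp add: zvars_def flip: single_of_nat)

lemma zvars_zvar [simp]: "zvars (zvar v) = {v}"
  by (simp add: zvars_def zvar_def)

lemma zvars_power: "zvars (P ^ n) \<subseteq> zvars P"
proof (induction n)
  case (Suc n)
  then show ?case using zvars_mult[of P "P ^ n"] by auto
qed simp

lemma zvars_sum: "(\<And>i. i \<in> I \<Longrightarrow> zvars (f i) \<subseteq> V) \<Longrightarrow> zvars (sum f I) \<subseteq> V"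
proof (induction I rule: infinite_finite_induct)
  case (insert x F)
  then show ?case using zvars_add[of "f x" "sum f F"] by auto
qed auto

lemma lookup_of_nat_mult: "Poly_Mapping.lookup (of_nat n * (P :: 'v zpoly)) m = int n * Poly_Mapping.lookup P m"
  by (induction n) (simp_all add: algebra_simps lookup_add)

lemma zvars_of_nat_mult: "n > 0 \<Longrightarrow> zvars (of_nat n * P) = zvars P"
  by (simp add: zvars_def in_keys_iff[abs_def] keys.rep_eq lookup_of_nat_mult)

lemma of_nat_mult_zpoly_eq_0_iff [simp]: "of_nat n * (P :: 'v zpoly) = 0 \<longleftrightarrow> n = 0 \<or> P = 0"
proof
  assume "of_nat n * P = 0"
  then have "int n * Poly_Mapping.lookup P m = 0" for m by (metis lookup_of_nat_mult lookup_zero)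
  then show "n = 0 \<or> P = 0" by (auto intro: poly_mapping_eqI)
qed auto

context cring
begin

definition zmon :: "('v \<Rightarrow> 'a) \<Rightarrow> ('v \<Rightarrow>\<^sub>0 nat) \<Rightarrow> 'a" where
  "zmon v m = (\<Otimes>i\<in>Poly_Mapping.keys m. v i [^] Poly_Mapping.lookup m i)"

lemma zmon_closed [simp]: "v \<in> UNIV \<rightarrow> carrier R \<Longrightarrow> zmon v m \<in> carrier R"
  unfolding zmon_def by (intro finprod_closed) auto

lemma zmon_superset:
  assumes "v \<in> UNIV \<rightarrow> carrier R" "finite S" "Poly_Mapping.keys m \<subseteq> S"
  shows "zmon v m = (\<Otimes>i\<in>S. v i [^] Poly_Mapping.lookup m i)"
  unfolding zmon_def
  by (rule finprod_mono_neutral_cong_left) (use assms in \<open>auto simp: in_keys_iff\<close>)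

lemma zmon_add:
  assumes "v \<in> UNIV \<rightarrow> carrier R"
  shows "zmon v (m + m') = zmon v m \<otimes> zmon v m'"
proof -
  let ?S = "Poly_Mapping.keys m \<union> Poly_Mapping.keys m'"
  have v: "v i \<in> carrier R" for i using assms by auto
  have "zmon v (m + m') = (\<Otimes>i\<in>?S. v i [^] Poly_Mapping.lookup m i \<otimes> v i [^] Poly_Mapping.lookup m' i)"
    using assms keys_add[of m m']
    by (subst zmon_superset[where S = ?S]) (auto simp: lookup_add nat_pow_mult v intro!: finprod_cong')
  also have "\<dots> = zmon v m \<otimes> zmon v m'"
    using assms by (subst finprod_multf) (auto simp: zmon_superset[of v ?S])
  finally show ?thesis .
qed

lemma zmon_single_one: "v i \<in> carrier R \<Longrightarrow> zmon v (Poly_Mapping.single i 1) = v i"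
  by (simp add: zmon_def)

lemma zeval_superset:
  assumes "v \<in> UNIV \<rightarrow> carrier R" "finite S" "Poly_Mapping.keys P \<subseteq> S"
  shows "zeval R v P = (\<Oplus>m\<in>S. [Poly_Mapping.lookup P m] \<cdot> zmon v m)"
  unfolding zeval_def zmon_def[symmetric]
  by (rule add.finprod_mono_neutral_cong_left)
    (use assms in \<open>auto simp: in_keys_iff add_pow_int_ge\<close>)

lemma zeval_closed [simp]: "v \<in> UNIV \<rightarrow> carrier R \<Longrightarrow> zeval R v P \<in> carrier R"
  by (subst zeval_superset[OF _ finite_keys subset_refl]) (auto intro!: finsum_closed)

lemma zeval_zero [simp]: "zeval R v 0 = \<zero>"
  by (simp add: zeval_def)

lemma zeval_add:
  assumes "v \<in> UNIV \<rightarrow> carrier R"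
  shows "zeval R v (P + Q) = zeval R v P \<oplus> zeval R v Q"
proof -
  let ?S = "Poly_Mapping.keys P \<union> Poly_Mapping.keys Q"
  have "zeval R v (P + Q) = (\<Oplus>m\<in>?S. [Poly_Mapping.lookup P m] \<cdot> zmon v m \<oplus> [Poly_Mapping.lookup Q m] \<cdot> zmon v m)"
    using assms keys_add[of P Q]
    by (subst zeval_superset[where S = ?S])
      (auto simp: lookup_add add.int_pow_mult intro!: finsum_cong' add.int_pow_closed)
  also have "\<dots> = zeval R v P \<oplus> zeval R v Q"
    using assms by (subst finsum_addf) (auto simp: zeval_superset[of v ?S])
  finally show ?thesis .
qed

lemma zeval_uminus:
  assumes "v \<in> UNIV \<rightarrow> carrier R"
  shows "zeval R v (- P) = \<ominus> zeval R v P"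
  using zeval_add[OF assms, of "- P" P] assms by (intro minus_equality[symmetric]) auto

lemma zeval_diff:
  assumes "v \<in> UNIV \<rightarrow> carrier R"
  shows "zeval R v (P - Q) = zeval R v P \<ominus> zeval R v Q"
  using zeval_add[OF assms, of P "- Q"] zeval_uminus[OF assms] by (simp add: minus_eq)

lemma zeval_frag_of [simp]: "v \<in> UNIV \<rightarrow> carrier R \<Longrightarrow> zeval R v (frag_of m) = zmon v m"
  by (simp add: zeval_def flip: zmon_def)

text \<open>Both sides are additive in each factor, and integer polynomials form the free abelian
  group on the monomials; two passes of \<open>frag_induction\<close> reduce the claim to
  \<open>zmon_add\<close>.\<close>

lemma zeval_mult:
  assumes v: "v \<in> UNIV \<rightarrow> carrier R"
  shows "zeval R v (P * Q) = zeval R v P \<otimes> zeval R v Q"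
proof -
  have 1: "zeval R v (frag_of m * Q) = zmon v m \<otimes> zeval R v Q" for m
    using subset_UNIV[of "Poly_Mapping.keys Q"]
  proof (induction Q rule: frag_induction)
    case (one x)
    have "frag_of m * frag_of x = frag_of (m + x)" by (simp add: mult_single)
    then show ?case using v by (simp add: zmon_add)
  next
    case (diff a b)
    then show ?case using v
      by (simp add: right_diff_distrib zeval_diff r_minus r_distr minus_eq)
  qed (use v in auto)
  show ?thesis
    using subset_UNIV[of "Poly_Mapping.keys P"]
  proof (induction P rule: frag_induction)
    case (diff a b)
    then show ?case using v
      by (simp add: left_diff_distrib zeval_diff l_minus l_distr minus_eq)
  qed (use v 1 in auto)
qed

lemma zeval_one: "zeval R v 1 = \<one>"
proof -
  have "Poly_Mapping.lookup (1 :: 'v zpoly) 0 = 1" by (simp add: lookup_one)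
  then show ?thesis by (simp add: zeval_def add_pow_int_ge)
qed

lemma zeval_hom: "v \<in> UNIV \<rightarrow> carrier R \<Longrightarrow> zeval R v \<in> ring_hom zpoly_ring R"
  by (rule ring_hom_memI) (simp_all add: zeval_mult zeval_add zeval_one)

lemma zeval_zvar [simp]: "v \<in> UNIV \<rightarrow> carrier R \<Longrightarrow> zeval R v (zvar i) = v i"
  unfolding zvar_def using zmon_single_one[of v i] by (subst zeval_frag_of) (auto simp: Pi_iff)

lemma zeval_power: "v \<in> UNIV \<rightarrow> carrier R \<Longrightarrow> zeval R v (P ^ n) = zeval R v P [^] n"
  by (induction n) (simp_all add: zeval_one zeval_mult m_comm)

lemma zeval_of_nat: "v \<in> UNIV \<rightarrow> carrier R \<Longrightarrow> zeval R v (of_nat n) = [n] \<cdot> \<one>"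
  by (induction n) (simp_all add: zeval_one zeval_add a_comm)

lemma zeval_of_nat_mult: "v \<in> UNIV \<rightarrow> carrier R \<Longrightarrow> zeval R v (of_nat n * P) = [n] \<cdot> zeval R v P"
  by (simp add: zeval_mult zeval_of_nat add_pow_ldistr)

lemma zeval_sum: "finite I \<Longrightarrow> v \<in> UNIV \<rightarrow> carrier R \<Longrightarrow> zeval R v (sum f I) = (\<Oplus>i\<in>I. zeval R v (f i))"
proof (induction I rule: finite_induct)
  case (insert x F)
  then show ?case by (subst finsum_insert) (auto simp: zeval_add)
qed auto

text \<open>Only \<open>v'\<close> has to take all its values in the carrier: \<open>v\<close> is
  typically a truncated Witt vector, which is \<open>undefined\<close> beyond its length.\<close>

lemma zeval_cong:
  assumes "\<And>i. i \<in> zvars P \<Longrightarrow> v i = v' i" "v' \<in> UNIV \<rightarrow> carrier R"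
  shows "zeval R v P = zeval R v' P"
  unfolding zeval_def
proof (rule finsum_cong'[OF refl])
  show "(\<lambda>m. [Poly_Mapping.lookup P m] \<cdot> (\<Otimes>i\<in>Poly_Mapping.keys m. v' i [^] Poly_Mapping.lookup m i))
    \<in> Poly_Mapping.keys P \<rightarrow> carrier R"
    using zmon_closed[OF assms(2)] by (auto simp: zmon_def)
  fix m assume "m \<in> Poly_Mapping.keys P"
  then have "(\<Otimes>i\<in>Poly_Mapping.keys m. v i [^] Poly_Mapping.lookup m i) = (\<Otimes>i\<in>Poly_Mapping.keys m. v' i [^] Poly_Mapping.lookup m i)"
    using assms by (intro finprod_cong') (auto simp: zvars_def intro!: arg_cong2[where f = "([^])"])
  then show "[Poly_Mapping.lookup P m] \<cdot> (\<Otimes>i\<in>Poly_Mapping.keys m. v i [^] Poly_Mapping.lookup m i)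
    = [Poly_Mapping.lookup P m] \<cdot> (\<Otimes>i\<in>Poly_Mapping.keys m. v' i [^] Poly_Mapping.lookup m i)" by simp
qed

end

lemma (in ring_hom_cring) hom_nat_pow: "x \<in> carrier R \<Longrightarrow> h (x [^]\<^bsub>R\<^esub> (n::nat)) = h x [^]\<^bsub>S\<^esub> n"
  by (induction n) simp_all

lemma (in ring_hom_cring) hom_add_pow: "x \<in> carrier R \<Longrightarrow> h ([(n::nat)] \<cdot>\<^bsub>R\<^esub> x) = [n] \<cdot>\<^bsub>S\<^esub> h x"
  by (induction n) simp_all

lemma (in ring_hom_cring) hom_zeval:
  assumes v: "v \<in> UNIV \<rightarrow> carrier R"
  shows "h (zeval R v P) = zeval S (\<lambda>i. h (v i)) P"
  using subset_UNIV[of "Poly_Mapping.keys P"]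
proof (induction P rule: frag_induction)
  case (one m)
  have "(\<lambda>i. h (v i)) \<in> UNIV \<rightarrow> carrier S" using v by auto
  moreover have "h (R.zmon v m) = S.zmon (\<lambda>i. h (v i)) m"
    unfolding R.zmon_def S.zmon_def using v
    by (subst hom_finprod) (auto intro!: S.finprod_cong' hom_nat_pow)
  ultimately show ?case using v by simp
next
  case (diff a b)
  have "(\<lambda>i. h (v i)) \<in> UNIV \<rightarrow> carrier S" using v by auto
  then show ?case using v diff by (simp add: R.zeval_diff S.zeval_diff R.minus_eq S.minus_eq)
qed auto

section \<open>Frobenius lifts and ghost components\<close>

text \<open>The prime divides the inner binomial coefficients. The linear term is kept explicit
  because \<open>wt_teich\<close> needs it; the other applications only use that everything between
  \<open>x ^ p\<close> and \<open>u ^ p\<close> is divisible by \<open>p\<close>.\<close>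

lemma power_add_prime:
  fixes x u :: "'a :: comm_ring_1"
  assumes "prime p"
  shows "\<exists>c. (x + u) ^ p = x ^ p + of_nat p * (x ^ (p - 1) * u) + of_nat p * (u\<^sup>2 * c) + u ^ p"
proof -
  have p2: "p \<ge> 2" using prime_ge_2_nat[OF assms] .
  define c where "c = (\<Sum>k\<in>{2..<p}. of_nat ((p choose k) div p) * (u ^ (k - 2) * x ^ (p - k)))"
  have *: "of_nat (p choose k) * u ^ k * x ^ (p - k) =
      of_nat p * (u\<^sup>2 * (of_nat ((p choose k) div p) * (u ^ (k - 2) * x ^ (p - k))))"
    if "k \<in> {2..<p}" for k
  proof -
    have "p dvd k * (p choose k)" using that by (simp add: times_binomial_minus1_eq)
    then have "p dvd (p choose k)" using that assms
      by (auto simp: prime_dvd_mult_iff dest: dvd_imp_le)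
    then have "(of_nat (p choose k) :: 'a) = of_nat p * of_nat ((p choose k) div p)"
      by (metis dvd_mult_div_cancel of_nat_mult)
    moreover have "u ^ k = u\<^sup>2 * u ^ (k - 2)"
    proof -
      have "2 \<le> k" using that by simp
      then obtain j where "k = 2 + j" using le_Suc_ex by blast
      then show ?thesis by (simp only: power_add add_diff_cancel_left')
    qed
    ultimately show ?thesis by (simp add: mult_ac)
  qed
  have "{..p} = insert 0 (insert 1 (insert p {2..<p}))" using p2 by auto
  then have "(u + x) ^ p = x ^ p + (of_nat p * u * x ^ (p - 1) +
      (u ^ p + (\<Sum>k\<in>{2..<p}. of_nat (p choose k) * u ^ k * x ^ (p - k))))"
    using p2 by (simp add: binomial_ring)
  also have "(\<Sum>k\<in>{2..<p}. of_nat (p choose k) * u ^ k * x ^ (p - k)) = of_nat p * (u\<^sup>2 * c)"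
    unfolding c_def sum_distrib_left by (rule sum.cong) (use * in auto)
  finally have "(x + u) ^ p = x ^ p + of_nat p * (x ^ (p - 1) * u) + of_nat p * (u\<^sup>2 * c) + u ^ p"
    by (simp add: algebra_simps)
  then show ?thesis by blast
qed

text \<open>The identity is universal: it is taken in the integer polynomials in two variables and
  evaluated at \<open>x\<close> and \<open>u\<close>.\<close>

lemma (in cring) pow_add_prime:
  fixes p :: nat
  assumes "prime p" and x: "x \<in> carrier R" and u: "u \<in> carrier R"
  shows "\<exists>c\<in>carrier R. (x \<oplus> u) [^] p =
    x [^] p \<oplus> [p] \<cdot> (x [^] (p - 1) \<otimes> u) \<oplus> [p] \<cdot> (u \<otimes> u \<otimes> c) \<oplus> u [^] p"
proof -
  let ?X = "zvar True :: bool zpoly" and ?U = "zvar False"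
  obtain c where "(?X + ?U) ^ p = ?X ^ p + of_nat p * (?X ^ (p - 1) * ?U) + of_nat p * (?U\<^sup>2 * c) + ?U ^ p"
    using power_add_prime[OF assms(1)] by blast
  moreover define v where "v b = (if b then x else u)" for b
  moreover have v: "v \<in> UNIV \<rightarrow> carrier R" using x u by (auto simp: v_def)
  ultimately have "zeval R v ((?X + ?U) ^ p) =
      zeval R v (?X ^ p + of_nat p * (?X ^ (p - 1) * ?U) + of_nat p * (?U\<^sup>2 * c) + ?U ^ p)" by simp
  then have "(x \<oplus> u) [^] p =
    x [^] p \<oplus> [p] \<cdot> (x [^] (p - 1) \<otimes> u) \<oplus> [p] \<cdot> (u \<otimes> u \<otimes> zeval R v c) \<oplus> u [^] p"
    using x u v by (simp add: zeval_add zeval_power zeval_mult zeval_of_nat_mult[OF v] v_def power2_eq_square)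
  then show ?thesis using v zeval_closed by blast
qed

lemma (in ring) add_pow_mult: "x \<in> carrier R \<Longrightarrow> [(m::nat)] \<cdot> ([(n::nat)] \<cdot> x) = [(m * n)] \<cdot> x"
  by (simp add: add.nat_pow_pow mult.commute)

lemma (in abelian_group) add_pow_minus: "x \<in> carrier G \<Longrightarrow> [(n::nat)] \<cdot> (\<ominus> x) = \<ominus> ([n] \<cdot> x)"
  using add.nat_pow_inv[of x n] by simp

text \<open>The setting of Dwork's lemma. It is met by \<open>W(k)\<close>, but also by integer
  polynomial rings, where the lemma produces the Witt polynomials themselves.\<close>

locale frob_lift = cring A for A (structure) +
  fixes p :: nat and \<phi> :: "'a \<Rightarrow> 'a"
  assumes prime_p: "prime p" and odd_p: "odd p"
    and torsion_free: "x \<in> carrier A \<Longrightarrow> [p] \<cdot> x = \<zero> \<Longrightarrow> x = \<zero>"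
    and phi_hom: "\<phi> \<in> ring_hom A A"
    and phi_lift: "x \<in> carrier A \<Longrightarrow> \<exists>c\<in>carrier A. \<phi> x = x [^] p \<oplus> [p] \<cdot> c"
begin

sublocale phi: ring_hom_cring A A \<phi>
  by unfold_locales (rule phi_hom)

lemma p_ge_3: "p \<ge> 3"
proof -
  have "p \<noteq> 2" using odd_p by auto
  then show ?thesis using prime_ge_2_nat[OF prime_p] by auto
qed

lemma torsion_free_pow: "x \<in> carrier A \<Longrightarrow> [(p ^ n)] \<cdot> x = \<zero> \<Longrightarrow> x = \<zero>"
proof (induction n)
  case (Suc n)
  then have "[p] \<cdot> ([(p ^ n)] \<cdot> x) = \<zero>" by (simp add: add_pow_mult)
  from torsion_free[OF _ this] show ?case using Suc.IH[OF Suc.prems(1)] Suc.prems(1) by blast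
qed simp

lemma p_pow_cancel:
  assumes "x \<in> carrier A" "y \<in> carrier A" "[(p ^ n)] \<cdot> x = [(p ^ n)] \<cdot> y"
  shows "x = y"
proof -
  have "[(p ^ n)] \<cdot> (x \<ominus> y) = [(p ^ n)] \<cdot> x \<oplus> \<ominus> ([(p ^ n)] \<cdot> y)"
    using assms(1,2) by (simp only: minus_eq add.nat_pow_distrib add_pow_minus a_inv_closed)
  then have "[(p ^ n)] \<cdot> (x \<ominus> y) = \<zero>"
    unfolding assms(3) using assms(2) by (simp only: r_neg add.nat_pow_closed)
  then have "x \<ominus> y = \<zero>" using assms(1,2) torsion_free_pow by blast
  moreover have "x = x \<ominus> y \<oplus> y" using assms by (simp add: minus_eq a_assoc l_neg)
  ultimately show ?thesis using assms by simp
qed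

definition pcong :: "nat \<Rightarrow> 'a \<Rightarrow> 'a \<Rightarrow> bool" where
  "pcong n x y \<longleftrightarrow> (\<exists>c\<in>carrier A. x = y \<oplus> [(p ^ n)] \<cdot> c)"

lemma pcongI: "c \<in> carrier A \<Longrightarrow> x = y \<oplus> [(p ^ n)] \<cdot> c \<Longrightarrow> pcong n x y"
  unfolding pcong_def by blast

lemma pcong_refl [simp]: "x \<in> carrier A \<Longrightarrow> pcong n x x"
  by (rule pcongI[of \<zero>]) auto

lemma pcong_0: "x \<in> carrier A \<Longrightarrow> y \<in> carrier A \<Longrightarrow> pcong 0 x y"
  by (rule pcongI[of "x \<ominus> y"]) (simp_all, algebra)

lemma pcong_sym: "pcong n x y \<Longrightarrow> y \<in> carrier A \<Longrightarrow> pcong n y x"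
  unfolding pcong_def
proof (elim bexE)
  fix c assume "c \<in> carrier A" "x = y \<oplus> [(p ^ n)] \<cdot> c" "y \<in> carrier A"
  then show "\<exists>c\<in>carrier A. y = x \<oplus> [(p ^ n)] \<cdot> c"
    by (intro bexI[of _ "\<ominus> c"]) (simp_all add: add_pow_minus a_assoc r_neg)
qed

lemma pcong_trans: "pcong n x y \<Longrightarrow> pcong n y z \<Longrightarrow> z \<in> carrier A \<Longrightarrow> pcong n x z"
  unfolding pcong_def
proof (elim bexE)
  fix c c' assume "c \<in> carrier A" "c' \<in> carrier A" "x = y \<oplus> [(p ^ n)] \<cdot> c" "y = z \<oplus> [(p ^ n)] \<cdot> c'" "z \<in> carrier A"
  then show "\<exists>c\<in>carrier A. x = z \<oplus> [(p ^ n)] \<cdot> c"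
    by (intro bexI[of _ "c' \<oplus> c"]) (simp_all add: add.nat_pow_distrib a_assoc)
qed

lemma pcong_add:
  "pcong n x y \<Longrightarrow> pcong n x' y' \<Longrightarrow> y \<in> carrier A \<Longrightarrow> y' \<in> carrier A \<Longrightarrow> pcong n (x \<oplus> x') (y \<oplus> y')"
  unfolding pcong_def
proof (elim bexE)
  fix c c' assume "c \<in> carrier A" "c' \<in> carrier A" "x = y \<oplus> [(p ^ n)] \<cdot> c" "x' = y' \<oplus> [(p ^ n)] \<cdot> c'"
    "y \<in> carrier A" "y' \<in> carrier A"
  then show "\<exists>c\<in>carrier A. x \<oplus> x' = y \<oplus> y' \<oplus> [(p ^ n)] \<cdot> c"
    by (intro bexI[of _ "c \<oplus> c'"]) (simp_all add: add.nat_pow_distrib a_ac)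
qed

lemma pcong_mult_left: "pcong n x y \<Longrightarrow> y \<in> carrier A \<Longrightarrow> z \<in> carrier A \<Longrightarrow> pcong n (z \<otimes> x) (z \<otimes> y)"
  unfolding pcong_def by (auto intro!: bexI[of _ "z \<otimes> _"] simp: r_distr add_pow_rdistr)

lemma pcong_closed: "pcong n x y \<Longrightarrow> y \<in> carrier A \<Longrightarrow> x \<in> carrier A"
  unfolding pcong_def by auto

lemma pcong_mult:
  assumes "pcong n x y" "pcong n x' y'" "y \<in> carrier A" "y' \<in> carrier A"
  shows "pcong n (x \<otimes> x') (y \<otimes> y')"
proof -
  have c: "x \<in> carrier A" "x' \<in> carrier A" using assms pcong_closed by auto
  have "pcong n (x \<otimes> x') (x \<otimes> y')" using assms c by (intro pcong_mult_left)
  moreover have "pcong n (y' \<otimes> x) (y' \<otimes> y)" using assms c by (intro pcong_mult_left)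
  ultimately show ?thesis using assms c pcong_trans m_comm by simp
qed

lemma pcong_mono: "pcong n x y \<Longrightarrow> m \<le> n \<Longrightarrow> pcong m x y"
  unfolding pcong_def
  by (auto simp: le_iff_add power_add add_pow_mult intro!: bexI[of _ "[(p ^ _)] \<cdot> _"])

lemma pcong_scale:
  "pcong n x y \<Longrightarrow> y \<in> carrier A \<Longrightarrow> pcong (k + n) ([(p ^ k)] \<cdot> x) ([(p ^ k)] \<cdot> y)"
  unfolding pcong_def by (auto simp: add.nat_pow_distrib add_pow_mult power_add)

lemma pcong_finsum:
  "finite I \<Longrightarrow> (\<And>i. i \<in> I \<Longrightarrow> pcong n (f i) (g i)) \<Longrightarrow> g \<in> I \<rightarrow> carrier A \<Longrightarrow>
   pcong n (\<Oplus>i\<in>I. f i) (\<Oplus>i\<in>I. g i)"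
proof (induction rule: finite_induct)
  case (insert x F)
  have "f \<in> insert x F \<rightarrow> carrier A" using insert.prems pcong_closed by blast
  then show ?case using insert by (simp add: pcong_add Pi_iff)
qed simp

lemma pcong_pow_p:
  assumes "pcong n x y" "y \<in> carrier A" "n \<ge> 1"
  shows "pcong (Suc n) (x [^] p) (y [^] p)"
proof -
  obtain t where t: "t \<in> carrier A" "x = y \<oplus> [(p ^ n)] \<cdot> t" using assms unfolding pcong_def by blast
  obtain c where c: "c \<in> carrier A" "x [^] p = y [^] p \<oplus> [p] \<cdot> (y [^] (p - 1) \<otimes> ([(p ^ n)] \<cdot> t))
      \<oplus> [p] \<cdot> (([(p ^ n)] \<cdot> t) \<otimes> ([(p ^ n)] \<cdot> t) \<otimes> c) \<oplus> ([(p ^ n)] \<cdot> t) [^] p"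
    using pow_add_prime[OF prime_p, of y "[(p ^ n)] \<cdot> t"] t assms(2) by auto
  have pow: "([m] \<cdot> t) [^] k = [(m ^ k)] \<cdot> (t [^] k)" for m k :: nat
  proof (induction k)
    case (Suc k)
    have "[m] \<cdot> t \<in> carrier A" using t by simp
    with Suc t show ?case by (simp add: add_pow_ldistr add_pow_rdistr add_pow_mult mult.commute)
  qed (use t in simp)
  \<comment> \<open>The last binomial term is divisible by \<open>p ^ (n * p)\<close>, and
    \<open>n * p\<close> is at least \<open>n + 1\<close> because \<open>n\<close> is
    positive.\<close>
  have "n * 3 \<le> n * p" using p_ge_3 by simp
  then have "n * p \<ge> Suc n" using assms(3) by linarith
  then have e: "(p ^ n) ^ p = p ^ Suc n * p ^ (n * p - Suc n)"
    by (simp only: power_mult[symmetric] power_add[symmetric] le_add_diff_inverse)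
  have e1: "p * p ^ n = p ^ Suc n" by simp
  have "x [^] p = y [^] p \<oplus> [(p ^ Suc n)] \<cdot> (y [^] (p - 1) \<otimes> t \<oplus> [(p ^ n)] \<cdot> (t \<otimes> t \<otimes> c) \<oplus>
      [(p ^ (n * p - Suc n))] \<cdot> (t [^] p))"
    using t c(1) assms(2) unfolding c(2) pow e
    by (simp add: add.nat_pow_distrib add_pow_mult add_pow_ldistr add_pow_rdistr a_assoc mult.assoc)
  from pcongI[OF _ this] show ?thesis using t(1) c(1) assms(2) by simp
qed

lemma pcong_pow_p_pow:
  assumes "pcong n x y" "y \<in> carrier A" "n \<ge> 1"
  shows "pcong (n + k) (x [^] (p ^ k)) (y [^] (p ^ k))"
proof (induction k)
  case (Suc k)
  have "x \<in> carrier A" using assms pcong_closed by blast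
  then show ?case using pcong_pow_p[OF Suc] assms
    by (simp add: nat_pow_pow mult.commute)
qed (use assms pcong_closed in auto)

lemma phi_pcong: "x \<in> carrier A \<Longrightarrow> pcong 1 (\<phi> x) (x [^] p)"
  using phi_lift unfolding pcong_def by simp

lemma phi_pow_pcong:
  assumes "x \<in> carrier A"
  shows "pcong (Suc k) (\<phi> x [^] (p ^ k)) (x [^] (p ^ Suc k))"
  using pcong_pow_p_pow[OF phi_pcong[OF assms], of k] assms
  by (simp add: nat_pow_pow)

text \<open>The core of Dwork's lemma: modulo \<open>p ^ n\<close>, the part of the
  \<open>n\<close>-th ghost component that precedes \<open>x n\<close> is fixed by the previous
  component. Indeed \<open>x ^ (p ^ (k+1))\<close> and \<open>\<phi>(x) ^ (p ^ k)\<close> agree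
  modulo \<open>p ^ (k+1)\<close>, and the \<open>i\<close>-th summand carries a further factor
  \<open>p ^ i\<close>.\<close>

lemma ghost_partial_pcong:
  assumes "x \<in> {..<n} \<rightarrow> carrier A" "n > 0"
  shows "pcong n (\<Oplus>i\<in>{..<n}. [(p ^ i)] \<cdot> (x i [^] (p ^ (n - i)))) (\<phi> (witt_ghost p A (n - 1) x))"
proof -
  have x: "x i \<in> carrier A" if "i < n" for i using assms that by auto
  have n: "{..n - 1} = {..<n}" using assms by auto
  have "\<phi> (witt_ghost p A (n - 1) x) = (\<Oplus>i\<in>{..<n}. [(p ^ i)] \<cdot> (\<phi> (x i) [^] (p ^ (n - 1 - i))))"
    unfolding witt_ghost_def n using x
    by (subst phi.hom_finsum) (auto simp: phi.hom_add_pow phi.hom_nat_pow intro!: finsum_cong')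
  moreover have "pcong n ([(p ^ i)] \<cdot> (x i [^] (p ^ (n - i)))) ([(p ^ i)] \<cdot> (\<phi> (x i) [^] (p ^ (n - 1 - i))))"
    if "i < n" for i
  proof -
    have e: "n - i = Suc (n - 1 - i)" "i + Suc (n - 1 - i) = n" using that by auto
    have xi: "x i \<in> carrier A" using x that by simp
    have "pcong (Suc (n - 1 - i)) (x i [^] (p ^ (n - i))) (\<phi> (x i) [^] (p ^ (n - 1 - i)))"
      unfolding e(1) by (rule pcong_sym[OF phi_pow_pcong[OF xi]]) (use xi in simp)
    from pcong_scale[OF this, of i] show ?thesis using xi unfolding e(2) by simp
  qed
  ultimately show ?thesis using x by (auto intro!: pcong_finsum)
qed

lemma ghost_closed: "x \<in> {..n} \<rightarrow> carrier A \<Longrightarrow> witt_ghost p A n x \<in> carrier A"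
  unfolding witt_ghost_def by (auto intro!: finsum_closed)

lemma ghost_split:
  assumes "x \<in> {..n} \<rightarrow> carrier A"
  shows "witt_ghost p A n x = (\<Oplus>i\<in>{..<n}. [(p ^ i)] \<cdot> (x i [^] (p ^ (n - i)))) \<oplus> [(p ^ n)] \<cdot> x n"
proof -
  have "{..n} = insert n {..<n}" by auto
  then show ?thesis unfolding witt_ghost_def using assms
    by (simp add: Pi_iff a_comm finsum_closed)
qed

lemma ghost_pcong:
  assumes "x \<in> {..n} \<rightarrow> carrier A" "n > 0"
  shows "pcong n (witt_ghost p A n x) (\<phi> (witt_ghost p A (n - 1) x))"
proof -
  have "pcong n (\<Oplus>i\<in>{..<n}. [(p ^ i)] \<cdot> (x i [^] (p ^ (n - i)))) (\<phi> (witt_ghost p A (n - 1) x))"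
    using assms by (intro ghost_partial_pcong) auto
  moreover have "pcong n (witt_ghost p A n x) (\<Oplus>i\<in>{..<n}. [(p ^ i)] \<cdot> (x i [^] (p ^ (n - i))))"
    using assms by (intro pcongI[of "x n"]) (auto simp: ghost_split)
  moreover have "witt_ghost p A (n - 1) x \<in> carrier A" using assms by (intro ghost_closed) auto
  ultimately show ?thesis using pcong_trans by blast
qed

text \<open>The coordinates are chosen one after the other: by \<open>ghost_partial_pcong\<close>
  and the hypothesis, \<open>w n\<close> minus the contribution of the earlier coordinates is
  divisible by \<open>p ^ n\<close>, and a quotient is the next coordinate.\<close>

lemma dwork:
  assumes w: "\<And>n. w n \<in> carrier A" and cong: "\<And>n. pcong (Suc n) (w (Suc n)) (\<phi> (w n))"
  shows "\<exists>x \<in> UNIV \<rightarrow> carrier A. \<forall>n. witt_ghost p A n x = w n"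
proof -
  \<comment> \<open>\<open>P f n r\<close> says that \<open>r\<close> continues the values of
    \<open>f\<close> below \<open>n\<close>. The premise on \<open>f\<close> is an implication
    because \<open>dependent_wf_choice\<close> asks for a predicate on arbitrary
    \<open>f\<close>.\<close>
  define P where "P f n r \<longleftrightarrow> r \<in> carrier A \<and> (f \<in> {..<n} \<rightarrow> carrier A \<longrightarrow>
    w n = (\<Oplus>i\<in>{..<n}. [(p ^ i)] \<cdot> (f i [^] (p ^ (n - i)))) \<oplus> [(p ^ n)] \<cdot> r)" for f n r
  have "\<exists>f. \<forall>n. P f n (f n)"
  proof (rule dependent_wf_choice)
    show "wf {(x, y :: nat). x < y}" by (rule wf)
    show "P f n r \<longleftrightarrow> P g n r" if "\<And>z. (z, n) \<in> {(x, y). x < y} \<Longrightarrow> f z = g z" for f g n r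
    proof -
      have fg: "f i = g i" if "i < n" for i using \<open>\<And>z. _ \<Longrightarrow> f z = g z\<close> that by auto
      have "(\<Oplus>i\<in>{..<n}. [(p ^ i)] \<cdot> (f i [^] (p ^ (n - i)))) = (\<Oplus>i\<in>{..<n}. [(p ^ i)] \<cdot> (g i [^] (p ^ (n - i))))"
        if "g \<in> {..<n} \<rightarrow> carrier A" using that fg by (intro finsum_cong') auto
      moreover have "f \<in> {..<n} \<rightarrow> carrier A \<longleftrightarrow> g \<in> {..<n} \<rightarrow> carrier A" using fg by (auto simp: Pi_iff)
      ultimately show ?thesis by (auto simp: P_def)
    qed
    show "\<exists>r. P f n r" if IH: "\<And>y. (y, n) \<in> {(x, y). x < y} \<Longrightarrow> P f y (f y)" for f n
    proof -
      have f: "f \<in> {..<n} \<rightarrow> carrier A" using IH by (auto simp: P_def)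
      show ?thesis
      proof (cases n)
        case 0
        then show ?thesis using w[of 0] by (intro exI[of _ "w 0"]) (auto simp: P_def)
      next
        case (Suc m)
        have "witt_ghost p A m f = w m"
          using IH[of m] Suc f by (subst ghost_split) (auto simp: P_def)
        then have "pcong n (\<Oplus>i\<in>{..<n}. [(p ^ i)] \<cdot> (f i [^] (p ^ (n - i)))) (\<phi> (w m))"
          using ghost_partial_pcong[OF f] Suc by simp
        then have "pcong n (\<phi> (w m)) (\<Oplus>i\<in>{..<n}. [(p ^ i)] \<cdot> (f i [^] (p ^ (n - i))))"
          by (rule pcong_sym) (use w in simp)
        moreover have "pcong n (w n) (\<phi> (w m))" using cong[of m] Suc by simp
        moreover have "(\<Oplus>i\<in>{..<n}. [(p ^ i)] \<cdot> (f i [^] (p ^ (n - i)))) \<in> carrier A"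
          using f by (intro finsum_closed) auto
        ultimately have "pcong n (w n) (\<Oplus>i\<in>{..<n}. [(p ^ i)] \<cdot> (f i [^] (p ^ (n - i))))"
          using pcong_trans by blast
        then show ?thesis unfolding pcong_def P_def by blast
      qed
    qed
  qed
  then obtain f where f: "\<And>n. P f n (f n)" by blast
  have "f \<in> UNIV \<rightarrow> carrier A" using f by (auto simp: P_def)
  moreover from this have "witt_ghost p A n f = w n" for n
    using f[of n] by (subst ghost_split) (auto simp: P_def)
  ultimately show ?thesis by blast
qed

lemma ghost_inj:
  assumes "x \<in> {..n} \<rightarrow> carrier A" "y \<in> {..n} \<rightarrow> carrier A"
    and "\<And>i. i \<le> n \<Longrightarrow> witt_ghost p A i x = witt_ghost p A i y"
  shows "x n = y n"
  using assms
proof (induction n rule: less_induct)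
  case (less n)
  have eq: "x i = y i" if "i < n" for i using less.prems that by (intro less.IH) auto
  let ?s = "\<lambda>z. (\<Oplus>i\<in>{..<n}. [(p ^ i)] \<cdot> (z i [^] (p ^ (n - i))))"
  have c: "x i \<in> carrier A" "y i \<in> carrier A" if "i \<le> n" for i using less.prems(1,2) that by auto
  have s: "?s y \<in> carrier A" using c by (intro finsum_closed) auto
  have "?s x = ?s y" using c eq by (intro finsum_cong') auto
  then have "?s y \<oplus> [(p ^ n)] \<cdot> x n = ?s y \<oplus> [(p ^ n)] \<cdot> y n"
    using less.prems(1,2) less.prems(3)[of n] by (simp add: ghost_split)
  then have "[(p ^ n)] \<cdot> x n = [(p ^ n)] \<cdot> y n" using s less.prems(1,2) by (auto simp: Pi_iff)
  from p_pow_cancel[OF c(1)[OF order_refl] c(2)[OF order_refl] this] show ?case .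
qed

end

text \<open>The standard Frobenius lift on a polynomial ring. It makes Dwork's lemma applicable to
  sequences of polynomials, which is how the Witt polynomials are shown to exist over the
  integers.\<close>

definition zpoly_frob :: "nat \<Rightarrow> 'v zpoly \<Rightarrow> 'v zpoly" where
  "zpoly_frob p = zeval zpoly_ring (\<lambda>v. zvar v ^ p)"

lemma zpoly_ring_zmon: "cring.zmon zpoly_ring zvar m = frag_of m"
proof -
  interpret P: cring "zpoly_ring :: 'a zpoly ring" by (rule cring_zpoly_ring)
  have "(\<Otimes>\<^bsub>zpoly_ring\<^esub>i\<in>I. zvar i [^]\<^bsub>zpoly_ring\<^esub> Poly_Mapping.lookup m i) =
     frag_of (\<Sum>i\<in>I. Poly_Mapping.single i (Poly_Mapping.lookup m i))" if "finite I" for I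
    using that
  proof (induction rule: finite_induct)
    case (insert x F)
    have "zvar x ^ n = frag_of (Poly_Mapping.single x n)" for n
      by (induction n) (auto simp: zvar_def mult_single simp flip: single_add)
    with insert show ?case by (simp add: mult_single)
  qed simp
  moreover have "(\<Sum>i\<in>Poly_Mapping.keys m. Poly_Mapping.single i (Poly_Mapping.lookup m i)) = m"
    by (rule poly_mapping_eqI) (simp add: lookup_sum lookup_single when_def in_keys_iff sum.delta)
  ultimately show ?thesis unfolding P.zmon_def by simp
qed

lemma frob_lift_zpoly:
  assumes "prime p" "odd p"
  shows "frob_lift (zpoly_ring :: 'v zpoly ring) p (zpoly_frob p)"
proof -
  interpret P: cring "zpoly_ring :: 'v zpoly ring" by (rule cring_zpoly_ring)
  have p0: "p > 0" using assms prime_gt_0_nat by blast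
  \<comment> \<open>Monomials are lifted exactly, with \<open>c = 0\<close>; differences inherit the
    property because the \<open>p\<close>-th power is additive modulo \<open>p\<close>.\<close>
  have lift: "\<exists>c. zpoly_frob p Q = Q ^ p + of_nat p * c" for Q :: "'v zpoly"
    using subset_UNIV[of "Poly_Mapping.keys Q"]
  proof (induction Q rule: frag_induction)
    case zero
    show ?case by (intro exI[of _ 0]) (use p0 in \<open>simp add: zpoly_frob_def zero_power\<close>)
  next
    case (one m)
    have "(\<Otimes>\<^bsub>zpoly_ring\<^esub>i\<in>I. (zvar i ^ p) [^]\<^bsub>zpoly_ring\<^esub> Poly_Mapping.lookup m i) =
      (\<Otimes>\<^bsub>zpoly_ring\<^esub>i\<in>I. zvar i [^]\<^bsub>zpoly_ring\<^esub> Poly_Mapping.lookup m i) ^ p" if "finite I" for I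
      using that by (induction rule: finite_induct) (auto simp: power_mult_distrib mult.commute simp flip: power_mult)
    then have "P.zmon (\<lambda>v. zvar v ^ p) m = P.zmon zvar m ^ p" unfolding P.zmon_def by simp
    then show ?case by (intro exI[of _ 0]) (simp add: zpoly_frob_def zpoly_ring_zmon)
  next
    case (diff a b)
    then obtain c d where cd: "zpoly_frob p a = a ^ p + of_nat p * c" "zpoly_frob p b = b ^ p + of_nat p * d" by blast
    obtain e where e: "(a + - b) ^ p = a ^ p + of_nat p * (a ^ (p - 1) * - b) + of_nat p * ((- b)\<^sup>2 * e) + (- b) ^ p"
      using power_add_prime[OF assms(1)] by blast
    have "zpoly_frob p (a - b) = zpoly_frob p a - zpoly_frob p b"
      unfolding zpoly_frob_def by (simp add: P.zeval_diff P.minus_eq)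
    also have "\<dots> = (a - b) ^ p + of_nat p * (c - d + a ^ (p - 1) * b - b\<^sup>2 * e)"
      using assms(2) e cd by (simp add: algebra_simps power_minus_odd)
    finally show ?case by blast
  qed
  show ?thesis
  proof (intro frob_lift.intro frob_lift_axioms.intro P.cring_axioms)
    show "zpoly_frob p \<in> ring_hom (zpoly_ring :: 'v zpoly ring) zpoly_ring"
      unfolding zpoly_frob_def by (rule P.zeval_hom) auto
  qed (use assms lift p0 in auto)
qed

lemma ghost_poly_eq: "ghost_poly p n X = witt_ghost p zpoly_ring n X"
  by (simp add: ghost_poly_def witt_ghost_def)

lemma (in cring) zeval_ghost_poly:
  assumes "v \<in> UNIV \<rightarrow> carrier R"
  shows "zeval R v (ghost_poly p n X) = witt_ghost p R n (\<lambda>i. zeval R v (X i))"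
  unfolding ghost_poly_def witt_ghost_def using assms
  by (subst zeval_sum) (auto simp only: zeval_of_nat_mult zeval_power finite_atMost)

lemma witt_polys_unique:
  assumes p: "prime p" "odd p" and "\<forall>n. ghost_poly p n S = \<Phi> n"
  shows "witt_polys p \<Phi> = S"
  unfolding witt_polys_def
proof (rule the_equality)
  interpret frob_lift "zpoly_ring :: 'a zpoly ring" p "zpoly_frob p" by (rule frob_lift_zpoly[OF p])
  fix T assume "\<forall>n. ghost_poly p n T = \<Phi> n"
  then show "T = S"
    using assms(3) by (intro ext) (rule ghost_inj, auto simp: ghost_poly_eq)
qed fact

text \<open>Dwork's lemma over the polynomial ring: the congruences are what makes the ghost
  equations solvable with integer coefficients.\<close>

lemma ghost_witt_polys:
  fixes \<Phi> :: "nat \<Rightarrow> 'v zpoly"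
  assumes p: "prime p" "odd p"
    and cong: "\<And>n. frob_lift.pcong zpoly_ring p (Suc n) (\<Phi> (Suc n)) (zpoly_frob p (\<Phi> n))"
  shows "ghost_poly p n (witt_polys p \<Phi>) = \<Phi> n"
proof -
  interpret frob_lift "zpoly_ring :: 'v zpoly ring" p "zpoly_frob p" by (rule frob_lift_zpoly[OF p])
  obtain S where "\<forall>n. ghost_poly p n S = \<Phi> n"
    using dwork[of \<Phi>] cong by (auto simp: ghost_poly_eq)
  then show ?thesis using witt_polys_unique[OF p] by blast
qed

text \<open>The ghost equation expresses \<open>p ^ n\<close> times the \<open>n\<close>-th solution
  through \<Phi> and earlier solutions, and a nonzero integer factor does not change the set of
  variables.\<close>

lemma zvars_witt_polys:
  fixes \<Phi> :: "nat \<Rightarrow> 'v zpoly"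
  assumes p: "prime p" and S: "\<And>n. ghost_poly p n S = \<Phi> n"
    and V: "\<And>n. zvars (\<Phi> n) \<subseteq> V n" "mono V"
  shows "zvars (S n) \<subseteq> V n"
proof (induction n rule: less_induct)
  case (less n)
  have "{..n} = insert n {..<n}" by auto
  then have "of_nat (p ^ n) * S n = \<Phi> n - (\<Sum>i<n. of_nat (p ^ i) * S i ^ (p ^ (n - i)))"
    using S[of n] by (simp add: ghost_poly_def algebra_simps)
  moreover have "zvars (of_nat (p ^ i) * S i ^ (p ^ (n - i))) \<subseteq> V n" if "i < n" for i
    using less[OF that] monoD[OF V(2), of i n] that zvars_mult[of "of_nat (p ^ i)" "S i ^ (p ^ (n - i))"]
      zvars_power[of "S i" "p ^ (n - i)"] by (simp only: zvars_of_nat) auto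
  then have "zvars (\<Sum>i<n. of_nat (p ^ i) * S i ^ (p ^ (n - i))) \<subseteq> V n" by (intro zvars_sum) auto
  ultimately have "zvars (of_nat (p ^ n) * S n) \<subseteq> V n"
    using zvars_diff[of "\<Phi> n"] V(1)[of n] by (simp del: of_nat_power) blast
  moreover have "p ^ n > 0" using p prime_gt_0_nat by simp
  ultimately show ?case by (simp only: zvars_of_nat_mult)
qed

lemma zvars_ghost_poly: "zvars (ghost_poly p n (\<lambda>i. zvar (f i))) \<subseteq> f ` {..n}"
  unfolding ghost_poly_def
proof (rule zvars_sum)
  fix i assume "i \<in> {..n}"
  then show "zvars (of_nat (p ^ i) * zvar (f i) ^ (p ^ (n - i))) \<subseteq> f ` {..n}"
    using zvars_mult[of "of_nat (p ^ i)" "zvar (f i) ^ (p ^ (n - i))"] zvars_power[of "zvar (f i)" "p ^ (n - i)"]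
    by (simp only: zvars_of_nat zvars_zvar) auto
qed

section \<open>The Witt polynomials for sum, product and Frobenius\<close>

context
  fixes p :: nat assumes p: "prime p" "odd p"
begin

lemma ghost_witt_add_polys:
  "ghost_poly p n (witt_add_polys p) = ghost_poly p n (\<lambda>i. zvar (Inl i)) + ghost_poly p n (\<lambda>i. zvar (Inr i))"
  unfolding witt_add_polys_def
proof (rule ghost_witt_polys[OF p])
  interpret frob_lift "zpoly_ring :: (nat + nat) zpoly ring" p "zpoly_frob p" by (rule frob_lift_zpoly[OF p])
  fix n
  show "pcong (Suc n) (ghost_poly p (Suc n) (\<lambda>i. zvar (Inl i)) + ghost_poly p (Suc n) (\<lambda>i. zvar (Inr i)))
         (zpoly_frob p (ghost_poly p n (\<lambda>i. zvar (Inl i)) + ghost_poly p n (\<lambda>i. zvar (Inr i))))"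
    using pcong_add[OF ghost_pcong[of "\<lambda>i. zvar (Inl i)" "Suc n"] ghost_pcong[of "\<lambda>i. zvar (Inr i)" "Suc n"]]
      phi.hom_add[of "ghost_poly p n (\<lambda>i. zvar (Inl i))" "ghost_poly p n (\<lambda>i. zvar (Inr i))"]
    by (simp add: ghost_poly_eq)
qed

lemma ghost_witt_mult_polys:
  "ghost_poly p n (witt_mult_polys p) = ghost_poly p n (\<lambda>i. zvar (Inl i)) * ghost_poly p n (\<lambda>i. zvar (Inr i))"
  unfolding witt_mult_polys_def
proof (rule ghost_witt_polys[OF p])
  interpret frob_lift "zpoly_ring :: (nat + nat) zpoly ring" p "zpoly_frob p" by (rule frob_lift_zpoly[OF p])
  fix n
  show "pcong (Suc n) (ghost_poly p (Suc n) (\<lambda>i. zvar (Inl i)) * ghost_poly p (Suc n) (\<lambda>i. zvar (Inr i)))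
         (zpoly_frob p (ghost_poly p n (\<lambda>i. zvar (Inl i)) * ghost_poly p n (\<lambda>i. zvar (Inr i))))"
    using pcong_mult[OF ghost_pcong[of "\<lambda>i. zvar (Inl i)" "Suc n"] ghost_pcong[of "\<lambda>i. zvar (Inr i)" "Suc n"]]
      phi.hom_mult[of "ghost_poly p n (\<lambda>i. zvar (Inl i))" "ghost_poly p n (\<lambda>i. zvar (Inr i))"]
    by (simp add: ghost_poly_eq)
qed

lemma ghost_witt_frob_polys:
  "ghost_poly p n (witt_frob_polys p) = ghost_poly p (Suc n) zvar"
  unfolding witt_frob_polys_def
proof (rule ghost_witt_polys[OF p])
  interpret frob_lift "zpoly_ring :: nat zpoly ring" p "zpoly_frob p" by (rule frob_lift_zpoly[OF p])
  fix n
  show "pcong (Suc n) (ghost_poly p (Suc (Suc n)) zvar) (zpoly_frob p (ghost_poly p (Suc n) zvar))"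
    using pcong_mono[OF ghost_pcong[of zvar "Suc (Suc n)"], of "Suc n"] by (simp add: ghost_poly_eq)
qed

lemma zvars_witt_add_polys: "zvars (witt_add_polys p n) \<subseteq> Inl ` {..n} \<union> Inr ` {..n}"
  by (rule zvars_witt_polys[OF p(1) ghost_witt_add_polys])
    (auto intro!: monoI dest!: set_mp[OF zvars_add] set_mp[OF zvars_ghost_poly])

lemma zvars_witt_mult_polys: "zvars (witt_mult_polys p n) \<subseteq> Inl ` {..n} \<union> Inr ` {..n}"
  by (rule zvars_witt_polys[OF p(1) ghost_witt_mult_polys])
    (auto intro!: monoI dest!: set_mp[OF zvars_mult] set_mp[OF zvars_ghost_poly])

lemma zvars_witt_frob_polys: "zvars (witt_frob_polys p n) \<subseteq> {..Suc n}"
  by (rule zvars_witt_polys[OF p(1) ghost_witt_frob_polys])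
    (use zvars_ghost_poly[of p _ "\<lambda>i. i"] in \<open>auto intro!: monoI\<close>)

text \<open>The reason why the Witt vector Frobenius is the coordinatewise \<open>p\<close>-th power
  in characteristic \<open>p\<close>. The two sides of \<open>ghost_witt_frob_polys\<close> are
  compared modulo \<open>p ^ Suc n\<close>: by induction the summands with \<open>i < n\<close>
  agree, which leaves \<open>p ^ n\<close> times the claim.\<close>

lemma witt_frob_polys_cong: "\<exists>g. witt_frob_polys p n = zvar n ^ p + of_nat p * g"
proof -
  interpret frob_lift "zpoly_ring :: nat zpoly ring" p "zpoly_frob p" by (rule frob_lift_zpoly[OF p])
  let ?S = "witt_frob_polys p"
  have "pcong 1 (?S n) (zvar n ^ p)"
  proof (induction n rule: less_induct)
    case (less n)
    have "pcong (Suc n) (of_nat (p ^ i) * ?S i ^ (p ^ (n - i))) (of_nat (p ^ i) * zvar i ^ (p ^ (Suc n - i)))"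
      if "i < n" for i
    proof -
      have "pcong (1 + (n - i)) (?S i ^ (p ^ (n - i))) ((zvar i ^ p) ^ (p ^ (n - i)))"
        using pcong_pow_p_pow[OF less[OF that], of "n - i"] by simp
      then have "pcong (i + (1 + (n - i))) (of_nat (p ^ i) * ?S i ^ (p ^ (n - i))) (of_nat (p ^ i) * (zvar i ^ p) ^ (p ^ (n - i)))"
        using pcong_scale[of "1 + (n - i)" _ _ i] by (simp only: zpoly_ring_add_pow zpoly_ring_simps UNIV_I)
      then show ?thesis using that by (simp add: Suc_diff_le flip: power_mult power_Suc)
    qed
    then have "pcong (Suc n) (\<Sum>i<n. of_nat (p ^ i) * ?S i ^ (p ^ (n - i))) (\<Sum>i<n. of_nat (p ^ i) * zvar i ^ (p ^ (Suc n - i)))"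
      using pcong_finsum[of "{..<n}" "Suc n"] by (simp del: of_nat_power)
    then obtain c where c: "(\<Sum>i<n. of_nat (p ^ i) * ?S i ^ (p ^ (n - i))) =
        (\<Sum>i<n. of_nat (p ^ i) * zvar i ^ (p ^ (Suc n - i))) + of_nat (p ^ Suc n) * c"
      unfolding pcong_def zpoly_ring_add_pow by auto
    have 1: "ghost_poly p n ?S = (\<Sum>i<n. of_nat (p ^ i) * ?S i ^ (p ^ (n - i))) + of_nat (p ^ n) * ?S n"
      unfolding ghost_poly_def lessThan_Suc_atMost[symmetric] by simp
    have 2: "ghost_poly p (Suc n) zvar =
      (\<Sum>i<n. of_nat (p ^ i) * zvar i ^ (p ^ (Suc n - i))) + of_nat (p ^ n) * zvar n ^ p + of_nat (p ^ Suc n) * zvar (Suc n)"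
      unfolding ghost_poly_def lessThan_Suc_atMost[symmetric] by simp
    have "of_nat (p ^ n) * ?S n = of_nat (p ^ n) * (zvar n ^ p + of_nat p * (zvar (Suc n) - c))"
      using ghost_witt_frob_polys[of n] unfolding 1 2 c by (simp add: algebra_simps)
    then have "?S n = zvar n ^ p + of_nat p * (zvar (Suc n) - c)"
      using p_pow_cancel[of "?S n" "zvar n ^ p + of_nat p * (zvar (Suc n) - c)" n] by (simp del: of_nat_power)
    then show ?case by (intro pcongI[of "zvar (Suc n) - c"]) auto
  qed
  then show ?thesis unfolding pcong_def by auto
qed

end

section \<open>Rings of Witt vectors\<close>

text \<open>Treats \<open>UNIV\<close> and \<open>{..<n}\<close> together. Index sets must be closed
  downwards because the \<open>n\<close>-th ghost component involves all coordinates up to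
  \<open>n\<close>.\<close>

definition initial_seg :: "nat set \<Rightarrow> bool" where
  "initial_seg J \<longleftrightarrow> (\<forall>i\<in>J. {..i} \<subseteq> J)"

lemma initial_seg_UNIV [simp]: "initial_seg UNIV" and initial_seg_lessThan [simp]: "initial_seg {..<n}"
  by (auto simp: initial_seg_def)

lemma initial_segD: "initial_seg J \<Longrightarrow> i \<in> J \<Longrightarrow> j \<le> i \<Longrightarrow> j \<in> J"
  by (auto simp: initial_seg_def)

lemma witt_ring_simps:
  "carrier (witt_ring p J R) = J \<rightarrow>\<^sub>E carrier R"
  "\<one>\<^bsub>witt_ring p J R\<^esub> = (\<lambda>i\<in>J. if i = 0 then \<one>\<^bsub>R\<^esub> else \<zero>\<^bsub>R\<^esub>)"
  "\<zero>\<^bsub>witt_ring p J R\<^esub> = (\<lambda>i\<in>J. \<zero>\<^bsub>R\<^esub>)"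
  "x \<oplus>\<^bsub>witt_ring p J R\<^esub> y = (\<lambda>i\<in>J. zeval R (case_sum x y) (witt_add_polys p i))"
  "x \<otimes>\<^bsub>witt_ring p J R\<^esub> y = (\<lambda>i\<in>J. zeval R (case_sum x y) (witt_mult_polys p i))"
  by (simp_all add: witt_ring_def)

text \<open>Collects what holds for Witt vectors over any commutative ring, since it is needed over
  \<open>k\<close> as well as over \<open>A\<close>.\<close>

locale cring_prime = cring R for R (structure) +
  fixes p :: nat
  assumes p_prime: "prime p" and p_odd: "odd p"
begin

lemma p_gt_0: "p > 0"
  using p_prime prime_gt_0_nat by blast

abbreviation W :: "nat set \<Rightarrow> (nat \<Rightarrow> 'a) ring" where
  "W J \<equiv> witt_ring p J R"

abbreviation gh :: "nat \<Rightarrow> (nat \<Rightarrow> 'a) \<Rightarrow> 'a" where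
  "gh \<equiv> witt_ghost p R"

lemma gh_cong:
  assumes "\<And>i. i \<le> n \<Longrightarrow> x i = y i" "\<And>i. i \<le> n \<Longrightarrow> y i \<in> carrier R"
  shows "gh n x = gh n y"
  unfolding witt_ghost_def using assms by (intro finsum_cong') auto

lemma gh_zeval:
  assumes "v \<in> UNIV \<rightarrow> carrier R" "\<And>i. i \<le> n \<Longrightarrow> x i = zeval R v (S i)"
  shows "gh n x = zeval R v (ghost_poly p n S)"
  using gh_cong[OF assms(2)] assms(1) by (simp add: zeval_ghost_poly)

text \<open>Evaluation of polynomials is a ring homomorphism only for total assignments, so vectors
  are extended by zero; by \<open>zeval_ext0\<close> this does not affect the Witt
  polynomials.\<close>

definition ext0 :: "nat set \<Rightarrow> (nat \<Rightarrow> 'a) \<Rightarrow> nat \<Rightarrow> 'a" where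
  "ext0 J x i = (if i \<in> J then x i else \<zero>)"

lemma ext0_closed: "x \<in> J \<rightarrow> carrier R \<Longrightarrow> ext0 J x i \<in> carrier R"
  by (auto simp: ext0_def)

lemma ext0_case_closed:
  "x \<in> J \<rightarrow> carrier R \<Longrightarrow> y \<in> J \<rightarrow> carrier R \<Longrightarrow> case_sum (ext0 J x) (ext0 J y) \<in> UNIV \<rightarrow> carrier R"
  by (auto simp: ext0_closed split: sum.splits)

lemma gh_ext0:
  assumes "initial_seg J" "n \<in> J" "x \<in> J \<rightarrow> carrier R"
  shows "gh n (ext0 J x) = gh n x"
  using assms initial_segD[OF assms(1,2)] by (intro gh_cong) (auto simp: ext0_def)

context
  fixes J assumes J: "initial_seg J"
begin

lemma zeval_ext0:
  assumes "x \<in> J \<rightarrow> carrier R" "y \<in> J \<rightarrow> carrier R" "i \<in> J" "zvars P \<subseteq> Inl ` {..i} \<union> Inr ` {..i}"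
  shows "zeval R (case_sum x y) P = zeval R (case_sum (ext0 J x) (ext0 J y)) P"
  using assms initial_segD[OF J assms(3)]
  by (intro zeval_cong[OF _ ext0_case_closed]) (auto simp: ext0_def)

lemma witt_add_closed: "x \<in> carrier (W J) \<Longrightarrow> y \<in> carrier (W J) \<Longrightarrow> x \<oplus>\<^bsub>W J\<^esub> y \<in> carrier (W J)"
proof -
  assume "x \<in> carrier (W J)" "y \<in> carrier (W J)"
  then have xy: "x \<in> J \<rightarrow> carrier R" "y \<in> J \<rightarrow> carrier R" by (auto simp: witt_ring_simps)
  from ext0_case_closed[OF this] show ?thesis
    by (auto simp: witt_ring_simps zeval_ext0[OF xy _ zvars_witt_add_polys[OF p_prime p_odd]])
qed

lemma witt_mult_closed: "x \<in> carrier (W J) \<Longrightarrow> y \<in> carrier (W J) \<Longrightarrow> x \<otimes>\<^bsub>W J\<^esub> y \<in> carrier (W J)"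
proof -
  assume "x \<in> carrier (W J)" "y \<in> carrier (W J)"
  then have xy: "x \<in> J \<rightarrow> carrier R" "y \<in> J \<rightarrow> carrier R" by (auto simp: witt_ring_simps)
  from ext0_case_closed[OF this] show ?thesis
    by (auto simp: witt_ring_simps zeval_ext0[OF xy _ zvars_witt_mult_polys[OF p_prime p_odd]])
qed

lemma gh_closed: "x \<in> carrier (W J) \<Longrightarrow> n \<in> J \<Longrightarrow> gh n x \<in> carrier R"
  using initial_segD[OF J] unfolding witt_ghost_def
  by (intro finsum_closed) (auto simp: witt_ring_simps PiE_iff)

lemma gh_add:
  assumes x: "x \<in> carrier (W J)" and y: "y \<in> carrier (W J)" and n: "n \<in> J"
  shows "gh n (x \<oplus>\<^bsub>W J\<^esub> y) = gh n x \<oplus> gh n y"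
proof -
  have xy: "x \<in> J \<rightarrow> carrier R" "y \<in> J \<rightarrow> carrier R" using x y by (auto simp: witt_ring_simps)
  let ?v = "case_sum (ext0 J x) (ext0 J y)"
  have v: "?v \<in> UNIV \<rightarrow> carrier R" using xy by (rule ext0_case_closed)
  have "gh n (x \<oplus>\<^bsub>W J\<^esub> y) = zeval R ?v (ghost_poly p n (witt_add_polys p))"
    using initial_segD[OF J n]
    by (intro gh_zeval[OF v]) (simp add: witt_ring_simps zeval_ext0[OF xy _ zvars_witt_add_polys[OF p_prime p_odd]])
  also have "\<dots> = gh n (ext0 J x) \<oplus> gh n (ext0 J y)"
    using v by (simp add: ghost_witt_add_polys[OF p_prime p_odd] zeval_add zeval_ghost_poly)
  finally show ?thesis using gh_ext0[OF J n] xy by simp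
qed

lemma gh_mult:
  assumes x: "x \<in> carrier (W J)" and y: "y \<in> carrier (W J)" and n: "n \<in> J"
  shows "gh n (x \<otimes>\<^bsub>W J\<^esub> y) = gh n x \<otimes> gh n y"
proof -
  have xy: "x \<in> J \<rightarrow> carrier R" "y \<in> J \<rightarrow> carrier R" using x y by (auto simp: witt_ring_simps)
  let ?v = "case_sum (ext0 J x) (ext0 J y)"
  have v: "?v \<in> UNIV \<rightarrow> carrier R" using xy by (rule ext0_case_closed)
  have "gh n (x \<otimes>\<^bsub>W J\<^esub> y) = zeval R ?v (ghost_poly p n (witt_mult_polys p))"
    using initial_segD[OF J n]
    by (intro gh_zeval[OF v]) (simp add: witt_ring_simps zeval_ext0[OF xy _ zvars_witt_mult_polys[OF p_prime p_odd]])
  also have "\<dots> = gh n (ext0 J x) \<otimes> gh n (ext0 J y)"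
    using v by (simp add: ghost_witt_mult_polys[OF p_prime p_odd] zeval_mult zeval_ghost_poly)
  finally show ?thesis using gh_ext0[OF J n] xy by simp
qed

lemma gh_split0:
  assumes "x \<in> {..n} \<rightarrow> carrier R" "\<And>i. 0 < i \<Longrightarrow> i \<le> n \<Longrightarrow> x i = \<zero>"
  shows "gh n x = x 0 [^] (p ^ n)"
proof -
  have "gh n x = (\<Oplus>i\<in>{..n}. if 0 = i then x 0 [^] (p ^ n) else \<zero>)"
    unfolding witt_ghost_def using assms p_gt_0
    by (intro finsum_cong') (auto simp: nat_pow_zero Pi_iff)
  also have "\<dots> = x 0 [^] (p ^ n)"
    using assms(1) by (subst finsum_singleton[of 0 "{..n}" "\<lambda>_. x 0 [^] (p ^ n)"]) (auto simp: Pi_iff)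
  finally show ?thesis .
qed

lemma witt_one_closed: "\<one>\<^bsub>W J\<^esub> \<in> carrier (W J)" and witt_zero_closed: "\<zero>\<^bsub>W J\<^esub> \<in> carrier (W J)"
  by (auto simp: witt_ring_simps)

lemma gh_one: "n \<in> J \<Longrightarrow> gh n \<one>\<^bsub>W J\<^esub> = \<one>"
  using initial_segD[OF J] by (subst gh_split0) (auto simp: witt_ring_simps)

lemma gh_zero: "n \<in> J \<Longrightarrow> gh n \<zero>\<^bsub>W J\<^esub> = \<zero>"
  using initial_segD[OF J] p_gt_0 by (subst gh_split0) (auto simp: witt_ring_simps nat_pow_zero)

lemma teich_closed: "a \<in> carrier R \<Longrightarrow> teichmueller J R a \<in> carrier (W J)"
  by (auto simp: witt_ring_simps teichmueller_def)

lemma gh_teich: "a \<in> carrier R \<Longrightarrow> n \<in> J \<Longrightarrow> gh n (teichmueller J R a) = a [^] (p ^ n)"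
  using initial_segD[OF J] by (subst gh_split0) (auto simp: teichmueller_def)

end

lemma witt_frob_closed:
  assumes "initial_seg J'" "\<And>i. i \<in> J \<Longrightarrow> Suc i \<in> J'" "x \<in> carrier (W J')"
  shows "witt_frob p J R x \<in> carrier (W J)"
    and "initial_seg J \<Longrightarrow> n \<in> J \<Longrightarrow> gh n (witt_frob p J R x) = gh (Suc n) x"
proof -
  have x: "x \<in> J' \<rightarrow> carrier R" using assms by (auto simp: witt_ring_simps)
  have v: "ext0 J' x \<in> UNIV \<rightarrow> carrier R" using ext0_closed[OF x] by auto
  have *: "zeval R x (witt_frob_polys p i) = zeval R (ext0 J' x) (witt_frob_polys p i)" if "i \<in> J" for i
    using zvars_witt_frob_polys[OF p_prime p_odd, of i] initial_segD[OF assms(1) assms(2)[OF that]] v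
    by (intro zeval_cong) (auto simp: ext0_def)
  show "witt_frob p J R x \<in> carrier (W J)"
    using v by (auto simp: witt_ring_simps witt_frob_def *)
  assume J: "initial_seg J" and n: "n \<in> J"
  have "gh n (witt_frob p J R x) = zeval R (ext0 J' x) (ghost_poly p n (witt_frob_polys p))"
    using initial_segD[OF J n] by (intro gh_zeval[OF v]) (simp add: witt_frob_def *)
  also have "\<dots> = gh (Suc n) (ext0 J' x)"
    using v by (simp add: ghost_witt_frob_polys[OF p_prime p_odd] zeval_ghost_poly)
  finally show "gh n (witt_frob p J R x) = gh (Suc n) x"
    using gh_ext0[OF assms(1) assms(2)[OF n] x] by simp
qed

lemma witt_ver_closed:
  assumes "\<And>i. Suc i \<in> J' \<Longrightarrow> i \<in> J" "x \<in> carrier (W J)"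
  shows "witt_ver J' R x \<in> carrier (W J')"
proof -
  have "x i \<in> carrier R" if "i \<in> J" for i using assms(2) that by (auto simp: witt_ring_simps)
  then show ?thesis using assms(1)
    by (auto simp: witt_ring_simps witt_ver_def)
qed

lemma gh_ver:
  assumes "initial_seg J'" "\<And>i. Suc i \<in> J' \<Longrightarrow> i \<in> J" "x \<in> carrier (W J)"
  shows "0 \<in> J' \<Longrightarrow> gh 0 (witt_ver J' R x) = \<zero>"
    and "Suc n \<in> J' \<Longrightarrow> gh (Suc n) (witt_ver J' R x) = [p] \<cdot> gh n x"
proof -
  show "gh 0 (witt_ver J' R x) = \<zero>" if "0 \<in> J'"
    using that by (simp add: witt_ghost_def witt_ver_def)
  assume n: "Suc n \<in> J'"
  have x: "x i \<in> carrier R" if "i \<le> n" for i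
    using assms(3) assms(2)[OF initial_segD[OF assms(1) n, of "Suc i"]] that by (auto simp: witt_ring_simps)
  have i: "i \<in> J'" if "i \<le> Suc n" for i using initial_segD[OF assms(1) n that] .
  have "{..Suc n} = insert 0 (Suc ` {..n})" by (rule atMost_Suc_eq_insert_0)
  then have "gh (Suc n) (witt_ver J' R x) =
      [(p ^ 0)] \<cdot> (witt_ver J' R x 0 [^] (p ^ (Suc n - 0))) \<oplus>
      (\<Oplus>i\<in>Suc ` {..n}. [(p ^ i)] \<cdot> (witt_ver J' R x i [^] (p ^ (Suc n - i))))"
    unfolding witt_ghost_def using x i by (simp only:) (subst finsum_insert, auto simp: witt_ver_def)
  also have "(\<Oplus>i\<in>Suc ` {..n}. [(p ^ i)] \<cdot> (witt_ver J' R x i [^] (p ^ (Suc n - i)))) =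
      (\<Oplus>i\<in>{..n}. [p] \<cdot> ([(p ^ i)] \<cdot> (x i [^] (p ^ (n - i)))))"
    using x i by (subst finsum_reindex) (auto simp: witt_ver_def add_pow_mult intro!: finsum_cong')
  also have "\<dots> = [p] \<cdot> gh n x"
  proof -
    have "(\<Oplus>i\<in>I. [p] \<cdot> f i) = [p] \<cdot> (\<Oplus>i\<in>I. f i)" if "finite I" "f \<in> I \<rightarrow> carrier R" for I and f :: "nat \<Rightarrow> 'a"
      using that by (induction rule: finite_induct) (simp_all add: add.nat_pow_distrib Pi_iff)
    then show ?thesis unfolding witt_ghost_def using x by auto
  qed
  finally show "gh (Suc n) (witt_ver J' R x) = [p] \<cdot> gh n x"
    using i[of 0] x p_gt_0 by (simp add: witt_ver_def nat_pow_zero) (simp add: witt_ghost_def finsum_closed Pi_iff)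
qed

lemma restrict_closed: "x \<in> carrier (W J) \<Longrightarrow> J' \<subseteq> J \<Longrightarrow> restrict x J' \<in> carrier (W J')"
  by (auto simp: witt_ring_simps)

lemma gh_restrict: "initial_seg J' \<Longrightarrow> J' \<subseteq> J \<Longrightarrow> x \<in> carrier (W J) \<Longrightarrow> n \<in> J' \<Longrightarrow> gh n (restrict x J') = gh n x"
  using initial_segD[of J' n] by (intro gh_cong) (auto simp: witt_ring_simps)

end

sublocale frob_lift \<subseteq> cring_prime A p
  by unfold_locales (rule prime_p odd_p)+

context frob_lift
begin

text \<open>Over a torsion free base every identity between Witt vectors is verified on ghost
  components; most proofs below go through this rule.\<close>

lemma witt_eqI:
  assumes J: "initial_seg J" and "x \<in> carrier (W J)" "y \<in> carrier (W J)"
    and gh: "\<And>n. n \<in> J \<Longrightarrow> gh n x = gh n y"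
  shows "x = y"
proof (rule PiE_ext)
  show x: "x \<in> J \<rightarrow>\<^sub>E carrier A" and y: "y \<in> J \<rightarrow>\<^sub>E carrier A" using assms by (auto simp: witt_ring_simps)
  fix n assume "n \<in> J"
  then show "x n = y n"
    using x y initial_segD[OF J] gh by (intro ghost_inj[of x n y]) auto
qed

lemma witt_cring:
  assumes J: "initial_seg J"
  shows "cring (W J)"
proof (rule cringI)
  note c = witt_add_closed[OF J] witt_mult_closed[OF J] witt_one_closed[OF J] witt_zero_closed[OF J]
  note g = gh_add[OF J] gh_mult[OF J] gh_one[OF J] gh_zero[OF J] gh_closed[OF J]
  show "abelian_group (W J)"
  proof (rule abelian_groupI)
    fix x assume x: "x \<in> carrier (W J)"
    show "\<exists>y\<in>carrier (W J). y \<oplus>\<^bsub>W J\<^esub> x = \<zero>\<^bsub>W J\<^esub>"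
    proof
      \<comment> \<open>For odd \<open>p\<close> the additive inverse is coordinatewise, since all
        exponents \<open>p ^ (n - i)\<close> are odd.\<close>
      let ?y = "\<lambda>i\<in>J. \<ominus> x i"
      have xc: "x i \<in> carrier A" if "i \<in> J" for i using x that by (auto simp: witt_ring_simps)
      show y: "?y \<in> carrier (W J)" using xc by (auto simp: witt_ring_simps)
      have "gh n ?y = \<ominus> gh n x" if "n \<in> J" for n
      proof -
        have odd_pow: "(\<ominus> a) [^] k = \<ominus> (a [^] k)" if "odd k" "a \<in> carrier A" for a and k :: nat
        proof -
          obtain l where l: "k = 2 * l + 1" using \<open>odd k\<close> oddE by blast
          have "(\<ominus> a) [^] (2 * l) = a [^] (2 * l)"
            using \<open>a \<in> carrier A\<close> by (induction l) (simp_all add: l_minus r_minus m_assoc)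
          then show ?thesis using \<open>a \<in> carrier A\<close> l by (simp add: r_minus)
        qed
        have i: "i \<in> J" if "i \<le> n" for i using initial_segD[OF J \<open>n \<in> J\<close> that] .
        have neg: "(\<Oplus>i\<in>I. \<ominus> f i) = \<ominus> (\<Oplus>i\<in>I. f i)" if "finite I" "f \<in> I \<rightarrow> carrier A" for I and f :: "nat \<Rightarrow> 'a"
          using that by (induction rule: finite_induct) (simp_all add: minus_add Pi_iff)
        have "gh n ?y = (\<Oplus>i\<in>{..n}. \<ominus> ([(p ^ i)] \<cdot> (x i [^] (p ^ (n - i)))))"
          unfolding witt_ghost_def using i xc odd_p
          by (intro finsum_cong') (auto simp: odd_pow add_pow_minus)
        also have "\<dots> = \<ominus> gh n x" unfolding witt_ghost_def using i xc by (intro neg) auto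
        finally show ?thesis .
      qed
      then show "?y \<oplus>\<^bsub>W J\<^esub> x = \<zero>\<^bsub>W J\<^esub>"
        using x y by (intro witt_eqI[OF J]) (auto simp: c g l_neg)
    qed
  qed (auto simp: c g a_ac intro!: witt_eqI[OF J])
  show "Group.comm_monoid (W J)"
    by (rule comm_monoidI) (auto simp: c g m_ac intro!: witt_eqI[OF J])
qed (auto simp: witt_add_closed[OF J] witt_mult_closed[OF J] gh_add[OF J] gh_mult[OF J] gh_closed[OF J] l_distr
    intro!: witt_eqI[OF J])

lemma gh_add_pow:
  assumes J: "initial_seg J" and "x \<in> carrier (W J)" "n \<in> J"
  shows "gh n ([(m::nat)] \<cdot>\<^bsub>W J\<^esub> x) = [m] \<cdot> gh n x"
proof -
  interpret WJ: cring "W J" by (rule witt_cring[OF J])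
  show ?thesis using assms by (induction m) (simp_all add: gh_zero gh_add)
qed

lemma gh_pow:
  assumes J: "initial_seg J" and "x \<in> carrier (W J)" "n \<in> J"
  shows "gh n (x [^]\<^bsub>W J\<^esub> (m::nat)) = gh n x [^] m"
proof -
  interpret WJ: cring "W J" by (rule witt_cring[OF J])
  show ?thesis using assms by (induction m) (simp_all add: gh_one gh_mult)
qed

section \<open>Frobenius and Verschiebung, for infinite length and for lengths \<open>n\<close> and
  \<open>n + 1\<close> at once\<close>

context
  fixes J J' assumes J: "initial_seg J" and J': "initial_seg J'" and Suc_J: "\<And>i. Suc i \<in> J' \<longleftrightarrow> i \<in> J"
begin

abbreviation "F \<equiv> witt_frob p J A"
abbreviation "V \<equiv> witt_ver J' A"

lemma F_closed: "x \<in> carrier (W J') \<Longrightarrow> F x \<in> carrier (W J)"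
  using Suc_J by (intro witt_frob_closed(1)[OF J']) auto

lemma V_closed: "x \<in> carrier (W J) \<Longrightarrow> V x \<in> carrier (W J')"
  using Suc_J by (intro witt_ver_closed) auto

lemma gh_F: "x \<in> carrier (W J') \<Longrightarrow> n \<in> J \<Longrightarrow> gh n (F x) = gh (Suc n) x"
  using Suc_J by (intro witt_frob_closed(2)[OF J' _ _ J]) auto

lemma gh_V_0: "x \<in> carrier (W J) \<Longrightarrow> 0 \<in> J' \<Longrightarrow> gh 0 (V x) = \<zero>"
  using Suc_J by (intro gh_ver(1)[OF J']) auto

lemma gh_V_Suc: "x \<in> carrier (W J) \<Longrightarrow> n \<in> J \<Longrightarrow> gh (Suc n) (V x) = [p] \<cdot> gh n x"
  using Suc_J by (intro gh_ver(2)[OF J']) auto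

lemma gh_V_cases:
  assumes "n \<in> J'"
  obtains "n = 0" "0 \<in> J'" | m where "n = Suc m" "m \<in> J"
  using assms Suc_J by (cases n) auto

lemma F_hom: "F \<in> ring_hom (W J') (W J)"
proof (rule ring_hom_memI)
  show "F \<one>\<^bsub>W J'\<^esub> = \<one>\<^bsub>W J\<^esub>"
    by (rule witt_eqI[OF J]) (auto simp: gh_F gh_one J J' Suc_J F_closed witt_one_closed)
qed (auto intro!: witt_eqI[OF J] simp: F_closed gh_F gh_add gh_mult J J' Suc_J
    witt_add_closed witt_mult_closed)

lemma FV:
  assumes "x \<in> carrier (W J)"
  shows "F (V x) = [p] \<cdot>\<^bsub>W J\<^esub> x"
proof -
  interpret WJ: cring "W J" by (rule witt_cring[OF J])
  show ?thesis
    using assms by (intro witt_eqI[OF J]) (auto simp: F_closed V_closed gh_F gh_V_Suc gh_add_pow J)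
qed

lemma V_add:
  assumes "x \<in> carrier (W J)" "y \<in> carrier (W J)"
  shows "V (x \<oplus>\<^bsub>W J\<^esub> y) = V x \<oplus>\<^bsub>W J'\<^esub> V y"
proof (rule witt_eqI[OF J'])
  fix n assume "n \<in> J'"
  then show "gh n (V (x \<oplus>\<^bsub>W J\<^esub> y)) = gh n (V x \<oplus>\<^bsub>W J'\<^esub> V y)"
    by (rule gh_V_cases) (use assms in \<open>simp_all add: V_closed witt_add_closed J J' gh_V_0 gh_V_Suc gh_add Suc_J
      add.nat_pow_distrib gh_closed[OF J]\<close>)
qed (use assms in \<open>auto intro!: V_closed witt_add_closed J J'\<close>)

lemma V_mult_F:
  assumes "x \<in> carrier (W J')" "y \<in> carrier (W J)"
  shows "V (F x \<otimes>\<^bsub>W J\<^esub> y) = x \<otimes>\<^bsub>W J'\<^esub> V y"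
proof (rule witt_eqI[OF J'])
  fix n assume "n \<in> J'"
  then show "gh n (V (F x \<otimes>\<^bsub>W J\<^esub> y)) = gh n (x \<otimes>\<^bsub>W J'\<^esub> V y)"
    by (rule gh_V_cases) (use assms in \<open>simp_all add: V_closed F_closed witt_mult_closed J J' gh_V_0 gh_V_Suc gh_mult
      gh_F Suc_J add_pow_rdistr gh_closed[OF J] gh_closed[OF J']\<close>)
qed (use assms in \<open>auto intro!: V_closed F_closed witt_mult_closed J J'\<close>)

text \<open>The decomposition needs no carries: in each ghost component the summand
  \<open>i = 0\<close> belongs to the Teichmueller part and the summands with positive
  \<open>i\<close> to the Verschiebung of the shifted vector.\<close>

lemma witt_decomp:
  assumes x: "x \<in> carrier (W J')" and 0: "0 \<in> J'"
  shows "\<exists>y\<in>carrier (W J). x = teichmueller J' A (x 0) \<oplus>\<^bsub>W J'\<^esub> V y"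
proof
  let ?y = "\<lambda>i\<in>J. x (Suc i)"
  have xc: "x i \<in> carrier A" if "i \<in> J'" for i using x that by (auto simp: witt_ring_simps)
  show y: "?y \<in> carrier (W J)" using xc Suc_J by (auto simp: witt_ring_simps)
  show "x = teichmueller J' A (x 0) \<oplus>\<^bsub>W J'\<^esub> V ?y"
  proof (rule witt_eqI[OF J' x])
    show "teichmueller J' A (x 0) \<oplus>\<^bsub>W J'\<^esub> V ?y \<in> carrier (W J')"
      using xc 0 y by (intro witt_add_closed teich_closed V_closed J')
    fix n assume n: "n \<in> J'"
    have g: "gh n (teichmueller J' A (x 0) \<oplus>\<^bsub>W J'\<^esub> V ?y) = x 0 [^] (p ^ n) \<oplus> gh n (V ?y)"
      using xc 0 y n by (simp add: gh_add teich_closed V_closed J' gh_teich)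
    show "gh n x = gh n (teichmueller J' A (x 0) \<oplus>\<^bsub>W J'\<^esub> V ?y)"
      unfolding g
    proof (rule gh_V_cases[OF n])
      assume "n = 0" "0 \<in> J'"
      then show "gh n x = x 0 [^] (p ^ n) \<oplus> gh n (V ?y)"
        using 0 y xc by (simp add: gh_V_0) (simp add: witt_ghost_def)
    next
      fix m assume m: "n = Suc m" "m \<in> J"
      have i: "i \<in> J'" if "i \<le> Suc m" for i using initial_segD[OF J' n] m that by simp
      have yx: "V ?y (Suc i) = x (Suc i)" if "i \<le> m" for i
        using i[of "Suc i"] that Suc_J by (simp add: witt_ver_def)
      have "{..Suc m} = insert 0 (Suc ` {..m})" by (rule atMost_Suc_eq_insert_0)
      then have s: "gh n z = z 0 [^] (p ^ n) \<oplus> (\<Oplus>i\<in>Suc ` {..m}. [(p ^ i)] \<cdot> (z i [^] (p ^ (n - i))))"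
        if "\<And>i. i \<le> Suc m \<Longrightarrow> z i \<in> carrier A" for z
        unfolding witt_ghost_def m using that by (simp only:) (subst finsum_insert, auto)
      have Vc: "V ?y i \<in> carrier A" if "i \<le> Suc m" for i
        using V_closed[OF y] i[OF that] by (auto simp: witt_ring_simps)
      have "V ?y 0 = \<zero>" using 0 by (simp add: witt_ver_def)
      then have "gh n (V ?y) = (\<Oplus>i\<in>Suc ` {..m}. [(p ^ i)] \<cdot> (x i [^] (p ^ (n - i))))"
        using s[OF Vc] p_gt_0 yx Vc xc i by (auto simp: nat_pow_zero intro!: l_zero finsum_closed finsum_cong' trans[OF l_zero])
      then show "gh n x = x 0 [^] (p ^ n) \<oplus> gh n (V ?y)" using s[of x] xc i by simp
    qed
  qed
qed

lemma F_teich: "a \<in> carrier A \<Longrightarrow> F (teichmueller J' A a) = teichmueller J A a [^]\<^bsub>W J\<^esub> p"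
proof -
  interpret WJ: cring "W J" by (rule witt_cring[OF J])
  show "a \<in> carrier A \<Longrightarrow> ?thesis"
    by (intro witt_eqI[OF J]) (auto simp: F_closed teich_closed gh_F gh_teich gh_pow J J' Suc_J nat_pow_pow mult.commute)
qed

end

text \<open>Serves to show that the \<open>p\<close>-th power of \<open>V(y)\<close> is divisible by
  \<open>p\<close>.\<close>

lemma V_square:
  assumes "x \<in> carrier (W UNIV)"
  shows "witt_ver UNIV A x \<otimes>\<^bsub>W UNIV\<^esub> witt_ver UNIV A x = [p] \<cdot>\<^bsub>W UNIV\<^esub> witt_ver UNIV A (x \<otimes>\<^bsub>W UNIV\<^esub> x)"
proof -
  interpret U: cring "W UNIV" by (rule witt_cring) simp
  have "gh n (witt_ver UNIV A x) \<otimes> gh n (witt_ver UNIV A x) = [p] \<cdot> gh n (witt_ver UNIV A (x \<otimes>\<^bsub>W UNIV\<^esub> x))" for n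
    using assms
    by (cases n) (simp_all add: gh_V_0[of UNIV UNIV] gh_V_Suc[of UNIV UNIV] gh_mult gh_closed[of UNIV] add_pow_ldistr add_pow_rdistr)
  then show ?thesis using assms
    by (intro witt_eqI[of UNIV]) (simp_all add: V_closed[of UNIV UNIV] gh_mult gh_add_pow)
qed

text \<open>Write \<open>x = [a] + V(y)\<close>. Then \<open>F(x) = [a]^p + p y\<close>, while
  \<open>x^p\<close> is \<open>[a]^p\<close> modulo \<open>p\<close> because \<open>V(y)^p\<close>
  is divisible by \<open>p\<close>.\<close>

lemma witt_frob_lift:
  assumes x: "x \<in> carrier (W UNIV)"
  shows "\<exists>c\<in>carrier (W UNIV). witt_frob p UNIV A x = x [^]\<^bsub>W UNIV\<^esub> p \<oplus>\<^bsub>W UNIV\<^esub> [p] \<cdot>\<^bsub>W UNIV\<^esub> c"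
proof -
  interpret U: cring "W UNIV" by (rule witt_cring) simp
  let ?V = "witt_ver UNIV A" and ?F = "witt_frob p UNIV A"
  interpret F: ring_hom_cring "W UNIV" "W UNIV" ?F by unfold_locales (rule F_hom, auto)
  obtain y where y: "y \<in> carrier (W UNIV)" "x = teichmueller UNIV A (x 0) \<oplus>\<^bsub>W UNIV\<^esub> ?V y"
    using witt_decomp[of UNIV UNIV x] x by auto
  define t where "t = teichmueller UNIV A (x 0)"
  have t: "t \<in> carrier (W UNIV)" using x unfolding t_def by (intro teich_closed) (auto simp: witt_ring_simps)
  have v: "?V y \<in> carrier (W UNIV)" "?V (y \<otimes>\<^bsub>W UNIV\<^esub> y) \<in> carrier (W UNIV)"
    using y by (simp_all add: V_closed[of UNIV UNIV])
  have xt: "x = t \<oplus>\<^bsub>W UNIV\<^esub> ?V y" using y t_def by simp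
  obtain c where c: "c \<in> carrier (W UNIV)" "x [^]\<^bsub>W UNIV\<^esub> p = t [^]\<^bsub>W UNIV\<^esub> p \<oplus>\<^bsub>W UNIV\<^esub> [p] \<cdot>\<^bsub>W UNIV\<^esub> (t [^]\<^bsub>W UNIV\<^esub> (p - 1) \<otimes>\<^bsub>W UNIV\<^esub> ?V y)
     \<oplus>\<^bsub>W UNIV\<^esub> [p] \<cdot>\<^bsub>W UNIV\<^esub> (?V y \<otimes>\<^bsub>W UNIV\<^esub> ?V y \<otimes>\<^bsub>W UNIV\<^esub> c) \<oplus>\<^bsub>W UNIV\<^esub> ?V y [^]\<^bsub>W UNIV\<^esub> p"
    using U.pow_add_prime[OF prime_p t v(1)] xt by auto
  obtain q where q: "p = Suc (Suc q)" using p_ge_3 by (metis Suc_le_D numeral_3_eq_3 Suc_le_mono)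
  have "?V y [^]\<^bsub>W UNIV\<^esub> Suc (Suc q) = ?V y [^]\<^bsub>W UNIV\<^esub> q \<otimes>\<^bsub>W UNIV\<^esub> (?V y \<otimes>\<^bsub>W UNIV\<^esub> ?V y)"
    using v by (simp add: U.m_assoc)
  then have "?V y [^]\<^bsub>W UNIV\<^esub> p = ?V y [^]\<^bsub>W UNIV\<^esub> q \<otimes>\<^bsub>W UNIV\<^esub> (?V y \<otimes>\<^bsub>W UNIV\<^esub> ?V y)"
    unfolding q[symmetric] .
  also have "\<dots> = [p] \<cdot>\<^bsub>W UNIV\<^esub> (?V y [^]\<^bsub>W UNIV\<^esub> q \<otimes>\<^bsub>W UNIV\<^esub> ?V (y \<otimes>\<^bsub>W UNIV\<^esub> y))"
    using v y by (simp add: V_square U.add_pow_rdistr)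
  finally have vp: "?V y [^]\<^bsub>W UNIV\<^esub> p = [p] \<cdot>\<^bsub>W UNIV\<^esub> (?V y [^]\<^bsub>W UNIV\<^esub> q \<otimes>\<^bsub>W UNIV\<^esub> ?V (y \<otimes>\<^bsub>W UNIV\<^esub> y))" .
  define d where "d = t [^]\<^bsub>W UNIV\<^esub> (p - 1) \<otimes>\<^bsub>W UNIV\<^esub> ?V y \<oplus>\<^bsub>W UNIV\<^esub> ?V y \<otimes>\<^bsub>W UNIV\<^esub> ?V y \<otimes>\<^bsub>W UNIV\<^esub> c
     \<oplus>\<^bsub>W UNIV\<^esub> ?V y [^]\<^bsub>W UNIV\<^esub> q \<otimes>\<^bsub>W UNIV\<^esub> ?V (y \<otimes>\<^bsub>W UNIV\<^esub> y)"
  have d: "d \<in> carrier (W UNIV)" unfolding d_def using t v c y by simp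
  have xp: "x [^]\<^bsub>W UNIV\<^esub> p = t [^]\<^bsub>W UNIV\<^esub> p \<oplus>\<^bsub>W UNIV\<^esub> [p] \<cdot>\<^bsub>W UNIV\<^esub> d"
    unfolding c(2) vp d_def using t v c y by (simp add: U.add.nat_pow_distrib U.a_assoc)
  have "?F t = t [^]\<^bsub>W UNIV\<^esub> p" unfolding t_def using x by (intro F_teich) (auto simp: witt_ring_simps)
  moreover have "?F (?V y) = [p] \<cdot>\<^bsub>W UNIV\<^esub> y" using y by (intro FV) auto
  ultimately have "?F x = t [^]\<^bsub>W UNIV\<^esub> p \<oplus>\<^bsub>W UNIV\<^esub> [p] \<cdot>\<^bsub>W UNIV\<^esub> y"
    unfolding xt using t v by simp
  also have "\<dots> = x [^]\<^bsub>W UNIV\<^esub> p \<oplus>\<^bsub>W UNIV\<^esub> [p] \<cdot>\<^bsub>W UNIV\<^esub> (y \<ominus>\<^bsub>W UNIV\<^esub> d)"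
    unfolding xp using t d y
    by (simp add: U.minus_eq U.add.nat_pow_distrib U.add_pow_minus U.a_ac U.r_neg1 U.r_neg2 U.r_neg)
  finally show ?thesis using y d by auto
qed

end

section \<open>Functoriality of Witt vectors in the base ring\<close>

definition witt_map :: "('a \<Rightarrow> 'b) \<Rightarrow> (nat \<Rightarrow> 'a) \<Rightarrow> nat \<Rightarrow> 'b" where
  "witt_map h x = (\<lambda>i. h (x i))"

lemma case_sum_comp: "(\<lambda>i. h (case_sum x y i)) = case_sum (\<lambda>i. h (x i)) (\<lambda>i. h (y i))"
  by (auto split: sum.splits)

context ring_hom_cring
begin

lemma witt_map_hom:
  "witt_map h \<in> ring_hom (witt_ring p UNIV R) (witt_ring p UNIV S)"
proof (rule ring_hom_memI)
  fix x y assume "x \<in> carrier (witt_ring p UNIV R)" "y \<in> carrier (witt_ring p UNIV R)"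
  then have "case_sum x y \<in> UNIV \<rightarrow> carrier R" by (auto simp: witt_ring_simps PiE_iff split: sum.splits)
  from hom_zeval[OF this]
  show "witt_map h (x \<otimes>\<^bsub>witt_ring p UNIV R\<^esub> y) = witt_map h x \<otimes>\<^bsub>witt_ring p UNIV S\<^esub> witt_map h y"
    "witt_map h (x \<oplus>\<^bsub>witt_ring p UNIV R\<^esub> y) = witt_map h x \<oplus>\<^bsub>witt_ring p UNIV S\<^esub> witt_map h y"
    by (simp_all add: witt_ring_simps witt_map_def case_sum_comp restrict_def)
qed (auto simp: witt_ring_simps witt_map_def)

lemma witt_map_zero: "witt_map h \<zero>\<^bsub>witt_ring p UNIV R\<^esub> = \<zero>\<^bsub>witt_ring p UNIV S\<^esub>"
  by (auto simp: witt_ring_simps witt_map_def)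

lemma witt_map_frob: "x \<in> carrier (witt_ring p UNIV R) \<Longrightarrow> witt_map h (witt_frob p UNIV R x) = witt_frob p UNIV S (witt_map h x)"
  using hom_zeval[of x] by (auto simp: witt_ring_simps PiE_iff witt_map_def witt_frob_def)

lemma witt_map_ver: "witt_map h (witt_ver UNIV R x) = witt_ver UNIV S (witt_map h x)"
  by (auto simp: witt_map_def witt_ver_def)

end

text \<open>Every ring is a quotient of a polynomial ring, so that ring identities in Witt vectors can be
  checked on ghost components of Witt vectors of a torsion free ring.\<close>

context cring_prime
begin

text \<open>The variables are all elements of the type; those outside the carrier are sent to zero,
  so that the assignment is total and the map still surjective.\<close>

definition gen_eval :: "'a zpoly \<Rightarrow> 'a" where
  "gen_eval = zeval R (\<lambda>a. if a \<in> carrier R then a else \<zero>)"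

lemma gen_eval_hom: "ring_hom_cring zpoly_ring R gen_eval"
  unfolding gen_eval_def using cring_zpoly_ring
  by (intro ring_hom_cringI ring_hom_cring.intro cring_axioms ring_hom_cring_axioms.intro zeval_hom) auto

lemma gen_eval_surj: "witt_map gen_eval ` carrier (witt_ring p UNIV zpoly_ring) = carrier (W UNIV)"
proof
  show "witt_map gen_eval ` carrier (witt_ring p UNIV zpoly_ring) \<subseteq> carrier (W UNIV)"
    by (auto simp: witt_map_def witt_ring_simps gen_eval_def)
  show "carrier (W UNIV) \<subseteq> witt_map gen_eval ` carrier (witt_ring p UNIV zpoly_ring)"
  proof
    fix x assume "x \<in> carrier (W UNIV)"
    then have "x = witt_map gen_eval (\<lambda>i. zvar (x i))"
      by (auto simp: witt_map_def witt_ring_simps gen_eval_def PiE_iff)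
    then show "x \<in> witt_map gen_eval ` carrier (witt_ring p UNIV zpoly_ring)"
      by (intro image_eqI[of _ _ "\<lambda>i. zvar (x i)"]) (auto simp: witt_ring_simps)
  qed
qed

interpretation Z: frob_lift "zpoly_ring :: 'a zpoly ring" p "zpoly_frob p"
  by (rule frob_lift_zpoly[OF p_prime p_odd])

interpretation e: ring_hom_cring "zpoly_ring :: 'a zpoly ring" R gen_eval
  by (rule gen_eval_hom)

interpretation ZU: cring "Z.W UNIV"
  by (rule Z.witt_cring) simp

lemma witt_UNIV_cring: "cring (W UNIV)"
proof -
  have "ring (W UNIV)"
    using ZU.ring_hom_imp_img_ring[OF e.witt_map_hom] by (simp add: gen_eval_surj e.witt_map_zero)
  then interpret U: ring "W UNIV" .
  show ?thesis
  proof
    fix x y assume "x \<in> carrier (W UNIV)" "y \<in> carrier (W UNIV)"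
    then obtain X Y where "X \<in> carrier (Z.W UNIV)" "Y \<in> carrier (Z.W UNIV)" "x = witt_map gen_eval X" "y = witt_map gen_eval Y"
      unfolding gen_eval_surj[symmetric] by blast
    then show "x \<otimes>\<^bsub>W UNIV\<^esub> y = y \<otimes>\<^bsub>W UNIV\<^esub> x"
      by (metis ring_hom_mult[OF e.witt_map_hom] ZU.m_comm)
  qed
qed

interpretation U: cring "W UNIV"
  by (rule witt_UNIV_cring)

interpretation eW: ring_hom_cring "Z.W UNIV" "W UNIV" "witt_map gen_eval"
  by unfold_locales (rule e.witt_map_hom)

interpretation ZF: ring_hom_cring "Z.W UNIV" "Z.W UNIV" "witt_frob p UNIV zpoly_ring"
  by unfold_locales (rule Z.F_hom, auto)

lemma witt_UNIV_E:
  assumes "x \<in> carrier (W UNIV)"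
  obtains X where "X \<in> carrier (Z.W UNIV)" "x = witt_map gen_eval X"
  using assms unfolding gen_eval_surj[symmetric] by blast

lemma witt_frob_hom_UNIV: "witt_frob p UNIV R \<in> ring_hom (W UNIV) (W UNIV)"
proof (rule ring_hom_memI)
  fix x y assume "x \<in> carrier (W UNIV)" "y \<in> carrier (W UNIV)"
  then obtain X Y where X: "X \<in> carrier (Z.W UNIV)" "Y \<in> carrier (Z.W UNIV)" "x = witt_map gen_eval X" "y = witt_map gen_eval Y"
    by (meson witt_UNIV_E)
  have f: "witt_frob p UNIV R (witt_map gen_eval Z) = witt_map gen_eval (witt_frob p UNIV zpoly_ring Z)"
    if "Z \<in> carrier (Z.W UNIV)" for Z using e.witt_map_frob[OF that] by simp
  show "witt_frob p UNIV R x \<in> carrier (W UNIV)" using X by (simp add: f)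
  show "witt_frob p UNIV R (x \<otimes>\<^bsub>W UNIV\<^esub> y) = witt_frob p UNIV R x \<otimes>\<^bsub>W UNIV\<^esub> witt_frob p UNIV R y"
    using X by (simp add: f flip: eW.hom_mult)
  show "witt_frob p UNIV R (x \<oplus>\<^bsub>W UNIV\<^esub> y) = witt_frob p UNIV R x \<oplus>\<^bsub>W UNIV\<^esub> witt_frob p UNIV R y"
    using X by (simp add: f flip: eW.hom_add)
next
  show "witt_frob p UNIV R \<one>\<^bsub>W UNIV\<^esub> = \<one>\<^bsub>W UNIV\<^esub>"
    using e.witt_map_frob[of "\<one>\<^bsub>Z.W UNIV\<^esub>" p] by simp
qed

lemma witt_FV_UNIV: "x \<in> carrier (W UNIV) \<Longrightarrow> witt_frob p UNIV R (witt_ver UNIV R x) = [p] \<cdot>\<^bsub>W UNIV\<^esub> x"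
proof (erule witt_UNIV_E)
  fix X assume X: "X \<in> carrier (Z.W UNIV)" and x: "x = witt_map gen_eval X"
  have "witt_frob p UNIV R (witt_ver UNIV R x) = witt_map gen_eval (witt_frob p UNIV zpoly_ring (witt_ver UNIV zpoly_ring X))"
    unfolding x using Z.V_closed[of UNIV UNIV X] X by (simp add: e.witt_map_frob e.witt_map_ver)
  also have "\<dots> = [p] \<cdot>\<^bsub>W UNIV\<^esub> x"
    unfolding x using X by (subst Z.FV) (auto simp: eW.hom_add_pow)
  finally show ?thesis .
qed

lemma witt_frob_lift_UNIV:
  assumes "x \<in> carrier (W UNIV)"
  shows "\<exists>c\<in>carrier (W UNIV). witt_frob p UNIV R x = x [^]\<^bsub>W UNIV\<^esub> p \<oplus>\<^bsub>W UNIV\<^esub> [p] \<cdot>\<^bsub>W UNIV\<^esub> c"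
proof -
  obtain X where X: "X \<in> carrier (Z.W UNIV)" and x: "x = witt_map gen_eval X" using assms by (rule witt_UNIV_E)
  obtain c where c: "c \<in> carrier (Z.W UNIV)"
    "witt_frob p UNIV zpoly_ring X = X [^]\<^bsub>Z.W UNIV\<^esub> p \<oplus>\<^bsub>Z.W UNIV\<^esub> [p] \<cdot>\<^bsub>Z.W UNIV\<^esub> c"
    using Z.witt_frob_lift[OF X] by blast
  show ?thesis
    unfolding x using X c by (intro bexI[of _ "witt_map gen_eval c"])
      (simp_all add: e.witt_map_frob[symmetric] eW.hom_add_pow eW.hom_nat_pow)
qed

lemma witt_frob_char_p:
  assumes char: "[p] \<cdot> \<one> = \<zero>" and x: "x \<in> carrier (W UNIV)"
  shows "witt_frob p UNIV R x i = x i [^] p"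
proof -
  obtain g where g: "witt_frob_polys p i = zvar i ^ p + of_nat p * g"
    using witt_frob_polys_cong[OF p_prime p_odd] by blast
  have v: "x \<in> UNIV \<rightarrow> carrier R" using x by (auto simp: witt_ring_simps)
  have "[p] \<cdot> zeval R x g = [p] \<cdot> \<one> \<otimes> zeval R x g" using v by (simp add: add_pow_ldistr)
  then show ?thesis using v
    by (simp add: witt_frob_def g zeval_add zeval_power zeval_of_nat_mult[OF v] char Pi_iff)
qed

end

text \<open>On \<open>W(k)\<close> the Frobenius is the coordinatewise \<open>p\<close>-th power,
  hence bijective because \<open>k\<close> is perfect. Torsion freeness follows from
  \<open>p x = F(V(x))\<close>, as \<open>F\<close> and \<open>V\<close> are both injective.\<close>

theorem frob_lift_Wk:
  assumes p: "prime p" "odd p" and k: "perfect_ring p k"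
  shows "frob_lift (Wk p k) p (Wk_frob p k)" and "bij_betw (Wk_frob p k) (carrier (Wk p k)) (carrier (Wk p k))"
proof -
  from k have "cring k" by (simp add: perfect_ring_def)
  interpret cring_prime k p
    by (intro cring_prime.intro cring_prime_axioms.intro p \<open>cring k\<close>)
  have char: "[p] \<cdot>\<^bsub>k\<^esub> \<one>\<^bsub>k\<^esub> = \<zero>\<^bsub>k\<^esub>" and bij: "bij_betw (\<lambda>x. x [^]\<^bsub>k\<^esub> p) (carrier k) (carrier k)"
    using k by (auto simp: perfect_ring_def)
  interpret U: cring "W UNIV" by (rule witt_UNIV_cring)
  have F: "witt_frob p UNIV k x = (\<lambda>i. x i [^]\<^bsub>k\<^esub> p)" if "x \<in> carrier (W UNIV)" for x
    using witt_frob_char_p[OF char that] by auto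
  show "bij_betw (Wk_frob p k) (carrier (Wk p k)) (carrier (Wk p k))"
    unfolding bij_betw_def Wk_def Wk_frob_def
  proof (intro conjI inj_onI subset_antisym subsetI)
    fix x y assume xy: "x \<in> carrier (W UNIV)" "y \<in> carrier (W UNIV)" "witt_frob p UNIV k x = witt_frob p UNIV k y"
    then have "x i [^]\<^bsub>k\<^esub> p = y i [^]\<^bsub>k\<^esub> p" for i using F by metis
    then show "x = y"
      using xy(1,2) inj_onD[OF bij_betw_imp_inj_on[OF bij]] by (intro ext) (auto simp: witt_ring_simps PiE_iff)
  next
    fix y assume y: "y \<in> carrier (W UNIV)"
    define x where "x i = inv_into (carrier k) (\<lambda>x. x [^]\<^bsub>k\<^esub> p) (y i)" for i
    have "y i \<in> (\<lambda>x. x [^]\<^bsub>k\<^esub> p) ` carrier k" for i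
      using y bij by (auto simp: bij_betw_def witt_ring_simps)
    then have "x i \<in> carrier k" "x i [^]\<^bsub>k\<^esub> p = y i" for i
      unfolding x_def by (rule inv_into_into, rule f_inv_into_f[where f = "\<lambda>x. x [^]\<^bsub>k\<^esub> p"])
    then have "x \<in> carrier (W UNIV)" "witt_frob p UNIV k x = y"
      using F[of x] by (auto simp: witt_ring_simps)
    then show "y \<in> witt_frob p UNIV k ` carrier (W UNIV)" by blast
  qed (use ring_hom_closed[OF witt_frob_hom_UNIV] in auto)
  then have inj: "inj_on (witt_frob p UNIV k) (carrier (W UNIV))"
    by (simp add: bij_betw_def Wk_def Wk_frob_def)
  show "frob_lift (Wk p k) p (Wk_frob p k)"
    unfolding Wk_def Wk_frob_def
  proof (intro frob_lift.intro frob_lift_axioms.intro U.cring_axioms p witt_frob_hom_UNIV witt_frob_lift_UNIV)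
    fix x assume x: "x \<in> carrier (W UNIV)" "[p] \<cdot>\<^bsub>W UNIV\<^esub> x = \<zero>\<^bsub>W UNIV\<^esub>"
    have V: "witt_ver UNIV k x \<in> carrier (W UNIV)" using x by (intro witt_ver_closed) auto
    interpret F: ring_hom_cring "W UNIV" "W UNIV" "witt_frob p UNIV k"
      by unfold_locales (rule witt_frob_hom_UNIV)
    have "witt_frob p UNIV k (witt_ver UNIV k x) = witt_frob p UNIV k \<zero>\<^bsub>W UNIV\<^esub>"
      using witt_FV_UNIV x by simp
    from inj_onD[OF inj this V U.zero_closed] have *: "witt_ver UNIV k x = \<zero>\<^bsub>W UNIV\<^esub>" .
    have "x i = \<zero>\<^bsub>k\<^esub>" for i
      using fun_cong[OF *, of "Suc i"] by (simp add: witt_ver_def witt_ring_simps)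
    then show "x = \<zero>\<^bsub>W UNIV\<^esub>" by (auto simp: witt_ring_simps)
  qed
qed

section \<open>The homomorphism \<open>s_phi\<close> and its truncations\<close>

context frob_lift
begin

lemma phi_pow_closed [simp]: "a \<in> carrier A \<Longrightarrow> (\<phi> ^^ n) a \<in> carrier A"
  by (induction n) auto

lemma phi_pow_hom: "\<phi> ^^ n \<in> ring_hom A A"
proof (induction n)
  case (Suc n)
  then show ?case using phi_hom by (auto intro!: ring_hom_memI simp: ring_hom_mult ring_hom_add ring_hom_one)
qed (auto intro!: ring_hom_memI)

text \<open>The sequence \<open>\<phi>^n(a)\<close> satisfies Dwork's congruences with equality.
  That the resulting map is a homomorphism and commutes with Frobenius can then be read off on ghost
  components.\<close>

lemma witt_section_exists:
  "\<exists>s. s \<in> ring_hom A (W UNIV) \<and> s \<in> extensional (carrier A) \<and>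
     (\<forall>a\<in>carrier A. witt_frob p UNIV A (s a) = s (\<phi> a)) \<and>
     (\<forall>a\<in>carrier A. \<forall>n. gh n (s a) = (\<phi> ^^ n) a)"
proof -
  have "\<forall>a\<in>carrier A. \<exists>x. x \<in> UNIV \<rightarrow> carrier A \<and> (\<forall>n. gh n x = (\<phi> ^^ n) a)"
  proof
    fix a assume "a \<in> carrier A"
    then have "\<exists>x\<in>UNIV \<rightarrow> carrier A. \<forall>n. gh n x = (\<phi> ^^ n) a" by (intro dwork) auto
    then show "\<exists>x. x \<in> UNIV \<rightarrow> carrier A \<and> (\<forall>n. gh n x = (\<phi> ^^ n) a)" by blast
  qed
  from bchoice[OF this] obtain t
    where t0: "\<forall>a\<in>carrier A. t a \<in> UNIV \<rightarrow> carrier A \<and> (\<forall>n. gh n (t a) = (\<phi> ^^ n) a)" by blast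
  then have t: "t a \<in> UNIV \<rightarrow> carrier A" "gh n (t a) = (\<phi> ^^ n) a" if "a \<in> carrier A" for a n
    using that by blast+
  let ?s = "restrict t (carrier A)"
  have c: "t a \<in> carrier (W UNIV)" if "a \<in> carrier A" for a
    using t(1)[OF that] by (auto simp: witt_ring_simps)
  have "?s \<in> ring_hom A (W UNIV)"
    by (rule ring_hom_memI)
      (auto intro!: witt_eqI[of UNIV] simp: c t(2) witt_mult_closed witt_add_closed witt_one_closed gh_add gh_mult gh_one
        ring_hom_mult[OF phi_pow_hom] ring_hom_add[OF phi_pow_hom] ring_hom_one[OF phi_pow_hom])
  moreover have "witt_frob p UNIV A (t a) = t (\<phi> a)" if "a \<in> carrier A" for a
    using that by (intro witt_eqI[of UNIV]) (auto simp: c t(2) F_closed[of UNIV UNIV] gh_F[of UNIV UNIV] funpow_swap1)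
  ultimately show ?thesis using t(2) by (intro exI[of _ ?s]) auto
qed

lemma witt_section_props:
  shows witt_section_hom: "witt_section p A \<phi> \<in> ring_hom A (W UNIV)"
    and gh_witt_section: "a \<in> carrier A \<Longrightarrow> gh n (witt_section p A \<phi> a) = (\<phi> ^^ n) a"
proof -
  have "\<exists>!s. s \<in> ring_hom A (W UNIV) \<and> s \<in> extensional (carrier A) \<and>
     (\<forall>a\<in>carrier A. witt_frob p UNIV A (s a) = s (\<phi> a)) \<and>
     (\<forall>a\<in>carrier A. \<forall>n. gh n (s a) = (\<phi> ^^ n) a)"
  proof (rule ex_ex1I[OF witt_section_exists])
    fix s t
    assume "s \<in> ring_hom A (W UNIV) \<and> s \<in> extensional (carrier A) \<and>
       (\<forall>a\<in>carrier A. witt_frob p UNIV A (s a) = s (\<phi> a)) \<and> (\<forall>a\<in>carrier A. \<forall>n. gh n (s a) = (\<phi> ^^ n) a)"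
     "t \<in> ring_hom A (W UNIV) \<and> t \<in> extensional (carrier A) \<and>
       (\<forall>a\<in>carrier A. witt_frob p UNIV A (t a) = t (\<phi> a)) \<and> (\<forall>a\<in>carrier A. \<forall>n. gh n (t a) = (\<phi> ^^ n) a)"
    then show "s = t"
      by (intro extensionalityI[of s "carrier A" t]) (auto intro!: witt_eqI[of UNIV] dest: ring_hom_closed)
  qed
  from theI'[OF this] show "witt_section p A \<phi> \<in> ring_hom A (W UNIV)"
    and "a \<in> carrier A \<Longrightarrow> gh n (witt_section p A \<phi> a) = (\<phi> ^^ n) a"
    unfolding witt_section_def by auto
qed

text \<open>The abstract counterpart of \<open>s_phi\<close>, with which it coincides for
  \<open>A = W(k)\<close>.\<close>

definition sec :: "nat \<Rightarrow> 'a \<Rightarrow> nat \<Rightarrow> 'a" where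
  "sec n a = restrict (witt_section p A \<phi> a) {..<n}"

lemma sec_closed [simp]: "a \<in> carrier A \<Longrightarrow> sec n a \<in> carrier (W {..<n})"
  unfolding sec_def using ring_hom_closed[OF witt_section_hom] by (intro restrict_closed) auto

lemma gh_sec: "a \<in> carrier A \<Longrightarrow> i < n \<Longrightarrow> gh i (sec n a) = (\<phi> ^^ i) a"
  unfolding sec_def using ring_hom_closed[OF witt_section_hom]
  by (subst gh_restrict[of _ UNIV]) (auto simp: gh_witt_section)

lemma sec_hom: "sec n \<in> ring_hom A (W {..<n})"
  by (rule ring_hom_memI)
    (auto intro!: witt_eqI[of "{..<n}"] simp: gh_sec witt_mult_closed witt_add_closed witt_one_closed gh_add gh_mult gh_one
      ring_hom_mult[OF phi_pow_hom] ring_hom_add[OF phi_pow_hom] ring_hom_one[OF phi_pow_hom])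

end

lemma (in abelian_group) add_diff_diff:
  assumes "x \<in> carrier G" "y \<in> carrier G"
  shows "x \<oplus> y \<ominus> x \<ominus> y = \<zero>"
proof -
  have "x \<oplus> y \<ominus> x \<ominus> y = (x \<oplus> y) \<oplus> \<ominus> (x \<oplus> y)"
    using assms by (simp add: minus_eq minus_add a_assoc)
  then show ?thesis using assms by (simp add: r_neg)
qed

section \<open>Quotient modules and Kaehler differentials\<close>

lemma quot_module_simps:
  "carrier (quot_module M H) = a_rcosets\<^bsub>M\<^esub> H" "\<zero>\<^bsub>quot_module M H\<^esub> = H"
  "x \<oplus>\<^bsub>quot_module M H\<^esub> y = x <+>\<^bsub>M\<^esub> y"
  "r \<odot>\<^bsub>quot_module M H\<^esub> C = (\<Union>m\<in>C. H +>\<^bsub>M\<^esub> (r \<odot>\<^bsub>M\<^esub> m))"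
  by (simp_all add: quot_module_def)

locale quot_mod = module R M for R (structure) and M (structure) +
  fixes H
  assumes sub: "submodule H R M"
begin

abbreviation Q where "Q \<equiv> quot_module M H"

sublocale H: abelian_subgroup H M
  using sub by (intro abelian_subgroupI3 additive_subgroup.intro M.abelian_group_axioms) (auto simp: submodule_def)

definition cl where "cl m = H +>\<^bsub>M\<^esub> m"

lemma quot_carrier: "carrier Q = cl ` carrier M"
  unfolding cl_def by (auto simp: quot_module_simps A_RCOSETS_def')

lemma cl_closed [simp, intro]: "m \<in> carrier M \<Longrightarrow> cl m \<in> carrier Q"
  by (simp add: quot_carrier)

lemma quot_E: assumes "C \<in> carrier Q" obtains m where "m \<in> carrier M" "C = cl m"
  using assms by (auto simp: quot_carrier)

lemma cl_add: "m \<in> carrier M \<Longrightarrow> m' \<in> carrier M \<Longrightarrow> cl m \<oplus>\<^bsub>Q\<^esub> cl m' = cl (m \<oplus>\<^bsub>M\<^esub> m')"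
  by (simp add: quot_module_simps cl_def H.a_rcos_sum)

lemma cl_zero: "cl \<zero>\<^bsub>M\<^esub> = \<zero>\<^bsub>Q\<^esub>"
  by (simp add: quot_module_simps cl_def H.a_subset)

lemma cl_eq_iff:
  assumes "m \<in> carrier M" "m' \<in> carrier M"
  shows "cl m = cl m' \<longleftrightarrow> m \<ominus>\<^bsub>M\<^esub> m' \<in> H"
proof -
  have "m \<in> cl m' \<longleftrightarrow> m \<ominus>\<^bsub>M\<^esub> m' \<in> H"
    using H.a_rcos_module[OF assms(2,1)] by (simp add: cl_def M.minus_eq)
  moreover have "cl m = cl m' \<longleftrightarrow> m \<in> cl m'"
    unfolding cl_def using H.a_repr_independence'[OF _ assms(2)] H.a_rcos_self[OF assms(1)] by blast
  ultimately show ?thesis by simp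
qed

text \<open>In \<open>quot_module\<close> a scalar multiple of a class is a union over its elements;
  all of them yield the same class, so that the union collapses.\<close>

lemma cl_smult:
  assumes "r \<in> carrier R" "m \<in> carrier M"
  shows "r \<odot>\<^bsub>Q\<^esub> cl m = cl (r \<odot>\<^bsub>M\<^esub> m)"
proof -
  have "cl (r \<odot>\<^bsub>M\<^esub> x) = cl (r \<odot>\<^bsub>M\<^esub> m)" if "x \<in> cl m" for x
  proof -
    from that obtain h where h: "h \<in> H" "x = h \<oplus>\<^bsub>M\<^esub> m" unfolding cl_def a_r_coset_def' by auto
    then have hc: "h \<in> carrier M" using H.a_subset by auto
    have "r \<odot>\<^bsub>M\<^esub> h \<in> H" using submodule.smult_closed[OF sub] assms h by auto
    then show ?thesis using assms h hc
      by (subst cl_eq_iff) (auto simp: smult_r_distr M.minus_eq M.a_assoc M.r_neg)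
  qed
  moreover have "m \<in> cl m" unfolding cl_def using assms by (rule_tac H.a_rcos_self)
  ultimately have "(\<Union>x\<in>cl m. cl (r \<odot>\<^bsub>M\<^esub> x)) = cl (r \<odot>\<^bsub>M\<^esub> m)" by blast
  then show ?thesis by (simp add: quot_module_simps cl_def)
qed

lemma quot_module: "module R Q"
proof (rule moduleI)
  show "abelian_group Q"
  proof (rule abelian_groupI)
    fix x assume "x \<in> carrier Q"
    then obtain m where m: "m \<in> carrier M" "x = cl m" by (rule quot_E)
    then show "\<exists>y\<in>carrier Q. y \<oplus>\<^bsub>Q\<^esub> x = \<zero>\<^bsub>Q\<^esub>"
      by (intro bexI[of _ "cl (\<ominus>\<^bsub>M\<^esub> m)"]) (simp_all add: cl_add M.l_neg cl_zero)
  qed (auto elim!: quot_E simp: cl_add M.a_ac simp flip: cl_zero)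
qed (auto elim!: quot_E simp: cl_smult cl_add smult_l_distr smult_r_distr smult_assoc1 R.cring_axioms)

end

section \<open>Free modules and the relations between differentials\<close>

lemma free_module_simps:
  "carrier (free_module R S) =
    {f. (\<forall>b. f b \<in> carrier R) \<and> (\<forall>b. b \<notin> S \<longrightarrow> f b = \<zero>\<^bsub>R\<^esub>) \<and> finite {b. f b \<noteq> \<zero>\<^bsub>R\<^esub>}}"
  "\<zero>\<^bsub>free_module R S\<^esub> = (\<lambda>b. \<zero>\<^bsub>R\<^esub>)"
  "f \<oplus>\<^bsub>free_module R S\<^esub> g = (\<lambda>b. f b \<oplus>\<^bsub>R\<^esub> g b)"
  "r \<odot>\<^bsub>free_module R S\<^esub> f = (\<lambda>b. r \<otimes>\<^bsub>R\<^esub> f b)"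
  by (simp_all add: free_module_def)

context cring
begin

lemma free_module_module: "module R (free_module R S)"
proof (rule moduleI)
  show "abelian_group (free_module R S)"
  proof (rule abelian_groupI)
    fix f assume f: "f \<in> carrier (free_module R S)"
    have "{b. \<ominus> f b \<noteq> \<zero>} = {b. f b \<noteq> \<zero>}"
      using f by (auto simp: free_module_simps)
    then show "\<exists>g\<in>carrier (free_module R S). g \<oplus>\<^bsub>free_module R S\<^esub> f = \<zero>\<^bsub>free_module R S\<^esub>"
      using f by (intro bexI[of _ "\<lambda>b. \<ominus> f b"]) (auto simp: free_module_simps l_neg)
  next
    fix f g assume f: "f \<in> carrier (free_module R S)" "g \<in> carrier (free_module R S)"
    have "{b. f b \<oplus> g b \<noteq> \<zero>} \<subseteq> {b. f b \<noteq> \<zero>} \<union> {b. g b \<noteq> \<zero>}" by auto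
    then show "f \<oplus>\<^bsub>free_module R S\<^esub> g \<in> carrier (free_module R S)"
      using f by (auto simp: free_module_simps dest: finite_subset)
  qed (auto simp: free_module_simps a_ac)
next
  fix r f assume f: "r \<in> carrier R" "f \<in> carrier (free_module R S)"
  then have "{b. r \<otimes> f b \<noteq> \<zero>} \<subseteq> {b. f b \<noteq> \<zero>}" by auto
  then show "r \<odot>\<^bsub>free_module R S\<^esub> f \<in> carrier (free_module R S)"
    using f by (auto simp: free_module_simps dest: finite_subset)
qed (auto simp: free_module_simps cring_axioms l_distr r_distr m_assoc)

abbreviation FM where "FM \<equiv> free_module R (carrier R)"

interpretation FM: module R FM
  by (rule free_module_module)

lemma free_gen_closed: "b \<in> S \<Longrightarrow> free_gen R b \<in> carrier (free_module R S)"
  by (auto simp: free_module_simps free_gen_def)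

lemma free_module_induct [consumes 1, case_names zero gen add]:
  assumes "f \<in> carrier (free_module R S)"
    and zero: "P \<zero>\<^bsub>free_module R S\<^esub>"
    and gen: "\<And>r b. r \<in> carrier R \<Longrightarrow> b \<in> S \<Longrightarrow> P (r \<odot>\<^bsub>free_module R S\<^esub> free_gen R b)"
    and add: "\<And>f g. f \<in> carrier (free_module R S) \<Longrightarrow> g \<in> carrier (free_module R S) \<Longrightarrow> P f \<Longrightarrow> P g \<Longrightarrow> P (f \<oplus>\<^bsub>free_module R S\<^esub> g)"
  shows "P f"
  using assms(1)
proof (induction "card {b. f b \<noteq> \<zero>}" arbitrary: f)
  case 0
  then have "f = \<zero>\<^bsub>free_module R S\<^esub>" by (auto simp: free_module_simps)
  then show ?case using zero by simp
next
  case (Suc n)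
  then obtain b where b: "f b \<noteq> \<zero>" by (metis (mono_tags, lifting) card.empty empty_Collect_eq nat.distinct(1))
  let ?g = "f(b := \<zero>)" and ?h = "f b \<odot>\<^bsub>free_module R S\<^esub> free_gen R b"
  have bS: "b \<in> S" "f b \<in> carrier R" using Suc.prems b by (auto simp: free_module_simps)
  have supp: "{c. ?g c \<noteq> \<zero>} = {c. f c \<noteq> \<zero>} - {b}" by auto
  have fin: "finite {c. f c \<noteq> \<zero>}" using Suc.prems by (simp add: free_module_simps)
  then have "n = card {c. ?g c \<noteq> \<zero>}" using Suc.hyps(2) b unfolding supp by simp
  moreover have g: "?g \<in> carrier (free_module R S)"
    using Suc.prems fin supp by (auto simp: free_module_simps)
  ultimately have "P ?g" using Suc.hyps(1) by blast
  moreover have "f = ?g \<oplus>\<^bsub>free_module R S\<^esub> ?h"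
    using Suc.prems bS by (auto simp: free_module_simps free_gen_def)
  moreover have "?h \<in> carrier (free_module R S)"
    using bS by (intro module.smult_closed[OF free_module_module] free_gen_closed)
  ultimately show ?case using add[OF g] gen bS by metis
qed

lemma kaehler_rels_subset: "kaehler_rels R \<subseteq> carrier FM"
  unfolding kaehler_rels_def Let_def
  by (auto intro!: FM.M.minus_closed FM.smult_closed free_gen_closed)

lemma kaehler_sub_submodule: "submodule (kaehler_sub R) R FM"
proof -
  have s: "submodule (carrier FM) R FM" by (rule FM.carrier_is_submodule)
  show ?thesis
    unfolding kaehler_sub_def submodule_span_def
  proof (rule FM.submoduleI)
    show "\<Inter> {N. submodule N R FM \<and> kaehler_rels R \<subseteq> N} \<subseteq> carrier FM"
      using s kaehler_rels_subset by blast
  next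
    show "\<zero>\<^bsub>FM\<^esub> \<in> \<Inter> {N. submodule N R FM \<and> kaehler_rels R \<subseteq> N}"
      using subgroup.one_closed[OF submodule.axioms(1)] by auto
  qed (auto dest: FM.submoduleE)
qed

lemma kaehler_rels_in_sub: "kaehler_rels R \<subseteq> kaehler_sub R"
  unfolding kaehler_sub_def submodule_span_def by auto

sublocale K: quot_mod R FM "kaehler_sub R"
  by (intro quot_mod.intro quot_mod_axioms.intro free_module_module kaehler_sub_submodule)

lemma kaehler_eq: "kaehler R = K.Q"
  by (simp add: kaehler_def)

lemma kaehler_d_eq: "kaehler_d R b = K.cl (free_gen R b)"
  by (simp add: kaehler_d_def K.cl_def)

lemma kaehler_module: "module R (kaehler R)"
  unfolding kaehler_eq by (rule K.quot_module)

sublocale Om: module R "kaehler R"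
  by (rule kaehler_module)

lemma kaehler_d_closed [simp]: "b \<in> carrier R \<Longrightarrow> kaehler_d R b \<in> carrier (kaehler R)"
  by (simp add: kaehler_eq kaehler_d_eq free_gen_closed)

lemma kaehler_d_add:
  assumes "a \<in> carrier R" "b \<in> carrier R"
  shows "kaehler_d R (a \<oplus> b) = kaehler_d R a \<oplus>\<^bsub>kaehler R\<^esub> kaehler_d R b"
proof -
  have "free_gen R (a \<oplus> b) \<ominus>\<^bsub>FM\<^esub> free_gen R a \<ominus>\<^bsub>FM\<^esub> free_gen R b \<in> kaehler_sub R"
    unfolding kaehler_rels_def Let_def
    by (intro subsetD[OF kaehler_rels_in_sub[unfolded kaehler_rels_def Let_def]] UnI1 CollectI exI[of _ a] exI[of _ b] conjI refl assms)
  then have "K.cl (free_gen R (a \<oplus> b)) = K.cl (free_gen R a \<oplus>\<^bsub>FM\<^esub> free_gen R b)"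
    using assms by (subst K.cl_eq_iff) (auto simp: free_gen_closed FM.M.minus_eq FM.M.minus_add FM.M.a_assoc)
  then show ?thesis using assms by (simp add: kaehler_eq kaehler_d_eq K.cl_add free_gen_closed)
qed

lemma kaehler_d_mult:
  assumes "a \<in> carrier R" "b \<in> carrier R"
  shows "kaehler_d R (a \<otimes> b) = a \<odot>\<^bsub>kaehler R\<^esub> kaehler_d R b \<oplus>\<^bsub>kaehler R\<^esub> b \<odot>\<^bsub>kaehler R\<^esub> kaehler_d R a"
proof -
  have "free_gen R (a \<otimes> b) \<ominus>\<^bsub>FM\<^esub> a \<odot>\<^bsub>FM\<^esub> free_gen R b \<ominus>\<^bsub>FM\<^esub> b \<odot>\<^bsub>FM\<^esub> free_gen R a \<in> kaehler_sub R"
    unfolding kaehler_rels_def Let_def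
    by (intro subsetD[OF kaehler_rels_in_sub[unfolded kaehler_rels_def Let_def]] UnI2 CollectI exI[of _ a] exI[of _ b] conjI refl assms)
  then have "K.cl (free_gen R (a \<otimes> b)) = K.cl (a \<odot>\<^bsub>FM\<^esub> free_gen R b \<oplus>\<^bsub>FM\<^esub> b \<odot>\<^bsub>FM\<^esub> free_gen R a)"
    using assms by (subst K.cl_eq_iff) (auto simp: free_gen_closed FM.M.minus_eq FM.M.minus_add FM.M.a_assoc)
  then show ?thesis using assms by (simp add: kaehler_eq kaehler_d_eq K.cl_add K.cl_smult free_gen_closed)
qed

lemma kaehler_induct [consumes 1, case_names zero gen add]:
  assumes "\<alpha> \<in> carrier (kaehler R)"
    and zero: "P \<zero>\<^bsub>kaehler R\<^esub>"
    and gen: "\<And>a b. a \<in> carrier R \<Longrightarrow> b \<in> carrier R \<Longrightarrow> P (a \<odot>\<^bsub>kaehler R\<^esub> kaehler_d R b)"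
    and add: "\<And>\<alpha> \<beta>. \<alpha> \<in> carrier (kaehler R) \<Longrightarrow> \<beta> \<in> carrier (kaehler R) \<Longrightarrow> P \<alpha> \<Longrightarrow> P \<beta> \<Longrightarrow> P (\<alpha> \<oplus>\<^bsub>kaehler R\<^esub> \<beta>)"
  shows "P \<alpha>"
proof -
  obtain f where f: "f \<in> carrier FM" "\<alpha> = K.cl f" using assms(1) unfolding kaehler_eq by (rule K.quot_E)
  have "P (K.cl f)" using f(1)
  proof (induction rule: free_module_induct)
    case zero
    then show ?case using assms(2) by (simp add: K.cl_zero kaehler_eq)
  next
    case (gen r b)
    then show ?case using assms(3)[OF gen] by (simp add: kaehler_eq kaehler_d_eq K.cl_smult free_gen_closed)
  next
    case (add f g)
    then show ?case using assms(4)[of "K.cl f" "K.cl g"] by (simp add: kaehler_eq K.cl_add)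
  qed
  then show ?thesis using f by simp
qed

end

section \<open>The universal property of Kaehler differentials, for derivations along a ring
  homomorphism\<close>

locale derivation = R: cring R + N: module S N
  for R :: "('a, 'm) ring_scheme" and S :: "('s, 'n) ring_scheme" and N :: "('s, 'b, 'k) module_scheme" +
  fixes \<rho> :: "'a \<Rightarrow> 's" and D :: "'a \<Rightarrow> 'b"
  assumes rho: "\<rho> \<in> ring_hom R S"
    and D_closed [simp]: "a \<in> carrier R \<Longrightarrow> D a \<in> carrier N"
    and D_add: "a \<in> carrier R \<Longrightarrow> b \<in> carrier R \<Longrightarrow> D (a \<oplus>\<^bsub>R\<^esub> b) = D a \<oplus>\<^bsub>N\<^esub> D b"
    and D_mult: "a \<in> carrier R \<Longrightarrow> b \<in> carrier R \<Longrightarrow> D (a \<otimes>\<^bsub>R\<^esub> b) = \<rho> a \<odot>\<^bsub>N\<^esub> D b \<oplus>\<^bsub>N\<^esub> \<rho> b \<odot>\<^bsub>N\<^esub> D a"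
begin

sublocale rho: ring_hom_cring R S \<rho>
  by unfold_locales (rule rho)

text \<open>The function that \<open>kaehler_map\<close> applies to all elements of a class. It
  kills the relations by \<open>kaehler_sub_lin\<close>, so that its image on a class is a
  singleton.\<close>

definition lin :: "('a \<Rightarrow> 'a) \<Rightarrow> 'b" where
  "lin f = (\<Oplus>\<^bsub>N\<^esub>b\<in>{b\<in>carrier R. f b \<noteq> \<zero>\<^bsub>R\<^esub>}. \<rho> (f b) \<odot>\<^bsub>N\<^esub> D b)"

lemma lin_superset:
  assumes "f \<in> carrier R.FM" "finite B" "{b. f b \<noteq> \<zero>\<^bsub>R\<^esub>} \<subseteq> B" "B \<subseteq> carrier R"
  shows "lin f = (\<Oplus>\<^bsub>N\<^esub>b\<in>B. \<rho> (f b) \<odot>\<^bsub>N\<^esub> D b)"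
  unfolding lin_def
  by (rule N.M.add.finprod_mono_neutral_cong_left) (use assms in \<open>auto simp: free_module_simps\<close>)

lemma supp_subset: "f \<in> carrier R.FM \<Longrightarrow> {b. f b \<noteq> \<zero>\<^bsub>R\<^esub>} \<subseteq> carrier R \<and> finite {b. f b \<noteq> \<zero>\<^bsub>R\<^esub>}"
  by (auto simp: free_module_simps)

lemma lin_closed: "f \<in> carrier R.FM \<Longrightarrow> lin f \<in> carrier N"
  unfolding lin_def by (intro N.M.finsum_closed) (auto simp: free_module_simps)

lemma lin_add:
  assumes f: "f \<in> carrier R.FM" and g: "g \<in> carrier R.FM"
  shows "lin (f \<oplus>\<^bsub>R.FM\<^esub> g) = lin f \<oplus>\<^bsub>N\<^esub> lin g"
proof -
  let ?B = "{b. f b \<noteq> \<zero>\<^bsub>R\<^esub>} \<union> {b. g b \<noteq> \<zero>\<^bsub>R\<^esub>}"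
  have B: "finite ?B" "?B \<subseteq> carrier R" using supp_subset[OF f] supp_subset[OF g] by auto
  have c: "f b \<in> carrier R" "g b \<in> carrier R" for b using f g by (auto simp: free_module_simps)
  have "lin (f \<oplus>\<^bsub>R.FM\<^esub> g) = (\<Oplus>\<^bsub>N\<^esub>b\<in>?B. \<rho> (f b) \<odot>\<^bsub>N\<^esub> D b \<oplus>\<^bsub>N\<^esub> \<rho> (g b) \<odot>\<^bsub>N\<^esub> D b)"
  proof -
    have "lin (f \<oplus>\<^bsub>R.FM\<^esub> g) = (\<Oplus>\<^bsub>N\<^esub>b\<in>?B. \<rho> ((f \<oplus>\<^bsub>R.FM\<^esub> g) b) \<odot>\<^bsub>N\<^esub> D b)"
      using B f g by (intro lin_superset R.K.M.a_closed) (auto simp: free_module_simps(3))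
    also have "\<dots> = (\<Oplus>\<^bsub>N\<^esub>b\<in>?B. \<rho> (f b) \<odot>\<^bsub>N\<^esub> D b \<oplus>\<^bsub>N\<^esub> \<rho> (g b) \<odot>\<^bsub>N\<^esub> D b)"
      using B c by (intro N.M.finsum_cong') (auto simp: free_module_simps(3) N.smult_l_distr subset_iff)
    finally show ?thesis .
  qed
  also have "\<dots> = lin f \<oplus>\<^bsub>N\<^esub> lin g"
    using B c lin_superset[OF f B(1) _ B(2)] lin_superset[OF g B(1) _ B(2)]
    by (subst N.M.finsum_addf) (auto simp: subset_iff)
  finally show ?thesis .
qed

lemma lin_smult:
  assumes r: "r \<in> carrier R" and f: "f \<in> carrier R.FM"
  shows "lin (r \<odot>\<^bsub>R.FM\<^esub> f) = \<rho> r \<odot>\<^bsub>N\<^esub> lin f"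
proof -
  let ?B = "{b. f b \<noteq> \<zero>\<^bsub>R\<^esub>}"
  have B: "finite ?B" "?B \<subseteq> carrier R" using supp_subset[OF f] by auto
  have c: "f b \<in> carrier R" for b using f by (auto simp: free_module_simps)
  have "lin (r \<odot>\<^bsub>R.FM\<^esub> f) = (\<Oplus>\<^bsub>N\<^esub>b\<in>?B. \<rho> r \<odot>\<^bsub>N\<^esub> (\<rho> (f b) \<odot>\<^bsub>N\<^esub> D b))"
  proof -
    have "lin (r \<odot>\<^bsub>R.FM\<^esub> f) = (\<Oplus>\<^bsub>N\<^esub>b\<in>?B. \<rho> ((r \<odot>\<^bsub>R.FM\<^esub> f) b) \<odot>\<^bsub>N\<^esub> D b)"
      using B f r by (intro lin_superset R.K.smult_closed) (auto simp: free_module_simps(4))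
    also have "\<dots> = (\<Oplus>\<^bsub>N\<^esub>b\<in>?B. \<rho> r \<odot>\<^bsub>N\<^esub> (\<rho> (f b) \<odot>\<^bsub>N\<^esub> D b))"
      using B c r by (intro N.M.finsum_cong') (auto simp: free_module_simps(4) N.smult_assoc1 subset_iff)
    finally show ?thesis .
  qed
  also have "\<dots> = \<rho> r \<odot>\<^bsub>N\<^esub> lin f"
    using B c r lin_superset[OF f B(1) subset_refl B(2)]
    by (subst N.finsum_smult_ldistr[symmetric]) (auto simp: subset_iff)
  finally show ?thesis .
qed

lemma lin_gen: "b \<in> carrier R \<Longrightarrow> lin (free_gen R b) = D b"
  by (subst lin_superset[of _ "{b}"]) (auto simp: R.free_gen_closed, auto simp: free_gen_def split: if_splits)

lemma lin_kernel_submodule: "submodule {f \<in> carrier R.FM. lin f = \<zero>\<^bsub>N\<^esub>} R R.FM"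
proof (rule R.K.submoduleI)
  show "\<zero>\<^bsub>R.FM\<^esub> \<in> {f \<in> carrier R.FM. lin f = \<zero>\<^bsub>N\<^esub>}"
    using lin_smult[of "\<zero>\<^bsub>R\<^esub>" "\<zero>\<^bsub>R.FM\<^esub>"] lin_closed by simp
next
  fix f assume "f \<in> {f \<in> carrier R.FM. lin f = \<zero>\<^bsub>N\<^esub>}"
  then show "\<ominus>\<^bsub>R.FM\<^esub> f \<in> {f \<in> carrier R.FM. lin f = \<zero>\<^bsub>N\<^esub>}"
    using lin_smult[of "\<ominus>\<^bsub>R\<^esub> \<one>\<^bsub>R\<^esub>" f] R.K.smult_l_minus[of "\<one>\<^bsub>R\<^esub>" f] by simp
qed (auto simp: lin_add lin_smult)

lemma lin_diff:
  assumes "f \<in> carrier R.FM" "g \<in> carrier R.FM"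
  shows "lin (f \<ominus>\<^bsub>R.FM\<^esub> g) = lin f \<ominus>\<^bsub>N\<^esub> lin g"
  using lin_smult[of "\<ominus>\<^bsub>R\<^esub> \<one>\<^bsub>R\<^esub>" g] R.K.smult_l_minus[of "\<one>\<^bsub>R\<^esub>" g] N.smult_l_minus[of "\<one>\<^bsub>S\<^esub>" "lin g"] lin_closed[of g] assms
  by (simp add: R.K.M.minus_eq N.M.minus_eq lin_add)

lemma kaehler_sub_lin:
  assumes "f \<in> kaehler_sub R"
  shows "lin f = \<zero>\<^bsub>N\<^esub>"
proof -
  have "kaehler_rels R \<subseteq> {f \<in> carrier R.FM. lin f = \<zero>\<^bsub>N\<^esub>}"
  proof
    fix r assume r: "r \<in> kaehler_rels R"
    then have rc: "r \<in> carrier R.FM" using R.kaehler_rels_subset by blast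
    from r consider
      (add) a b where "a \<in> carrier R" "b \<in> carrier R" "r = free_gen R (a \<oplus>\<^bsub>R\<^esub> b) \<ominus>\<^bsub>R.FM\<^esub> free_gen R a \<ominus>\<^bsub>R.FM\<^esub> free_gen R b"
    | (mult) a b where "a \<in> carrier R" "b \<in> carrier R" "r = free_gen R (a \<otimes>\<^bsub>R\<^esub> b) \<ominus>\<^bsub>R.FM\<^esub> a \<odot>\<^bsub>R.FM\<^esub> free_gen R b \<ominus>\<^bsub>R.FM\<^esub> b \<odot>\<^bsub>R.FM\<^esub> free_gen R a"
      unfolding kaehler_rels_def Let_def by blast
    then have "lin r = \<zero>\<^bsub>N\<^esub>"
    proof cases
      case add
      then show ?thesis
        by (simp add: lin_diff lin_gen R.free_gen_closed D_add N.M.add_diff_diff)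
    next
      case mult
      then show ?thesis
        by (simp add: lin_diff lin_gen R.free_gen_closed lin_smult D_mult N.M.add_diff_diff)
    qed
    then show "r \<in> {f \<in> carrier R.FM. lin f = \<zero>\<^bsub>N\<^esub>}" using rc by simp
  qed
  then have "kaehler_sub R \<subseteq> {f \<in> carrier R.FM. lin f = \<zero>\<^bsub>N\<^esub>}"
    unfolding kaehler_sub_def submodule_span_def using lin_kernel_submodule by blast
  then show ?thesis using assms by blast
qed

abbreviation kmap where "kmap \<equiv> kaehler_map R \<rho> D N"

lemma kmap_cl:
  assumes f: "f \<in> carrier R.FM"
  shows "kmap (R.K.cl f) = lin f"
proof -
  have "lin g = lin f" if "g \<in> R.K.cl f" for g
  proof -
    from that obtain h where "h \<in> kaehler_sub R" "g = h \<oplus>\<^bsub>R.FM\<^esub> f" unfolding R.K.cl_def a_r_coset_def' by blast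
    moreover from this have "h \<in> carrier R.FM" "lin h = \<zero>\<^bsub>N\<^esub>" using kaehler_sub_lin R.K.H.a_subset by blast+
    ultimately show ?thesis using f lin_closed[OF f] by (simp add: lin_add)
  qed
  then have "lin ` R.K.cl f = (\<lambda>_. lin f) ` R.K.cl f" by (intro image_cong refl)
  moreover have "f \<in> R.K.cl f" unfolding R.K.cl_def using f by (rule R.K.H.a_rcos_self)
  ultimately have "lin ` R.K.cl f = {lin f}" by (simp only: image_constant)
  then show ?thesis unfolding kaehler_map_def lin_def[symmetric, abs_def] by simp
qed

lemma kaehler_E:
  assumes "\<alpha> \<in> carrier (kaehler R)"
  obtains f where "f \<in> carrier R.FM" "\<alpha> = R.K.cl f"
  using assms unfolding R.kaehler_eq by (rule R.K.quot_E)

lemma kmap_closed: "\<alpha> \<in> carrier (kaehler R) \<Longrightarrow> kmap \<alpha> \<in> carrier N"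
  by (erule kaehler_E) (simp add: kmap_cl lin_closed)

lemma kmap_add:
  assumes "\<alpha> \<in> carrier (kaehler R)" "\<beta> \<in> carrier (kaehler R)"
  shows "kmap (\<alpha> \<oplus>\<^bsub>kaehler R\<^esub> \<beta>) = kmap \<alpha> \<oplus>\<^bsub>N\<^esub> kmap \<beta>"
proof -
  obtain f g where fg: "f \<in> carrier R.FM" "\<alpha> = R.K.cl f" "g \<in> carrier R.FM" "\<beta> = R.K.cl g"
    using assms kaehler_E by metis
  have "kmap (R.K.cl (f \<oplus>\<^bsub>R.FM\<^esub> g)) = lin f \<oplus>\<^bsub>N\<^esub> lin g"
    using kmap_cl[OF R.K.M.a_closed[OF fg(1,3)]] lin_add[OF fg(1,3)] by simp
  then show ?thesis
    unfolding fg(2,4) R.kaehler_eq R.K.cl_add[OF fg(1,3)] using kmap_cl fg(1,3) by simp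
qed

lemma kmap_smult:
  assumes "r \<in> carrier R" "\<alpha> \<in> carrier (kaehler R)"
  shows "kmap (r \<odot>\<^bsub>kaehler R\<^esub> \<alpha>) = \<rho> r \<odot>\<^bsub>N\<^esub> kmap \<alpha>"
proof -
  obtain f where f: "f \<in> carrier R.FM" "\<alpha> = R.K.cl f" using assms(2) by (rule kaehler_E)
  have "kmap (R.K.cl (r \<odot>\<^bsub>R.FM\<^esub> f)) = \<rho> r \<odot>\<^bsub>N\<^esub> lin f"
    using kmap_cl[OF R.K.smult_closed[OF assms(1) f(1)]] lin_smult[OF assms(1) f(1)] by simp
  then show ?thesis
    unfolding f(2) R.kaehler_eq R.K.cl_smult[OF assms(1) f(1)] using kmap_cl f(1) by simp
qed

lemma kmap_d: "b \<in> carrier R \<Longrightarrow> kmap (kaehler_d R b) = D b"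
  by (simp add: R.kaehler_d_eq kmap_cl R.free_gen_closed lin_gen)

lemma kmap_zero: "kmap \<zero>\<^bsub>kaehler R\<^esub> = \<zero>\<^bsub>N\<^esub>"
  using kmap_smult[of "\<zero>\<^bsub>R\<^esub>" "\<zero>\<^bsub>kaehler R\<^esub>"] kmap_closed[OF R.Om.M.zero_closed] by simp

end

text \<open>With \<open>Q = ((x + y)^p - x^p - y^p) / p\<close>, the second and third equations are
  its partial derivatives in \<open>x\<close> and in \<open>y\<close>. They are recorded with the
  same coefficients because \<open>frob_d_add\<close> differentiates \<open>Q\<close>.\<close>

lemma power_add_prime_coeffs:
  fixes x y :: "'a :: comm_ring_1"
  assumes p: "prime p"
  obtains c :: "nat \<Rightarrow> nat" where
    "(x + y) ^ p = x ^ p + y ^ p + of_nat p * (\<Sum>k\<in>{1..<p}. of_nat (c k) * (x ^ k * y ^ (p - k)))"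
    "(\<Sum>k\<in>{1..<p}. of_nat (c k) * (of_nat k * x ^ (k - 1) * y ^ (p - k))) = (x + y) ^ (p - 1) - x ^ (p - 1)"
    "(\<Sum>k\<in>{1..<p}. of_nat (c k) * (of_nat (p - k) * x ^ k * y ^ (p - k - 1))) = (x + y) ^ (p - 1) - y ^ (p - 1)"
proof -
  have p2: "p \<ge> 2" using prime_ge_2_nat[OF p] .
  define c where "c k = (p choose k) div p" for k
  have c: "p * c k = p choose k" if "k \<in> {1..<p}" for k
  proof -
    have "p dvd k * (p choose k)" using that by (simp add: times_binomial_minus1_eq)
    then have "p dvd (p choose k)" using that p by (auto simp: prime_dvd_mult_iff dest: dvd_imp_le)
    then show ?thesis by (simp add: c_def)
  qed
  have c1: "c k * k = (p - 1) choose (k - 1)" if "k \<in> {1..<p}" for k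
  proof -
    have "p * (c k * k) = p * ((p - 1) choose (k - 1))"
      using c[OF that] times_binomial_minus1_eq[of k p] that by (simp add: mult.assoc[symmetric]) (simp add: mult.commute)
    then show ?thesis using p2 by simp
  qed
  have c2: "c k * (p - k) = (p - 1) choose k" if "k \<in> {1..<p}" for k
  proof -
    have "c k * (p - k) + c k * k = p choose k" proof -
      have "c k * (p - k) + c k * k = c k * (p - k + k)" by (simp only: distrib_left)
      then show ?thesis using c[OF that] that by (simp add: mult.commute)
    qed
    moreover have "p choose k = ((p - 1) choose (k - 1)) + ((p - 1) choose k)"
      using choose_reduce_nat[of p k] that p2 by simp
    ultimately show ?thesis using c1[OF that] by simp
  qed
  show ?thesis
  proof (rule that)
    have "{..p} = insert 0 (insert p {1..<p})" using p2 by auto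
    then have "(x + y) ^ p = y ^ p + (x ^ p + (\<Sum>k\<in>{1..<p}. of_nat (p choose k) * x ^ k * y ^ (p - k)))"
      using p2 by (simp add: binomial_ring)
    also have "(\<Sum>k\<in>{1..<p}. of_nat (p choose k) * x ^ k * y ^ (p - k)) =
        of_nat p * (\<Sum>k\<in>{1..<p}. of_nat (c k) * (x ^ k * y ^ (p - k)))"
      unfolding sum_distrib_left
      by (intro sum.cong refl) (simp add: mult.assoc flip: c)
    finally show "(x + y) ^ p = x ^ p + y ^ p + of_nat p * (\<Sum>k\<in>{1..<p}. of_nat (c k) * (x ^ k * y ^ (p - k)))"
      by simp
  next
    have "(\<Sum>k\<in>{1..<p}. of_nat (c k) * (of_nat k * x ^ (k - 1) * y ^ (p - k))) =
        (\<Sum>k\<in>{1..<p}. of_nat ((p - 1) choose (k - 1)) * x ^ (k - 1) * y ^ (p - 1 - (k - 1)))"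
      by (intro sum.cong refl) (subst c1[symmetric], auto simp: mult.assoc)
    also have "\<dots> = (\<Sum>j<p - 1. of_nat ((p - 1) choose j) * x ^ j * y ^ (p - 1 - j))"
      by (rule sum.reindex_bij_witness[of _ Suc "\<lambda>k. k - 1"]) auto
    also have "\<dots> = (x + y) ^ (p - 1) - x ^ (p - 1)"
      by (simp add: binomial_ring flip: lessThan_Suc_atMost)
    finally show "(\<Sum>k\<in>{1..<p}. of_nat (c k) * (of_nat k * x ^ (k - 1) * y ^ (p - k))) = (x + y) ^ (p - 1) - x ^ (p - 1)" .
  next
    have "(\<Sum>k\<in>{1..<p}. of_nat (c k) * (of_nat (p - k) * x ^ k * y ^ (p - k - 1))) =
        (\<Sum>k\<in>{1..<p}. of_nat ((p - 1) choose k) * x ^ k * y ^ (p - 1 - k))"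
      by (intro sum.cong refl) (subst c2[symmetric], auto simp: mult.assoc)
    moreover have "{..p - 1} = insert 0 {1..<p}" using p2 by auto
    ultimately show "(\<Sum>k\<in>{1..<p}. of_nat (c k) * (of_nat (p - k) * x ^ k * y ^ (p - k - 1))) = (x + y) ^ (p - 1) - y ^ (p - 1)"
      by (simp add: binomial_ring)
  qed
qed

context module
begin

lemma smult_add_pow_right: "r \<in> carrier R \<Longrightarrow> x \<in> carrier M \<Longrightarrow> r \<odot>\<^bsub>M\<^esub> ([(n::nat)] \<cdot>\<^bsub>M\<^esub> x) = [n] \<cdot>\<^bsub>M\<^esub> (r \<odot>\<^bsub>M\<^esub> x)"
  by (induction n) (simp_all add: smult_r_distr)

lemma smult_add_pow_left: "r \<in> carrier R \<Longrightarrow> x \<in> carrier M \<Longrightarrow> ([(n::nat)] \<cdot> r) \<odot>\<^bsub>M\<^esub> x = [n] \<cdot>\<^bsub>M\<^esub> (r \<odot>\<^bsub>M\<^esub> x)"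
  by (induction n) (simp_all add: smult_l_distr)

lemma add_pow_add: "x \<in> carrier M \<Longrightarrow> y \<in> carrier M \<Longrightarrow> [(n::nat)] \<cdot>\<^bsub>M\<^esub> (x \<oplus>\<^bsub>M\<^esub> y) = [n] \<cdot>\<^bsub>M\<^esub> x \<oplus>\<^bsub>M\<^esub> [n] \<cdot>\<^bsub>M\<^esub> y"
  by (rule M.add.nat_pow_distrib)

lemma add_pow_pow: "x \<in> carrier M \<Longrightarrow> [(m::nat)] \<cdot>\<^bsub>M\<^esub> ([(n::nat)] \<cdot>\<^bsub>M\<^esub> x) = [(m * n)] \<cdot>\<^bsub>M\<^esub> x"
  by (simp add: M.add.nat_pow_pow mult.commute)

end

lemma (in derivation) D_one: "D \<one>\<^bsub>R\<^esub> = \<zero>\<^bsub>N\<^esub>"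
  using D_mult[of "\<one>\<^bsub>R\<^esub>" "\<one>\<^bsub>R\<^esub>"] by simp

lemma (in derivation) D_zero: "D \<zero>\<^bsub>R\<^esub> = \<zero>\<^bsub>N\<^esub>"
  using D_add[of "\<zero>\<^bsub>R\<^esub>" "\<zero>\<^bsub>R\<^esub>"] by simp

lemma (in derivation) D_add_pow: "a \<in> carrier R \<Longrightarrow> D ([(n::nat)] \<cdot>\<^bsub>R\<^esub> a) = [n] \<cdot>\<^bsub>N\<^esub> D a"
  by (induction n) (simp_all add: D_zero D_add)

lemma (in derivation) D_minus: "a \<in> carrier R \<Longrightarrow> D (\<ominus>\<^bsub>R\<^esub> a) = \<ominus>\<^bsub>N\<^esub> D a"
  using D_add[of "\<ominus>\<^bsub>R\<^esub> a" a] by (intro N.M.minus_equality[symmetric]) (simp_all add: R.l_neg D_zero)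

lemma (in derivation) D_pow:
  assumes a: "a \<in> carrier R"
  shows "D (a [^]\<^bsub>R\<^esub> (n::nat)) = [n] \<cdot>\<^bsub>N\<^esub> (\<rho> (a [^]\<^bsub>R\<^esub> (n - 1)) \<odot>\<^bsub>N\<^esub> D a)"
proof (induction n)
  case 0
  then show ?case by (simp add: D_one)
next
  case (Suc n)
  have "\<rho> a \<odot>\<^bsub>N\<^esub> ([n] \<cdot>\<^bsub>N\<^esub> (\<rho> (a [^]\<^bsub>R\<^esub> (n - 1)) \<odot>\<^bsub>N\<^esub> D a)) = [n] \<cdot>\<^bsub>N\<^esub> (\<rho> (a [^]\<^bsub>R\<^esub> n) \<odot>\<^bsub>N\<^esub> D a)"
  proof (cases n)
    case (Suc m)
    have "\<rho> a \<odot>\<^bsub>N\<^esub> (\<rho> (a [^]\<^bsub>R\<^esub> (n - 1)) \<odot>\<^bsub>N\<^esub> D a) = \<rho> (a [^]\<^bsub>R\<^esub> n) \<odot>\<^bsub>N\<^esub> D a"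
      using a Suc by (simp add: N.R.m_comm flip: N.smult_assoc1)
    then show ?thesis using a by (subst N.smult_add_pow_right) auto
  qed (use a in simp)
  then show ?case using a by (simp add: D_mult Suc N.M.a_comm)
qed

context cring
begin

lemma kaehler_derivation: "derivation R R (kaehler R) (\<lambda>x. x) (kaehler_d R)"
  by (intro derivation.intro derivation_axioms.intro cring_axioms kaehler_module)
    (auto intro!: ring_hom_memI simp: kaehler_d_add kaehler_d_mult)

lemmas kaehler_d_one = derivation.D_one[OF kaehler_derivation]
  and kaehler_d_zero = derivation.D_zero[OF kaehler_derivation]
  and kaehler_d_add_pow = derivation.D_add_pow[OF kaehler_derivation]
  and kaehler_d_pow = derivation.D_pow[OF kaehler_derivation]

text \<open>The chain rule for \<open>P\<close> at \<open>(x, y)\<close>, with \<open>P1\<close> and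
  \<open>P2\<close> in the role of the partial derivatives. As a relation it is established for
  monomials and passed on to sums.\<close>

definition has_pderivs :: "'a \<Rightarrow> 'a \<Rightarrow> bool zpoly \<Rightarrow> bool zpoly \<Rightarrow> bool zpoly \<Rightarrow> bool" where
  "has_pderivs x y P P1 P2 \<longleftrightarrow> (let ev = zeval R (\<lambda>b. if b then x else y) in
     kaehler_d R (ev P) = ev P1 \<odot>\<^bsub>kaehler R\<^esub> kaehler_d R x \<oplus>\<^bsub>kaehler R\<^esub> ev P2 \<odot>\<^bsub>kaehler R\<^esub> kaehler_d R y)"

context
  fixes x y assumes xy: "x \<in> carrier R" "y \<in> carrier R"
begin

lemma ev_closed: "(\<lambda>b. if b then x else y) \<in> UNIV \<rightarrow> carrier R"
  using xy by auto

lemma has_pderivs_add: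
  "has_pderivs x y P P1 P2 \<Longrightarrow> has_pderivs x y Q Q1 Q2 \<Longrightarrow> has_pderivs x y (P + Q) (P1 + Q1) (P2 + Q2)"
  using xy unfolding has_pderivs_def Let_def
  by (simp add: zeval_add[OF ev_closed] zeval_closed[OF ev_closed] kaehler_d_add Om.smult_l_distr Om.M.a_ac)

lemma has_pderivs_sum:
  "finite I \<Longrightarrow> (\<And>k. k \<in> I \<Longrightarrow> has_pderivs x y (f k) (g k) (h k)) \<Longrightarrow> has_pderivs x y (sum f I) (sum g I) (sum h I)"
proof (induction rule: finite_induct)
  case empty
  then show ?case using xy by (simp add: has_pderivs_def kaehler_d_zero)
qed (simp add: has_pderivs_add)

lemma has_pderivs_monomial:
  "has_pderivs x y (of_nat c * (zvar True ^ k * zvar False ^ l))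
     (of_nat c * (of_nat k * zvar True ^ (k - 1) * zvar False ^ l))
     (of_nat c * (of_nat l * zvar True ^ k * zvar False ^ (l - 1)))"
proof -
  have 1: "zeval R (\<lambda>b. if b then x else y) (of_nat k * zvar True ^ (k - 1) * zvar False ^ l) = [k] \<cdot> (x [^] (k - 1) \<otimes> y [^] l)"
    using xy by (simp add: zeval_mult[OF ev_closed] zeval_power[OF ev_closed] zeval_of_nat[OF ev_closed] zeval_zvar[OF ev_closed] add_pow_ldistr)
  have 2: "zeval R (\<lambda>b. if b then x else y) (of_nat l * zvar True ^ k * zvar False ^ (l - 1)) = [l] \<cdot> (x [^] k \<otimes> y [^] (l - 1))"
    using xy by (simp add: zeval_mult[OF ev_closed] zeval_power[OF ev_closed] zeval_of_nat[OF ev_closed] zeval_zvar[OF ev_closed] add_pow_ldistr)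
  have 3: "zeval R (\<lambda>b. if b then x else y) (zvar True ^ k * zvar False ^ l) = x [^] k \<otimes> y [^] l"
    using xy by (simp add: zeval_mult[OF ev_closed] zeval_power[OF ev_closed] zeval_zvar[OF ev_closed])
  have "kaehler_d R (x [^] k \<otimes> y [^] l) = [k] \<cdot> (x [^] (k - 1) \<otimes> y [^] l) \<odot>\<^bsub>kaehler R\<^esub> kaehler_d R x
      \<oplus>\<^bsub>kaehler R\<^esub> [l] \<cdot> (x [^] k \<otimes> y [^] (l - 1)) \<odot>\<^bsub>kaehler R\<^esub> kaehler_d R y"
    using xy
    by (simp add: kaehler_d_mult kaehler_d_pow Om.smult_add_pow_right Om.smult_add_pow_left Om.M.a_comm m_comm flip: Om.smult_assoc1)
  then show ?thesis
    unfolding has_pderivs_def Let_def zeval_of_nat_mult[OF ev_closed] 1 2 3 using xy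
    by (simp add: kaehler_d_add_pow Om.add_pow_add Om.smult_add_pow_left)
qed

end

end

section \<open>Unique \<open>p\<close>-divisibility of the differentials of \<open>A\<close>\<close>

locale frob_aut = frob_lift +
  assumes phi_bij: "bij_betw \<phi> (carrier A) (carrier A)"
begin

abbreviation \<Omega> where "\<Omega> \<equiv> kaehler A"
abbreviation dd where "dd \<equiv> kaehler_d A"

text \<open>The map on differentials induced by a ring endomorphism,
  \<open>a db |-> f(a) d(f(b))\<close>.\<close>

definition push :: "('a \<Rightarrow> 'a) \<Rightarrow> ('a \<Rightarrow> 'a) set \<Rightarrow> ('a \<Rightarrow> 'a) set" where
  "push f = kaehler_map A f (\<lambda>b. dd (f b)) \<Omega>"

lemma push_derivation: "f \<in> ring_hom A A \<Longrightarrow> derivation A A \<Omega> f (\<lambda>b. dd (f b))"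
  by (intro derivation.intro derivation_axioms.intro cring_axioms kaehler_module)
    (auto simp: ring_hom_closed ring_hom_add ring_hom_mult kaehler_d_add kaehler_d_mult)

lemma push_props:
  assumes f: "f \<in> ring_hom A A"
  shows push_closed: "\<alpha> \<in> carrier \<Omega> \<Longrightarrow> push f \<alpha> \<in> carrier \<Omega>"
    and push_add: "\<alpha> \<in> carrier \<Omega> \<Longrightarrow> \<beta> \<in> carrier \<Omega> \<Longrightarrow> push f (\<alpha> \<oplus>\<^bsub>\<Omega>\<^esub> \<beta>) = push f \<alpha> \<oplus>\<^bsub>\<Omega>\<^esub> push f \<beta>"
    and push_smult: "a \<in> carrier A \<Longrightarrow> \<alpha> \<in> carrier \<Omega> \<Longrightarrow> push f (a \<odot>\<^bsub>\<Omega>\<^esub> \<alpha>) = f a \<odot>\<^bsub>\<Omega>\<^esub> push f \<alpha>"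
    and push_d: "b \<in> carrier A \<Longrightarrow> push f (dd b) = dd (f b)"
    and push_zero: "push f \<zero>\<^bsub>\<Omega>\<^esub> = \<zero>\<^bsub>\<Omega>\<^esub>"
  unfolding push_def using derivation.kmap_closed[OF push_derivation[OF f]] derivation.kmap_add[OF push_derivation[OF f]]
    derivation.kmap_smult[OF push_derivation[OF f]] derivation.kmap_d[OF push_derivation[OF f]]
    derivation.kmap_zero[OF push_derivation[OF f]] by auto

lemma push_add_pow:
  "f \<in> ring_hom A A \<Longrightarrow> \<alpha> \<in> carrier \<Omega> \<Longrightarrow> push f ([(n::nat)] \<cdot>\<^bsub>\<Omega>\<^esub> \<alpha>) = [n] \<cdot>\<^bsub>\<Omega>\<^esub> push f \<alpha>"
  by (induction n) (simp_all add: push_zero push_add)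

text \<open>The \<open>p\<close>-derivation belonging to the Frobenius lift. Torsion freeness of
  \<open>A\<close> makes it unique, so its sum and product formulas follow from those of
  \<phi>.\<close>

definition delta :: "'a \<Rightarrow> 'a" where
  "delta x = (SOME c. c \<in> carrier A \<and> \<phi> x = x [^] p \<oplus> [p] \<cdot> c)"

lemma delta:
  assumes "x \<in> carrier A"
  shows "delta x \<in> carrier A" "\<phi> x = x [^] p \<oplus> [p] \<cdot> delta x"
  using someI_ex[of "\<lambda>c. c \<in> carrier A \<and> \<phi> x = x [^] p \<oplus> [p] \<cdot> c"] phi_lift[OF assms]
  unfolding delta_def by blast+

lemma p_cancel: "x \<in> carrier A \<Longrightarrow> y \<in> carrier A \<Longrightarrow> [p] \<cdot> x = [p] \<cdot> y \<Longrightarrow> x = y"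
  using p_pow_cancel[of x y 1] by simp

text \<open>This is \<open>d\<phi>(x) / p\<close>, defined before \<open>\<Omega>\<^sup>1\<^sub>A\<close> is known to be uniquely \<open>p\<close>-divisible.\<close>

definition frob_d :: "'a \<Rightarrow> ('a \<Rightarrow> 'a) set" where
  "frob_d x = x [^] (p - 1) \<odot>\<^bsub>\<Omega>\<^esub> dd x \<oplus>\<^bsub>\<Omega>\<^esub> dd (delta x)"

lemma frob_d_closed: "x \<in> carrier A \<Longrightarrow> frob_d x \<in> carrier \<Omega>"
  by (simp add: frob_d_def delta)

lemma pow_p_split: "x \<in> carrier A \<Longrightarrow> x [^] p = x \<otimes> x [^] (p - 1)"
  using p_gt_0 nat_pow_Suc[of x "p - 1"] by (simp add: m_comm)

text \<open>Multiplying by \<open>p\<close> would reduce this to the Leibniz rule for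
  \<open>d \<phi>\<close>, but \<open>p\<close> cannot yet be cancelled in \<Omega>. Instead the
  product formula for \<open>delta\<close> is obtained by cancelling \<open>p\<close> in
  \<open>A\<close>, and then differentiated.\<close>

lemma frob_d_mult:
  assumes x: "x \<in> carrier A" and y: "y \<in> carrier A"
  shows "frob_d (x \<otimes> y) = \<phi> x \<odot>\<^bsub>\<Omega>\<^esub> frob_d y \<oplus>\<^bsub>\<Omega>\<^esub> \<phi> y \<odot>\<^bsub>\<Omega>\<^esub> frob_d x"
proof -
  note c = x y delta(1)[OF x] delta(1)[OF y]
  let ?e = "x [^] p \<otimes> delta y \<oplus> y [^] p \<otimes> delta x \<oplus> [p] \<cdot> (delta x \<otimes> delta y)"
  have ec: "?e \<in> carrier A" using c by simp
  have "(x \<otimes> y) [^] p \<oplus> [p] \<cdot> delta (x \<otimes> y) = (x [^] p \<oplus> [p] \<cdot> delta x) \<otimes> (y [^] p \<oplus> [p] \<cdot> delta y)"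
    using delta(2)[of "x \<otimes> y"] delta(2)[OF x] delta(2)[OF y] x y by simp
  also have "\<dots> = (x \<otimes> y) [^] p \<oplus> [p] \<cdot> ?e"
    using c by (simp add: nat_pow_distrib l_distr r_distr add_pow_ldistr add_pow_rdistr add.nat_pow_distrib add_pow_mult a_ac m_ac)
  finally have "[p] \<cdot> delta (x \<otimes> y) = [p] \<cdot> ?e" using c ec delta(1)[of "x \<otimes> y"] by simp
  then have de: "delta (x \<otimes> y) = ?e" using p_cancel[of "delta (x \<otimes> y)" ?e] delta(1)[of "x \<otimes> y"] c by simp
  let ?P = "x [^] (p - 1)" and ?Q = "y [^] (p - 1)"
  have pw: "(x \<otimes> y) [^] (p - 1) = ?P \<otimes> ?Q" using c by (simp add: nat_pow_distrib)
  have PQ: "?P \<in> carrier A" "?Q \<in> carrier A" using c by auto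
  have dde: "dd ?e = x [^] p \<odot>\<^bsub>\<Omega>\<^esub> dd (delta y) \<oplus>\<^bsub>\<Omega>\<^esub> delta y \<odot>\<^bsub>\<Omega>\<^esub> ([p] \<cdot>\<^bsub>\<Omega>\<^esub> (?P \<odot>\<^bsub>\<Omega>\<^esub> dd x))
      \<oplus>\<^bsub>\<Omega>\<^esub> (y [^] p \<odot>\<^bsub>\<Omega>\<^esub> dd (delta x) \<oplus>\<^bsub>\<Omega>\<^esub> delta x \<odot>\<^bsub>\<Omega>\<^esub> ([p] \<cdot>\<^bsub>\<Omega>\<^esub> (?Q \<odot>\<^bsub>\<Omega>\<^esub> dd y)))
      \<oplus>\<^bsub>\<Omega>\<^esub> [p] \<cdot>\<^bsub>\<Omega>\<^esub> (delta x \<odot>\<^bsub>\<Omega>\<^esub> dd (delta y) \<oplus>\<^bsub>\<Omega>\<^esub> delta y \<odot>\<^bsub>\<Omega>\<^esub> dd (delta x))"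
    using c by (simp add: kaehler_d_mult kaehler_d_add kaehler_d_add_pow kaehler_d_pow)
  show ?thesis
    unfolding frob_d_def de pw delta(2)[OF x] delta(2)[OF y] dde
    unfolding pow_p_split[OF x] pow_p_split[OF y]
    using c PQ
    by (simp add: kaehler_d_mult Om.smult_l_distr Om.smult_r_distr Om.add_pow_add Om.smult_add_pow_right
        Om.smult_add_pow_left Om.M.a_ac m_ac r_distr add_pow_rdistr flip: Om.smult_assoc1)
qed

text \<open>The failure of \<open>delta\<close> to be additive is \<open>-Q(x, y)\<close> with
  \<open>Q\<close> as in \<open>power_add_prime_coeffs\<close>. Its differential is exactly what
  separates \<open>(x + y)^(p-1) d(x + y)\<close> from
  \<open>x^(p-1) dx + y^(p-1) dy\<close>.\<close>

lemma frob_d_add: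
  assumes x: "x \<in> carrier A" and y: "y \<in> carrier A"
  shows "frob_d (x \<oplus> y) = frob_d x \<oplus>\<^bsub>\<Omega>\<^esub> frob_d y"
proof -
  let ?X = "zvar True :: bool zpoly" and ?Y = "zvar False :: bool zpoly"
  define ev where "ev = zeval A (\<lambda>b. if b then x else y)"
  note evc = ev_closed[OF x y]
  have evX [simp]: "ev ?X = x" and evY [simp]: "ev ?Y = y" using zeval_zvar[OF evc] by (simp_all add: ev_def)
  have ev_cl [simp]: "ev P \<in> carrier A" for P unfolding ev_def by (rule zeval_closed[OF evc])
  obtain c where c:
    "(?X + ?Y) ^ p = ?X ^ p + ?Y ^ p + of_nat p * (\<Sum>k\<in>{1..<p}. of_nat (c k) * (?X ^ k * ?Y ^ (p - k)))"
    "(\<Sum>k\<in>{1..<p}. of_nat (c k) * (of_nat k * ?X ^ (k - 1) * ?Y ^ (p - k))) = (?X + ?Y) ^ (p - 1) - ?X ^ (p - 1)"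
    "(\<Sum>k\<in>{1..<p}. of_nat (c k) * (of_nat (p - k) * ?X ^ k * ?Y ^ (p - k - 1))) = (?X + ?Y) ^ (p - 1) - ?Y ^ (p - 1)"
    by (rule power_add_prime_coeffs[OF prime_p])
  define Q where "Q = (\<Sum>k\<in>{1..<p}. of_nat (c k) * (?X ^ k * ?Y ^ (p - k)))"
  let ?S = "(x \<oplus> y) [^] (p - 1)"
  have "has_pderivs x y Q (\<Sum>k\<in>{1..<p}. of_nat (c k) * (of_nat k * ?X ^ (k - 1) * ?Y ^ (p - k)))
    (\<Sum>k\<in>{1..<p}. of_nat (c k) * (of_nat (p - k) * ?X ^ k * ?Y ^ (p - k - 1)))"
    unfolding Q_def by (rule has_pderivs_sum[OF x y], simp, rule has_pderivs_monomial[OF x y])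
  then have dQ: "dd (ev Q) = (?S \<ominus> x [^] (p - 1)) \<odot>\<^bsub>\<Omega>\<^esub> dd x \<oplus>\<^bsub>\<Omega>\<^esub> (?S \<ominus> y [^] (p - 1)) \<odot>\<^bsub>\<Omega>\<^esub> dd y"
    unfolding c(2,3) has_pderivs_def Let_def ev_def[symmetric]
    by (simp add: ev_def zeval_diff[OF evc] zeval_power[OF evc] zeval_add[OF evc] zeval_zvar[OF evc])
  have pw: "(x \<oplus> y) [^] p = x [^] p \<oplus> y [^] p \<oplus> [p] \<cdot> ev Q"
    using arg_cong[OF c(1), of ev] unfolding Q_def[symmetric]
    by (simp add: ev_def zeval_power[OF evc] zeval_add[OF evc] zeval_zvar[OF evc] zeval_of_nat_mult[OF evc])
  note cl = x y delta(1)[OF x] delta(1)[OF y] delta(1)[OF a_closed[OF x y]]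
  have "(x \<oplus> y) [^] p \<oplus> [p] \<cdot> delta (x \<oplus> y) = (x [^] p \<oplus> [p] \<cdot> delta x) \<oplus> (y [^] p \<oplus> [p] \<cdot> delta y)"
    using delta(2)[of "x \<oplus> y"] delta(2)[OF x] delta(2)[OF y] x y by simp
  then have "(x [^] p \<oplus> y [^] p) \<oplus> [p] \<cdot> (ev Q \<oplus> delta (x \<oplus> y)) = (x [^] p \<oplus> y [^] p) \<oplus> [p] \<cdot> (delta x \<oplus> delta y)"
    unfolding pw using cl by (simp add: add.nat_pow_distrib a_ac)
  then have "[p] \<cdot> (ev Q \<oplus> delta (x \<oplus> y)) = [p] \<cdot> (delta x \<oplus> delta y)"
    using cl by (simp del: nat_pow_distrib)
  then have "ev Q \<oplus> delta (x \<oplus> y) = delta x \<oplus> delta y"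
    using cl p_cancel[of "ev Q \<oplus> delta (x \<oplus> y)" "delta x \<oplus> delta y"] by simp
  then have "dd (ev Q) \<oplus>\<^bsub>\<Omega>\<^esub> dd (delta (x \<oplus> y)) = dd (delta x) \<oplus>\<^bsub>\<Omega>\<^esub> dd (delta y)"
    using cl by (metis kaehler_d_add ev_cl)
  moreover have "dd (ev Q) \<oplus>\<^bsub>\<Omega>\<^esub> frob_d (x \<oplus> y) = ?S \<odot>\<^bsub>\<Omega>\<^esub> (dd x \<oplus>\<^bsub>\<Omega>\<^esub> dd y) \<oplus>\<^bsub>\<Omega>\<^esub> (dd (ev Q) \<oplus>\<^bsub>\<Omega>\<^esub> dd (delta (x \<oplus> y)))"
    unfolding frob_d_def using cl by (simp add: kaehler_d_add Om.smult_r_distr Om.M.a_ac)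
  ultimately have "dd (ev Q) \<oplus>\<^bsub>\<Omega>\<^esub> frob_d (x \<oplus> y) = ?S \<odot>\<^bsub>\<Omega>\<^esub> (dd x \<oplus>\<^bsub>\<Omega>\<^esub> dd y) \<oplus>\<^bsub>\<Omega>\<^esub> (dd (delta x) \<oplus>\<^bsub>\<Omega>\<^esub> dd (delta y))"
    by simp
  moreover have "dd (ev Q) \<oplus>\<^bsub>\<Omega>\<^esub> (frob_d x \<oplus>\<^bsub>\<Omega>\<^esub> frob_d y) =
      ((?S \<ominus> x [^] (p - 1)) \<oplus> x [^] (p - 1)) \<odot>\<^bsub>\<Omega>\<^esub> dd x \<oplus>\<^bsub>\<Omega>\<^esub> ((?S \<ominus> y [^] (p - 1)) \<oplus> y [^] (p - 1)) \<odot>\<^bsub>\<Omega>\<^esub> dd y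
      \<oplus>\<^bsub>\<Omega>\<^esub> (dd (delta x) \<oplus>\<^bsub>\<Omega>\<^esub> dd (delta y))"
    unfolding dQ frob_d_def using cl by (simp add: Om.smult_l_distr Om.M.a_ac)
  moreover have "(?S \<ominus> x [^] (p - 1)) \<oplus> x [^] (p - 1) = ?S" "(?S \<ominus> y [^] (p - 1)) \<oplus> y [^] (p - 1) = ?S"
    using cl by (simp_all add: minus_eq a_assoc l_neg)
  ultimately have "dd (ev Q) \<oplus>\<^bsub>\<Omega>\<^esub> frob_d (x \<oplus> y) = dd (ev Q) \<oplus>\<^bsub>\<Omega>\<^esub> (frob_d x \<oplus>\<^bsub>\<Omega>\<^esub> frob_d y)"
    using cl by (simp add: Om.smult_r_distr)
  then show ?thesis using cl by (simp add: frob_d_closed)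
qed

lemma frob_d_derivation: "derivation A A \<Omega> \<phi> frob_d"
  by (intro derivation.intro derivation_axioms.intro cring_axioms kaehler_module phi_hom
      frob_d_closed frob_d_add frob_d_mult)

lemma p_frob_d: "x \<in> carrier A \<Longrightarrow> [p] \<cdot>\<^bsub>\<Omega>\<^esub> frob_d x = dd (\<phi> x)"
  using delta[of x]
  by (simp add: frob_d_def kaehler_d_add kaehler_d_add_pow kaehler_d_pow Om.add_pow_add)

interpretation Fr: derivation A A \<Omega> \<phi> frob_d
  by (rule frob_d_derivation)

text \<open>\<open>Fr.kmap\<close> is the divided Frobenius on \<Omega>. Since
  \<open>push \<phi>\<close> is bijective, this factorisation of it through multiplication by
  \<open>p\<close> makes that multiplication surjective; as the two factors commute, it is injective
  as well.\<close>

lemma p_frob: "\<alpha> \<in> carrier \<Omega> \<Longrightarrow> [p] \<cdot>\<^bsub>\<Omega>\<^esub> Fr.kmap \<alpha> = push \<phi> \<alpha>"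
proof (induction rule: kaehler_induct)
  case zero
  then show ?case by (simp add: Fr.kmap_zero push_zero[OF phi_hom])
next
  case (gen a b)
  then show ?case
    by (simp add: Fr.kmap_smult Fr.kmap_d push_smult[OF phi_hom] push_d[OF phi_hom] frob_d_closed p_frob_d
        flip: Om.smult_add_pow_right)
next
  case (add \<alpha> \<beta>)
  then show ?case by (simp add: Fr.kmap_add Fr.kmap_closed push_add[OF phi_hom] Om.add_pow_add)
qed

lemma Fr_add_pow: "\<alpha> \<in> carrier \<Omega> \<Longrightarrow> Fr.kmap ([(n::nat)] \<cdot>\<^bsub>\<Omega>\<^esub> \<alpha>) = [n] \<cdot>\<^bsub>\<Omega>\<^esub> Fr.kmap \<alpha>"
  by (induction n) (simp_all add: Fr.kmap_zero Fr.kmap_add)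

definition phi_inv :: "'a \<Rightarrow> 'a" where
  "phi_inv = inv_into (carrier A) \<phi>"

lemma phi_inv: "x \<in> carrier A \<Longrightarrow> phi_inv x \<in> carrier A" "x \<in> carrier A \<Longrightarrow> \<phi> (phi_inv x) = x"
  "x \<in> carrier A \<Longrightarrow> phi_inv (\<phi> x) = x"
  using phi_bij unfolding phi_inv_def bij_betw_def
  by (auto intro: inv_into_into f_inv_into_f inv_into_f_f)

lemma phi_inv_hom: "phi_inv \<in> ring_hom A A"
proof (rule ring_hom_memI)
  fix x y assume "x \<in> carrier A" "y \<in> carrier A"
  then show "phi_inv (x \<otimes> y) = phi_inv x \<otimes> phi_inv y" "phi_inv (x \<oplus> y) = phi_inv x \<oplus> phi_inv y"
    using phi_inv(3)[of "phi_inv x \<otimes> phi_inv y"] phi_inv(3)[of "phi_inv x \<oplus> phi_inv y"] by (simp_all add: phi_inv)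
next
  show "phi_inv \<one> = \<one>" using phi_inv(3)[of \<one>] by simp
qed (simp add: phi_inv)

lemma push_push:
  assumes "f \<in> ring_hom A A" "g \<in> ring_hom A A" "\<And>x. x \<in> carrier A \<Longrightarrow> f (g x) = x" "\<alpha> \<in> carrier \<Omega>"
  shows "push f (push g \<alpha>) = \<alpha>"
  using assms(4)
proof (induction rule: kaehler_induct)
  case (gen a b)
  then show ?case
    using assms by (simp add: push_smult push_d push_closed ring_hom_closed[OF assms(1)] ring_hom_closed[OF assms(2)])
qed (use assms in \<open>simp_all add: push_zero push_add push_closed\<close>)

lemma Omega_torsion_free: "\<alpha> \<in> carrier \<Omega> \<Longrightarrow> [p] \<cdot>\<^bsub>\<Omega>\<^esub> \<alpha> = \<zero>\<^bsub>\<Omega>\<^esub> \<Longrightarrow> \<alpha> = \<zero>\<^bsub>\<Omega>\<^esub>"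
proof -
  assume a: "\<alpha> \<in> carrier \<Omega>" "[p] \<cdot>\<^bsub>\<Omega>\<^esub> \<alpha> = \<zero>\<^bsub>\<Omega>\<^esub>"
  have "push \<phi> \<alpha> = Fr.kmap ([p] \<cdot>\<^bsub>\<Omega>\<^esub> \<alpha>)" using a(1) by (simp only: Fr_add_pow p_frob)
  then have "push \<phi> \<alpha> = \<zero>\<^bsub>\<Omega>\<^esub>" using a(2) by (simp add: Fr.kmap_zero)
  then show "\<alpha> = \<zero>\<^bsub>\<Omega>\<^esub>"
    using push_push[OF phi_inv_hom phi_hom phi_inv(3) a(1)] push_zero[OF phi_inv_hom] by simp
qed

lemma Omega_p_divisible: "\<alpha> \<in> carrier \<Omega> \<Longrightarrow> \<exists>\<beta>\<in>carrier \<Omega>. [p] \<cdot>\<^bsub>\<Omega>\<^esub> \<beta> = \<alpha>"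
  using push_push[OF phi_hom phi_inv_hom phi_inv(2)] p_frob[OF push_closed[OF phi_inv_hom]]
    Fr.kmap_closed[OF push_closed[OF phi_inv_hom]] by metis

lemma Omega_torsion_free_pow: "\<alpha> \<in> carrier \<Omega> \<Longrightarrow> [(p ^ n)] \<cdot>\<^bsub>\<Omega>\<^esub> \<alpha> = \<zero>\<^bsub>\<Omega>\<^esub> \<Longrightarrow> \<alpha> = \<zero>\<^bsub>\<Omega>\<^esub>"
proof (induction n)
  case (Suc n)
  then have "[p] \<cdot>\<^bsub>\<Omega>\<^esub> ([(p ^ n)] \<cdot>\<^bsub>\<Omega>\<^esub> \<alpha>) = \<zero>\<^bsub>\<Omega>\<^esub>" by (simp add: Om.add_pow_pow)
  from Omega_torsion_free[OF _ this] show ?case using Suc.IH[OF Suc.prems(1)] Suc.prems(1) by simp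
qed simp

lemma Omega_pow_divisible: "\<alpha> \<in> carrier \<Omega> \<Longrightarrow> \<exists>\<beta>\<in>carrier \<Omega>. [(p ^ n)] \<cdot>\<^bsub>\<Omega>\<^esub> \<beta> = \<alpha>"
proof (induction n arbitrary: \<alpha>)
  case (Suc n)
  obtain \<beta> where b: "\<beta> \<in> carrier \<Omega>" "[p] \<cdot>\<^bsub>\<Omega>\<^esub> \<beta> = \<alpha>" using Omega_p_divisible[OF Suc.prems] by blast
  obtain \<gamma> where "\<gamma> \<in> carrier \<Omega>" "[(p ^ n)] \<cdot>\<^bsub>\<Omega>\<^esub> \<gamma> = \<beta>" using Suc.IH[OF b(1)] by blast
  then show ?case using b by (intro bexI[of _ \<gamma>]) (simp_all add: Om.add_pow_pow[symmetric])
qed auto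

definition pdiv :: "nat \<Rightarrow> ('a \<Rightarrow> 'a) set \<Rightarrow> ('a \<Rightarrow> 'a) set" where
  "pdiv n = divide_nat \<Omega> (p ^ n)"

lemma Omega_pow_cancel:
  assumes "\<alpha> \<in> carrier \<Omega>" "\<beta> \<in> carrier \<Omega>" "[(p ^ n)] \<cdot>\<^bsub>\<Omega>\<^esub> \<alpha> = [(p ^ n)] \<cdot>\<^bsub>\<Omega>\<^esub> \<beta>"
  shows "\<alpha> = \<beta>"
proof -
  have "[(p ^ n)] \<cdot>\<^bsub>\<Omega>\<^esub> (\<alpha> \<oplus>\<^bsub>\<Omega>\<^esub> \<ominus>\<^bsub>\<Omega>\<^esub> \<beta>) = \<zero>\<^bsub>\<Omega>\<^esub>"
    using assms by (simp add: Om.add_pow_add Om.M.add_pow_minus Om.M.r_neg del: Om.M.add.nat_pow_inv)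
  moreover have "\<alpha> \<oplus>\<^bsub>\<Omega>\<^esub> \<ominus>\<^bsub>\<Omega>\<^esub> \<beta> \<in> carrier \<Omega>" using assms by simp
  ultimately have "\<alpha> \<oplus>\<^bsub>\<Omega>\<^esub> \<ominus>\<^bsub>\<Omega>\<^esub> \<beta> = \<zero>\<^bsub>\<Omega>\<^esub>" using Omega_torsion_free_pow[of _ n] by (simp only:)
  then have "\<alpha> = \<ominus>\<^bsub>\<Omega>\<^esub> (\<ominus>\<^bsub>\<Omega>\<^esub> \<beta>)" using assms Om.M.minus_equality[of \<alpha> "\<ominus>\<^bsub>\<Omega>\<^esub> \<beta>"] by simp
  then show ?thesis using assms by simp
qed

lemma pdiv:
  assumes "\<alpha> \<in> carrier \<Omega>"
  shows pdiv_closed: "pdiv n \<alpha> \<in> carrier \<Omega>" and pdiv_mult: "[(p ^ n)] \<cdot>\<^bsub>\<Omega>\<^esub> pdiv n \<alpha> = \<alpha>"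
proof -
  have "\<exists>!\<beta>. \<beta> \<in> carrier \<Omega> \<and> [(p ^ n)] \<cdot>\<^bsub>\<Omega>\<^esub> \<beta> = \<alpha>"
    using Omega_pow_divisible[OF assms, of n] Omega_pow_cancel[of _ _ n] by metis
  from theI'[OF this] show "pdiv n \<alpha> \<in> carrier \<Omega>" "[(p ^ n)] \<cdot>\<^bsub>\<Omega>\<^esub> pdiv n \<alpha> = \<alpha>"
    unfolding pdiv_def divide_nat_def by auto
qed

lemma pdiv_eqI: "\<beta> \<in> carrier \<Omega> \<Longrightarrow> [(p ^ n)] \<cdot>\<^bsub>\<Omega>\<^esub> \<beta> = \<alpha> \<Longrightarrow> pdiv n \<alpha> = \<beta>"
  using Omega_pow_cancel[of "pdiv n \<alpha>" \<beta> n] pdiv[of \<alpha> n] by auto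

lemma pdiv_add: "\<alpha> \<in> carrier \<Omega> \<Longrightarrow> \<beta> \<in> carrier \<Omega> \<Longrightarrow> pdiv n (\<alpha> \<oplus>\<^bsub>\<Omega>\<^esub> \<beta>) = pdiv n \<alpha> \<oplus>\<^bsub>\<Omega>\<^esub> pdiv n \<beta>"
  by (rule pdiv_eqI) (simp_all add: pdiv Om.add_pow_add)

lemma pdiv_smult: "a \<in> carrier A \<Longrightarrow> \<alpha> \<in> carrier \<Omega> \<Longrightarrow> pdiv n (a \<odot>\<^bsub>\<Omega>\<^esub> \<alpha>) = a \<odot>\<^bsub>\<Omega>\<^esub> pdiv n \<alpha>"
  by (rule pdiv_eqI) (simp_all add: pdiv flip: Om.smult_add_pow_right)

lemma pdiv_p_pow: "\<alpha> \<in> carrier \<Omega> \<Longrightarrow> pdiv n ([(p ^ n)] \<cdot>\<^bsub>\<Omega>\<^esub> \<alpha>) = \<alpha>"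
  by (rule pdiv_eqI) simp_all

lemma pdiv_Suc_p: "\<alpha> \<in> carrier \<Omega> \<Longrightarrow> pdiv (Suc n) ([p] \<cdot>\<^bsub>\<Omega>\<^esub> \<alpha>) = pdiv n \<alpha>"
  by (rule pdiv_eqI) (simp_all add: pdiv flip: Om.add_pow_pow)

end

section \<open>Products and pairs of modules\<close>

lemma pair_module_simps:
  "carrier (pair_module M N) = carrier M \<times> carrier N" "\<zero>\<^bsub>pair_module M N\<^esub> = (\<zero>\<^bsub>M\<^esub>, \<zero>\<^bsub>N\<^esub>)"
  "x \<oplus>\<^bsub>pair_module M N\<^esub> y = (fst x \<oplus>\<^bsub>M\<^esub> fst y, snd x \<oplus>\<^bsub>N\<^esub> snd y)"
  "r \<odot>\<^bsub>pair_module M N\<^esub> x = (r \<odot>\<^bsub>M\<^esub> fst x, r \<odot>\<^bsub>N\<^esub> snd x)"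
  by (simp_all add: pair_module_def)

lemma pair_module_module:
  assumes "module R M" "module R N"
  shows "module R (pair_module M N)"
proof -
  interpret M: module R M by fact
  interpret N: module R N by fact
  show ?thesis
  proof (rule moduleI)
    show "abelian_group (pair_module M N)"
    proof (rule abelian_groupI)
      fix x assume "x \<in> carrier (pair_module M N)"
      then show "\<exists>y\<in>carrier (pair_module M N). y \<oplus>\<^bsub>pair_module M N\<^esub> x = \<zero>\<^bsub>pair_module M N\<^esub>"
        by (intro bexI[of _ "(\<ominus>\<^bsub>M\<^esub> fst x, \<ominus>\<^bsub>N\<^esub> snd x)"]) (auto simp: pair_module_simps M.M.l_neg N.M.l_neg)
    qed (auto simp: pair_module_simps M.M.a_ac N.M.a_ac)
  qed (auto simp: pair_module_simps M.smult_l_distr N.smult_l_distr M.smult_r_distr N.smult_r_distr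
      M.smult_assoc1 N.smult_assoc1 M.R.cring_axioms)
qed

lemma pi_module_simps:
  "carrier (pi_module I M) = (\<Pi>\<^sub>E i\<in>I. carrier (M i))" "\<zero>\<^bsub>pi_module I M\<^esub> = (\<lambda>i\<in>I. \<zero>\<^bsub>M i\<^esub>)"
  "x \<oplus>\<^bsub>pi_module I M\<^esub> y = (\<lambda>i\<in>I. x i \<oplus>\<^bsub>M i\<^esub> y i)"
  "r \<odot>\<^bsub>pi_module I M\<^esub> x = (\<lambda>i\<in>I. r \<odot>\<^bsub>M i\<^esub> x i)"
  by (simp_all add: pi_module_def)

lemma pi_module_module:
  assumes "cring R" and M: "\<And>i. i \<in> I \<Longrightarrow> module R (M i)"
  shows "module R (pi_module I M)"
proof (rule moduleI)
  note ag = module.axioms(2)[OF M]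
  show "abelian_group (pi_module I M)"
  proof (rule abelian_groupI)
    fix x assume "x \<in> carrier (pi_module I M)"
    then show "\<exists>y\<in>carrier (pi_module I M). y \<oplus>\<^bsub>pi_module I M\<^esub> x = \<zero>\<^bsub>pi_module I M\<^esub>"
      using abelian_group.a_inv_closed[OF ag] abelian_group.l_neg[OF ag]
      by (intro bexI[of _ "\<lambda>i\<in>I. \<ominus>\<^bsub>M i\<^esub> x i"]) (auto simp: pi_module_simps PiE_iff intro!: ext)
  next
    fix x y z
    assume "x \<in> carrier (pi_module I M)" "y \<in> carrier (pi_module I M)" "z \<in> carrier (pi_module I M)"
    then show "x \<oplus>\<^bsub>pi_module I M\<^esub> y \<oplus>\<^bsub>pi_module I M\<^esub> z = x \<oplus>\<^bsub>pi_module I M\<^esub> (y \<oplus>\<^bsub>pi_module I M\<^esub> z)"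
      using abelian_monoid.a_assoc[OF abelian_group.axioms(1)[OF ag]]
      by (auto simp: pi_module_simps PiE_iff intro!: ext)
  next
    fix x y
    assume "x \<in> carrier (pi_module I M)" "y \<in> carrier (pi_module I M)"
    then show "x \<oplus>\<^bsub>pi_module I M\<^esub> y \<in> carrier (pi_module I M)" "x \<oplus>\<^bsub>pi_module I M\<^esub> y = y \<oplus>\<^bsub>pi_module I M\<^esub> x"
      using abelian_monoid.a_comm[OF abelian_group.axioms(1)[OF ag]] abelian_monoid.a_closed[OF abelian_group.axioms(1)[OF ag]]
      by (auto simp: pi_module_simps PiE_iff intro!: ext)
  next
    show "\<zero>\<^bsub>pi_module I M\<^esub> \<in> carrier (pi_module I M)"
      using abelian_monoid.zero_closed[OF abelian_group.axioms(1)[OF ag]] by (auto simp: pi_module_simps)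
  next
    fix x
    assume "x \<in> carrier (pi_module I M)"
    then show "\<zero>\<^bsub>pi_module I M\<^esub> \<oplus>\<^bsub>pi_module I M\<^esub> x = x"
      using abelian_monoid.l_zero[OF abelian_group.axioms(1)[OF ag]]
      by (intro ext) (auto simp: pi_module_simps PiE_iff extensional_def)
  qed
qed (auto simp: pi_module_simps PiE_iff assms(1) extensional_def module.smult_l_distr[OF M] module.smult_r_distr[OF M]
    module.smult_assoc1[OF M] module.smult_one[OF M] module.smult_closed[OF M] intro!: ext)

text \<open>Restriction of scalars along \<rho>. It is used along ghost components for the test
  complex and along \<open>sec\<close> for the target of the comparison map.\<close>

definition pull_module :: "('a \<Rightarrow> 's) \<Rightarrow> ('s, 'b, 'm) module_scheme \<Rightarrow> ('a, 'b) module" where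
  "pull_module \<rho> M = \<lparr>carrier = carrier M, monoid.mult = undefined, one = undefined, zero = \<zero>\<^bsub>M\<^esub>,
     add = (\<oplus>\<^bsub>M\<^esub>), smult = (\<lambda>r. (\<odot>\<^bsub>M\<^esub>) (\<rho> r))\<rparr>"

lemma pull_module_simps:
  "carrier (pull_module \<rho> M) = carrier M" "\<zero>\<^bsub>pull_module \<rho> M\<^esub> = \<zero>\<^bsub>M\<^esub>"
  "x \<oplus>\<^bsub>pull_module \<rho> M\<^esub> y = x \<oplus>\<^bsub>M\<^esub> y" "r \<odot>\<^bsub>pull_module \<rho> M\<^esub> x = \<rho> r \<odot>\<^bsub>M\<^esub> x"
  by (simp_all add: pull_module_def)

lemma pull_module_module:
  assumes "module S M" "cring R" "\<rho> \<in> ring_hom R S"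
  shows "module R (pull_module \<rho> M)"
proof -
  interpret M: module S M by fact
  interpret R: cring R by fact
  interpret \<rho>: ring_hom_cring R S \<rho> by unfold_locales fact
  show ?thesis
  proof (rule moduleI)
    show "abelian_group (pull_module \<rho> M)"
    proof (rule abelian_groupI)
      fix x assume "x \<in> carrier (pull_module \<rho> M)"
      then show "\<exists>y\<in>carrier (pull_module \<rho> M). y \<oplus>\<^bsub>pull_module \<rho> M\<^esub> x = \<zero>\<^bsub>pull_module \<rho> M\<^esub>"
        by (intro bexI[of _ "\<ominus>\<^bsub>M\<^esub> x"]) (auto simp: pull_module_simps M.M.l_neg)
    qed (auto simp: pull_module_simps M.M.a_ac)
  qed (auto simp: pull_module_simps M.smult_l_distr M.smult_r_distr M.smult_assoc1 R.cring_axioms)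
qed

section \<open>Witt vectors of finite length: \<open>F\<close>, \<open>V\<close> and the
  section\<close>

context frob_lift
begin

abbreviation Wn :: "nat \<Rightarrow> (nat \<Rightarrow> 'a) ring" where "Wn n \<equiv> W {..<n}"
abbreviation Fr :: "nat \<Rightarrow> (nat \<Rightarrow> 'a) \<Rightarrow> nat \<Rightarrow> 'a" where "Fr n \<equiv> witt_frob p {..<n} A"
abbreviation Ve :: "nat \<Rightarrow> (nat \<Rightarrow> 'a) \<Rightarrow> nat \<Rightarrow> 'a" where "Ve n \<equiv> witt_ver {..<Suc n} A"

lemma Wn_cring: "cring (Wn n)"
  by (rule witt_cring) simp

lemma Fr_hom: "Fr n \<in> ring_hom (Wn (Suc n)) (Wn n)"
  by (rule F_hom) auto

lemma Fr_closed [simp]: "x \<in> carrier (Wn (Suc n)) \<Longrightarrow> Fr n x \<in> carrier (Wn n)"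
  by (rule F_closed[of "{..<n}" "{..<Suc n}"]) auto

lemma Ve_closed [simp]: "x \<in> carrier (Wn n) \<Longrightarrow> Ve n x \<in> carrier (Wn (Suc n))"
  by (rule V_closed[of "{..<n}" "{..<Suc n}"]) auto

lemma gh_Fr: "x \<in> carrier (Wn (Suc n)) \<Longrightarrow> i < n \<Longrightarrow> gh i (Fr n x) = gh (Suc i) x"
  by (rule gh_F[of "{..<n}" "{..<Suc n}"]) auto

lemma gh_Ve_0: "x \<in> carrier (Wn n) \<Longrightarrow> gh 0 (Ve n x) = \<zero>"
  by (rule gh_V_0[of "{..<n}" "{..<Suc n}"]) auto

lemma gh_Ve_Suc: "x \<in> carrier (Wn n) \<Longrightarrow> i < n \<Longrightarrow> gh (Suc i) (Ve n x) = [p] \<cdot> gh i x"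
  by (rule gh_V_Suc[of "{..<n}" "{..<Suc n}"]) auto

lemma Ve_add: "x \<in> carrier (Wn n) \<Longrightarrow> y \<in> carrier (Wn n) \<Longrightarrow> Ve n (x \<oplus>\<^bsub>Wn n\<^esub> y) = Ve n x \<oplus>\<^bsub>Wn (Suc n)\<^esub> Ve n y"
  by (rule V_add[of "{..<n}" "{..<Suc n}"]) auto

lemma Ve_mult_Fr: "x \<in> carrier (Wn (Suc n)) \<Longrightarrow> y \<in> carrier (Wn n) \<Longrightarrow> Ve n (Fr n x \<otimes>\<^bsub>Wn n\<^esub> y) = x \<otimes>\<^bsub>Wn (Suc n)\<^esub> Ve n y"
  by (rule V_mult_F[of "{..<n}" "{..<Suc n}"]) auto

lemma Fr_Ve: "x \<in> carrier (Wn n) \<Longrightarrow> Fr n (Ve n x) = [p] \<cdot>\<^bsub>Wn n\<^esub> x"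
  by (rule FV[of "{..<n}" "{..<Suc n}"]) auto

lemma Ve_add_pow:
  assumes "y \<in> carrier (Wn n)"
  shows "Ve n ([(k::nat)] \<cdot>\<^bsub>Wn n\<^esub> y) = [k] \<cdot>\<^bsub>Wn (Suc n)\<^esub> Ve n y"
proof -
  interpret Wn: cring "Wn n" by (rule Wn_cring)
  interpret WSn: cring "Wn (Suc n)" by (rule Wn_cring)
  have z: "Ve n \<zero>\<^bsub>Wn n\<^esub> = \<zero>\<^bsub>Wn (Suc n)\<^esub>"
    using Ve_add[of "\<zero>\<^bsub>Wn n\<^esub>" n "\<zero>\<^bsub>Wn n\<^esub>"] by simp
  show ?thesis using assms by (induction k) (simp_all add: z Ve_add)
qed

text \<open>By the projection formula the left-hand side is \<open>V(F(V(1)) y)\<close>, and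
  \<open>F(V(1)) = p\<close>. This identity is what \<open>V1_D\<close> differentiates.\<close>

lemma Ve_one_mult: "y \<in> carrier (Wn n) \<Longrightarrow> Ve n \<one>\<^bsub>Wn n\<^esub> \<otimes>\<^bsub>Wn (Suc n)\<^esub> Ve n y = [p] \<cdot>\<^bsub>Wn (Suc n)\<^esub> Ve n y"
proof -
  assume y: "y \<in> carrier (Wn n)"
  interpret Wn: cring "Wn n" by (rule Wn_cring)
  interpret WSn: cring "Wn (Suc n)" by (rule Wn_cring)
  have "Ve n (Fr n (Ve n \<one>\<^bsub>Wn n\<^esub>) \<otimes>\<^bsub>Wn n\<^esub> y) = Ve n ([p] \<cdot>\<^bsub>Wn n\<^esub> y)"
    using y by (simp add: Fr_Ve Wn.add_pow_ldistr)
  also have "\<dots> = [p] \<cdot>\<^bsub>Wn (Suc n)\<^esub> Ve n y" using y by (rule Ve_add_pow)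
  finally show ?thesis using Ve_mult_Fr[of "Ve n \<one>\<^bsub>Wn n\<^esub>" n y] y by simp
qed

lemma Fr_sec: "a \<in> carrier A \<Longrightarrow> Fr n (sec (Suc n) a) = sec n (\<phi> a)"
  by (rule witt_eqI[of "{..<n}"]) (auto simp: gh_Fr gh_sec funpow_swap1)

text \<open>Replaces the Teichmueller representative by the ring homomorphism \<open>sec\<close>.
  The difference \<open>x - s_phi(x 0)\<close> has zeroth ghost component, hence zeroth coordinate,
  equal to zero and is therefore a Verschiebung.\<close>

lemma witt_sec_decomp:
  assumes x: "x \<in> carrier (Wn (Suc n))"
  obtains a y where "a \<in> carrier A" "y \<in> carrier (Wn n)" "x = sec (Suc n) a \<oplus>\<^bsub>Wn (Suc n)\<^esub> Ve n y"
proof -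
  interpret Wn: cring "Wn (Suc n)" by (rule Wn_cring)
  have a: "x 0 \<in> carrier A" using PiE_mem[of x "{..<Suc n}" "\<lambda>_. carrier A" 0] x by (simp add: witt_ring_simps)
  define z where "z = x \<ominus>\<^bsub>Wn (Suc n)\<^esub> sec (Suc n) (x 0)"
  have z: "z \<in> carrier (Wn (Suc n))" unfolding z_def using x a by simp
  have xz: "x = sec (Suc n) (x 0) \<oplus>\<^bsub>Wn (Suc n)\<^esub> z"
    unfolding z_def using x a by (simp add: Wn.minus_eq Wn.a_ac Wn.r_neg1 Wn.r_neg2 Wn.r_neg)
  have g0: "gh 0 u = u 0" if "u \<in> carrier (Wn (Suc n))" for u
  proof -
    have "u 0 \<in> carrier A" using PiE_mem[of u "{..<Suc n}" "\<lambda>_. carrier A" 0] that by (simp add: witt_ring_simps)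
    then show ?thesis by (simp add: witt_ghost_def)
  qed
  have "x 0 = x 0 \<oplus> gh 0 z"
    using gh_add[of "{..<Suc n}" "sec (Suc n) (x 0)" z 0] xz x a z g0[OF x] gh_sec[OF a, of 0 "Suc n"] by simp
  then have "z 0 = \<zero>" using a z g0[OF z] gh_closed[of "{..<Suc n}" z 0] by simp
  then have "z = Ve n (\<lambda>i\<in>{..<n}. z (Suc i))"
  proof (intro ext)
    fix i
    have "z i = undefined" if "\<not> i < Suc n" using z that PiE_arb[of z] by (simp add: witt_ring_simps)
    then show "z i = Ve n (\<lambda>i\<in>{..<n}. z (Suc i)) i"
      using \<open>z 0 = \<zero>\<close> by (cases i) (simp_all add: witt_ver_def)
  qed
  moreover have "(\<lambda>i\<in>{..<n}. z (Suc i)) \<in> carrier (Wn n)"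
    using PiE_mem[of z "{..<Suc n}" "\<lambda>_. carrier A"] z by (simp add: witt_ring_simps)
  ultimately show ?thesis using that a xz by metis
qed

primrec VW :: "nat \<Rightarrow> nat \<Rightarrow> (nat \<Rightarrow> 'a) \<Rightarrow> nat \<Rightarrow> 'a" where
  "VW m 0 x = x"
| "VW m (Suc j) x = Ve (m + j) (VW m j x)"

lemma VW_closed [simp]: "x \<in> carrier (Wn m) \<Longrightarrow> VW m j x \<in> carrier (Wn (m + j))"
  by (induction j) auto

lemma VW_add: "x \<in> carrier (Wn m) \<Longrightarrow> y \<in> carrier (Wn m) \<Longrightarrow> VW m j (x \<oplus>\<^bsub>Wn m\<^esub> y) = VW m j x \<oplus>\<^bsub>Wn (m + j)\<^esub> VW m j y"
  by (induction j) (simp_all add: Ve_add)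

lemma gh_VW: "x \<in> carrier (Wn m) \<Longrightarrow> i < m + j \<Longrightarrow> gh i (VW m j x) = (if i < j then \<zero> else [(p ^ j)] \<cdot> gh (i - j) x)"
proof (induction j arbitrary: i)
  case 0
  then show ?case using gh_closed[of "{..<m}" x i] by simp
next
  case (Suc j)
  show ?case
  proof (cases i)
    case 0
    then show ?thesis using Suc.prems by (simp add: gh_Ve_0)
  next
    case (Suc i')
    then show ?thesis using Suc.prems Suc.IH[of i'] gh_closed[of "{..<m}" x "i' - j"]
      by (auto simp: gh_Ve_Suc add_pow_mult)
  qed
qed

text \<open>Iterating \<open>witt_sec_decomp\<close> writes every vector as a sum of terms
  \<open>V^j(s_phi(a))\<close>. The set \<open>G\<close> has to be arbitrary, since the induction
  hypothesis is applied to its preimage under \<open>V\<close>.\<close>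

lemma witt_span:
  assumes "\<And>m j a. m + j = n \<Longrightarrow> a \<in> carrier A \<Longrightarrow> VW m j (sec m a) \<in> G"
    and "\<And>x y. x \<in> G \<Longrightarrow> y \<in> G \<Longrightarrow> x \<in> carrier (Wn n) \<Longrightarrow> y \<in> carrier (Wn n) \<Longrightarrow> x \<oplus>\<^bsub>Wn n\<^esub> y \<in> G"
    and "x \<in> carrier (Wn n)"
  shows "x \<in> G"
  using assms
proof (induction n arbitrary: x G)
  case 0
  \<comment> \<open>In length 0 the only vector is the function that is \<open>undefined\<close>
    everywhere.\<close>
  have "sec 0 \<zero> = x" using 0(3) by (auto simp: sec_def witt_ring_simps)
  then show ?case using 0(1)[of 0 0 \<zero>] by simp
next
  case (Suc n)
  obtain a y where ay: "a \<in> carrier A" "y \<in> carrier (Wn n)" "x = sec (Suc n) a \<oplus>\<^bsub>Wn (Suc n)\<^esub> Ve n y"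
    using Suc.prems(3) by (rule witt_sec_decomp)
  have "y \<in> {y. Ve n y \<in> G}"
  proof (rule Suc.IH)
    fix m j a assume "m + j = n" "a \<in> carrier A"
    then show "VW m j (sec m a) \<in> {y. Ve n y \<in> G}" using Suc.prems(1)[of m "Suc j" a] by auto
  next
    fix x y assume "x \<in> {y. Ve n y \<in> G}" "y \<in> {y. Ve n y \<in> G}" "x \<in> carrier (Wn n)" "y \<in> carrier (Wn n)"
    then show "x \<oplus>\<^bsub>Wn n\<^esub> y \<in> {y. Ve n y \<in> G}" using Suc.prems(2) by (simp add: Ve_add)
  qed (rule ay(2))
  moreover have "sec (Suc n) a \<in> G" using Suc.prems(1)[of "Suc n" 0 a] ay(1) by simp
  ultimately show ?case using ay Suc.prems(2) by simp
qed

end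

section \<open>Modules over Witt vectors with a derivation\<close>

text \<open>The structure in degrees zero and one that \<open>E\<close> and the test complex share.
  Interpreting it for both makes \<open>sN\<close>, \<open>Vp\<close> and \<open>T\<close> available
  on both sides of the realization map.\<close>

locale witt_deriv = frob_aut +
  fixes N :: "nat \<Rightarrow> (nat \<Rightarrow> 'a, 'u) module"
    and D :: "nat \<Rightarrow> (nat \<Rightarrow> 'a) \<Rightarrow> 'u"
    and F1 V1 :: "nat \<Rightarrow> 'u \<Rightarrow> 'u"
  assumes D_derivation: "derivation (Wn n) (Wn n) (N n) (\<lambda>x. x) (D n)"
    and F1_closed [simp]: "\<omega> \<in> carrier (N (Suc n)) \<Longrightarrow> F1 n \<omega> \<in> carrier (N n)"
    and F1_add: "\<omega> \<in> carrier (N (Suc n)) \<Longrightarrow> \<eta> \<in> carrier (N (Suc n)) \<Longrightarrow>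
      F1 n (\<omega> \<oplus>\<^bsub>N (Suc n)\<^esub> \<eta>) = F1 n \<omega> \<oplus>\<^bsub>N n\<^esub> F1 n \<eta>"
    and F1_smult: "x \<in> carrier (Wn (Suc n)) \<Longrightarrow> \<omega> \<in> carrier (N (Suc n)) \<Longrightarrow>
      F1 n (x \<odot>\<^bsub>N (Suc n)\<^esub> \<omega>) = Fr n x \<odot>\<^bsub>N n\<^esub> F1 n \<omega>"
    and V1_closed [simp]: "\<omega> \<in> carrier (N n) \<Longrightarrow> V1 n \<omega> \<in> carrier (N (Suc n))"
    and V1_add: "\<omega> \<in> carrier (N n) \<Longrightarrow> \<eta> \<in> carrier (N n) \<Longrightarrow>
      V1 n (\<omega> \<oplus>\<^bsub>N n\<^esub> \<eta>) = V1 n \<omega> \<oplus>\<^bsub>N (Suc n)\<^esub> V1 n \<eta>"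
    and V1_smult_F: "x \<in> carrier (Wn (Suc n)) \<Longrightarrow> \<omega> \<in> carrier (N n) \<Longrightarrow>
      V1 n (Fr n x \<odot>\<^bsub>N n\<^esub> \<omega>) = x \<odot>\<^bsub>N (Suc n)\<^esub> V1 n \<omega>"
    and V1_smult_F1: "y \<in> carrier (Wn n) \<Longrightarrow> \<omega> \<in> carrier (N (Suc n)) \<Longrightarrow>
      V1 n (y \<odot>\<^bsub>N n\<^esub> F1 n \<omega>) = Ve n y \<odot>\<^bsub>N (Suc n)\<^esub> \<omega>"
    and F1_D_V: "y \<in> carrier (Wn n) \<Longrightarrow> F1 n (D (Suc n) (Ve n y)) = D n y"
    and N_0: "carrier (N 0) = {\<zero>\<^bsub>N 0\<^esub>}"
begin

lemma N_module: "module (Wn n) (N n)"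
  using D_derivation unfolding derivation_def by blast

sublocale N: module "Wn n" "N n" for n
  by (rule N_module)

lemmas D_closed [simp] = derivation.D_closed[OF D_derivation]
  and D_add = derivation.D_add[OF D_derivation]
  and D_mult = derivation.D_mult[OF D_derivation]
  and D_zero = derivation.D_zero[OF D_derivation]
  and D_one = derivation.D_one[OF D_derivation]
  and D_add_pow = derivation.D_add_pow[OF D_derivation]
  and D_minus = derivation.D_minus[OF D_derivation]

lemma V1_zero: "V1 n \<zero>\<^bsub>N n\<^esub> = \<zero>\<^bsub>N (Suc n)\<^esub>"
  using V1_add[of "\<zero>\<^bsub>N n\<^esub>" n "\<zero>\<^bsub>N n\<^esub>"] by simp

lemma F1_zero: "F1 n \<zero>\<^bsub>N (Suc n)\<^esub> = \<zero>\<^bsub>N n\<^esub>"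
  using F1_add[of "\<zero>\<^bsub>N (Suc n)\<^esub>" n "\<zero>\<^bsub>N (Suc n)\<^esub>"] by simp

lemma F1_add_pow: "\<omega> \<in> carrier (N (Suc n)) \<Longrightarrow> F1 n ([(k::nat)] \<cdot>\<^bsub>N (Suc n)\<^esub> \<omega>) = [k] \<cdot>\<^bsub>N n\<^esub> F1 n \<omega>"
  by (induction k) (simp_all add: F1_zero F1_add)

lemma V1_add_pow: "\<omega> \<in> carrier (N n) \<Longrightarrow> V1 n ([(k::nat)] \<cdot>\<^bsub>N n\<^esub> \<omega>) = [k] \<cdot>\<^bsub>N (Suc n)\<^esub> V1 n \<omega>"
  by (induction k) (simp_all add: V1_zero V1_add)

text \<open>The projection formula gives \<open>V(dy) = V(1) dV(y)\<close> and
  \<open>V(y) dV(1) = V(y d1) = 0\<close>. Differentiating \<open>V(1) V(y) = p V(y)\<close>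
  combines the two.\<close>

lemma V1_D:
  assumes y: "y \<in> carrier (Wn n)"
  shows "V1 n (D n y) = [p] \<cdot>\<^bsub>N (Suc n)\<^esub> D (Suc n) (Ve n y)"
proof -
  have "V1 n (D n y) = V1 n (\<one>\<^bsub>Wn n\<^esub> \<odot>\<^bsub>N n\<^esub> F1 n (D (Suc n) (Ve n y)))" using y by (simp add: F1_D_V)
  also have "\<dots> = Ve n \<one>\<^bsub>Wn n\<^esub> \<odot>\<^bsub>N (Suc n)\<^esub> D (Suc n) (Ve n y)" using y by (subst V1_smult_F1) auto
  finally have 1: "V1 n (D n y) = Ve n \<one>\<^bsub>Wn n\<^esub> \<odot>\<^bsub>N (Suc n)\<^esub> D (Suc n) (Ve n y)" .
  have "Ve n y \<odot>\<^bsub>N (Suc n)\<^esub> D (Suc n) (Ve n \<one>\<^bsub>Wn n\<^esub>) = V1 n (y \<odot>\<^bsub>N n\<^esub> F1 n (D (Suc n) (Ve n \<one>\<^bsub>Wn n\<^esub>)))"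
    using y by (subst V1_smult_F1) auto
  also have "\<dots> = \<zero>\<^bsub>N (Suc n)\<^esub>" using y by (simp add: F1_D_V D_one V1_zero)
  finally have 2: "Ve n y \<odot>\<^bsub>N (Suc n)\<^esub> D (Suc n) (Ve n \<one>\<^bsub>Wn n\<^esub>) = \<zero>\<^bsub>N (Suc n)\<^esub>" .
  have "[p] \<cdot>\<^bsub>N (Suc n)\<^esub> D (Suc n) (Ve n y) = D (Suc n) (Ve n \<one>\<^bsub>Wn n\<^esub> \<otimes>\<^bsub>Wn (Suc n)\<^esub> Ve n y)"
    using y by (simp add: Ve_one_mult D_add_pow)
  also have "\<dots> = V1 n (D n y)" unfolding 1 using y by (simp add: D_mult 2)
  finally show ?thesis by simp
qed

text \<open>Apply \<open>F d\<close> to \<open>V(F(x)) = x V(1)\<close>. The left side gives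
  \<open>d F(x)\<close>; on the right the Leibniz rule leaves \<open>p F(dx)\<close>, because
  \<open>F dV(1) = d1 = 0\<close> and \<open>F(V(1)) = p\<close>.\<close>

lemma p_F1_D:
  assumes x: "x \<in> carrier (Wn (Suc n))"
  shows "[p] \<cdot>\<^bsub>N n\<^esub> F1 n (D (Suc n) x) = D n (Fr n x)"
proof -
  interpret Frn: ring_hom_cring "Wn (Suc n)" "Wn n" "Fr n" by unfold_locales (rule Fr_hom)
  have "D n (Fr n x) = F1 n (D (Suc n) (x \<otimes>\<^bsub>Wn (Suc n)\<^esub> Ve n \<one>\<^bsub>Wn n\<^esub>))"
    using F1_D_V[of "Fr n x" n] Ve_mult_Fr[of x n "\<one>\<^bsub>Wn n\<^esub>"] x by simp
  also have "\<dots> = [p] \<cdot>\<^bsub>N n\<^esub> F1 n (D (Suc n) x)"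
    using x by (simp add: D_mult F1_add F1_smult F1_D_V D_one Fr_Ve N.smult_add_pow_left)
  finally show ?thesis by simp
qed

primrec Vp :: "nat \<Rightarrow> nat \<Rightarrow> 'u \<Rightarrow> 'u" where
  "Vp m 0 \<omega> = \<omega>"
| "Vp m (Suc j) \<omega> = V1 (m + j) (Vp m j \<omega>)"

text \<open>The outermost level is lowered first, so that \<open>m\<close> remains the level of the
  result throughout the recursion.\<close>

primrec Fp :: "nat \<Rightarrow> nat \<Rightarrow> 'u \<Rightarrow> 'u" where
  "Fp m 0 \<omega> = \<omega>"
| "Fp m (Suc j) \<omega> = Fp m j (F1 (m + j) \<omega>)"

primrec FW :: "nat \<Rightarrow> nat \<Rightarrow> (nat \<Rightarrow> 'a) \<Rightarrow> nat \<Rightarrow> 'a" where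
  "FW m 0 x = x"
| "FW m (Suc j) x = FW m j (Fr (m + j) x)"

lemma Vp_closed [simp]: "\<omega> \<in> carrier (N m) \<Longrightarrow> Vp m j \<omega> \<in> carrier (N (m + j))"
  by (induction j) auto

lemma Vp_add: "\<omega> \<in> carrier (N m) \<Longrightarrow> \<eta> \<in> carrier (N m) \<Longrightarrow> Vp m j (\<omega> \<oplus>\<^bsub>N m\<^esub> \<eta>) = Vp m j \<omega> \<oplus>\<^bsub>N (m + j)\<^esub> Vp m j \<eta>"
  by (induction j) (simp_all add: V1_add)

lemma Fp_closed [simp]: "\<omega> \<in> carrier (N (m + j)) \<Longrightarrow> Fp m j \<omega> \<in> carrier (N m)"
  by (induction j arbitrary: \<omega>) auto

lemma Fp_add: "\<omega> \<in> carrier (N (m + j)) \<Longrightarrow> \<eta> \<in> carrier (N (m + j)) \<Longrightarrow> Fp m j (\<omega> \<oplus>\<^bsub>N (m + j)\<^esub> \<eta>) = Fp m j \<omega> \<oplus>\<^bsub>N m\<^esub> Fp m j \<eta>"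
  by (induction j arbitrary: \<omega> \<eta>) (simp_all add: F1_add)

lemma Fp_smult: "x \<in> carrier (Wn (m + j)) \<Longrightarrow> \<omega> \<in> carrier (N (m + j)) \<Longrightarrow> Fp m j (x \<odot>\<^bsub>N (m + j)\<^esub> \<omega>) = FW m j x \<odot>\<^bsub>N m\<^esub> Fp m j \<omega>"
  by (induction j arbitrary: \<omega> x) (simp_all add: F1_smult)

lemma Fp_add_pow: "\<omega> \<in> carrier (N (m + j)) \<Longrightarrow> Fp m j ([(k::nat)] \<cdot>\<^bsub>N (m + j)\<^esub> \<omega>) = [k] \<cdot>\<^bsub>N m\<^esub> Fp m j \<omega>"
  by (induction j arbitrary: \<omega>) (simp_all add: F1_add_pow)

lemma Vp_smult_F: "x \<in> carrier (Wn (m + j)) \<Longrightarrow> \<omega> \<in> carrier (N m) \<Longrightarrow> Vp m j (FW m j x \<odot>\<^bsub>N m\<^esub> \<omega>) = x \<odot>\<^bsub>N (m + j)\<^esub> Vp m j \<omega>"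
  by (induction j arbitrary: x) (simp_all add: V1_smult_F)

lemma VW_mult_F: "x \<in> carrier (Wn (m + j)) \<Longrightarrow> y \<in> carrier (Wn m) \<Longrightarrow> VW m j (FW m j x \<otimes>\<^bsub>Wn m\<^esub> y) = x \<otimes>\<^bsub>Wn (m + j)\<^esub> VW m j y"
  by (induction j arbitrary: x) (simp_all add: Ve_mult_Fr)

lemma Vp_smult_Fp: "y \<in> carrier (Wn m) \<Longrightarrow> \<omega> \<in> carrier (N (m + j)) \<Longrightarrow> Vp m j (y \<odot>\<^bsub>N m\<^esub> Fp m j \<omega>) = VW m j y \<odot>\<^bsub>N (m + j)\<^esub> \<omega>"
  by (induction j arbitrary: \<omega>) (simp_all add: V1_smult_F1)

lemma FW_sec: "a \<in> carrier A \<Longrightarrow> FW m j (sec (m + j) a) = sec m ((\<phi> ^^ j) a)"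
  by (induction j arbitrary: a) (simp_all add: Fr_sec funpow_swap1)

lemma Vp_D: "y \<in> carrier (Wn m) \<Longrightarrow> Vp m j (D m y) = [(p ^ j)] \<cdot>\<^bsub>N (m + j)\<^esub> D (m + j) (VW m j y)"
  by (induction j) (simp_all add: V1_add_pow V1_D N.add_pow_pow mult.commute)

lemma p_Fp_D: "x \<in> carrier (Wn (m + j)) \<Longrightarrow> [(p ^ j)] \<cdot>\<^bsub>N m\<^esub> Fp m j (D (m + j) x) = D m (FW m j x)"
proof (induction j arbitrary: x)
  case (Suc j)
  have "[(p ^ Suc j)] \<cdot>\<^bsub>N m\<^esub> Fp m (Suc j) (D (m + Suc j) x) = [(p ^ j)] \<cdot>\<^bsub>N m\<^esub> Fp m j ([p] \<cdot>\<^bsub>N (m + j)\<^esub> F1 (m + j) (D (Suc (m + j)) x))"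
    using Suc.prems by (simp add: Fp_add_pow N.add_pow_pow mult.commute)
  then show ?case using Suc by (simp add: p_F1_D)
qed simp

text \<open>The detour through the differentials of \<open>Wn n\<close> makes this agree literally
  with \<open>s_phi_Omega\<close>.\<close>

definition sN :: "nat \<Rightarrow> ('a \<Rightarrow> 'a) set \<Rightarrow> 'u" where
  "sN n \<alpha> = kaehler_map (Wn n) (\<lambda>x. x) (D n) (N n)
     (kaehler_map A (sec n) (\<lambda>b. kaehler_d (Wn n) (sec n b)) (kaehler (Wn n)) \<alpha>)"

lemma sec_derivation: "derivation A (Wn n) (kaehler (Wn n)) (sec n) (\<lambda>b. kaehler_d (Wn n) (sec n b))"
  by (intro derivation.intro derivation_axioms.intro cring_axioms N.R.kaehler_module)
    (auto simp: sec_hom ring_hom_add[OF sec_hom] ring_hom_mult[OF sec_hom] N.R.kaehler_d_add N.R.kaehler_d_mult)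

lemma sN_closed [simp]: "\<alpha> \<in> carrier \<Omega> \<Longrightarrow> sN n \<alpha> \<in> carrier (N n)"
  unfolding sN_def by (intro derivation.kmap_closed[OF D_derivation] derivation.kmap_closed[OF sec_derivation])

lemma sN_add: "\<alpha> \<in> carrier \<Omega> \<Longrightarrow> \<beta> \<in> carrier \<Omega> \<Longrightarrow> sN n (\<alpha> \<oplus>\<^bsub>\<Omega>\<^esub> \<beta>) = sN n \<alpha> \<oplus>\<^bsub>N n\<^esub> sN n \<beta>"
  unfolding sN_def
  by (simp add: derivation.kmap_add[OF sec_derivation] derivation.kmap_add[OF D_derivation] derivation.kmap_closed[OF sec_derivation])

lemma sN_smult: "a \<in> carrier A \<Longrightarrow> \<alpha> \<in> carrier \<Omega> \<Longrightarrow> sN n (a \<odot>\<^bsub>\<Omega>\<^esub> \<alpha>) = sec n a \<odot>\<^bsub>N n\<^esub> sN n \<alpha>"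
  unfolding sN_def
  by (simp add: derivation.kmap_smult[OF sec_derivation] derivation.kmap_smult[OF D_derivation] derivation.kmap_closed[OF sec_derivation])

lemma sN_d: "b \<in> carrier A \<Longrightarrow> sN n (dd b) = D n (sec n b)"
  unfolding sN_def by (simp add: derivation.kmap_d[OF sec_derivation] derivation.kmap_d[OF D_derivation])

lemma sN_zero: "sN n \<zero>\<^bsub>\<Omega>\<^esub> = \<zero>\<^bsub>N n\<^esub>"
  using sN_add[of "\<zero>\<^bsub>\<Omega>\<^esub>" "\<zero>\<^bsub>\<Omega>\<^esub>" n] by simp

lemma sN_add_pow: "\<alpha> \<in> carrier \<Omega> \<Longrightarrow> sN n ([(k::nat)] \<cdot>\<^bsub>\<Omega>\<^esub> \<alpha>) = [k] \<cdot>\<^bsub>N n\<^esub> sN n \<alpha>"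
  by (induction k) (simp_all add: sN_zero sN_add)

lemma sN_minus: "\<alpha> \<in> carrier \<Omega> \<Longrightarrow> sN n (\<ominus>\<^bsub>\<Omega>\<^esub> \<alpha>) = \<ominus>\<^bsub>N n\<^esub> sN n \<alpha>"
  using sN_add[of "\<ominus>\<^bsub>\<Omega>\<^esub> \<alpha>" \<alpha> n] by (intro N.M.minus_equality[symmetric]) (simp_all add: Om.M.l_neg sN_zero)

text \<open>\<open>F^j d\<close> is under control only after multiplication by \<open>p^j\<close>,
  and \<open>N\<close> may have \<open>p\<close>-torsion. Keeping the factor on the argument in
  \<Omega> avoids dividing in \<open>N\<close>.\<close>

lemma Fp_sN:
  assumes "\<beta> \<in> carrier \<Omega>"
  shows "Fp m j (sN (m + j) ([(p ^ j)] \<cdot>\<^bsub>\<Omega>\<^esub> \<beta>)) = sN m (push (\<phi> ^^ j) \<beta>)"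
proof -
  note h = phi_pow_hom[of j]
  have "[(p ^ j)] \<cdot>\<^bsub>N m\<^esub> Fp m j (sN (m + j) \<beta>) = sN m (push (\<phi> ^^ j) \<beta>)"
    using assms
  proof (induction rule: kaehler_induct)
    case zero
    have "Fp m j \<zero>\<^bsub>N (m + j)\<^esub> = \<zero>\<^bsub>N m\<^esub>" using Fp_add[of "\<zero>\<^bsub>N (m + j)\<^esub>" m j "\<zero>\<^bsub>N (m + j)\<^esub>"] by simp
    then show ?case by (simp add: sN_zero push_zero[OF h])
  next
    case (gen a b)
    have "[(p ^ j)] \<cdot>\<^bsub>N m\<^esub> Fp m j (sN (m + j) (a \<odot>\<^bsub>\<Omega>\<^esub> dd b)) =
        sec m ((\<phi> ^^ j) a) \<odot>\<^bsub>N m\<^esub> ([(p ^ j)] \<cdot>\<^bsub>N m\<^esub> Fp m j (D (m + j) (sec (m + j) b)))"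
      using gen by (simp add: sN_smult sN_d Fp_smult FW_sec N.smult_add_pow_right)
    also have "\<dots> = sec m ((\<phi> ^^ j) a) \<odot>\<^bsub>N m\<^esub> D m (sec m ((\<phi> ^^ j) b))"
      using gen by (simp only: p_Fp_D sec_closed FW_sec)
    also have "\<dots> = sN m (push (\<phi> ^^ j) (a \<odot>\<^bsub>\<Omega>\<^esub> dd b))"
      using gen by (simp add: push_smult[OF h] push_d[OF h] sN_smult sN_d)
    finally show ?case .
  next
    case (add \<alpha> \<beta>)
    then show ?case by (simp add: sN_add Fp_add N.add_pow_add push_add[OF h] push_closed[OF h])
  qed
  then show ?thesis using assms by (simp add: sN_add_pow Fp_add_pow)
qed

text \<open>The value of the comparison map on the class of \<open>(\<alpha>, a)\<close>. Here
  \<open>m\<close> is the level at which \<open>s_phi\<close> is taken, so that the value lies in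
  level \<open>m + j\<close>.\<close>

definition T :: "nat \<Rightarrow> nat \<Rightarrow> ('a \<Rightarrow> 'a) set \<Rightarrow> 'a \<Rightarrow> 'u" where
  "T m j \<alpha> a = Vp m j (sN m \<alpha>) \<oplus>\<^bsub>N (m + j)\<^esub> D (m + j) (VW m j (sec m a))"

lemma T_closed [simp]: "\<alpha> \<in> carrier \<Omega> \<Longrightarrow> a \<in> carrier A \<Longrightarrow> T m j \<alpha> a \<in> carrier (N (m + j))"
  by (simp add: T_def)

lemma T_add:
  "\<alpha> \<in> carrier \<Omega> \<Longrightarrow> a \<in> carrier A \<Longrightarrow> \<beta> \<in> carrier \<Omega> \<Longrightarrow> b \<in> carrier A \<Longrightarrow>
   T m j (\<alpha> \<oplus>\<^bsub>\<Omega>\<^esub> \<beta>) (a \<oplus> b) = T m j \<alpha> a \<oplus>\<^bsub>N (m + j)\<^esub> T m j \<beta> b"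
  by (simp add: T_def sN_add Vp_add ring_hom_add[OF sec_hom] VW_add D_add N.M.a_ac)

lemma sec_add_pow: "a \<in> carrier A \<Longrightarrow> sec m ([(k::nat)] \<cdot> a) = [k] \<cdot>\<^bsub>Wn m\<^esub> sec m a"
proof -
  interpret s: ring_hom_cring A "Wn m" "sec m" by unfold_locales (rule sec_hom)
  show "a \<in> carrier A \<Longrightarrow> ?thesis" by (rule s.hom_add_pow)
qed

lemma VW_add_pow: "x \<in> carrier (Wn m) \<Longrightarrow> VW m j ([(k::nat)] \<cdot>\<^bsub>Wn m\<^esub> x) = [k] \<cdot>\<^bsub>Wn (m + j)\<^esub> VW m j x"
proof (induction k)
  case 0
  then show ?case using VW_add[of "\<zero>\<^bsub>Wn m\<^esub>" m "\<zero>\<^bsub>Wn m\<^esub>" j] by simp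
qed (simp add: VW_add)

text \<open>By \<open>Vp_D\<close>, \<open>V^j(d s_phi(a)) = p^j dV^j(s_phi(a))\<close>; this is the
  relation that is divided out in \<open>M_j\<close>.\<close>

lemma T_h: "a \<in> carrier A \<Longrightarrow> T m j (\<ominus>\<^bsub>\<Omega>\<^esub> dd a) ([(p ^ j)] \<cdot> a) = \<zero>\<^bsub>N (m + j)\<^esub>"
proof -
  assume a: "a \<in> carrier A"
  have "Vp m j (\<ominus>\<^bsub>N m\<^esub> \<omega>) = \<ominus>\<^bsub>N (m + j)\<^esub> Vp m j \<omega>" if "\<omega> \<in> carrier (N m)" for \<omega>
  proof (rule N.M.minus_equality[symmetric])
    have "Vp m j \<zero>\<^bsub>N m\<^esub> = \<zero>\<^bsub>N (m + j)\<^esub>" using Vp_add[of "\<zero>\<^bsub>N m\<^esub>" m "\<zero>\<^bsub>N m\<^esub>" j] by simp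
    then show "Vp m j (\<ominus>\<^bsub>N m\<^esub> \<omega>) \<oplus>\<^bsub>N (m + j)\<^esub> Vp m j \<omega> = \<zero>\<^bsub>N (m + j)\<^esub>"
      using that Vp_add[of "\<ominus>\<^bsub>N m\<^esub> \<omega>" m \<omega> j] by (simp add: N.M.l_neg)
  qed (use that in auto)
  then show ?thesis
    using a by (simp add: T_def sN_minus sN_d Vp_D sec_add_pow VW_add_pow D_add_pow N.M.l_neg)
qed

text \<open>\<open>s_phi(x) dV^j(s_phi(a))\<close> differs from
  \<open>d(s_phi(x) V^j(s_phi(a)))\<close> by \<open>V^j(s_phi(a) F^j d s_phi(x))\<close>, and the
  latter is \<open>V^j\<close> of \<open>s_phi(a d\<phi>^j(x) / p^j)\<close>.\<close>

lemma T_smult: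
  assumes x: "x \<in> carrier A" and \<alpha>: "\<alpha> \<in> carrier \<Omega>" and a: "a \<in> carrier A"
  shows "sec (m + j) x \<odot>\<^bsub>N (m + j)\<^esub> T m j \<alpha> a =
    T m j ((\<phi> ^^ j) x \<odot>\<^bsub>\<Omega>\<^esub> \<alpha> \<ominus>\<^bsub>\<Omega>\<^esub> pdiv j (a \<odot>\<^bsub>\<Omega>\<^esub> dd ((\<phi> ^^ j) x))) ((\<phi> ^^ j) x \<otimes> a)"
proof -
  let ?y = "(\<phi> ^^ j) x"
  have y: "?y \<in> carrier A" using x by simp
  note h = phi_pow_hom[of j]
  have dx: "dd x = [(p ^ j)] \<cdot>\<^bsub>\<Omega>\<^esub> pdiv j (dd x)" and pd: "pdiv j (dd x) \<in> carrier \<Omega>" "pdiv j (dd ?y) \<in> carrier \<Omega>"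
    using x by (simp_all add: pdiv)
  have "[(p ^ j)] \<cdot>\<^bsub>\<Omega>\<^esub> push (\<phi> ^^ j) (pdiv j (dd x)) = dd ?y"
    using push_add_pow[OF h pd(1), of "p ^ j"] x by (simp add: pdiv_mult push_d[OF h])
  then have push: "push (\<phi> ^^ j) (pdiv j (dd x)) = pdiv j (dd ?y)"
    using pd by (intro pdiv_eqI[symmetric] push_closed[OF h])
  let ?\<beta> = "pdiv j (a \<odot>\<^bsub>\<Omega>\<^esub> dd ?y)"
  have \<beta>: "?\<beta> \<in> carrier \<Omega>" "?\<beta> = a \<odot>\<^bsub>\<Omega>\<^esub> pdiv j (dd ?y)" using a y by (simp_all add: pdiv pdiv_smult)
  have "VW m j (sec m a) \<odot>\<^bsub>N (m + j)\<^esub> D (m + j) (sec (m + j) x) =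
      Vp m j (sec m a \<odot>\<^bsub>N m\<^esub> Fp m j (sN (m + j) (dd x)))"
    using a x by (subst Vp_smult_Fp) (simp_all add: sN_d)
  \<comment> \<open>Writing \<open>dd x\<close> as \<open>p^j\<close> times its quotient is what
    makes \<open>Fp_sN\<close> applicable.\<close>
  also have "Fp m j (sN (m + j) (dd x)) = sN m (pdiv j (dd ?y))"
    by (subst dx) (simp add: Fp_sN pd push)
  also have "sec m a \<odot>\<^bsub>N m\<^esub> \<dots> = sN m ?\<beta>" using a pd by (simp add: sN_smult \<beta>)
  finally have 1: "VW m j (sec m a) \<odot>\<^bsub>N (m + j)\<^esub> D (m + j) (sec (m + j) x) = Vp m j (sN m ?\<beta>)" .
  have 2: "sec (m + j) x \<odot>\<^bsub>N (m + j)\<^esub> Vp m j (sN m \<alpha>) = Vp m j (sN m (?y \<odot>\<^bsub>\<Omega>\<^esub> \<alpha>))"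
    using x \<alpha> by (subst Vp_smult_F[symmetric]) (simp_all add: FW_sec sN_smult)
  have "D (m + j) (VW m j (sec m (?y \<otimes> a))) = D (m + j) (sec (m + j) x \<otimes>\<^bsub>Wn (m + j)\<^esub> VW m j (sec m a))"
    using x a by (subst VW_mult_F[symmetric]) (simp_all add: FW_sec ring_hom_mult[OF sec_hom])
  also have "\<dots> = sec (m + j) x \<odot>\<^bsub>N (m + j)\<^esub> D (m + j) (VW m j (sec m a)) \<oplus>\<^bsub>N (m + j)\<^esub> Vp m j (sN m ?\<beta>)"
    using x a by (simp add: D_mult 1)
  finally have 3: "D (m + j) (VW m j (sec m (?y \<otimes> a))) =
      sec (m + j) x \<odot>\<^bsub>N (m + j)\<^esub> D (m + j) (VW m j (sec m a)) \<oplus>\<^bsub>N (m + j)\<^esub> Vp m j (sN m ?\<beta>)" .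
  have "sN m (?y \<odot>\<^bsub>\<Omega>\<^esub> \<alpha> \<ominus>\<^bsub>\<Omega>\<^esub> ?\<beta>) \<oplus>\<^bsub>N m\<^esub> sN m ?\<beta> = sN m (?y \<odot>\<^bsub>\<Omega>\<^esub> \<alpha>)"
    using y \<alpha> \<beta>(1) by (subst sN_add[symmetric]) (simp_all add: Om.M.minus_eq Om.M.a_assoc Om.M.l_neg)
  then have 4: "Vp m j (sN m (?y \<odot>\<^bsub>\<Omega>\<^esub> \<alpha> \<ominus>\<^bsub>\<Omega>\<^esub> ?\<beta>)) \<oplus>\<^bsub>N (m + j)\<^esub> Vp m j (sN m ?\<beta>) = Vp m j (sN m (?y \<odot>\<^bsub>\<Omega>\<^esub> \<alpha>))"
    using y \<alpha> \<beta>(1) by (subst Vp_add[symmetric]) simp_all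
  show ?thesis
    unfolding T_def 3 using x y \<alpha> a \<beta>(1)
    by (simp add: N.smult_r_distr 2 N.M.a_ac flip: 4)
qed

text \<open>Induction on the level, with \<open>H\<close> arbitrary because the induction hypothesis
  is used for the preimage of \<open>H\<close> under \<open>V\<close>. Writing
  \<open>x = s_phi(a) + V(x')\<close> and \<open>y = s_phi(b) + V(y')\<close>, the form
  \<open>x dy\<close> splits into \<open>s_phi(a db)\<close>, \<open>V(x' F(dy))\<close> and
  \<open>s_phi(a) dV(y')\<close>. Terms \<open>d s_phi(b)\<close> are of the first kind, hence only
  \<open>Suc j\<close> in the third hypothesis.\<close>

theorem span:
  assumes gen: "\<And>n H. (\<And>x y. x \<in> carrier (Wn n) \<Longrightarrow> y \<in> carrier (Wn n) \<Longrightarrow> x \<odot>\<^bsub>N n\<^esub> D n y \<in> H) \<Longrightarrow>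
      (\<And>u v. u \<in> H \<Longrightarrow> v \<in> H \<Longrightarrow> u \<in> carrier (N n) \<Longrightarrow> v \<in> carrier (N n) \<Longrightarrow> u \<oplus>\<^bsub>N n\<^esub> v \<in> H) \<Longrightarrow> carrier (N n) \<subseteq> H"
    and "\<And>m j \<alpha>. m + j = n \<Longrightarrow> \<alpha> \<in> carrier \<Omega> \<Longrightarrow> Vp m j (sN m \<alpha>) \<in> H"
    and "\<And>m j a. m + Suc j = n \<Longrightarrow> a \<in> carrier A \<Longrightarrow> D n (VW m (Suc j) (sec m a)) \<in> H"
    and "\<And>u v. u \<in> H \<Longrightarrow> v \<in> H \<Longrightarrow> u \<in> carrier (N n) \<Longrightarrow> v \<in> carrier (N n) \<Longrightarrow> u \<oplus>\<^bsub>N n\<^esub> v \<in> H"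
  shows "carrier (N n) \<subseteq> H"
  using assms(2-)
proof (induction n arbitrary: H)
  case 0
  then show ?case using N_0 0(1)[of 0 0 "\<zero>\<^bsub>\<Omega>\<^esub>"] by (simp add: sN_zero)
next
  case (Suc n)
  have V: "V1 n \<omega> \<in> H" if "\<omega> \<in> carrier (N n)" for \<omega>
  proof -
    have "carrier (N n) \<subseteq> {\<omega>. V1 n \<omega> \<in> H}"
    proof (rule Suc.IH)
      fix m j \<alpha> assume "m + j = n" "\<alpha> \<in> carrier \<Omega>"
      then show "Vp m j (sN m \<alpha>) \<in> {\<omega>. V1 n \<omega> \<in> H}" using Suc.prems(1)[of m "Suc j" \<alpha>] by auto
    next
      \<comment> \<open>By \<open>V1_D\<close>, applying \<open>V\<close> to
        \<open>dV^(j+1)(s_phi(a))\<close> gives \<open>p dV^(j+2)(s_phi(a))\<close>; the factor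
        \<open>p\<close> is then absorbed into \<open>a\<close>.\<close>
      fix m j a assume "m + Suc j = n" "a \<in> carrier A"
      then show "D n (VW m (Suc j) (sec m a)) \<in> {\<omega>. V1 n \<omega> \<in> H}"
        using Suc.prems(2)[of m "Suc j" "[p] \<cdot> a"] VW_closed[of "sec m a" m "Suc j"] VW_add_pow[of "sec m a" m "Suc (Suc j)" p]
          D_add_pow[of "VW m (Suc (Suc j)) (sec m a)" "Suc n" p] VW_closed[of "sec m a" m "Suc (Suc j)"]
        by (auto simp: V1_D sec_add_pow simp del: VW_closed)
    next
      fix u v assume "u \<in> {\<omega>. V1 n \<omega> \<in> H}" "v \<in> {\<omega>. V1 n \<omega> \<in> H}" "u \<in> carrier (N n)" "v \<in> carrier (N n)"
      then show "u \<oplus>\<^bsub>N n\<^esub> v \<in> {\<omega>. V1 n \<omega> \<in> H}" using Suc.prems(3) by (simp add: V1_add)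
    qed
    then show ?thesis using that by blast
  qed
  have DV: "D (Suc n) (Ve n w) \<in> H" if "w \<in> carrier (Wn n)" for w
  proof -
    have "w \<in> {w. D (Suc n) (Ve n w) \<in> H}"
    proof (rule witt_span[OF _ _ that])
      fix m j a assume "m + j = n" "a \<in> carrier A"
      then show "VW m j (sec m a) \<in> {w. D (Suc n) (Ve n w) \<in> H}" using Suc.prems(2)[of m j a] by auto
    next
      fix x y assume "x \<in> {w. D (Suc n) (Ve n w) \<in> H}" "y \<in> {w. D (Suc n) (Ve n w) \<in> H}" "x \<in> carrier (Wn n)" "y \<in> carrier (Wn n)"
      then show "x \<oplus>\<^bsub>Wn n\<^esub> y \<in> {w. D (Suc n) (Ve n w) \<in> H}" using Suc.prems(3) by (simp add: Ve_add D_add)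
    qed
    then show ?thesis by blast
  qed
  show ?case
  proof (rule gen)
    fix x y assume x: "x \<in> carrier (Wn (Suc n))" and y: "y \<in> carrier (Wn (Suc n))"
    obtain a x' where ax: "a \<in> carrier A" "x' \<in> carrier (Wn n)" "x = sec (Suc n) a \<oplus>\<^bsub>Wn (Suc n)\<^esub> Ve n x'"
      using x by (rule witt_sec_decomp)
    obtain b y' where by': "b \<in> carrier A" "y' \<in> carrier (Wn n)" "y = sec (Suc n) b \<oplus>\<^bsub>Wn (Suc n)\<^esub> Ve n y'"
      using y by (rule witt_sec_decomp)
    have 1: "sec (Suc n) a \<odot>\<^bsub>N (Suc n)\<^esub> D (Suc n) (sec (Suc n) b) \<in> H"
      using Suc.prems(1)[of "Suc n" 0 "a \<odot>\<^bsub>\<Omega>\<^esub> dd b"] ax by' by (simp add: sN_smult sN_d)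
    have 2: "Ve n x' \<odot>\<^bsub>N (Suc n)\<^esub> D (Suc n) y \<in> H"
      using V[of "x' \<odot>\<^bsub>N n\<^esub> F1 n (D (Suc n) y)"] ax y by (simp add: V1_smult_F1)
    \<comment> \<open>The correction in the Leibniz rule:
      \<open>s_phi(a) dV(y') = dV(F(s_phi(a)) y') - V(y' F d s_phi(a))\<close>.\<close>
    let ?\<omega> = "y' \<odot>\<^bsub>N n\<^esub> F1 n (D (Suc n) (sec (Suc n) a))"
    have \<omega>: "?\<omega> \<in> carrier (N n)" using ax by' by simp
    have "V1 n (\<ominus>\<^bsub>N n\<^esub> ?\<omega>) \<oplus>\<^bsub>N (Suc n)\<^esub> V1 n ?\<omega> = \<zero>\<^bsub>N (Suc n)\<^esub>"
      using \<omega> by (subst V1_add[symmetric]) (simp_all add: N.M.l_neg V1_zero)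
    moreover have "D (Suc n) (Ve n (Fr n (sec (Suc n) a) \<otimes>\<^bsub>Wn n\<^esub> y')) =
        sec (Suc n) a \<odot>\<^bsub>N (Suc n)\<^esub> D (Suc n) (Ve n y') \<oplus>\<^bsub>N (Suc n)\<^esub> V1 n ?\<omega>"
      using ax by' by (simp add: Ve_mult_Fr D_mult V1_smult_F1)
    ultimately have "sec (Suc n) a \<odot>\<^bsub>N (Suc n)\<^esub> D (Suc n) (Ve n y') =
        D (Suc n) (Ve n (Fr n (sec (Suc n) a) \<otimes>\<^bsub>Wn n\<^esub> y')) \<oplus>\<^bsub>N (Suc n)\<^esub> V1 n (\<ominus>\<^bsub>N n\<^esub> ?\<omega>)"
      using ax by' \<omega> by (simp add: N.M.a_assoc) (simp add: N.M.a_comm)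
    then have 3: "sec (Suc n) a \<odot>\<^bsub>N (Suc n)\<^esub> D (Suc n) (Ve n y') \<in> H"
      using Suc.prems(3)[OF DV V, of "Fr n (sec (Suc n) a) \<otimes>\<^bsub>Wn n\<^esub> y'" "\<ominus>\<^bsub>N n\<^esub> ?\<omega>"] ax by' \<omega> by simp
    have "x \<odot>\<^bsub>N (Suc n)\<^esub> D (Suc n) y = (sec (Suc n) a \<odot>\<^bsub>N (Suc n)\<^esub> D (Suc n) (sec (Suc n) b)
        \<oplus>\<^bsub>N (Suc n)\<^esub> sec (Suc n) a \<odot>\<^bsub>N (Suc n)\<^esub> D (Suc n) (Ve n y')) \<oplus>\<^bsub>N (Suc n)\<^esub> Ve n x' \<odot>\<^bsub>N (Suc n)\<^esub> D (Suc n) y"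
      using ax by' y by (simp add: N.smult_l_distr) (simp add: D_add N.smult_r_distr)
    then show "x \<odot>\<^bsub>N (Suc n)\<^esub> D (Suc n) y \<in> H"
      using Suc.prems(3)[OF Suc.prems(3)[OF 1 3] 2] ax by' y by simp
  qed (rule Suc.prems(3))
qed

end

section \<open>Degree one of a Witt complex as a module with derivation\<close>

lemma abelian_group_cong:
  assumes "abelian_group G" "carrier H = carrier G" "\<zero>\<^bsub>H\<^esub> = \<zero>\<^bsub>G\<^esub>"
    "\<And>x y. x \<in> carrier G \<Longrightarrow> y \<in> carrier G \<Longrightarrow> x \<oplus>\<^bsub>H\<^esub> y = x \<oplus>\<^bsub>G\<^esub> y"
  shows "abelian_group H"
proof -
  interpret G: abelian_group G by fact
  show ?thesis
  proof (rule abelian_groupI)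
    fix x assume "x \<in> carrier H"
    then show "\<exists>y\<in>carrier H. y \<oplus>\<^bsub>H\<^esub> x = \<zero>\<^bsub>H\<^esub>"
      using assms by (intro bexI[of _ "\<ominus>\<^bsub>G\<^esub> x"]) (auto simp: G.l_neg)
  qed (use assms in \<open>auto simp: G.a_ac\<close>)
qed

lemma add_pow_nat_cong:
  assumes "\<zero>\<^bsub>H\<^esub> = \<zero>\<^bsub>G\<^esub>" "(\<oplus>\<^bsub>H\<^esub>) = (\<oplus>\<^bsub>G\<^esub>)"
  shows "[(n::nat)] \<cdot>\<^bsub>H\<^esub> x = [n] \<cdot>\<^bsub>G\<^esub> x"
  using assms by (induction n) (simp_all add: add_pow_def nat_pow_def)

lemma deg1_module_simps:
  "carrier (deg1_module E m \<rho>) = elts E m 1" "\<zero>\<^bsub>deg1_module E m \<rho>\<^esub> = \<zero>\<^bsub>cmp E m 1\<^esub>"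
  "x \<oplus>\<^bsub>deg1_module E m \<rho>\<^esub> y = x \<oplus>\<^bsub>cmp E m 1\<^esub> y"
  "r \<odot>\<^bsub>deg1_module E m \<rho>\<^esub> x = mul E m 0 1 (\<rho> r) x"
  by (simp_all add: deg1_module_def)

lemma deg0_ring_simps:
  "carrier (deg0_ring E n) = elts E n 0" "x \<oplus>\<^bsub>deg0_ring E n\<^esub> y = x \<oplus>\<^bsub>cmp E n 0\<^esub> y"
  "x \<otimes>\<^bsub>deg0_ring E n\<^esub> y = mul E n 0 0 x y" "\<one>\<^bsub>deg0_ring E n\<^esub> = unt E n"
  by (simp_all add: deg0_ring_def)

lemma (in frob_aut) witt_complex_deriv:
  assumes E: "witt_complex p A E"
  shows "witt_deriv A p \<phi> (\<lambda>n. deg1_module E n (lam E n)) (\<lambda>n x. dif E n 0 (lam E n x)) (\<lambda>n. fro E n 1) (\<lambda>n. ver E n 1)"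
proof -
  interpret E: witt_complex p A E by fact
  have lam: "lam E n x \<in> elts E n 0" if "x \<in> carrier (Wn n)" for n x
    using ring_hom_closed[OF E.lam_hom that] by (simp add: deg0_ring_simps)
  have lam_add: "lam E n (x \<oplus>\<^bsub>Wn n\<^esub> y) = lam E n x \<oplus>\<^bsub>cmp E n 0\<^esub> lam E n y"
    and lam_mult: "lam E n (x \<otimes>\<^bsub>Wn n\<^esub> y) = mul E n 0 0 (lam E n x) (lam E n y)"
    if "x \<in> carrier (Wn n)" "y \<in> carrier (Wn n)" for n x y
    using ring_hom_add[OF E.lam_hom that] ring_hom_mult[OF E.lam_hom that] by (simp_all add: deg0_ring_simps)
  have lam_one: "lam E n \<one>\<^bsub>Wn n\<^esub> = unt E n" for n
    using ring_hom_one[OF E.lam_hom] by (simp add: deg0_ring_simps)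
  have dif: "dif E n 0 x \<in> elts E n 1" if "x \<in> elts E n 0" for n x using E.dif_closed[OF that] by simp
  have mod: "module (Wn n) (deg1_module E n (lam E n))" for n
  proof (rule moduleI)
    show "abelian_group (deg1_module E n (lam E n))"
      by (rule abelian_group_cong[OF E.abelian_group_cmp[of n 1]]) (simp_all add: deg1_module_simps)
  qed (use E.mul_closed[of _ n 0 _ 1] E.mul_l_distr[of _ n 0 _ _ 1] E.mul_r_distr[of _ n 0 _ 1] E.mul_assoc[of _ n 0 _ 0 _ 1] E.unt_l[of _ n 1]
    in \<open>simp_all add: deg1_module_simps Wn_cring lam lam_add lam_mult lam_one\<close>)
  have der: "derivation (Wn n) (Wn n) (deg1_module E n (lam E n)) (\<lambda>x. x) (\<lambda>x. dif E n 0 (lam E n x))" for n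
  proof (intro derivation.intro derivation_axioms.intro Wn_cring mod)
    fix x y assume xy: "x \<in> carrier (Wn n)" "y \<in> carrier (Wn n)"
    show "dif E n 0 (lam E n (x \<oplus>\<^bsub>Wn n\<^esub> y)) = dif E n 0 (lam E n x) \<oplus>\<^bsub>deg1_module E n (lam E n)\<^esub> dif E n 0 (lam E n y)"
      using E.dif_add[OF lam[OF xy(1)] lam[OF xy(2)]] xy by (simp add: deg1_module_simps lam_add)
    have c: "mul E n 1 0 (dif E n 0 (lam E n x)) (lam E n y) = mul E n 0 1 (lam E n y) (dif E n 0 (lam E n x))"
      using E.graded_comm[OF dif[OF lam[OF xy(1)]] lam[OF xy(2)]] by (simp add: sgn_pow_def)
    have m: "mul E n 0 1 (lam E n u) (dif E n 0 (lam E n v)) \<in> elts E n 1" if "u \<in> carrier (Wn n)" "v \<in> carrier (Wn n)" for u v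
      using E.mul_closed[OF lam[OF that(1)] dif[OF lam[OF that(2)]]] by simp
    show "dif E n 0 (lam E n (x \<otimes>\<^bsub>Wn n\<^esub> y)) = x \<odot>\<^bsub>deg1_module E n (lam E n)\<^esub> dif E n 0 (lam E n y)
        \<oplus>\<^bsub>deg1_module E n (lam E n)\<^esub> y \<odot>\<^bsub>deg1_module E n (lam E n)\<^esub> dif E n 0 (lam E n x)"
      using E.dif_mul[OF lam[OF xy(1)] lam[OF xy(2)]] xy c
        abelian_monoid.a_comm[OF abelian_group.axioms(1)[OF E.abelian_group_cmp] m m, of x y y x]
      by (simp add: deg1_module_simps lam_mult sgn_pow_def)
  qed (auto intro!: ring_hom_memI simp: deg1_module_simps lam dif[simplified])
  show ?thesis
  proof (intro witt_deriv.intro witt_deriv_axioms.intro frob_aut_axioms der)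
    fix n x \<omega> assume "x \<in> carrier (Wn (Suc n))" "\<omega> \<in> carrier (deg1_module E (Suc n) (lam E (Suc n)))"
    then show "fro E n 1 (x \<odot>\<^bsub>deg1_module E (Suc n) (lam E (Suc n))\<^esub> \<omega>) = Fr n x \<odot>\<^bsub>deg1_module E n (lam E n)\<^esub> fro E n 1 \<omega>"
      using E.fro_mul[of "lam E (Suc n) x" n 0 \<omega> 1] E.fro_lam[of x n] lam[of x "Suc n"] by (simp add: deg1_module_simps)
  next
    fix n x \<omega> assume "x \<in> carrier (Wn (Suc n))" "\<omega> \<in> carrier (deg1_module E n (lam E n))"
    then show "ver E n 1 (Fr n x \<odot>\<^bsub>deg1_module E n (lam E n)\<^esub> \<omega>) = x \<odot>\<^bsub>deg1_module E (Suc n) (lam E (Suc n))\<^esub> ver E n 1 \<omega>"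
      using E.ver_mul_l[of "lam E (Suc n) x" n 0 \<omega> 1] E.fro_lam[of x n] lam[of x "Suc n"] by (simp add: deg1_module_simps)
  next
    fix n y \<omega> assume "y \<in> carrier (Wn n)" "\<omega> \<in> carrier (deg1_module E (Suc n) (lam E (Suc n)))"
    then show "ver E n 1 (y \<odot>\<^bsub>deg1_module E n (lam E n)\<^esub> fro E n 1 \<omega>) = Ve n y \<odot>\<^bsub>deg1_module E (Suc n) (lam E (Suc n))\<^esub> \<omega>"
      using E.ver_mul_r[of "lam E n y" n 0 \<omega> 1] E.ver_lam[of y n] lam[of y n] by (simp add: deg1_module_simps)
  next
    fix n y assume "y \<in> carrier (Wn n)"
    then show "fro E n 1 (dif E (Suc n) 0 (lam E (Suc n) (Ve n y))) = dif E n 0 (lam E n y)"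
      using E.fro_dif_ver[of "lam E n y" n 0] E.ver_lam[of y n] lam[of y n] by simp
  qed (use E.fro_closed[of _ _ 1] E.fro_add[of _ _ 1] E.ver_closed[of _ _ 1] E.ver_add[of _ _ 1] E.level0[of 1]
    in \<open>auto simp: deg1_module_simps\<close>)
qed

section \<open>Restriction maps on Witt vectors of finite length\<close>

context frob_lift
begin

lemma restrict_hom: "(\<lambda>x. restrict x {..<n}) \<in> ring_hom (Wn (Suc n)) (Wn n)"
proof (rule ring_hom_memI)
  interpret WSn: cring "Wn (Suc n)" by (rule Wn_cring)
  interpret Wn: cring "Wn n" by (rule Wn_cring)
  have c: "restrict x {..<n} \<in> carrier (Wn n)" if "x \<in> carrier (Wn (Suc n))" for x
    using that by (intro restrict_closed[of _ "{..<Suc n}"]) auto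
  have g: "gh i (restrict x {..<n}) = gh i x" if "x \<in> carrier (Wn (Suc n))" "i < n" for x i
    using that by (intro gh_restrict[of _ "{..<Suc n}"]) auto
  fix x y assume xy: "x \<in> carrier (Wn (Suc n))" "y \<in> carrier (Wn (Suc n))"
  then show "restrict x {..<n} \<in> carrier (Wn n)" using c by blast
  show "restrict (x \<otimes>\<^bsub>Wn (Suc n)\<^esub> y) {..<n} = restrict x {..<n} \<otimes>\<^bsub>Wn n\<^esub> restrict y {..<n}"
    by (rule witt_eqI[of "{..<n}"]) (use xy in \<open>simp_all add: c g gh_mult\<close>)
  show "restrict (x \<oplus>\<^bsub>Wn (Suc n)\<^esub> y) {..<n} = restrict x {..<n} \<oplus>\<^bsub>Wn n\<^esub> restrict y {..<n}"
    by (rule witt_eqI[of "{..<n}"]) (use xy in \<open>simp_all add: c g gh_add\<close>)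
next
  show "restrict \<one>\<^bsub>Wn (Suc n)\<^esub> {..<n} = \<one>\<^bsub>Wn n\<^esub>" by (auto simp: witt_ring_simps)
qed

lemma Ve_mult_Fr_right:
  assumes "x \<in> carrier (Wn (Suc n))" "y \<in> carrier (Wn n)"
  shows "Ve n (y \<otimes>\<^bsub>Wn n\<^esub> Fr n x) = Ve n y \<otimes>\<^bsub>Wn (Suc n)\<^esub> x"
  using Ve_mult_Fr[OF assms] assms cring.cring_simprules(14)[OF Wn_cring] by simp

lemma Ve_restrict: "Ve n (restrict x {..<n}) = restrict (Ve (Suc n) x) {..<Suc n}"
  by (intro ext) (auto simp: witt_ver_def restrict_def)

lemma Fr_restrict:
  assumes x: "x \<in> carrier (Wn (Suc (Suc n)))"
  shows "Fr n (restrict x {..<Suc n}) = restrict (Fr (Suc n) x) {..<n}"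
proof -
  have c: "restrict x {..<Suc n} \<in> carrier (Wn (Suc n))" using x by (intro restrict_closed[of _ "{..<Suc (Suc n)}"]) auto
  have c': "restrict (Fr (Suc n) x) {..<n} \<in> carrier (Wn n)" using x by (intro restrict_closed[of _ "{..<Suc n}"]) auto
  show ?thesis
  proof (rule witt_eqI[of "{..<n}"])
    fix i assume "i \<in> {..<n}"
    then show "gh i (Fr n (restrict x {..<Suc n})) = gh i (restrict (Fr (Suc n) x) {..<n})"
      using x c gh_restrict[of "{..<Suc n}" "{..<Suc (Suc n)}" x "Suc i"] gh_restrict[of "{..<n}" "{..<Suc n}" "Fr (Suc n) x" i]
      by (simp add: gh_Fr)
  qed (use c c' in auto)
qed

end

section \<open>Witt complexes that vanish in degrees at least two\<close>

text \<open>Initiality of the de Rham-Witt complex is available only for complexes with elements in \<open>'u\<close>,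
  hence the transport along injections \<open>e\<close>.\<close>

definition enc_ring :: "('b, 'm) ring_scheme \<Rightarrow> ('b \<Rightarrow> 'v) \<Rightarrow> 'v ring" where
  "enc_ring G e = \<lparr>carrier = e ` carrier G, monoid.mult = undefined, one = undefined, zero = e \<zero>\<^bsub>G\<^esub>,
     add = (\<lambda>x y. e (inv_into (carrier G) e x \<oplus>\<^bsub>G\<^esub> inv_into (carrier G) e y))\<rparr>"

lemma enc_ring_simps:
  "carrier (enc_ring G e) = e ` carrier G" "\<zero>\<^bsub>enc_ring G e\<^esub> = e \<zero>\<^bsub>G\<^esub>"
  by (simp_all add: enc_ring_def)

lemma enc_ring_add:
  "inj_on e (carrier G) \<Longrightarrow> x \<in> carrier G \<Longrightarrow> y \<in> carrier G \<Longrightarrow> e x \<oplus>\<^bsub>enc_ring G e\<^esub> e y = e (x \<oplus>\<^bsub>G\<^esub> y)"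
  by (simp add: enc_ring_def)

lemma enc_ring_group:
  assumes "abelian_group G" "inj_on e (carrier G)"
  shows "abelian_group (enc_ring G e)"
proof -
  interpret G: abelian_group G by fact
  show ?thesis
  proof (rule abelian_groupI)
    fix x assume "x \<in> carrier (enc_ring G e)"
    then obtain g where "g \<in> carrier G" "x = e g" by (auto simp: enc_ring_simps)
    then show "\<exists>y\<in>carrier (enc_ring G e). y \<oplus>\<^bsub>enc_ring G e\<^esub> x = \<zero>\<^bsub>enc_ring G e\<^esub>"
      using assms(2) by (intro bexI[of _ "e (\<ominus>\<^bsub>G\<^esub> g)"]) (auto simp: enc_ring_simps enc_ring_add G.l_neg)
  qed (use assms(2) in \<open>auto simp: enc_ring_simps enc_ring_add G.a_ac\<close>)
qed

lemma enc_ring_add_pow: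
  assumes "abelian_group G" "inj_on e (carrier G)" "x \<in> carrier G"
  shows "[(n::nat)] \<cdot>\<^bsub>enc_ring G e\<^esub> (e x) = e ([n] \<cdot>\<^bsub>G\<^esub> x)"
proof -
  interpret G: abelian_group G by fact
  interpret H: abelian_group "enc_ring G e" by (rule enc_ring_group) fact+
  show ?thesis using assms by (induction n) (simp_all add: enc_ring_simps enc_ring_add)
qed

text \<open>The zero group placed in degrees at least two. Its element is \<open>undefined\<close>
  because that is the default value of the structure maps of the complex there.\<close>

definition trivial_ring :: "'v ring" where
  "trivial_ring = \<lparr>carrier = {undefined}, monoid.mult = undefined, one = undefined, zero = undefined,
     add = (\<lambda>x y. undefined)\<rparr>"

lemma trivial_ring_simps:
  "carrier trivial_ring = {undefined}" "\<zero>\<^bsub>trivial_ring\<^esub> = undefined" "x \<oplus>\<^bsub>trivial_ring\<^esub> y = undefined"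
  by (simp_all add: trivial_ring_def)

lemma trivial_ring_group: "abelian_group trivial_ring"
  by (rule abelian_groupI) (auto simp: trivial_ring_simps)

lemma trivial_ring_more: "\<ominus>\<^bsub>trivial_ring\<^esub> undefined = undefined" "[(n::nat)] \<cdot>\<^bsub>trivial_ring\<^esub> undefined = undefined"
proof -
  interpret T: abelian_group trivial_ring by (rule trivial_ring_group)
  show "\<ominus>\<^bsub>trivial_ring\<^esub> undefined = undefined" "[(n::nat)] \<cdot>\<^bsub>trivial_ring\<^esub> undefined = undefined"
    using T.a_inv_closed[of undefined] T.add.nat_pow_closed[of undefined n] by (auto simp: trivial_ring_simps)
qed

text \<open>What has to be added to \<open>witt_deriv\<close> for a Witt complex in which products
  of degree one elements vanish: restriction maps, \<open>FV = p\<close>, the Teichmueller rule, and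
  codings \<open>e0\<close>, \<open>e1\<close> of the components inside the type
  \<open>'v\<close>.\<close>

locale trunc_complex = witt_deriv A p \<phi> N D F1 V1
  for A :: "('a, 'm) ring_scheme" (structure) and p \<phi> and N :: "nat \<Rightarrow> (nat \<Rightarrow> 'a, 'b) module" and D F1 V1 +
  fixes R1 :: "nat \<Rightarrow> 'b \<Rightarrow> 'b"
    and e0 :: "nat \<Rightarrow> (nat \<Rightarrow> 'a) \<Rightarrow> 'v" and e1 :: "nat \<Rightarrow> 'b \<Rightarrow> 'v"
  assumes R1_closed [simp]: "\<omega> \<in> carrier (N (Suc n)) \<Longrightarrow> R1 n \<omega> \<in> carrier (N n)"
    and R1_add: "\<omega> \<in> carrier (N (Suc n)) \<Longrightarrow> \<eta> \<in> carrier (N (Suc n)) \<Longrightarrow>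
      R1 n (\<omega> \<oplus>\<^bsub>N (Suc n)\<^esub> \<eta>) = R1 n \<omega> \<oplus>\<^bsub>N n\<^esub> R1 n \<eta>"
    and R1_smult: "x \<in> carrier (Wn (Suc n)) \<Longrightarrow> \<omega> \<in> carrier (N (Suc n)) \<Longrightarrow>
      R1 n (x \<odot>\<^bsub>N (Suc n)\<^esub> \<omega>) = restrict x {..<n} \<odot>\<^bsub>N n\<^esub> R1 n \<omega>"
    and R1_D: "x \<in> carrier (Wn (Suc n)) \<Longrightarrow> R1 n (D (Suc n) x) = D n (restrict x {..<n})"
    and F1_R1: "\<omega> \<in> carrier (N (Suc (Suc n))) \<Longrightarrow> F1 n (R1 (Suc n) \<omega>) = R1 n (F1 (Suc n) \<omega>)"
    and V1_R1: "\<omega> \<in> carrier (N (Suc n)) \<Longrightarrow> V1 n (R1 n \<omega>) = R1 (Suc n) (V1 (Suc n) \<omega>)"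
    and F1_V1: "\<omega> \<in> carrier (N n) \<Longrightarrow> F1 n (V1 n \<omega>) = [p] \<cdot>\<^bsub>N n\<^esub> \<omega>"
    and F1_D_teich: "a \<in> carrier A \<Longrightarrow> F1 n (D (Suc n) (teichmueller {..<Suc n} A a)) =
      (teichmueller {..<n} A a [^]\<^bsub>Wn n\<^esub> (p - 1)) \<odot>\<^bsub>N n\<^esub> D n (teichmueller {..<n} A a)"
    and inj_e0: "inj_on (e0 n) (carrier (Wn n))"
    and inj_e1: "inj_on (e1 n) (carrier (N n))"
begin

definition d0 where "d0 n = inv_into (carrier (Wn n)) (e0 n)"
definition d1 where "d1 n = inv_into (carrier (N n)) (e1 n)"

lemma d0_e0 [simp]: "x \<in> carrier (Wn n) \<Longrightarrow> d0 n (e0 n x) = x"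
  unfolding d0_def by (rule inv_into_f_f[OF inj_e0])

lemma d1_e1 [simp]: "x \<in> carrier (N n) \<Longrightarrow> d1 n (e1 n x) = x"
  unfolding d1_def by (rule inv_into_f_f[OF inj_e1])

definition E :: "('a, 'v) witt_data" where
  "E = \<lparr>
     cmp = (\<lambda>n q. if q = 0 then enc_ring (Wn n) (e0 n) else if q = 1 then enc_ring (N n) (e1 n) else trivial_ring),
     mul = (\<lambda>n q r x y. if q = 0 \<and> r = 0 then e0 n (d0 n x \<otimes>\<^bsub>Wn n\<^esub> d0 n y)
        else if q = 0 \<and> r = 1 then e1 n (d0 n x \<odot>\<^bsub>N n\<^esub> d1 n y)
        else if q = 1 \<and> r = 0 then e1 n (d0 n y \<odot>\<^bsub>N n\<^esub> d1 n x) else undefined),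
     unt = (\<lambda>n. e0 n \<one>\<^bsub>Wn n\<^esub>),
     dif = (\<lambda>n q x. if q = 0 then e1 n (D n (d0 n x)) else undefined),
     res = (\<lambda>n q x. if q = 0 then e0 n (restrict (d0 (Suc n) x) {..<n}) else if q = 1 then e1 n (R1 n (d1 (Suc n) x)) else undefined),
     lam = e0,
     fro = (\<lambda>n q x. if q = 0 then e0 n (Fr n (d0 (Suc n) x)) else if q = 1 then e1 n (F1 n (d1 (Suc n) x)) else undefined),
     ver = (\<lambda>n q x. if q = 0 then e0 (Suc n) (Ve n (d0 n x)) else if q = 1 then e1 (Suc n) (V1 n (d1 n x)) else undefined)\<rparr>"

lemma E_sel:
  "cmp E n q = (if q = 0 then enc_ring (Wn n) (e0 n) else if q = 1 then enc_ring (N n) (e1 n) else trivial_ring)"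
  "mul E n q r x y = (if q = 0 \<and> r = 0 then e0 n (d0 n x \<otimes>\<^bsub>Wn n\<^esub> d0 n y)
        else if q = 0 \<and> r = 1 then e1 n (d0 n x \<odot>\<^bsub>N n\<^esub> d1 n y)
        else if q = 1 \<and> r = 0 then e1 n (d0 n y \<odot>\<^bsub>N n\<^esub> d1 n x) else undefined)"
  "unt E n = e0 n \<one>\<^bsub>Wn n\<^esub>"
  "dif E n q x = (if q = 0 then e1 n (D n (d0 n x)) else undefined)"
  "res E n q x = (if q = 0 then e0 n (restrict (d0 (Suc n) x) {..<n}) else if q = 1 then e1 n (R1 n (d1 (Suc n) x)) else undefined)"
  "lam E = e0"
  "fro E n q x = (if q = 0 then e0 n (Fr n (d0 (Suc n) x)) else if q = 1 then e1 n (F1 n (d1 (Suc n) x)) else undefined)"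
  "ver E n q x = (if q = 0 then e0 (Suc n) (Ve n (d0 n x)) else if q = 1 then e1 (Suc n) (V1 n (d1 n x)) else undefined)"
  by (simp_all add: E_def)

lemma elts_E: "elts E n q = (if q = 0 then e0 n ` carrier (Wn n) else if q = 1 then e1 n ` carrier (N n) else {undefined})"
  by (simp add: E_sel enc_ring_simps trivial_ring_simps)

text \<open>After this case split each axiom is a law of a ring, a module or a derivation, or else
  compares \<open>undefined\<close> with itself.\<close>

lemma elts_cases:
  assumes "x \<in> elts E n q"
  obtains w where "q = 0" "w \<in> carrier (Wn n)" "x = e0 n w"
  | \<omega> where "q = 1" "\<omega> \<in> carrier (N n)" "x = e1 n \<omega>"
  | q' where "q = Suc (Suc q')" "x = undefined"
proof (cases q)
  case 0
  then show ?thesis using assms that(1) by (auto simp: elts_E)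
next
  case (Suc r)
  then show ?thesis using assms that(2,3) by (cases r) (auto simp: elts_E)
qed

lemma restrict_Wn [simp]: "x \<in> carrier (Wn (Suc n)) \<Longrightarrow> restrict x {..<n} \<in> carrier (Wn n)"
  by (rule ring_hom_closed[OF restrict_hom])

lemmas E_simps = E_sel enc_ring_simps enc_ring_add trivial_ring_simps inj_e0 inj_e1

lemma pro_dg_ring_E: "pro_dg_ring E"
proof (rule pro_dg_ring.intro)
  fix n q show "abelian_group (cmp E n q)"
    by (auto simp: E_sel intro: enc_ring_group inj_e0 inj_e1 trivial_ring_group N.M.abelian_group_axioms N.R.abelian_group_axioms)
next
  fix q
  have "carrier (Wn 0) = {\<zero>\<^bsub>Wn 0\<^esub>}" by (auto simp: witt_ring_simps)
  then show "elts E 0 q = {\<zero>\<^bsub>cmp E 0 q\<^esub>}" using N_0 by (auto simp: E_simps)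
next
  fix n q r t x y z assume "x \<in> elts E n q" "y \<in> elts E n r" "z \<in> elts E n t"
  then show "mul E n (q + r) t (mul E n q r x y) z = mul E n q (r + t) x (mul E n r t y z)"
    by (elim elts_cases) (simp_all add: E_simps N.R.m_ac N.smult_assoc1[symmetric])
next
  fix n q r x y assume "x \<in> elts E n q" "y \<in> elts E n r"
  then show "mul E n q r x y = sgn_pow (cmp E n (q + r)) (q * r) (mul E n r q y x)"
    by (elim elts_cases) (simp_all add: E_simps N.R.m_ac sgn_pow_def trivial_ring_more)
next
  fix n q r x y assume "x \<in> elts E n q" "y \<in> elts E n r"
  then show "dif E n (q + r) (mul E n q r x y) = mul E n (q + 1) r (dif E n q x) y \<oplus>\<^bsub>cmp E n (q + r + 1)\<^esub>
      sgn_pow (cmp E n (q + r + 1)) q (mul E n q (r + 1) x (dif E n r y))"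
    by (elim elts_cases) (simp_all add: E_simps sgn_pow_def trivial_ring_more D_mult N.M.a_comm)
next
  fix n q x y assume "x \<in> elts E (n + 1) q" "y \<in> elts E (n + 1) q"
  then show "res E n q (x \<oplus>\<^bsub>cmp E (n + 1) q\<^esub> y) = res E n q x \<oplus>\<^bsub>cmp E n q\<^esub> res E n q y"
    by (elim elts_cases) (simp_all add: E_simps ring_hom_add[OF restrict_hom] R1_add)
next
  fix n q r x y assume "x \<in> elts E (n + 1) q" "y \<in> elts E (n + 1) r"
  then show "res E n (q + r) (mul E (n + 1) q r x y) = mul E n q r (res E n q x) (res E n r y)"
    by (elim elts_cases) (simp_all add: E_simps ring_hom_mult[OF restrict_hom] R1_smult)
next
  fix n show "res E n 0 (unt E (n + 1)) = unt E n"
    using ring_hom_one[OF restrict_hom] by (simp add: E_simps)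
next
  fix n q x assume "x \<in> elts E (n + 1) q"
  then show "res E n (q + 1) (dif E (n + 1) q x) = dif E n q (res E n q x)"
    by (elim elts_cases) (simp_all add: E_simps R1_D)
next
  fix n q r x y assume "x \<in> elts E n q" "y \<in> elts E n r"
  then show "mul E n q r x y \<in> elts E n (q + r)"
    by (elim elts_cases) (simp_all add: E_simps)
next
  fix n q r x y z assume "x \<in> elts E n q" "y \<in> elts E n q" "z \<in> elts E n r"
  then show "mul E n q r (x \<oplus>\<^bsub>cmp E n q\<^esub> y) z = mul E n q r x z \<oplus>\<^bsub>cmp E n (q + r)\<^esub> mul E n q r y z"
    by (elim elts_cases) (simp_all add: E_simps N.R.l_distr N.smult_l_distr N.smult_r_distr)
next
  fix n q r x y z assume "x \<in> elts E n q" "y \<in> elts E n r" "z \<in> elts E n r"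
  then show "mul E n q r x (y \<oplus>\<^bsub>cmp E n r\<^esub> z) = mul E n q r x y \<oplus>\<^bsub>cmp E n (q + r)\<^esub> mul E n q r x z"
    by (elim elts_cases) (simp_all add: E_simps N.R.r_distr N.smult_l_distr N.smult_r_distr)
next
  fix n show "unt E n \<in> elts E n 0" by (simp add: E_simps)
next
  fix n q x assume "x \<in> elts E n q"
  then show "mul E n 0 q (unt E n) x = x" "mul E n q 0 x (unt E n) = x"
    "dif E n q x \<in> elts E n (q + 1)" "dif E n (q + 1) (dif E n q x) = \<zero>\<^bsub>cmp E n (q + 2)\<^esub>"
    by (elim elts_cases; simp add: E_simps)+
next
  fix n q x y assume "x \<in> elts E n q" "y \<in> elts E n q"
  then show "dif E n q (x \<oplus>\<^bsub>cmp E n q\<^esub> y) = dif E n q x \<oplus>\<^bsub>cmp E n (q + 1)\<^esub> dif E n q y"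
    by (elim elts_cases) (simp_all add: E_simps D_add)
next
  fix n q x assume "x \<in> elts E (n + 1) q"
  then show "res E n q x \<in> elts E n q" by (elim elts_cases) (simp_all add: E_simps)
qed

lemma witt_complex_E: "witt_complex p A E"
proof (intro witt_complex.intro pro_dg_ring_E witt_complex_axioms.intro cring_axioms)
  fix n show "lam E n \<in> ring_hom (Wn n) (deg0_ring E n)"
    by (rule ring_hom_memI) (simp_all add: deg0_ring_simps E_simps)
next
  fix w n assume "w \<in> carrier (Wn (n + 1))"
  then show "res E n 0 (lam E (n + 1) w) = lam E n (restrict w {..<n})" by (simp add: E_simps)
next
  fix x n q y assume "x \<in> elts E (n + 1) q" "y \<in> elts E (n + 1) q"
  then show "fro E n q (x \<oplus>\<^bsub>cmp E (n + 1) q\<^esub> y) = fro E n q x \<oplus>\<^bsub>cmp E n q\<^esub> fro E n q y"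
    by (elim elts_cases) (simp_all add: E_simps ring_hom_add[OF Fr_hom] F1_add)
next
  fix x n q y r assume "x \<in> elts E (n + 1) q" "y \<in> elts E (n + 1) r"
  then show "fro E n (q + r) (mul E (n + 1) q r x y) = mul E n q r (fro E n q x) (fro E n r y)"
    by (elim elts_cases) (simp_all add: E_simps ring_hom_mult[OF Fr_hom] F1_smult)
next
  fix n show "fro E n 0 (unt E (n + 1)) = unt E n" using ring_hom_one[OF Fr_hom] by (simp add: E_simps)
next
  fix x n q assume "x \<in> elts E (n + 2) q"
  then show "fro E n q (res E (n + 1) q x) = res E n q (fro E (n + 1) q x)"
    by (elim elts_cases) (simp_all add: E_simps Fr_restrict F1_R1)
next
  fix a n assume "a \<in> carrier A"
  then show "fro E n 1 (dif E (n + 1) 0 (lam E (n + 1) (teichmueller {..<n + 1} A a))) =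
     mul E n 0 1 (lam E n (teichmueller {..<n} A a [^]\<^bsub>Wn n\<^esub> (p - 1))) (dif E n 0 (lam E n (teichmueller {..<n} A a)))"
    using teich_closed[of "{..<Suc n}" a] teich_closed[of "{..<n}" a] F1_D_teich[of a n] by (simp add: E_simps)
next
  fix x n q y assume "x \<in> elts E n q" "y \<in> elts E n q"
  then show "ver E n q (x \<oplus>\<^bsub>cmp E n q\<^esub> y) = ver E n q x \<oplus>\<^bsub>cmp E (n + 1) q\<^esub> ver E n q y"
    by (elim elts_cases) (simp_all add: E_simps Ve_add V1_add)
next
  fix x n q y r assume "x \<in> elts E (n + 1) q" "y \<in> elts E n r"
  then show "ver E n (q + r) (mul E n q r (fro E n q x) y) = mul E (n + 1) q r x (ver E n r y)"
    by (elim elts_cases) (simp_all add: E_simps Ve_mult_Fr V1_smult_F V1_smult_F1)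
next
  fix x n q y r assume "x \<in> elts E n q" "y \<in> elts E (n + 1) r"
  then show "ver E n (q + r) (mul E n q r x (fro E n r y)) = mul E (n + 1) q r (ver E n q x) y"
    by (elim elts_cases) (simp_all add: E_simps Ve_mult_Fr_right V1_smult_F V1_smult_F1)
next
  fix x n q assume "x \<in> elts E (n + 1) q"
  then show "ver E n q (res E n q x) = res E (n + 1) q (ver E (n + 1) q x)"
    by (elim elts_cases) (simp_all add: E_simps Ve_restrict V1_R1)
next
  fix x n q assume "x \<in> elts E n q"
  then show "fro E n (q + 1) (dif E (n + 1) q (ver E n q x)) = dif E n q x"
    by (elim elts_cases) (simp_all add: E_simps F1_D_V)
next
  fix x n q assume "x \<in> elts E n q"
  then show "fro E n q (ver E n q x) = add_pow (cmp E n q) p x"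
    by (elim elts_cases) (simp_all add: E_simps Fr_Ve F1_V1 enc_ring_add_pow N.M.abelian_group_axioms N.R.abelian_group_axioms trivial_ring_more)
next
  fix w n assume "w \<in> carrier (Wn (n + 1))"
  then show "fro E n 0 (lam E (n + 1) w) = lam E n (Fr n w)" by (simp add: E_simps)
next
  fix w n assume "w \<in> carrier (Wn n)"
  then show "ver E n 0 (lam E n w) = lam E (n + 1) (witt_ver {..<n + 1} A w)" by (simp add: E_simps)
next
  fix x n q assume "x \<in> elts E n q"
  then show "ver E n q x \<in> elts E (n + 1) q" by (elim elts_cases) (simp_all add: E_simps)
next
  fix x n q assume "x \<in> elts E (n + 1) q"
  then show "fro E n q x \<in> elts E n q" by (elim elts_cases) (simp_all add: E_simps)
qed

end

section \<open>The Witt complex detecting injectivity\<close>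

text \<open>Lets the quotient of \<open>A\<close> by a power of \<open>p\<close> be an instance of
  \<open>quot_module\<close>.\<close>

definition reg_module :: "('a, 'm) ring_scheme \<Rightarrow> ('a, 'a) module" where
  "reg_module R = \<lparr>carrier = carrier R, monoid.mult = undefined, one = undefined, zero = \<zero>\<^bsub>R\<^esub>,
     add = (\<oplus>\<^bsub>R\<^esub>), smult = (\<otimes>\<^bsub>R\<^esub>)\<rparr>"

lemma reg_module_simps:
  "carrier (reg_module R) = carrier R" "\<zero>\<^bsub>reg_module R\<^esub> = \<zero>\<^bsub>R\<^esub>"
  "x \<oplus>\<^bsub>reg_module R\<^esub> y = x \<oplus>\<^bsub>R\<^esub> y" "x \<odot>\<^bsub>reg_module R\<^esub> y = x \<otimes>\<^bsub>R\<^esub> y"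
  by (simp_all add: reg_module_def)

lemma (in cring) reg_module_module: "module R (reg_module R)"
proof (rule moduleI)
  show "abelian_group (reg_module R)"
    by (rule abelian_group_cong[OF is_abelian_group]) (simp_all add: reg_module_simps)
qed (simp_all add: reg_module_simps cring_axioms l_distr r_distr m_assoc)

context frob_aut
begin

interpretation reg: module A "reg_module A"
  by (rule reg_module_module)

lemma reg_minus: "a \<in> carrier A \<Longrightarrow> \<ominus>\<^bsub>reg_module A\<^esub> a = \<ominus> a"
  by (rule reg.M.minus_equality) (simp_all add: reg_module_simps l_neg)

definition p_ideal :: "nat \<Rightarrow> 'a set" where
  "p_ideal m = (\<lambda>c. [(p ^ m)] \<cdot> c) ` carrier A"

lemma p_ideal_submodule: "submodule (p_ideal m) A (reg_module A)"
proof (rule reg.submoduleI)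
  show "p_ideal m \<subseteq> carrier (reg_module A)" by (auto simp: p_ideal_def reg_module_simps)
  show "\<zero>\<^bsub>reg_module A\<^esub> \<in> p_ideal m"
    unfolding p_ideal_def by (rule image_eqI[of _ _ \<zero>]) (simp_all add: reg_module_simps)
next
  fix a assume "a \<in> p_ideal m"
  then obtain c where "c \<in> carrier A" "a = [(p ^ m)] \<cdot> c" by (auto simp: p_ideal_def)
  then show "\<ominus>\<^bsub>reg_module A\<^esub> a \<in> p_ideal m"
    unfolding p_ideal_def by (intro image_eqI[of _ _ "\<ominus> c"]) (simp_all add: reg_minus add_pow_minus)
next
  fix a b assume "a \<in> p_ideal m" "b \<in> p_ideal m"
  then obtain c d where "c \<in> carrier A" "a = [(p ^ m)] \<cdot> c" "d \<in> carrier A" "b = [(p ^ m)] \<cdot> d" by (auto simp: p_ideal_def)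
  then show "a \<oplus>\<^bsub>reg_module A\<^esub> b \<in> p_ideal m"
    unfolding p_ideal_def by (intro image_eqI[of _ _ "c \<oplus> d"]) (simp_all add: reg_module_simps add.nat_pow_distrib)
next
  fix a x assume "a \<in> carrier A" "x \<in> p_ideal m"
  then obtain c where "a \<in> carrier A" "c \<in> carrier A" "x = [(p ^ m)] \<cdot> c" by (auto simp: p_ideal_def)
  then show "a \<odot>\<^bsub>reg_module A\<^esub> x \<in> p_ideal m"
    unfolding p_ideal_def by (intro image_eqI[of _ _ "a \<otimes> c"]) (simp_all add: reg_module_simps add_pow_rdistr)
qed

interpretation tq: quot_mod A "reg_module A" "p_ideal m" for m
  by (intro quot_mod.intro quot_mod_axioms.intro reg_module_module p_ideal_submodule)

text \<open>The module \<open>A/p^m\<close>. It is zero for \<open>m = 0\<close>, in accordance with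
  the absence of a congruence on the zeroth ghost component.\<close>

definition tq :: "nat \<Rightarrow> ('a, 'a set) module" where
  "tq m = quot_module (reg_module A) (p_ideal m)"

definition cl :: "nat \<Rightarrow> 'a \<Rightarrow> 'a set" where
  "cl m = quot_mod.cl (reg_module A) (p_ideal m)"

lemma tq_module: "module A (tq m)"
  unfolding tq_def by (rule tq.quot_module)

lemma cl_closed [simp]: "a \<in> carrier A \<Longrightarrow> cl m a \<in> carrier (tq m)"
  unfolding tq_def cl_def by (rule tq.cl_closed) (simp add: reg_module_simps)

lemma tq_E: assumes "t \<in> carrier (tq m)" obtains a where "a \<in> carrier A" "t = cl m a"
  using assms unfolding tq_def cl_def by (rule tq.quot_E) (simp add: reg_module_simps)

lemma cl_add: "a \<in> carrier A \<Longrightarrow> b \<in> carrier A \<Longrightarrow> cl m a \<oplus>\<^bsub>tq m\<^esub> cl m b = cl m (a \<oplus> b)"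
  unfolding tq_def cl_def using tq.cl_add[of a b m] by (simp add: reg_module_simps)

lemma cl_zero: "\<zero>\<^bsub>tq m\<^esub> = cl m \<zero>"
  unfolding tq_def cl_def using tq.cl_zero[of m] by (simp add: reg_module_simps)

lemma cl_smult: "a \<in> carrier A \<Longrightarrow> b \<in> carrier A \<Longrightarrow> a \<odot>\<^bsub>tq m\<^esub> cl m b = cl m (a \<otimes> b)"
  unfolding tq_def cl_def using tq.cl_smult[of a b m] by (simp add: reg_module_simps)

lemma cl_eq_iff: "a \<in> carrier A \<Longrightarrow> b \<in> carrier A \<Longrightarrow> cl m a = cl m b \<longleftrightarrow> pcong m a b"
proof -
  assume ab: "a \<in> carrier A" "b \<in> carrier A"
  have "cl m a = cl m b \<longleftrightarrow> a \<ominus>\<^bsub>reg_module A\<^esub> b \<in> p_ideal m"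
    unfolding cl_def using tq.cl_eq_iff[of a b m] ab by (simp add: reg_module_simps)
  also have "a \<ominus>\<^bsub>reg_module A\<^esub> b = a \<oplus> \<ominus> b" using ab by (simp add: a_minus_def reg_minus reg_module_simps)
  also have "a \<oplus> \<ominus> b \<in> p_ideal m \<longleftrightarrow> pcong m a b"
  proof
    assume "a \<oplus> \<ominus> b \<in> p_ideal m"
    then obtain c where c: "c \<in> carrier A" "a \<oplus> \<ominus> b = [(p ^ m)] \<cdot> c" by (auto simp: p_ideal_def)
    have "a = b \<oplus> (a \<oplus> \<ominus> b)" using ab by (simp add: a_lcomm r_neg)
    then show "pcong m a b" using c by (intro pcongI[OF c(1)]) simp
  next
    assume "pcong m a b"
    then obtain c where c: "c \<in> carrier A" "a = b \<oplus> [(p ^ m)] \<cdot> c" by (auto simp: pcong_def)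
    then have "a \<oplus> \<ominus> b = [(p ^ m)] \<cdot> c" using ab by (simp add: a_ac r_neg1 r_neg2)
    then show "a \<oplus> \<ominus> b \<in> p_ideal m" using c by (auto simp: p_ideal_def)
  qed
  finally show ?thesis .
qed

text \<open>A chosen lift to \<open>A\<close>. The choice does not matter: \<open>FF\<close> passes
  from \<open>A/p^(m+1)\<close> to \<open>A/p^m\<close>, and \<open>VV\<close> multiplies by
  \<open>p\<close> from \<open>A/p^m\<close> to \<open>A/p^(m+1)\<close>.\<close>

definition rep :: "nat \<Rightarrow> 'a set \<Rightarrow> 'a" where
  "rep m t = (SOME a. a \<in> carrier A \<and> cl m a = t)"

lemma rep: "a \<in> carrier A \<Longrightarrow> rep m (cl m a) \<in> carrier A" "a \<in> carrier A \<Longrightarrow> pcong m (rep m (cl m a)) a"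
proof -
  assume a: "a \<in> carrier A"
  then have *: "rep m (cl m a) \<in> carrier A \<and> cl m (rep m (cl m a)) = cl m a"
    unfolding rep_def by (intro someI[of "\<lambda>b. b \<in> carrier A \<and> cl m b = cl m a" a]) simp
  then show "rep m (cl m a) \<in> carrier A" "pcong m (rep m (cl m a)) a"
    using a cl_eq_iff by auto
qed

text \<open>Degree one, level \<open>n\<close> of the test complex. A Witt vector acts on the
  \<open>m\<close>-th factor through its \<open>m\<close>-th ghost component.\<close>

definition NN :: "nat \<Rightarrow> (nat \<Rightarrow> 'a, nat \<Rightarrow> ('a \<Rightarrow> 'a) set \<times> 'a set) module" where
  "NN n = pi_module {..<n} (\<lambda>m. pull_module (gh m) (pair_module \<Omega> (tq m)))"

definition mk :: "nat \<Rightarrow> (nat \<Rightarrow> ('a \<Rightarrow> 'a) set) \<Rightarrow> (nat \<Rightarrow> 'a) \<Rightarrow> nat \<Rightarrow> ('a \<Rightarrow> 'a) set \<times> 'a set" where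
  "mk n \<alpha> t = (\<lambda>m\<in>{..<n}. (\<alpha> m, cl m (t m)))"

lemma NN_simps:
  "carrier (NN n) = (\<Pi>\<^sub>E m\<in>{..<n}. carrier \<Omega> \<times> carrier (tq m))"
  "\<zero>\<^bsub>NN n\<^esub> = (\<lambda>m\<in>{..<n}. (\<zero>\<^bsub>\<Omega>\<^esub>, \<zero>\<^bsub>tq m\<^esub>))"
  "\<omega> \<oplus>\<^bsub>NN n\<^esub> \<eta> = (\<lambda>m\<in>{..<n}. (fst (\<omega> m) \<oplus>\<^bsub>\<Omega>\<^esub> fst (\<eta> m), snd (\<omega> m) \<oplus>\<^bsub>tq m\<^esub> snd (\<eta> m)))"
  "x \<odot>\<^bsub>NN n\<^esub> \<omega> = (\<lambda>m\<in>{..<n}. (gh m x \<odot>\<^bsub>\<Omega>\<^esub> fst (\<omega> m), gh m x \<odot>\<^bsub>tq m\<^esub> snd (\<omega> m)))"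
  by (simp_all add: NN_def pi_module_simps pull_module_simps pair_module_simps)

lemma gh_ghc [simp]: "x \<in> carrier (Wn n) \<Longrightarrow> m < n \<Longrightarrow> gh m x \<in> carrier A"
  by (rule gh_closed) auto

lemma gh_hom: "m < n \<Longrightarrow> gh m \<in> ring_hom (Wn n) A"
  by (rule ring_hom_memI) (auto simp: gh_mult gh_add gh_one)

lemma NN_module: "module (Wn n) (NN n)"
  unfolding NN_def
  by (intro pi_module_module pull_module_module[where S = A] pair_module_module Wn_cring kaehler_module tq_module gh_hom cring_axioms) auto

lemma mk_closed: "(\<And>m. m < n \<Longrightarrow> \<alpha> m \<in> carrier \<Omega>) \<Longrightarrow> (\<And>m. m < n \<Longrightarrow> t m \<in> carrier A) \<Longrightarrow> mk n \<alpha> t \<in> carrier (NN n)"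
  by (auto simp: NN_simps mk_def)

lemma mk_cong:
  "(\<And>m. m < n \<Longrightarrow> \<alpha> m = \<beta> m) \<Longrightarrow> (\<And>m. m < n \<Longrightarrow> t m \<in> carrier A) \<Longrightarrow> (\<And>m. m < n \<Longrightarrow> u m \<in> carrier A) \<Longrightarrow>
   (\<And>m. m < n \<Longrightarrow> pcong m (t m) (u m)) \<Longrightarrow> mk n \<alpha> t = mk n \<beta> u"
  unfolding mk_def by (intro restrict_ext) (simp add: cl_eq_iff)

lemma NN_E:
  assumes "\<omega> \<in> carrier (NN n)"
  obtains \<alpha> t where "\<And>m. m < n \<Longrightarrow> \<alpha> m \<in> carrier \<Omega>" "\<And>m. m < n \<Longrightarrow> t m \<in> carrier A" "\<omega> = mk n \<alpha> t"
proof -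
  have c: "fst (\<omega> m) \<in> carrier \<Omega> \<and> snd (\<omega> m) \<in> carrier (tq m)" if "m < n" for m
    using PiE_mem[of \<omega> "{..<n}" "\<lambda>m. carrier \<Omega> \<times> carrier (tq m)" m] assms that by (auto simp: NN_simps mem_Times_iff)
  have "\<exists>a. m < n \<longrightarrow> a \<in> carrier A \<and> snd (\<omega> m) = cl m a" for m
    using c[of m] tq_E[of "snd (\<omega> m)" m] by blast
  then obtain t where t: "\<And>m. m < n \<Longrightarrow> t m \<in> carrier A \<and> snd (\<omega> m) = cl m (t m)" by metis
  have "\<omega> = mk n (\<lambda>m. fst (\<omega> m)) t"
  proof
    fix m show "\<omega> m = mk n (\<lambda>m. fst (\<omega> m)) t m"
      using assms t[of m] PiE_arb[of \<omega> "{..<n}" "\<lambda>m. carrier \<Omega> \<times> carrier (tq m)" m]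
      by (cases "m < n") (simp_all add: mk_def NN_simps prod_eq_iff)
  qed
  then show ?thesis using that[of "\<lambda>m. fst (\<omega> m)" t] c t by blast
qed

lemma NN_ex:
  "\<omega> \<in> carrier (NN n) \<Longrightarrow> \<exists>\<alpha> t. (\<forall>m<n. \<alpha> m \<in> carrier \<Omega>) \<and> (\<forall>m<n. t m \<in> carrier A) \<and> \<omega> = mk n \<alpha> t"
  by (erule NN_E) blast

lemma mk_add:
  assumes "\<And>m. m < n \<Longrightarrow> t m \<in> carrier A" "\<And>m. m < n \<Longrightarrow> u m \<in> carrier A"
  shows "mk n \<alpha> t \<oplus>\<^bsub>NN n\<^esub> mk n \<beta> u = mk n (\<lambda>m. \<alpha> m \<oplus>\<^bsub>\<Omega>\<^esub> \<beta> m) (\<lambda>m. t m \<oplus> u m)"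
  unfolding NN_simps unfolding mk_def by (intro restrict_ext) (simp add: cl_add assms)

lemma mk_smult:
  assumes "\<And>m. m < n \<Longrightarrow> t m \<in> carrier A" "x \<in> carrier (Wn n)"
  shows "x \<odot>\<^bsub>NN n\<^esub> mk n \<alpha> t = mk n (\<lambda>m. gh m x \<odot>\<^bsub>\<Omega>\<^esub> \<alpha> m) (\<lambda>m. gh m x \<otimes> t m)"
  unfolding NN_simps unfolding mk_def by (intro restrict_ext) (simp add: cl_smult assms gh_ghc[OF assms(2)])

lemma mk_zero: "\<zero>\<^bsub>NN n\<^esub> = mk n (\<lambda>m. \<zero>\<^bsub>\<Omega>\<^esub>) (\<lambda>m. \<zero>)"
  unfolding NN_simps mk_def cl_zero by simp

lemma mk_add_pow:
  assumes "\<And>m. m < n \<Longrightarrow> t m \<in> carrier A"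
  shows "[(k::nat)] \<cdot>\<^bsub>NN n\<^esub> mk n \<alpha> t = mk n (\<lambda>m. [k] \<cdot>\<^bsub>\<Omega>\<^esub> \<alpha> m) (\<lambda>m. [k] \<cdot> t m)"
proof -
  interpret N: module "Wn n" "NN n" by (rule NN_module)
  show ?thesis using assms by (induction k) (simp_all add: mk_zero mk_add)
qed

text \<open>The element \<open>c\<close> exists by Dwork's lemma and is unique because \<open>A\<close> is torsion free.\<close>

definition wt :: "nat \<Rightarrow> (nat \<Rightarrow> 'a) \<Rightarrow> 'a" where
  "wt m x = (SOME c. c \<in> carrier A \<and> gh m x = \<phi> (gh (m - 1) x) \<oplus> [(p ^ m)] \<cdot> c)"

lemma wt:
  assumes "x \<in> carrier (Wn n)" "m < n"
  shows wt_closed [simp]: "wt m x \<in> carrier A" and wt_eq: "gh m x = \<phi> (gh (m - 1) x) \<oplus> [(p ^ m)] \<cdot> wt m x"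
proof -
  have x: "x \<in> {..m} \<rightarrow> carrier A"
    using PiE_mem[of x "{..<n}" "\<lambda>_. carrier A"] assms by (intro Pi_I) (simp add: witt_ring_simps)
  \<comment> \<open>For \<open>m = 0\<close> the index \<open>m - 1\<close> is again 0. The
    resulting value carries no information, since \<open>wt 0\<close> only enters modulo
    \<open>p ^ 0\<close>.\<close>
  have "pcong m (gh m x) (\<phi> (gh (m - 1) x))"
  proof (cases "m = 0")
    case True
    then show ?thesis using assms by (simp add: pcong_0)
  qed (use ghost_pcong[OF x] in simp)
  then have "\<exists>c. c \<in> carrier A \<and> gh m x = \<phi> (gh (m - 1) x) \<oplus> [(p ^ m)] \<cdot> c" by (auto simp: pcong_def)
  from someI_ex[OF this] show "wt m x \<in> carrier A" "gh m x = \<phi> (gh (m - 1) x) \<oplus> [(p ^ m)] \<cdot> wt m x"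
    unfolding wt_def by auto
qed

lemma wtI:
  assumes "x \<in> carrier (Wn n)" "m < n" "c \<in> carrier A" "gh m x = \<phi> (gh (m - 1) x) \<oplus> [(p ^ m)] \<cdot> c"
  shows "wt m x = c"
proof -
  have g: "gh (m - 1) x \<in> carrier A" using assms by simp
  have "\<phi> (gh (m - 1) x) \<oplus> [(p ^ m)] \<cdot> wt m x = \<phi> (gh (m - 1) x) \<oplus> [(p ^ m)] \<cdot> c"
    using assms(4) wt_eq[OF assms(1,2)] by simp
  then have "[(p ^ m)] \<cdot> wt m x = [(p ^ m)] \<cdot> c" using g assms by simp
  from p_pow_cancel[OF _ assms(3) this] show ?thesis using assms by simp
qed

lemma wt_add:
  assumes x: "x \<in> carrier (Wn n)" and y: "y \<in> carrier (Wn n)" and m: "m < n"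
  shows "wt m (x \<oplus>\<^bsub>Wn n\<^esub> y) = wt m x \<oplus> wt m y"
proof (rule wtI[OF _ m])
  have c: "gh (m - 1) x \<in> carrier A" "gh (m - 1) y \<in> carrier A" "m - 1 < n" using assms by auto
  show "gh m (x \<oplus>\<^bsub>Wn n\<^esub> y) = \<phi> (gh (m - 1) (x \<oplus>\<^bsub>Wn n\<^esub> y)) \<oplus> [(p ^ m)] \<cdot> (wt m x \<oplus> wt m y)"
    using assms c wt_closed[OF x m] wt_closed[OF y m] wt_eq[OF x m] wt_eq[OF y m]
    by (simp add: gh_add add.nat_pow_distrib a_ac)
qed (use assms wt_closed in \<open>auto intro!: witt_add_closed\<close>)

text \<open>Exactly, the coefficient of \<open>wt m x\<close> is \<open>\<phi>\<close> of the
  previous ghost component of \<open>y\<close>. Replacing it by \<open>gh m y\<close>, as the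
  Leibniz rule demands, costs a multiple of \<open>p ^ m\<close>; hence the second coordinates live
  in \<open>A/p^m\<close>.\<close>

lemma wt_mult:
  assumes x: "x \<in> carrier (Wn n)" and y: "y \<in> carrier (Wn n)" and m: "m < n"
  shows "pcong m (wt m (x \<otimes>\<^bsub>Wn n\<^esub> y)) (gh m x \<otimes> wt m y \<oplus> gh m y \<otimes> wt m x)"
proof -
  have c: "gh (m - 1) x \<in> carrier A" "gh (m - 1) y \<in> carrier A" "m - 1 < n" "gh m x \<in> carrier A" "gh m y \<in> carrier A"
    "wt m x \<in> carrier A" "wt m y \<in> carrier A" "\<phi> (gh (m - 1) x) \<in> carrier A" "\<phi> (gh (m - 1) y) \<in> carrier A"
    using assms wt_closed by auto
  let ?u = "gh m x" and ?v = "\<phi> (gh (m - 1) x)" and ?v' = "\<phi> (gh (m - 1) y)"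
  have e: "gh m y = ?v' \<oplus> [(p ^ m)] \<cdot> wt m y" "?u = ?v \<oplus> [(p ^ m)] \<cdot> wt m x"
    by (rule wt_eq[OF y m], rule wt_eq[OF x m])
  have "wt m (x \<otimes>\<^bsub>Wn n\<^esub> y) = ?u \<otimes> wt m y \<oplus> ?v' \<otimes> wt m x"
  proof (rule wtI[OF _ m])
    have "?u \<otimes> gh m y = ?u \<otimes> ?v' \<oplus> ?u \<otimes> ([(p ^ m)] \<cdot> wt m y)" using c by (subst e(1)) (simp add: r_distr)
    also have "?u \<otimes> ?v' = ?v \<otimes> ?v' \<oplus> [(p ^ m)] \<cdot> wt m x \<otimes> ?v'" using c by (subst e(2)) (simp add: l_distr)
    finally show "gh m (x \<otimes>\<^bsub>Wn n\<^esub> y) = \<phi> (gh (m - 1) (x \<otimes>\<^bsub>Wn n\<^esub> y)) \<oplus> [(p ^ m)] \<cdot> (?u \<otimes> wt m y \<oplus> ?v' \<otimes> wt m x)"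
      using c assms by (simp add: gh_mult add.nat_pow_distrib add_pow_ldistr add_pow_rdistr a_ac m_ac)
  qed (use assms c in \<open>auto intro!: witt_mult_closed\<close>)
  moreover have "pcong m (wt m x \<otimes> ?v') (wt m x \<otimes> gh m y)"
  proof (rule pcong_mult_left)
    show "pcong m ?v' (gh m y)" by (rule pcong_sym[OF pcongI[OF c(7) e(1)]]) (use c in simp)
  qed (use c in auto)
  then have "pcong m (?u \<otimes> wt m y \<oplus> wt m x \<otimes> ?v') (?u \<otimes> wt m y \<oplus> wt m x \<otimes> gh m y)"
    using c by (intro pcong_add) auto
  ultimately show ?thesis using c by (simp add: m_comm)
qed

definition DD :: "nat \<Rightarrow> (nat \<Rightarrow> 'a) \<Rightarrow> nat \<Rightarrow> ('a \<Rightarrow> 'a) set \<times> 'a set" where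
  "DD n x = mk n (\<lambda>m. pdiv m (dd (gh m x))) (\<lambda>m. wt m x)"

text \<open>A shift without any factor: \<open>DD\<close> divides the \<open>m\<close>-th
  differential by \<open>p ^ m\<close>, so that shifting by one component already accounts for the
  \<open>p\<close> in \<open>p F d = d F\<close>.\<close>

definition FF :: "nat \<Rightarrow> (nat \<Rightarrow> ('a \<Rightarrow> 'a) set \<times> 'a set) \<Rightarrow> nat \<Rightarrow> ('a \<Rightarrow> 'a) set \<times> 'a set" where
  "FF n \<omega> = mk n (\<lambda>m. fst (\<omega> (Suc m))) (\<lambda>m. rep (Suc m) (snd (\<omega> (Suc m))))"

definition VV :: "nat \<Rightarrow> (nat \<Rightarrow> ('a \<Rightarrow> 'a) set \<times> 'a set) \<Rightarrow> nat \<Rightarrow> ('a \<Rightarrow> 'a) set \<times> 'a set" where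
  "VV n \<omega> = mk (Suc n) (case_nat \<zero>\<^bsub>\<Omega>\<^esub> (\<lambda>m. [p] \<cdot>\<^bsub>\<Omega>\<^esub> fst (\<omega> m))) (case_nat \<zero> (\<lambda>m. [p] \<cdot> rep m (snd (\<omega> m))))"

definition RR :: "nat \<Rightarrow> (nat \<Rightarrow> ('a \<Rightarrow> 'a) set \<times> 'a set) \<Rightarrow> nat \<Rightarrow> ('a \<Rightarrow> 'a) set \<times> 'a set" where
  "RR n \<omega> = restrict \<omega> {..<n}"

lemma FF_mk:
  assumes "\<And>m. m < Suc n \<Longrightarrow> t m \<in> carrier A"
  shows "FF n (mk (Suc n) \<alpha> t) = mk n (\<lambda>m. \<alpha> (Suc m)) (\<lambda>m. t (Suc m))"
  unfolding FF_def
proof (rule mk_cong)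
  fix m assume "m < n"
  then show "pcong m (rep (Suc m) (snd (mk (Suc n) \<alpha> t (Suc m)))) (t (Suc m))"
    using pcong_mono[OF rep(2)[OF assms[of "Suc m"]], of m] by (simp add: mk_def)
qed (simp_all add: mk_def assms rep(1))

lemma VV_mk:
  assumes "\<And>m. m < n \<Longrightarrow> t m \<in> carrier A"
  shows "VV n (mk n \<alpha> t) = mk (Suc n) (case_nat \<zero>\<^bsub>\<Omega>\<^esub> (\<lambda>m. [p] \<cdot>\<^bsub>\<Omega>\<^esub> \<alpha> m)) (case_nat \<zero> (\<lambda>m. [p] \<cdot> t m))"
  unfolding VV_def
proof (rule mk_cong)
  fix m assume "m < Suc n"
  then show "pcong m (case m of 0 \<Rightarrow> \<zero> | Suc m \<Rightarrow> [p] \<cdot> rep m (snd (mk n \<alpha> t m))) (case m of 0 \<Rightarrow> \<zero> | Suc m \<Rightarrow> [p] \<cdot> t m)"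
  proof (cases m)
    case (Suc l)
    then have l: "l < n" using \<open>m < Suc n\<close> by simp
    have "pcong (1 + l) ([(p ^ 1)] \<cdot> rep l (cl l (t l))) ([(p ^ 1)] \<cdot> t l)"
      using assms[OF l] by (intro pcong_scale rep)
    then show ?thesis using Suc l by (simp add: mk_def)
  qed simp
qed (auto simp: mk_def assms rep(1) split: nat.splits)

lemma RR_mk: "RR n (mk (Suc n) \<alpha> t) = mk n \<alpha> t"
  unfolding RR_def mk_def by (auto simp: restrict_def)

lemma DD_derivation: "derivation (Wn n) (Wn n) (NN n) (\<lambda>x. x) (DD n)"
proof (intro derivation.intro derivation_axioms.intro Wn_cring NN_module)
  note c = witt_add_closed[of "{..<n}"] witt_mult_closed[of "{..<n}"]
  fix x y assume xy: "x \<in> carrier (Wn n)" "y \<in> carrier (Wn n)"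
  show "DD n (x \<oplus>\<^bsub>Wn n\<^esub> y) = DD n x \<oplus>\<^bsub>NN n\<^esub> DD n y"
    unfolding DD_def using xy c
    by (subst mk_add) (auto intro!: mk_cong wt_closed simp: gh_add kaehler_d_add pdiv_add wt_add)
  show "DD n (x \<otimes>\<^bsub>Wn n\<^esub> y) = x \<odot>\<^bsub>NN n\<^esub> DD n y \<oplus>\<^bsub>NN n\<^esub> y \<odot>\<^bsub>NN n\<^esub> DD n x"
  proof -
    have w: "wt m x \<in> carrier A" "wt m y \<in> carrier A" "wt m (x \<otimes>\<^bsub>Wn n\<^esub> y) \<in> carrier A" if "m < n" for m
      using wt_closed[OF xy(1) that] wt_closed[OF xy(2) that] wt_closed[OF _ that, of "x \<otimes>\<^bsub>Wn n\<^esub> y"] c(2) xy by auto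
    have "x \<odot>\<^bsub>NN n\<^esub> DD n y \<oplus>\<^bsub>NN n\<^esub> y \<odot>\<^bsub>NN n\<^esub> DD n x =
        mk n (\<lambda>m. gh m x \<odot>\<^bsub>\<Omega>\<^esub> pdiv m (dd (gh m y)) \<oplus>\<^bsub>\<Omega>\<^esub> gh m y \<odot>\<^bsub>\<Omega>\<^esub> pdiv m (dd (gh m x)))
          (\<lambda>m. gh m x \<otimes> wt m y \<oplus> gh m y \<otimes> wt m x)"
      unfolding DD_def using xy w by (simp add: mk_smult mk_add)
    also have "\<dots> = DD n (x \<otimes>\<^bsub>Wn n\<^esub> y)"
      unfolding DD_def using xy c w pcong_sym[OF wt_mult[OF xy]]
      by (intro mk_cong) (auto simp: gh_mult kaehler_d_mult pdiv_add pdiv_smult)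
    finally show ?thesis by simp
  qed
qed (auto intro!: ring_hom_memI mk_closed pdiv_closed wt_closed simp: DD_def)

text \<open>Second coordinate of the rule for \<open>F d[a]\<close>. Let \<open>u = a^(p^m)\<close>
  and \<open>u = v + p^m t\<close> with \<open>v = \<phi>(a^(p^(m-1)))\<close>; then
  \<open>v^p = \<phi>(u)\<close>, so \<open>u^p = v^p + p^(m+1) t'\<close>. Expanding
  \<open>v^p = (u - p^m t)^p\<close> modulo \<open>p^(2m+1)\<close> and cancelling
  \<open>p^(m+1)\<close> gives \<open>t' = u^(p-1) t\<close> modulo \<open>p^m\<close>.\<close>

lemma wt_teich:
  assumes a: "a \<in> carrier A" and m: "Suc m < n" and m': "m < n'"
  shows "pcong m (wt (Suc m) (teichmueller {..<n} A a)) ((a [^] (p ^ m)) [^] (p - 1) \<otimes> wt m (teichmueller {..<n'} A a))"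
proof (cases "m = 0")
  case True
  have "wt 0 (teichmueller {..<n'} A a) \<in> carrier A" "wt (Suc 0) (teichmueller {..<n} A a) \<in> carrier A"
    using a m' m True by (auto intro!: wt_closed teich_closed)
  then show ?thesis using a True by (simp add: pcong_0)
next
  case False
  let ?x = "teichmueller {..<n} A a" and ?x' = "teichmueller {..<n'} A a"
  have x: "?x \<in> carrier (Wn n)" "?x' \<in> carrier (Wn n')" using a by (auto intro: teich_closed)
  define u v t t' where "u = a [^] (p ^ m)" "v = \<phi> (a [^] (p ^ (m - 1)))" "t = wt m ?x'" "t' = wt (Suc m) ?x"
  note defs = this
  have c: "u \<in> carrier A" "v \<in> carrier A" "t \<in> carrier A" "t' \<in> carrier A"
    using a x m m' unfolding defs by (auto intro: wt_closed)
  have g: "gh i ?x = a [^] (p ^ i)" if "i < n" for i using gh_teich[of "{..<n}" a i] a that by simp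
  have g': "gh i ?x' = a [^] (p ^ i)" if "i < n'" for i using gh_teich[of "{..<n'}" a i] a that by simp
  have uv: "u = v \<oplus> [(p ^ m)] \<cdot> t"
    using wt_eq[OF x(2) m'] g'[of m] g'[of "m - 1"] m' unfolding defs by simp
  have vp: "v [^] p = \<phi> u"
    using a False unfolding defs by (simp add: phi.hom_nat_pow nat_pow_pow flip: power_Suc2)
  have up: "u [^] p = v [^] p \<oplus> [(p ^ Suc m)] \<cdot> t'"
    using wt_eq[OF x(1) m] g[of m] g[of "Suc m"] m a unfolding vp unfolding defs by (simp add: nat_pow_pow mult.commute)
  define h where "h = [(p ^ m)] \<cdot> (\<ominus> t)"
  have h: "h \<in> carrier A" "v = u \<oplus> h" unfolding h_def uv using c by (simp_all add: add_pow_minus a_assoc r_neg)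
  obtain d where d: "d \<in> carrier A" "v [^] p = u [^] p \<oplus> [p] \<cdot> (u [^] (p - 1) \<otimes> h) \<oplus> [p] \<cdot> (h \<otimes> h \<otimes> d) \<oplus> h [^] p"
    using pow_add_prime[OF prime_p c(1) h(1)] h(2) by auto
  have pow: "([k] \<cdot> b) [^] l = [(k ^ l)] \<cdot> (b [^] l)" if "b \<in> carrier A" for b and k l :: nat
    using that by (induction l) (simp_all add: add_pow_ldistr add_pow_rdistr add_pow_mult mult.commute)
  \<comment> \<open>\<open>h ^ p\<close> is divisible by \<open>p ^ (m * p)\<close>, and
    \<open>m * p\<close> is at least \<open>2 m + 1\<close> since \<open>m\<close> is positive and
    \<open>p\<close> is at least 3; the bound fails for \<open>p = 2\<close>.\<close>
  have "m * 3 \<le> m * p" using p_ge_3 by simp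
  then have "Suc m + m \<le> m * p" using False by linarith
  then have e: "(p ^ m) ^ p = p ^ Suc m * (p ^ m * p ^ (m * p - (Suc m + m)))"
    by (simp only: power_mult[symmetric] power_add[symmetric] add.assoc[symmetric] le_add_diff_inverse)
  define r where "r = t \<otimes> t \<otimes> d \<oplus> [(p ^ (m * p - (Suc m + m)))] \<cdot> ((\<ominus> t) [^] p)"
  have r: "r \<in> carrier A" unfolding r_def using c d by simp
  have hp: "h [^] p = [(p ^ Suc m)] \<cdot> ([(p ^ m)] \<cdot> ([(p ^ (m * p - (Suc m + m)))] \<cdot> ((\<ominus> t) [^] p)))"
    using c unfolding h_def by (simp only: pow a_inv_closed e add_pow_mult add.nat_pow_closed nat_pow_closed)
  have hh: "[p] \<cdot> (h \<otimes> h \<otimes> d) = [(p ^ Suc m)] \<cdot> ([(p ^ m)] \<cdot> (t \<otimes> t \<otimes> d))"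
    using c d unfolding h_def
    by (simp add: add_pow_ldistr add_pow_rdistr add_pow_mult l_minus r_minus add_pow_minus mult.assoc)
  have h1: "[p] \<cdot> (u [^] (p - 1) \<otimes> h) = \<ominus> ([(p ^ Suc m)] \<cdot> (u [^] (p - 1) \<otimes> t))"
    using c unfolding h_def by (simp add: add_pow_rdistr add_pow_mult r_minus add_pow_minus)
  have "[(p ^ Suc m)] \<cdot> (t' \<oplus> [(p ^ m)] \<cdot> r) = [(p ^ Suc m)] \<cdot> (u [^] (p - 1) \<otimes> t)"
  proof -
    have "u [^] p = u [^] p \<oplus> (\<ominus> ([(p ^ Suc m)] \<cdot> (u [^] (p - 1) \<otimes> t)) \<oplus> [(p ^ Suc m)] \<cdot> ([(p ^ m)] \<cdot> r) \<oplus> [(p ^ Suc m)] \<cdot> t')"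
      using up unfolding d(2) h1 hh hp r_def using c d by (simp add: add.nat_pow_distrib a_assoc del: power_Suc)
    then have "\<ominus> ([(p ^ Suc m)] \<cdot> (u [^] (p - 1) \<otimes> t)) \<oplus> ([(p ^ Suc m)] \<cdot> ([(p ^ m)] \<cdot> r) \<oplus> [(p ^ Suc m)] \<cdot> t') = \<zero>"
      using c r by (simp add: a_assoc del: power_Suc)
    then have "\<ominus> (\<ominus> ([(p ^ Suc m)] \<cdot> (u [^] (p - 1) \<otimes> t))) = [(p ^ Suc m)] \<cdot> ([(p ^ m)] \<cdot> r) \<oplus> [(p ^ Suc m)] \<cdot> t'"
      using c r by (intro minus_equality) (simp_all add: a_comm del: power_Suc)
    then show ?thesis using c r by (simp add: add.nat_pow_distrib a_comm del: power_Suc)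
  qed
  from p_pow_cancel[OF _ _ this] have "u [^] (p - 1) \<otimes> t = t' \<oplus> [(p ^ m)] \<cdot> r" using c r by simp
  then have "pcong m (u [^] (p - 1) \<otimes> t) t'" using r by (intro pcongI)
  then show ?thesis using c pcong_sym unfolding defs by blast
qed

lemma witt_deriv_NN: "witt_deriv A p \<phi> NN DD FF VV"
proof (intro witt_deriv.intro witt_deriv_axioms.intro frob_aut_axioms DD_derivation)
  fix n \<omega> assume "\<omega> \<in> carrier (NN (Suc n))"
  then show "FF n \<omega> \<in> carrier (NN n)" by (elim NN_E) (auto simp: FF_mk intro!: mk_closed)
next
  fix n \<omega> \<eta> assume "\<omega> \<in> carrier (NN (Suc n))" "\<eta> \<in> carrier (NN (Suc n))"
  then show "FF n (\<omega> \<oplus>\<^bsub>NN (Suc n)\<^esub> \<eta>) = FF n \<omega> \<oplus>\<^bsub>NN n\<^esub> FF n \<eta>"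
    by (elim NN_E) (simp add: FF_mk mk_add)
next
  fix n x \<omega> assume x: "x \<in> carrier (Wn (Suc n))" and w0: "\<omega> \<in> carrier (NN (Suc n))"
  obtain \<alpha> t where w: "\<And>m. m < Suc n \<Longrightarrow> \<alpha> m \<in> carrier \<Omega>" "\<And>m. m < Suc n \<Longrightarrow> t m \<in> carrier A" "\<omega> = mk (Suc n) \<alpha> t" using NN_ex[OF w0] by blast
  show "FF n (x \<odot>\<^bsub>NN (Suc n)\<^esub> \<omega>) = Fr n x \<odot>\<^bsub>NN n\<^esub> FF n \<omega>"
    unfolding w(3) using x w(1,2) by (simp add: FF_mk mk_smult) (auto intro!: mk_cong simp: gh_Fr)
next
  fix n \<omega> assume "\<omega> \<in> carrier (NN n)"
  then show "VV n \<omega> \<in> carrier (NN (Suc n))" by (elim NN_E) (auto simp: VV_mk intro!: mk_closed split: nat.splits)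
next
  fix n \<omega> \<eta> assume "\<omega> \<in> carrier (NN n)" "\<eta> \<in> carrier (NN n)"
  then obtain \<alpha> t where w1: "\<And>m. m < n \<Longrightarrow> \<alpha> m \<in> carrier \<Omega>" "\<And>m. m < n \<Longrightarrow> t m \<in> carrier A" "\<omega> = mk n \<alpha> t"
    using NN_ex by blast
  from \<open>\<eta> \<in> carrier (NN n)\<close> obtain \<beta> u
    where w2: "\<And>m. m < n \<Longrightarrow> \<beta> m \<in> carrier \<Omega>" "\<And>m. m < n \<Longrightarrow> u m \<in> carrier A" "\<eta> = mk n \<beta> u" using NN_ex by blast
  note w = w1 w2
  show "VV n (\<omega> \<oplus>\<^bsub>NN n\<^esub> \<eta>) = VV n \<omega> \<oplus>\<^bsub>NN (Suc n)\<^esub> VV n \<eta>"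
    unfolding w(3,6) using w(1,2,4,5)
    by (subst mk_add, simp, simp, subst (1 2 3) VV_mk, simp, simp, simp, subst mk_add)
      (auto intro!: mk_cong simp: Om.add_pow_add add.nat_pow_distrib split: nat.splits)
next
  fix n x \<omega> assume x: "x \<in> carrier (Wn (Suc n))" and w0: "\<omega> \<in> carrier (NN n)"
  obtain \<alpha> t where w: "\<And>m. m < n \<Longrightarrow> \<alpha> m \<in> carrier \<Omega>" "\<And>m. m < n \<Longrightarrow> t m \<in> carrier A" "\<omega> = mk n \<alpha> t" using NN_ex[OF w0] by blast
  show "VV n (Fr n x \<odot>\<^bsub>NN n\<^esub> \<omega>) = x \<odot>\<^bsub>NN (Suc n)\<^esub> VV n \<omega>"
  proof -
    have g: "gh m (Fr n x) \<in> carrier A" if "m < n" for m by (rule gh_ghc[OF Fr_closed[OF x] that])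
    have 1: "Fr n x \<odot>\<^bsub>NN n\<^esub> mk n \<alpha> t = mk n (\<lambda>m. gh m (Fr n x) \<odot>\<^bsub>\<Omega>\<^esub> \<alpha> m) (\<lambda>m. gh m (Fr n x) \<otimes> t m)"
      using x w(1,2) by (intro mk_smult) auto
    have 2: "VV n (mk n \<alpha> t) = mk (Suc n) (case_nat \<zero>\<^bsub>\<Omega>\<^esub> (\<lambda>m. [p] \<cdot>\<^bsub>\<Omega>\<^esub> \<alpha> m)) (case_nat \<zero> (\<lambda>m. [p] \<cdot> t m))"
      using w by (intro VV_mk) auto
    have 3: "VV n (mk n (\<lambda>m. gh m (Fr n x) \<odot>\<^bsub>\<Omega>\<^esub> \<alpha> m) (\<lambda>m. gh m (Fr n x) \<otimes> t m)) =
        mk (Suc n) (case_nat \<zero>\<^bsub>\<Omega>\<^esub> (\<lambda>m. [p] \<cdot>\<^bsub>\<Omega>\<^esub> (gh m (Fr n x) \<odot>\<^bsub>\<Omega>\<^esub> \<alpha> m))) (case_nat \<zero> (\<lambda>m. [p] \<cdot> (gh m (Fr n x) \<otimes> t m)))"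
      using w g by (intro VV_mk) auto
    have 4: "x \<odot>\<^bsub>NN (Suc n)\<^esub> mk (Suc n) (case_nat \<zero>\<^bsub>\<Omega>\<^esub> (\<lambda>m. [p] \<cdot>\<^bsub>\<Omega>\<^esub> \<alpha> m)) (case_nat \<zero> (\<lambda>m. [p] \<cdot> t m)) =
        mk (Suc n) (\<lambda>m. gh m x \<odot>\<^bsub>\<Omega>\<^esub> case_nat \<zero>\<^bsub>\<Omega>\<^esub> (\<lambda>m. [p] \<cdot>\<^bsub>\<Omega>\<^esub> \<alpha> m) m) (\<lambda>m. gh m x \<otimes> case_nat \<zero> (\<lambda>m. [p] \<cdot> t m) m)"
      using x w by (intro mk_smult) (auto split: nat.splits)
    show ?thesis
      unfolding w(3) 1 2 3 4 using x w(1,2) g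
      by (intro mk_cong) (auto simp: gh_Fr Om.smult_add_pow_right add_pow_rdistr split: nat.splits)
  qed
next
  fix n y \<omega> assume y: "y \<in> carrier (Wn n)" and w0: "\<omega> \<in> carrier (NN (Suc n))"
  obtain \<alpha> t where w: "\<And>m. m < Suc n \<Longrightarrow> \<alpha> m \<in> carrier \<Omega>" "\<And>m. m < Suc n \<Longrightarrow> t m \<in> carrier A" "\<omega> = mk (Suc n) \<alpha> t" using NN_ex[OF w0] by blast
  show "VV n (y \<odot>\<^bsub>NN n\<^esub> FF n \<omega>) = Ve n y \<odot>\<^bsub>NN (Suc n)\<^esub> \<omega>"
  proof -
    have g: "gh m y \<in> carrier A" if "m < n" for m by (rule gh_ghc[OF y that])
    have 1: "FF n (mk (Suc n) \<alpha> t) = mk n (\<lambda>m. \<alpha> (Suc m)) (\<lambda>m. t (Suc m))" using w by (intro FF_mk) auto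
    have 2: "y \<odot>\<^bsub>NN n\<^esub> mk n (\<lambda>m. \<alpha> (Suc m)) (\<lambda>m. t (Suc m)) =
        mk n (\<lambda>m. gh m y \<odot>\<^bsub>\<Omega>\<^esub> \<alpha> (Suc m)) (\<lambda>m. gh m y \<otimes> t (Suc m))"
      using y w by (intro mk_smult) auto
    have 3: "VV n (mk n (\<lambda>m. gh m y \<odot>\<^bsub>\<Omega>\<^esub> \<alpha> (Suc m)) (\<lambda>m. gh m y \<otimes> t (Suc m))) =
        mk (Suc n) (case_nat \<zero>\<^bsub>\<Omega>\<^esub> (\<lambda>m. [p] \<cdot>\<^bsub>\<Omega>\<^esub> (gh m y \<odot>\<^bsub>\<Omega>\<^esub> \<alpha> (Suc m)))) (case_nat \<zero> (\<lambda>m. [p] \<cdot> (gh m y \<otimes> t (Suc m))))"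
      using w g by (intro VV_mk) auto
    have 4: "Ve n y \<odot>\<^bsub>NN (Suc n)\<^esub> mk (Suc n) \<alpha> t = mk (Suc n) (\<lambda>m. gh m (Ve n y) \<odot>\<^bsub>\<Omega>\<^esub> \<alpha> m) (\<lambda>m. gh m (Ve n y) \<otimes> t m)"
      using y w by (intro mk_smult) auto
    have g': "gh m (Ve n y) \<in> carrier A" if "m < Suc n" for m by (rule gh_ghc[OF Ve_closed[OF y] that])
    show ?thesis
      unfolding w(3) 1 2 3 4 using y w(1,2) g g'
      by (intro mk_cong) (auto simp: gh_Ve_0 gh_Ve_Suc Om.smult_add_pow_left add_pow_ldistr split: nat.splits)
  qed
next
  fix n y assume y: "y \<in> carrier (Wn n)"
  have Vy: "Ve n y \<in> carrier (Wn (Suc n))" using y by simp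
  \<comment> \<open>The two ghost components of \<open>V(y)\<close> involved are \<open>p\<close>
    times those of \<open>y\<close>, so the same \<open>c\<close> works one index higher. This needs
    a component of \<open>y\<close> before the \<open>m\<close>-th one; for \<open>m = 0\<close>
    both values agree modulo \<open>p ^ 0\<close>.\<close>
  have "wt (Suc m) (Ve n y) = wt m y" if "m < n" "m \<noteq> 0" for m
  proof -
    from that(2) obtain l where l: "m = Suc l" by (cases m) auto
    have c: "gh l y \<in> carrier A" "wt (Suc l) y \<in> carrier A" using y that l wt_closed[OF y that(1)] by auto
    show ?thesis
    proof (rule wtI[OF Vy])
      show "gh (Suc m) (Ve n y) = \<phi> (gh (Suc m - 1) (Ve n y)) \<oplus> [(p ^ Suc m)] \<cdot> wt m y"
        using y that wt_eq[OF y that(1)] l c by (simp add: gh_Ve_Suc add.nat_pow_distrib phi.hom_add_pow add_pow_mult)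
    qed (use that wt_closed[OF y that(1)] in auto)
  qed
  moreover have "wt m y \<in> carrier A" "wt (Suc m) (Ve n y) \<in> carrier A" if "m < n" for m
    using wt_closed[OF y that] wt_closed[OF Vy, of "Suc m"] that by auto
  ultimately have "pcong m (wt (Suc m) (Ve n y)) (wt m y)" if "m < n" for m
    using that by (cases "m = 0") (simp_all add: pcong_0)
  then show "FF n (DD (Suc n) (Ve n y)) = DD n y"
    unfolding DD_def using y wt_closed[OF y] wt_closed[OF Vy] gh_ghc[OF y]
    by (subst FF_mk) (auto intro!: mk_cong simp: gh_Ve_Suc kaehler_d_add_pow pdiv_Suc_p)
next
  show "carrier (NN 0) = {\<zero>\<^bsub>NN 0\<^esub>}" by (auto simp: NN_simps)
qed

lemma trunc_complex_NN:
  assumes "\<And>n. inj_on (e0 n) (carrier (Wn n))" "\<And>n. inj_on (e1 n) (carrier (NN n))"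
  shows "trunc_complex A p \<phi> NN DD FF VV RR e0 e1"
proof (intro trunc_complex.intro trunc_complex_axioms.intro witt_deriv_NN assms)
  have rc: "restrict x {..<n} \<in> carrier (Wn n)" if "x \<in> carrier (Wn (Suc n))" for x n
    using ring_hom_closed[OF restrict_hom that] .
  have rg: "gh m (restrict x {..<n}) = gh m x" if "x \<in> carrier (Wn (Suc n))" "m < n" for x n m
    using that by (intro gh_restrict[of _ "{..<Suc n}"]) auto
  {
    fix n \<omega> assume "\<omega> \<in> carrier (NN (Suc n))"
    then show "RR n \<omega> \<in> carrier (NN n)" by (elim NN_E) (auto simp: RR_mk intro!: mk_closed)
  next
    fix n \<omega> \<eta> assume "\<omega> \<in> carrier (NN (Suc n))" "\<eta> \<in> carrier (NN (Suc n))"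
    then show "RR n (\<omega> \<oplus>\<^bsub>NN (Suc n)\<^esub> \<eta>) = RR n \<omega> \<oplus>\<^bsub>NN n\<^esub> RR n \<eta>"
      by (elim NN_E) (simp add: RR_mk mk_add)
  next
    fix n x \<omega> assume x: "x \<in> carrier (Wn (Suc n))" and w0: "\<omega> \<in> carrier (NN (Suc n))"
    obtain \<alpha> t where w: "\<And>m. m < Suc n \<Longrightarrow> \<alpha> m \<in> carrier \<Omega>" "\<And>m. m < Suc n \<Longrightarrow> t m \<in> carrier A" "\<omega> = mk (Suc n) \<alpha> t" using NN_ex[OF w0] by blast
    show "RR n (x \<odot>\<^bsub>NN (Suc n)\<^esub> \<omega>) = restrict x {..<n} \<odot>\<^bsub>NN n\<^esub> RR n \<omega>"
      unfolding w(3) using x w(1,2) by (simp add: RR_mk mk_smult rc) (auto intro!: mk_cong simp: rg)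
  next
    fix n x assume x: "x \<in> carrier (Wn (Suc n))"
    have "wt m (restrict x {..<n}) = wt m x" if "m < n" for m using x that by (simp add: wt_def rg)
    then show "RR n (DD (Suc n) x) = DD n (restrict x {..<n})"
      unfolding DD_def using x rc[OF x] by (auto intro!: mk_cong wt_closed simp: RR_mk rg)
  next
    fix n \<omega> assume "\<omega> \<in> carrier (NN (Suc (Suc n)))"
    then show "FF n (RR (Suc n) \<omega>) = RR n (FF (Suc n) \<omega>)" by (elim NN_E) (simp add: RR_mk FF_mk)
  next
    fix n \<omega> assume "\<omega> \<in> carrier (NN (Suc n))"
    then show "VV n (RR n \<omega>) = RR (Suc n) (VV (Suc n) \<omega>)" by (elim NN_E) (simp add: RR_mk VV_mk)
  next
    fix n \<omega> assume "\<omega> \<in> carrier (NN n)"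
    then obtain \<alpha> t where w: "\<And>m. m < n \<Longrightarrow> \<alpha> m \<in> carrier \<Omega>" "\<And>m. m < n \<Longrightarrow> t m \<in> carrier A" "\<omega> = mk n \<alpha> t" using NN_ex by blast
    show "FF n (VV n \<omega>) = [p] \<cdot>\<^bsub>NN n\<^esub> \<omega>"
      unfolding w(3) using w(1,2) by (subst VV_mk, simp, subst FF_mk) (auto simp: mk_add_pow split: nat.splits)
  next
    fix n a assume a: "a \<in> carrier A"
    let ?x = "teichmueller {..<Suc n} A a" and ?y = "teichmueller {..<n} A a"
    have x: "?x \<in> carrier (Wn (Suc n))" "?y \<in> carrier (Wn n)" using a by (auto intro: teich_closed)
    interpret Wn: cring "Wn n" by (rule Wn_cring)
    have yp: "?y [^]\<^bsub>Wn n\<^esub> (p - 1) \<in> carrier (Wn n)" using x by simp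
    have gy: "gh m (?y [^]\<^bsub>Wn n\<^esub> (p - 1)) = (a [^] (p ^ m)) [^] (p - 1)" if "m < n" for m
      using a that x gh_teich[of "{..<n}" a m] by (simp add: gh_pow)
    have pd: "pdiv m (dd (a [^] (p ^ m))) = a [^] (p ^ m - 1) \<odot>\<^bsub>\<Omega>\<^esub> dd a" for m
      using a by (simp add: kaehler_d_pow pdiv_p_pow)
    \<comment> \<open>First coordinate of the Teichmueller rule. Since
      \<open>d(a^(p^m)) / p^m = a^(p^m - 1) da\<close>, it amounts to an identity between
      exponents.\<close>
    have "pdiv (Suc m) (dd (gh (Suc m) ?x)) = (a [^] (p ^ m)) [^] (p - 1) \<odot>\<^bsub>\<Omega>\<^esub> pdiv m (dd (gh m ?y))" if "m < n" for m
    proof -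
      have "p ^ m * (p - 1) + (p ^ m - 1) = p ^ Suc m - 1"
      proof -
        have "p ^ m > 0" "p > 0" using p_gt_0 by auto
        then have "p ^ m * (p - 1) + p ^ m = p ^ m * p" by (simp add: algebra_simps)
        moreover have "a + (x - 1) = y - 1" if "a + x = y" "x > 0" for a x y :: nat using that by linarith
        ultimately show ?thesis using \<open>p ^ m > 0\<close> by (metis power_Suc2)
      qed
      then have "a [^] (p ^ m * (p - 1)) \<otimes> a [^] (p ^ m - 1) = a [^] (p ^ Suc m - 1)"
        using a by (simp only: nat_pow_mult)
      then show ?thesis
        using a that gh_teich[of "{..<Suc n}" a "Suc m"] gh_teich[of "{..<n}" a m]
        by (simp only: pd initial_seg_lessThan lessThan_iff Suc_less_eq) (simp add: pd nat_pow_pow flip: Om.smult_assoc1 del: power_Suc)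
    qed
    then show "FF n (DD (Suc n) ?x) = (?y [^]\<^bsub>Wn n\<^esub> (p - 1)) \<odot>\<^bsub>NN n\<^esub> DD n ?y"
      unfolding DD_def using a x yp gy wt_teich[OF a]
      by (subst FF_mk, (auto intro: wt_closed)[1], subst mk_smult)
        (auto intro!: mk_cong wt_closed)
  }
qed

interpretation NN: witt_deriv A p \<phi> NN DD FF VV
  by (rule witt_deriv_NN)

lemma cl_0: "a \<in> carrier A \<Longrightarrow> b \<in> carrier A \<Longrightarrow> cl 0 a = cl 0 b"
  by (simp add: cl_eq_iff pcong_0)

lemma pdiv_0: "\<alpha> \<in> carrier \<Omega> \<Longrightarrow> pdiv 0 \<alpha> = \<alpha>"
  by (rule pdiv_eqI) auto

lemma DD_comp: "m < n \<Longrightarrow> DD n x m = (pdiv m (dd (gh m x)), cl m (wt m x))"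
  by (simp add: DD_def mk_def)

lemma VV_comp:
  "VV n \<omega> 0 = (\<zero>\<^bsub>\<Omega>\<^esub>, cl 0 \<zero>)"
  "m < n \<Longrightarrow> VV n \<omega> (Suc m) = ([p] \<cdot>\<^bsub>\<Omega>\<^esub> fst (\<omega> m), cl (Suc m) ([p] \<cdot> rep m (snd (\<omega> m))))"
  by (simp_all add: VV_def mk_def)

lemma NN_snd_0: "\<omega> \<in> carrier (NN n) \<Longrightarrow> 0 < n \<Longrightarrow> snd (\<omega> 0) = cl 0 \<zero>"
proof -
  assume \<omega>: "\<omega> \<in> carrier (NN n)" and n: "0 < n"
  obtain \<alpha> t where t: "\<forall>m<n. t m \<in> carrier A" "\<omega> = mk n \<alpha> t" using NN_ex[OF \<omega>] by blast
  have "snd (\<omega> 0) = cl 0 (t 0)" using n t(2) by (simp add: mk_def)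
  also have "\<dots> = cl 0 \<zero>" using n t(1) by (intro cl_0) auto
  finally show ?thesis .
qed

text \<open>The zeroth ghost component of \<open>s_phi(a)\<close> is \<open>a\<close>, so the zeroth
  component of the test complex recovers \<alpha>.\<close>

lemma NN_sN_0:
  assumes "\<alpha> \<in> carrier \<Omega>" "0 < n"
  shows "NN.sN n \<alpha> 0 = (\<alpha>, cl 0 \<zero>)"
proof -
  have "fst (NN.sN n \<alpha> 0) = \<alpha>"
    using assms(1)
  proof (induction rule: kaehler_induct)
    case zero
    then show ?case using assms(2) by (simp add: NN.sN_zero NN_simps)
  next
    case (gen a b)
    then show ?case using assms(2)
      by (simp add: NN.sN_smult NN.sN_d NN_simps DD_comp gh_sec pdiv_0)
  next
    case (add \<alpha> \<beta>)
    then show ?case using assms(2) by (simp add: NN.sN_add NN_simps)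
  qed
  moreover have "snd (NN.sN n \<alpha> 0) = cl 0 \<zero>"
    using NN_snd_0[OF NN.sN_closed[OF assms(1)] assms(2)] .
  ultimately show ?thesis by (simp add: prod_eq_iff)
qed

lemma NN_Vp:
  assumes \<omega>: "\<omega> \<in> carrier (NN m)" and m: "0 < m" and i: "i \<le> j"
  shows "NN.Vp m j \<omega> i = (if i < j then \<zero>\<^bsub>\<Omega>\<^esub> else [(p ^ j)] \<cdot>\<^bsub>\<Omega>\<^esub> fst (\<omega> 0), cl i \<zero>)"
  using i
proof (induction j arbitrary: i)
  case 0
  have "fst (\<omega> 0) \<in> carrier \<Omega>" using \<omega> m by (elim NN_E) (auto simp: mk_def)
  then show ?case using 0 NN_snd_0[OF \<omega> m] by (simp add: prod_eq_iff)
next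
  case (Suc j)
  have c: "fst (\<omega> 0) \<in> carrier \<Omega>" using \<omega> m by (elim NN_E) (auto simp: mk_def)
  \<comment> \<open>The lift chosen by \<open>rep\<close> for the zero class is some multiple of
    \<open>p ^ l\<close>; the extra factor \<open>p\<close> kills it modulo
    \<open>p ^ Suc l\<close>.\<close>
  have r: "cl (Suc l) ([p] \<cdot> rep l (cl l \<zero>)) = cl (Suc l) \<zero>" for l
    using pcong_scale[OF rep(2)[of \<zero> l], of 1] rep(1)[of \<zero> l] by (simp add: cl_eq_iff)
  show ?case
  proof (cases i)
    case 0
    then show ?thesis by (simp add: VV_comp)
  next
    case (Suc l)
    then show ?thesis using Suc.prems Suc.IH[of l] m r c
      by (simp add: VV_comp Om.add_pow_pow)
  qed
qed

text \<open>The ghost components of \<open>x = V^j(s_phi(a))\<close> vanish below \<open>j\<close>,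
  and the \<open>j\<close>-th one is \<open>p^j a\<close>. So in component \<open>j\<close> the
  differential \<open>dx\<close> is \<open>(d(p^j a) / p^j, a)\<close>, while
  \<open>V^j(s_phi(\<alpha>))\<close> contributes \<open>p^j \<alpha>\<close> to the first
  entry.\<close>

lemma NN_T:
  assumes \<alpha>: "\<alpha> \<in> carrier \<Omega>" and a: "a \<in> carrier A" and m: "0 < m" and j: "0 < j"
  shows "i < j \<Longrightarrow> NN.T m j \<alpha> a i = (\<zero>\<^bsub>\<Omega>\<^esub>, cl i \<zero>)"
    and "NN.T m j \<alpha> a j = ([(p ^ j)] \<cdot>\<^bsub>\<Omega>\<^esub> \<alpha> \<oplus>\<^bsub>\<Omega>\<^esub> dd a, cl j a)"
proof -
  let ?x = "VW m j (sec m a)"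
  have x: "?x \<in> carrier (Wn (m + j))" using a by simp
  have g0: "gh i ?x = \<zero>" if "i < j" for i using that a by (simp add: gh_VW)
  have gj: "gh j ?x = [(p ^ j)] \<cdot> a" using a m by (simp add: gh_VW gh_sec)
  have T: "NN.T m j \<alpha> a i = (fst (NN.Vp m j (NN.sN m \<alpha>) i) \<oplus>\<^bsub>\<Omega>\<^esub> pdiv i (dd (gh i ?x)),
      snd (NN.Vp m j (NN.sN m \<alpha>) i) \<oplus>\<^bsub>tq i\<^esub> cl i (wt i ?x))" if "i < m + j" for i
    using that by (simp add: NN.T_def NN_simps DD_comp)
  have pd0: "pdiv i \<zero>\<^bsub>\<Omega>\<^esub> = \<zero>\<^bsub>\<Omega>\<^esub>" for i by (rule pdiv_eqI) auto
  note Vp = NN_Vp[OF NN.sN_closed[OF \<alpha>] m]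
  {
    assume i: "i < j"
    have "wt i ?x = \<zero>" using i m g0 by (intro wtI[OF x]) auto
    then show "NN.T m j \<alpha> a i = (\<zero>\<^bsub>\<Omega>\<^esub>, cl i \<zero>)"
      using i m T[of i] Vp[of i j] by (simp add: g0 kaehler_d_zero pd0 cl_add)
  }
  have "wt j ?x = a" using m j g0[of "j - 1"] gj a by (intro wtI[OF x]) auto
  then show "NN.T m j \<alpha> a j = ([(p ^ j)] \<cdot>\<^bsub>\<Omega>\<^esub> \<alpha> \<oplus>\<^bsub>\<Omega>\<^esub> dd a, cl j a)"
    using m T[of j] Vp[of j j] NN_sN_0[OF \<alpha> m] a by (simp add: gj kaehler_d_add_pow pdiv_p_pow cl_add)
qed

end

section \<open>The subcomplex generated in degree one\<close>

lemma abelian_subgroup_group: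
  assumes "abelian_group G" "S \<subseteq> carrier G" "\<zero>\<^bsub>G\<^esub> \<in> S"
    "\<And>x y. x \<in> S \<Longrightarrow> y \<in> S \<Longrightarrow> x \<oplus>\<^bsub>G\<^esub> y \<in> S" "\<And>x. x \<in> S \<Longrightarrow> \<ominus>\<^bsub>G\<^esub> x \<in> S"
  shows "abelian_group (G\<lparr>carrier := S\<rparr>)"
proof -
  interpret G: abelian_group G by fact
  show ?thesis
  proof (rule abelian_groupI)
    fix x assume "x \<in> carrier (G\<lparr>carrier := S\<rparr>)"
    then show "\<exists>y\<in>carrier (G\<lparr>carrier := S\<rparr>). y \<oplus>\<^bsub>G\<lparr>carrier := S\<rparr>\<^esub> x = \<zero>\<^bsub>G\<lparr>carrier := S\<rparr>\<^esub>"
      using assms by (intro bexI[of _ "\<ominus>\<^bsub>G\<^esub> x"]) (auto simp: G.l_neg)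
  qed (use assms in \<open>auto simp: G.a_ac subset_iff\<close>)
qed

locale frob_witt_complex = frob_aut +
  fixes E :: "('a, 'u) witt_data"
  assumes E: "witt_complex p A E"
begin

sublocale E: witt_complex p A E by (rule E)

sublocale W: witt_deriv A p \<phi> "\<lambda>n. deg1_module E n (lam E n)" "\<lambda>n x. dif E n 0 (lam E n x)" "\<lambda>n. fro E n 1" "\<lambda>n. ver E n 1"
  by (rule witt_complex_deriv[OF E])

abbreviation N where "N n \<equiv> deg1_module E n (lam E n)"
abbreviation D where "D n x \<equiv> dif E n 0 (lam E n x)"

text \<open>Negatives and scalar multiples need no clauses of their own, because the coefficient
  \<open>x\<close> is arbitrary.\<close>

inductive_set dspan for n where
  gen: "x \<in> carrier (Wn n) \<Longrightarrow> y \<in> carrier (Wn n) \<Longrightarrow> x \<odot>\<^bsub>N n\<^esub> D n y \<in> dspan n"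
| add: "u \<in> dspan n \<Longrightarrow> v \<in> dspan n \<Longrightarrow> u \<oplus>\<^bsub>N n\<^esub> v \<in> dspan n"

lemma lam_closed [simp]: "x \<in> carrier (Wn n) \<Longrightarrow> lam E n x \<in> elts E n 0"
  using ring_hom_closed[OF E.lam_hom] by (simp add: deg0_ring_simps)

lemma lam_zero: "lam E n \<zero>\<^bsub>Wn n\<^esub> = \<zero>\<^bsub>cmp E n 0\<^esub>"
proof -
  interpret c: abelian_group "cmp E n 0" by (rule E.abelian_group_cmp)
  have "lam E n \<zero>\<^bsub>Wn n\<^esub> \<oplus>\<^bsub>cmp E n 0\<^esub> lam E n \<zero>\<^bsub>Wn n\<^esub> = lam E n \<zero>\<^bsub>Wn n\<^esub>"
    using ring_hom_add[OF E.lam_hom, of "\<zero>\<^bsub>Wn n\<^esub>" n "\<zero>\<^bsub>Wn n\<^esub>"] by (simp add: deg0_ring_simps)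
  moreover have "lam E n \<zero>\<^bsub>Wn n\<^esub> \<in> elts E n 0" by simp
  ultimately show ?thesis using c.add.l_cancel_one by blast
qed

lemma lam_minus: "x \<in> carrier (Wn n) \<Longrightarrow> \<ominus>\<^bsub>cmp E n 0\<^esub> lam E n x = lam E n (\<ominus>\<^bsub>Wn n\<^esub> x)"
proof -
  assume x: "x \<in> carrier (Wn n)"
  interpret c: abelian_group "cmp E n 0" by (rule E.abelian_group_cmp)
  have "lam E n (\<ominus>\<^bsub>Wn n\<^esub> x) \<oplus>\<^bsub>cmp E n 0\<^esub> lam E n x = \<zero>\<^bsub>cmp E n 0\<^esub>"
    using ring_hom_add[OF E.lam_hom, of "\<ominus>\<^bsub>Wn n\<^esub> x" n x] x lam_zero by (simp add: deg0_ring_simps W.N.R.l_neg)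
  then show ?thesis using x by (intro c.minus_equality) simp_all
qed

lemma dspan_closed: "u \<in> dspan n \<Longrightarrow> u \<in> carrier (N n)"
  by (induction rule: dspan.induct) auto

lemma dspan_D: "x \<in> carrier (Wn n) \<Longrightarrow> D n x \<in> dspan n"
  using dspan.gen[of "\<one>\<^bsub>Wn n\<^esub>" n x] by simp

lemma dspan_zero: "\<zero>\<^bsub>N n\<^esub> \<in> dspan n"
  using dspan.gen[of "\<zero>\<^bsub>Wn n\<^esub>" n "\<zero>\<^bsub>Wn n\<^esub>"] by simp

lemma dspan_smult: "u \<in> dspan n \<Longrightarrow> x \<in> carrier (Wn n) \<Longrightarrow> x \<odot>\<^bsub>N n\<^esub> u \<in> dspan n"
proof (induction rule: dspan.induct)
  case (gen y z)
  then show ?case using dspan.gen[of "x \<otimes>\<^bsub>Wn n\<^esub> y" n z] by (simp add: W.N.smult_assoc1)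
qed (auto simp: W.N.smult_r_distr dspan_closed intro: dspan.add)

lemma dspan_minus: "u \<in> dspan n \<Longrightarrow> \<ominus>\<^bsub>N n\<^esub> u \<in> dspan n"
  using dspan_smult[of u n "\<ominus>\<^bsub>Wn n\<^esub> \<one>\<^bsub>Wn n\<^esub>"] W.N.smult_l_minus[of "\<one>\<^bsub>Wn n\<^esub>" n u] dspan_closed[of u n] by simp

text \<open>\<open>V(x dy) = V(x F(dV(y))) = V(x) dV(y)\<close>.\<close>

lemma dspan_V: "u \<in> dspan n \<Longrightarrow> ver E n 1 u \<in> dspan (Suc n)"
proof (induction rule: dspan.induct)
  case (gen x y)
  have "ver E n 1 (x \<odot>\<^bsub>N n\<^esub> D n y) = ver E n 1 (x \<odot>\<^bsub>N n\<^esub> fro E n 1 (D (Suc n) (Ve n y)))"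
    using gen by (simp only: W.F1_D_V)
  also have "\<dots> = Ve n x \<odot>\<^bsub>N (Suc n)\<^esub> D (Suc n) (Ve n y)"
    using gen by (intro W.V1_smult_F1 W.D_closed Ve_closed)
  finally show ?case using gen dspan.gen[of "Ve n x" "Suc n" "Ve n y"] by simp
next
  case (add u v)
  then show ?case using W.V1_add[of u n v] dspan_closed dspan.add by simp
qed

text \<open>Write \<open>y = [y 0] + V(z)\<close>. The axiom on Teichmueller representatives treats
  the first summand, and \<open>F dV(z) = dz\<close> the second.\<close>

lemma dspan_F_D: "y \<in> carrier (Wn (Suc n)) \<Longrightarrow> fro E n 1 (D (Suc n) y) \<in> dspan n"
proof -
  assume y: "y \<in> carrier (Wn (Suc n))"
  let ?t = "teichmueller {..<Suc n} A (y 0)" and ?t' = "teichmueller {..<n} A (y 0)"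
  obtain z where z: "z \<in> carrier (Wn n)" "y = ?t \<oplus>\<^bsub>Wn (Suc n)\<^esub> Ve n z"
    using witt_decomp[of "{..<n}" "{..<Suc n}" y] y by auto
  have y0: "y 0 \<in> carrier A" using PiE_mem[of y "{..<Suc n}" "\<lambda>_. carrier A" 0] y by (simp add: witt_ring_simps)
  have t: "?t \<in> carrier (Wn (Suc n))" "?t' \<in> carrier (Wn n)" using y0 by (auto intro: teich_closed)
  have "fro E n 1 (D (Suc n) ?t) = (?t' [^]\<^bsub>Wn n\<^esub> (p - 1)) \<odot>\<^bsub>N n\<^esub> D n ?t'"
    using E.fro_dif_teich[OF y0, of n] by (simp add: deg1_module_simps)
  moreover have "(?t' [^]\<^bsub>Wn n\<^esub> (p - 1)) \<odot>\<^bsub>N n\<^esub> D n ?t' \<in> dspan n" using t by (intro dspan.gen W.N.R.nat_pow_closed)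
  ultimately have 1: "fro E n 1 (D (Suc n) ?t) \<in> dspan n" by simp
  have 2: "fro E n 1 (D (Suc n) (Ve n z)) \<in> dspan n" using z by (simp only: W.F1_D_V dspan_D)
  have "D (Suc n) y = D (Suc n) (?t \<oplus>\<^bsub>Wn (Suc n)\<^esub> Ve n z)" by (rule arg_cong[OF z(2)])
  also have "\<dots> = D (Suc n) ?t \<oplus>\<^bsub>N (Suc n)\<^esub> D (Suc n) (Ve n z)"
    using t z(1) by (intro W.D_add Ve_closed)
  finally have "fro E n 1 (D (Suc n) y) = fro E n 1 (D (Suc n) ?t) \<oplus>\<^bsub>N n\<^esub> fro E n 1 (D (Suc n) (Ve n z))"
    using W.F1_add[of "D (Suc n) ?t" n "D (Suc n) (Ve n z)"] W.D_closed[of ?t "Suc n"] W.D_closed[of "Ve n z" "Suc n"] t z by simp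
  then show ?thesis using dspan.add[OF 1 2] by simp
qed

lemma dspan_F: "u \<in> dspan (Suc n) \<Longrightarrow> fro E n 1 u \<in> dspan n"
proof (induction rule: dspan.induct)
  case (gen x y)
  have "fro E n 1 (x \<odot>\<^bsub>N (Suc n)\<^esub> D (Suc n) y) = Fr n x \<odot>\<^bsub>N n\<^esub> fro E n 1 (D (Suc n) y)"
    using gen by (intro W.F1_smult W.D_closed)
  then show ?case using gen dspan_smult[OF dspan_F_D] by simp
next
  case (add u v)
  then show ?case using W.F1_add[of u n v] dspan_closed dspan.add by simp
qed

lemma dspan_res: "u \<in> dspan (Suc n) \<Longrightarrow> res E n 1 u \<in> dspan n"
proof (induction rule: dspan.induct)
  case (gen x y)
  have r: "restrict x {..<n} \<in> carrier (Wn n)" "restrict y {..<n} \<in> carrier (Wn n)"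
    using gen ring_hom_closed[OF restrict_hom] by auto
  have "res E n 1 (x \<odot>\<^bsub>N (Suc n)\<^esub> D (Suc n) y) = restrict x {..<n} \<odot>\<^bsub>N n\<^esub> D n (restrict y {..<n})"
    using gen E.res_mul[of "lam E (Suc n) x" n 0 "D (Suc n) y" 1] E.res_dif[of "lam E (Suc n) y" n 0]
      E.res_lam[of x n] E.res_lam[of y n] E.dif_closed[of "lam E (Suc n) y" "Suc n" 0] by (simp add: deg1_module_simps)
  then show ?case using r dspan.gen by simp
next
  case (add u v)
  then show ?case using E.res_add[of u n 1 v] dspan_closed[of u "Suc n"] dspan_closed[of v "Suc n"] dspan.add[of _ n]
    by (simp add: deg1_module_simps)
qed

text \<open>Only degrees zero and one are shrunk. Keeping all of \<open>E\<close> in higher degrees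
  makes closure there automatic, and the conclusion concerns degree one.\<close>

definition E' :: "('a, 'u) witt_data" where
  "E' = E\<lparr>cmp := \<lambda>n q. if q = 0 then (cmp E n 0)\<lparr>carrier := lam E n ` carrier (Wn n)\<rparr>
     else if q = 1 then (cmp E n 1)\<lparr>carrier := dspan n\<rparr> else cmp E n q\<rparr>"

lemma E'_sel [simp]:
  "mul E' = mul E" "unt E' = unt E" "dif E' = dif E" "res E' = res E" "lam E' = lam E" "fro E' = fro E" "ver E' = ver E"
  "\<zero>\<^bsub>cmp E' n q\<^esub> = \<zero>\<^bsub>cmp E n q\<^esub>" "(\<oplus>\<^bsub>cmp E' n q\<^esub>) = (\<oplus>\<^bsub>cmp E n q\<^esub>)"
  by (simp_all add: E'_def)

lemma elts_E': "elts E' n q = (if q = 0 then lam E n ` carrier (Wn n) else if q = 1 then dspan n else elts E n q)"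
  by (simp add: E'_def)

lemma elts_E'_subset: "x \<in> elts E' n q \<Longrightarrow> x \<in> elts E n q"
  using dspan_closed by (auto simp: elts_E' deg1_module_simps split: if_splits)

text \<open>Additive inverses are defined relative to the carrier and could change with it. In the
  axioms a minus sign occurs only in total degree at least two, where \<open>E'\<close> and
  \<open>E\<close> have the same components.\<close>

lemma sgn_pow_E': "m \<ge> 2 \<or> even j \<Longrightarrow> sgn_pow (cmp E' n m) j x = sgn_pow (cmp E n m) j x"
  by (auto simp: sgn_pow_def E'_def)

lemma E'_cases:
  assumes "x \<in> elts E' n q"
  obtains w where "q = 0" "w \<in> carrier (Wn n)" "x = lam E n w"
  | "q = 1" "x \<in> dspan n" | "q \<ge> 2" "x \<in> elts E n q"
  using assms by (cases "q = 0"; cases "q = 1") (auto simp: elts_E')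

lemma mul_01: "w \<in> carrier (Wn n) \<Longrightarrow> u \<in> dspan n \<Longrightarrow> mul E n 0 1 (lam E n w) u \<in> dspan n"
  using dspan_smult[of u n w] by (simp add: deg1_module_simps)

lemma mul_10: "w \<in> carrier (Wn n) \<Longrightarrow> u \<in> dspan n \<Longrightarrow> mul E n 1 0 u (lam E n w) \<in> dspan n"
  using mul_01[of w n u] E.graded_comm[of u n 1 "lam E n w" 0] dspan_closed[of u n] by (simp add: deg1_module_simps sgn_pow_def)

lemma pro_dg_ring_E': "pro_dg_ring E'"
proof (rule pro_dg_ring.intro)
  note s = elts_E'_subset
  fix n q
  interpret c: abelian_group "cmp E n q" by (rule E.abelian_group_cmp)
  show "abelian_group (cmp E' n q)"
  proof -
    consider "q = 0" | "q = 1" | "q \<ge> 2" by linarith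
    then show ?thesis
    proof cases
      case 1
      have "abelian_group ((cmp E n 0)\<lparr>carrier := lam E n ` carrier (Wn n)\<rparr>)"
      proof (rule abelian_subgroup_group[OF E.abelian_group_cmp])
        show "\<zero>\<^bsub>cmp E n 0\<^esub> \<in> lam E n ` carrier (Wn n)" using lam_zero[of n] by (auto intro!: image_eqI[of _ _ "\<zero>\<^bsub>Wn n\<^esub>"])
      next
        fix x y assume "x \<in> lam E n ` carrier (Wn n)" "y \<in> lam E n ` carrier (Wn n)"
        then obtain a b where ab: "a \<in> carrier (Wn n)" "b \<in> carrier (Wn n)" "x = lam E n a" "y = lam E n b" by auto
        then have "x \<oplus>\<^bsub>cmp E n 0\<^esub> y = lam E n (a \<oplus>\<^bsub>Wn n\<^esub> b)" using ring_hom_add[OF E.lam_hom ab(1,2)] by (simp add: deg0_ring_simps)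
        then show "x \<oplus>\<^bsub>cmp E n 0\<^esub> y \<in> lam E n ` carrier (Wn n)" using ab by simp
      qed (auto simp: lam_minus)
      then show ?thesis using 1 by (simp add: E'_def)
    next
      case 2
      have m: "\<ominus>\<^bsub>cmp E n 1\<^esub> u = \<ominus>\<^bsub>N n\<^esub> u" if "u \<in> dspan n" for u
        using dspan_closed[OF that] dspan_closed[OF dspan_minus[OF that]] W.N.M.l_neg[of u n] 2
        by (intro c.minus_equality[unfolded 2]) (simp_all add: deg1_module_simps)
      have "abelian_group ((cmp E n 1)\<lparr>carrier := dspan n\<rparr>)"
        using dspan_zero[of n] dspan.add[of _ n] dspan_closed[of _ n] dspan_minus[of _ n] m
        by (intro abelian_subgroup_group[OF E.abelian_group_cmp]) (auto simp: deg1_module_simps)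
      then show ?thesis using 2 by (simp add: E'_def)
    next
      case 3
      then show ?thesis using E.abelian_group_cmp[of n q] by (simp add: E'_def)
    qed
  qed
next
  fix q
  have "carrier (Wn 0) = {\<zero>\<^bsub>Wn 0\<^esub>}" by (auto simp: witt_ring_simps)
  moreover have "\<zero>\<^bsub>N 0\<^esub> \<in> dspan 0" "dspan 0 \<subseteq> elts E 0 1" using dspan_zero[of 0] dspan_closed[of _ 0] by (auto simp: deg1_module_simps)
  moreover have "lam E 0 \<zero>\<^bsub>Wn 0\<^esub> = \<zero>\<^bsub>cmp E 0 0\<^esub>" by (rule lam_zero)
  ultimately show "elts E' 0 q = {\<zero>\<^bsub>cmp E' 0 q\<^esub>}"
    using E.level0[of q] by (auto simp: elts_E' deg1_module_simps)
next
  fix x n q y r assume x: "x \<in> elts E' n q" and y: "y \<in> elts E' n r"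
  show "mul E' n q r x y \<in> elts E' n (q + r)"
  proof (cases "q + r \<ge> 2")
    case True
    then show ?thesis using E.mul_closed[OF elts_E'_subset[OF x] elts_E'_subset[OF y]] by (auto simp: elts_E')
  next
    case False
    then consider "q = 0" "r = 0" | "q = 0" "r = 1" | "q = 1" "r = 0" by linarith
    then show ?thesis
    proof cases
      case 1
      then obtain v w where vw: "v \<in> carrier (Wn n)" "w \<in> carrier (Wn n)" "x = lam E n v" "y = lam E n w"
        using x y by (auto simp: elts_E')
      then have "mul E' n q r x y = lam E n (v \<otimes>\<^bsub>Wn n\<^esub> w)"
        using 1 ring_hom_mult[OF E.lam_hom vw(1,2)] by (simp add: deg0_ring_simps)
      then show ?thesis using 1 vw by (simp add: elts_E')
    next
      case 2
      then show ?thesis using x y mul_01[of _ n y] by (auto simp: elts_E')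
    next
      case 3
      then show ?thesis using x y mul_10[of _ n x] by (auto simp: elts_E')
    qed
  qed
next
  fix x n q y r assume *: "x \<in> elts E' n q" "y \<in> elts E' n r"
  have "q + r \<ge> 2 \<or> even (q * r)"
    by (cases q; cases r) auto
  then show "mul E' n q r x y = sgn_pow (cmp E' n (q + r)) (q * r) (mul E' n r q y x)"
    by (simp only: E'_sel sgn_pow_E' E.graded_comm[OF *[THEN elts_E'_subset]])
next
  fix x n q assume x: "x \<in> elts E' n q"
  show "dif E' n q x \<in> elts E' n (q + 1)"
  proof (cases "q = 0")
    case True
    then show ?thesis using x dspan_D by (auto simp: elts_E')
  next
    case False
    then show ?thesis using E.dif_closed[OF elts_E'_subset[OF x]] by (simp add: elts_E')
  qed
next
  fix x n q y r assume "x \<in> elts E' n q" "y \<in> elts E' n r"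
  moreover have "q + r + 1 \<ge> 2 \<or> even q" by (cases "q = 0") auto
  ultimately show "dif E' n (q + r) (mul E' n q r x y) = mul E' n (q + 1) r (dif E' n q x) y \<oplus>\<^bsub>cmp E' n (q + r + 1)\<^esub>
      sgn_pow (cmp E' n (q + r + 1)) q (mul E' n q (r + 1) x (dif E' n r y))"
    by (simp only: E'_sel sgn_pow_E' E.dif_mul[OF elts_E'_subset elts_E'_subset])
next
  fix x n q assume x: "x \<in> elts E' (n + 1) q"
  then show "res E' n q x \<in> elts E' n q"
  proof (cases rule: E'_cases)
    case (1 w)
    then show ?thesis using E.res_lam[of w n] ring_hom_closed[OF restrict_hom] by (simp add: elts_E')
  next
    case 2
    then show ?thesis using dspan_res[of x n] by (simp add: elts_E')
  next
    case 3
    then show ?thesis using E.res_closed[of x n q] by (simp add: elts_E')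
  qed
next
  fix n
  have "lam E n \<one>\<^bsub>Wn n\<^esub> = unt E n" using ring_hom_one[OF E.lam_hom] by (simp add: deg0_ring_simps)
  then show "unt E' n \<in> elts E' n 0" by (auto simp: elts_E' intro!: image_eqI[of _ _ "\<one>\<^bsub>Wn n\<^esub>"])
next
  fix n show "res E' n 0 (unt E' (n + 1)) = unt E' n" using E.res_unt by simp
next
  fix x y z n q r assume "x \<in> elts E' n q" "y \<in> elts E' n q" "z \<in> elts E' n r"
  then show "mul E' n q r (x \<oplus>\<^bsub>cmp E' n q\<^esub> y) z = mul E' n q r x z \<oplus>\<^bsub>cmp E' n (q + r)\<^esub> mul E' n q r y z"
    unfolding E'_sel by (rule E.mul_l_distr[OF elts_E'_subset elts_E'_subset elts_E'_subset])
next
  fix x y z n q r assume "x \<in> elts E' n q" "y \<in> elts E' n r" "z \<in> elts E' n r"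
  then show "mul E' n q r x (y \<oplus>\<^bsub>cmp E' n r\<^esub> z) = mul E' n q r x y \<oplus>\<^bsub>cmp E' n (q + r)\<^esub> mul E' n q r x z"
    unfolding E'_sel by (rule E.mul_r_distr[OF elts_E'_subset elts_E'_subset elts_E'_subset])
next
  fix x y z n q r t assume "x \<in> elts E' n q" "y \<in> elts E' n r" "z \<in> elts E' n t"
  then show "mul E' n (q + r) t (mul E' n q r x y) z = mul E' n q (r + t) x (mul E' n r t y z)"
    unfolding E'_sel by (rule E.mul_assoc[OF elts_E'_subset elts_E'_subset elts_E'_subset])
next
  fix x n q assume "x \<in> elts E' n q"
  then show "mul E' n 0 q (unt E' n) x = x"
    unfolding E'_sel by (rule E.unt_l[OF elts_E'_subset])
next
  fix x n q assume "x \<in> elts E' n q"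
  then show "mul E' n q 0 x (unt E' n) = x"
    unfolding E'_sel by (rule E.unt_r[OF elts_E'_subset])
next
  fix x y n q assume "x \<in> elts E' n q" "y \<in> elts E' n q"
  then show "dif E' n q (x \<oplus>\<^bsub>cmp E' n q\<^esub> y) = dif E' n q x \<oplus>\<^bsub>cmp E' n (q + 1)\<^esub> dif E' n q y"
    unfolding E'_sel by (rule E.dif_add[OF elts_E'_subset elts_E'_subset])
next
  fix x n q assume "x \<in> elts E' n q"
  then show "dif E' n (q + 1) (dif E' n q x) = \<zero>\<^bsub>cmp E' n (q + 2)\<^esub>"
    unfolding E'_sel by (rule E.dif_dif[OF elts_E'_subset])
next
  fix x y n q assume "x \<in> elts E' (n + 1) q" "y \<in> elts E' (n + 1) q"
  then show "res E' n q (x \<oplus>\<^bsub>cmp E' (n + 1) q\<^esub> y) = res E' n q x \<oplus>\<^bsub>cmp E' n q\<^esub> res E' n q y"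
    unfolding E'_sel by (rule E.res_add[OF elts_E'_subset elts_E'_subset])
next
  fix x y n q r assume "x \<in> elts E' (n + 1) q" "y \<in> elts E' (n + 1) r"
  then show "res E' n (q + r) (mul E' (n + 1) q r x y) = mul E' n q r (res E' n q x) (res E' n r y)"
    unfolding E'_sel by (rule E.res_mul[OF elts_E'_subset elts_E'_subset])
next
  fix x n q assume "x \<in> elts E' (n + 1) q"
  then show "res E' n (q + 1) (dif E' (n + 1) q x) = dif E' n q (res E' n q x)"
    unfolding E'_sel by (rule E.res_dif[OF elts_E'_subset])
qed

lemma witt_complex_E': "witt_complex p A E'"
proof (intro witt_complex.intro pro_dg_ring_E' witt_complex_axioms.intro cring_axioms)
  fix n show "lam E' n \<in> ring_hom (Wn n) (deg0_ring E' n)"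
    using ring_hom_mult[OF E.lam_hom, of _ n] ring_hom_add[OF E.lam_hom, of _ n] ring_hom_one[OF E.lam_hom, of n]
    by (intro ring_hom_memI) (auto simp: deg0_ring_simps elts_E')
next
  fix x n q assume x: "x \<in> elts E' (n + 1) q"
  then show "fro E' n q x \<in> elts E' n q"
  proof (cases rule: E'_cases)
    case (1 w)
    then show ?thesis using E.fro_lam[of w n] by (simp add: elts_E')
  next
    case 2
    then show ?thesis using dspan_F[of x n] by (simp add: elts_E')
  next
    case 3
    then show ?thesis using E.fro_closed[of x n q] by (simp add: elts_E')
  qed
next
  fix x n q assume x: "x \<in> elts E' n q"
  then show "ver E' n q x \<in> elts E' (n + 1) q"
  proof (cases rule: E'_cases)
    case (1 w)
    then show ?thesis using E.ver_lam[of w n] by (simp add: elts_E')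
  next
    case 2
    then show ?thesis using dspan_V[of x n] by (simp add: elts_E')
  next
    case 3
    then show ?thesis using E.ver_closed[of x n q] by (simp add: elts_E')
  qed
next
  fix x n q assume "x \<in> elts E' n q"
  then show "fro E' n q (ver E' n q x) = add_pow (cmp E' n q) p x"
    using E.fro_ver[OF elts_E'_subset, of x n q] add_pow_nat_cong[of "cmp E' n q" "cmp E n q" p x] by simp
next
  fix a n assume "a \<in> carrier A"
  then show "fro E' n 1 (dif E' (n + 1) 0 (lam E' (n + 1) (teichmueller {..<n + 1} A a))) =
     mul E' n 0 1 (lam E' n (teichmueller {..<n} A a [^]\<^bsub>Wn n\<^esub> (p - 1))) (dif E' n 0 (lam E' n (teichmueller {..<n} A a)))"
    unfolding E'_sel by (rule E.fro_dif_teich)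
next
  fix w n assume "w \<in> carrier (witt_ring p {..<n + 1} A)"
  then show "res E' n 0 (lam E' (n + 1) w) = lam E' n (restrict w {..<n})"
    unfolding E'_sel by (rule E.res_lam[OF _])
next
  fix x y n q assume "x \<in> elts E' (n + 1) q" "y \<in> elts E' (n + 1) q"
  then show "fro E' n q (x \<oplus>\<^bsub>cmp E' (n + 1) q\<^esub> y) = fro E' n q x \<oplus>\<^bsub>cmp E' n q\<^esub> fro E' n q y"
    unfolding E'_sel by (rule E.fro_add[OF elts_E'_subset elts_E'_subset])
next
  fix x y n q r assume "x \<in> elts E' (n + 1) q" "y \<in> elts E' (n + 1) r"
  then show "fro E' n (q + r) (mul E' (n + 1) q r x y) = mul E' n q r (fro E' n q x) (fro E' n r y)"
    unfolding E'_sel by (rule E.fro_mul[OF elts_E'_subset elts_E'_subset])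
next
  fix n show "fro E' n 0 (unt E' (n + 1)) = unt E' n" unfolding E'_sel by (rule E.fro_unt)
next
  fix x n q assume "x \<in> elts E' (n + 2) q"
  then show "fro E' n q (res E' (n + 1) q x) = res E' n q (fro E' (n + 1) q x)"
    unfolding E'_sel by (rule E.fro_res[OF elts_E'_subset])
next
  fix w n assume "w \<in> carrier (witt_ring p {..<n + 1} A)"
  then show "fro E' n 0 (lam E' (n + 1) w) = lam E' n (witt_frob p {..<n} A w)"
    unfolding E'_sel by (rule E.fro_lam[OF _])
next
  fix x y n q assume "x \<in> elts E' n q" "y \<in> elts E' n q"
  then show "ver E' n q (x \<oplus>\<^bsub>cmp E' n q\<^esub> y) = ver E' n q x \<oplus>\<^bsub>cmp E' (n + 1) q\<^esub> ver E' n q y"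
    unfolding E'_sel by (rule E.ver_add[OF elts_E'_subset elts_E'_subset])
next
  fix x y n q r assume "x \<in> elts E' (n + 1) q" "y \<in> elts E' n r"
  then show "ver E' n (q + r) (mul E' n q r (fro E' n q x) y) = mul E' (n + 1) q r x (ver E' n r y)"
    unfolding E'_sel by (rule E.ver_mul_l[OF elts_E'_subset elts_E'_subset])
next
  fix x y n q r assume "x \<in> elts E' n q" "y \<in> elts E' (n + 1) r"
  then show "ver E' n (q + r) (mul E' n q r x (fro E' n r y)) = mul E' (n + 1) q r (ver E' n q x) y"
    unfolding E'_sel by (rule E.ver_mul_r[OF elts_E'_subset elts_E'_subset])
next
  fix x n q assume "x \<in> elts E' (n + 1) q"
  then show "ver E' n q (res E' n q x) = res E' (n + 1) q (ver E' (n + 1) q x)"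
    unfolding E'_sel by (rule E.ver_res[OF elts_E'_subset])
next
  fix w n assume "w \<in> carrier (witt_ring p {..<n} A)"
  then show "ver E' n 0 (lam E' n w) = lam E' (n + 1) (witt_ver {..<n + 1} A w)"
    unfolding E'_sel by (rule E.ver_lam[OF _])
next
  fix x n q assume "x \<in> elts E' n q"
  then show "fro E' n (q + 1) (dif E' (n + 1) q (ver E' n q x)) = dif E' n q x"
    unfolding E'_sel by (rule E.fro_dif_ver[OF elts_E'_subset])
qed

text \<open>The morphism from \<open>E\<close> to \<open>E'\<close> given by initiality, followed by
  the inclusion, is an endomorphism of \<open>E\<close> and hence the identity; so degree one of
  \<open>E\<close> is contained in \<open>dspan\<close>.\<close>

lemma de_rham_witt_generated:
  assumes drw: "is_de_rham_witt p A E"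
  shows "carrier (N n) \<subseteq> dspan n"
proof -
  obtain f where f: "witt_complex_hom p A E E' f" using drw witt_complex_E' unfolding is_de_rham_witt_def by blast
  obtain f0 where f0: "\<And>g n q x. witt_complex_hom p A E E g \<Longrightarrow> x \<in> elts E n q \<Longrightarrow> g n q x = f0 n q x"
    using drw E unfolding is_de_rham_witt_def by blast
  have "witt_complex_hom p A E E (\<lambda>n q x. x)" by (simp add: witt_complex_hom_def)
  moreover have "witt_complex_hom p A E E f"
    by (insert f, unfold witt_complex_hom_def E'_sel, elim conjE, intro conjI) (assumption | blast intro: elts_E'_subset)+
  ultimately have "f n 1 x = x" if "x \<in> elts E n 1" for x using f0 that by metis
  moreover have "f n 1 x \<in> elts E' n 1" if "x \<in> elts E n 1" for x
    using conjunct1[OF f[unfolded witt_complex_hom_def]] that by blast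
  ultimately show ?thesis unfolding elts_E' by (force simp: deg1_module_simps)
qed

lemma dspan_gen:
  assumes "is_de_rham_witt p A E"
    and "\<And>x y. x \<in> carrier (Wn n) \<Longrightarrow> y \<in> carrier (Wn n) \<Longrightarrow> x \<odot>\<^bsub>N n\<^esub> D n y \<in> H"
    and "\<And>u v. u \<in> H \<Longrightarrow> v \<in> H \<Longrightarrow> u \<in> carrier (N n) \<Longrightarrow> v \<in> carrier (N n) \<Longrightarrow> u \<oplus>\<^bsub>N n\<^esub> v \<in> H"
  shows "carrier (N n) \<subseteq> H"
proof -
  have "u \<in> H" if "u \<in> dspan n" for u
    using that by (induction rule: dspan.induct) (auto simp: assms(2) dspan_closed intro: assms(3))
  then show ?thesis using de_rham_witt_generated[OF assms(1)] by blast
qed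

end

section \<open>The comparison map\<close>

context frob_aut
begin

text \<open>This and the following definitions restate those made for \<open>W(k)\<close> over an
  abstract \<open>A\<close> with Frobenius automorphism; for \<open>A = W(k)\<close> they agree by
  unfolding.\<close>

definition twisted_mod :: "nat \<Rightarrow> ('a, ('a \<Rightarrow> 'a) set \<times> 'a) module" where
  "twisted_mod j =
     \<lparr>carrier = carrier \<Omega> \<times> carrier A, monoid.mult = undefined, one = undefined,
      zero = (\<zero>\<^bsub>\<Omega>\<^esub>, \<zero>), add = (\<lambda>u v. (fst u \<oplus>\<^bsub>\<Omega>\<^esub> fst v, snd u \<oplus> snd v)),
      smult = (\<lambda>x (\<alpha>, a). let y = (\<phi> ^^ j) x in
        (y \<odot>\<^bsub>\<Omega>\<^esub> \<alpha> \<ominus>\<^bsub>\<Omega>\<^esub> divide_nat \<Omega> (p ^ j) (a \<odot>\<^bsub>\<Omega>\<^esub> dd y), y \<otimes> a))\<rparr>"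

lemma twisted_mod_simps:
  "carrier (twisted_mod j) = carrier \<Omega> \<times> carrier A" "\<zero>\<^bsub>twisted_mod j\<^esub> = (\<zero>\<^bsub>\<Omega>\<^esub>, \<zero>)"
  "u \<oplus>\<^bsub>twisted_mod j\<^esub> v = (fst u \<oplus>\<^bsub>\<Omega>\<^esub> fst v, snd u \<oplus> snd v)"
  "x \<odot>\<^bsub>twisted_mod j\<^esub> u = ((\<phi> ^^ j) x \<odot>\<^bsub>\<Omega>\<^esub> fst u \<ominus>\<^bsub>\<Omega>\<^esub> pdiv j (snd u \<odot>\<^bsub>\<Omega>\<^esub> dd ((\<phi> ^^ j) x)), (\<phi> ^^ j) x \<otimes> snd u)"
  by (simp_all add: twisted_mod_def Let_def pdiv_def split_beta)

lemma twisted_mod_group: "abelian_group (twisted_mod j)"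
proof -
  interpret P: module A "pair_module \<Omega> (reg_module A)"
    by (intro pair_module_module kaehler_module reg_module_module)
  show ?thesis
    by (rule abelian_group_cong[OF P.M.abelian_group_axioms]) (simp_all add: twisted_mod_simps pair_module_simps reg_module_simps)
qed

text \<open>The Leibniz rule in the shape that associativity of the twisted action requires.\<close>

lemma pdiv_dd_mult:
  assumes "y \<in> carrier A" "z \<in> carrier A" "a \<in> carrier A"
  shows "pdiv j (a \<odot>\<^bsub>\<Omega>\<^esub> dd (y \<otimes> z)) = y \<odot>\<^bsub>\<Omega>\<^esub> pdiv j (a \<odot>\<^bsub>\<Omega>\<^esub> dd z) \<oplus>\<^bsub>\<Omega>\<^esub> pdiv j ((z \<otimes> a) \<odot>\<^bsub>\<Omega>\<^esub> dd y)"
proof -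
  have "a \<odot>\<^bsub>\<Omega>\<^esub> dd (y \<otimes> z) = y \<odot>\<^bsub>\<Omega>\<^esub> (a \<odot>\<^bsub>\<Omega>\<^esub> dd z) \<oplus>\<^bsub>\<Omega>\<^esub> (z \<otimes> a) \<odot>\<^bsub>\<Omega>\<^esub> dd y"
    using assms by (simp add: kaehler_d_mult Om.smult_r_distr m_comm flip: Om.smult_assoc1)
  then show ?thesis using assms by (simp add: pdiv_add pdiv_smult)
qed

lemma twisted_mod_module: "module A (twisted_mod j)"
proof (rule module.intro[OF cring_axioms twisted_mod_group], unfold_locales)
  note s = twisted_mod_simps ring_hom_closed[OF phi_pow_hom] ring_hom_add[OF phi_pow_hom] ring_hom_mult[OF phi_pow_hom] ring_hom_one[OF phi_pow_hom]
  fix x u assume "x \<in> carrier A" "u \<in> carrier (twisted_mod j)"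
  then show "x \<odot>\<^bsub>twisted_mod j\<^esub> u \<in> carrier (twisted_mod j)" by (auto simp: s pdiv)
next
  note s = twisted_mod_simps ring_hom_closed[OF phi_pow_hom] ring_hom_add[OF phi_pow_hom]
  fix x y u assume "x \<in> carrier A" "y \<in> carrier A" "u \<in> carrier (twisted_mod j)"
  then show "(x \<oplus> y) \<odot>\<^bsub>twisted_mod j\<^esub> u = x \<odot>\<^bsub>twisted_mod j\<^esub> u \<oplus>\<^bsub>twisted_mod j\<^esub> y \<odot>\<^bsub>twisted_mod j\<^esub> u"
    by (auto simp: s pdiv kaehler_d_add Om.smult_r_distr Om.smult_l_distr pdiv_add Om.M.minus_eq Om.M.minus_add Om.M.a_ac l_distr)
next
  fix x u v assume "x \<in> carrier A" "u \<in> carrier (twisted_mod j)" "v \<in> carrier (twisted_mod j)"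
  then show "x \<odot>\<^bsub>twisted_mod j\<^esub> (u \<oplus>\<^bsub>twisted_mod j\<^esub> v) = x \<odot>\<^bsub>twisted_mod j\<^esub> u \<oplus>\<^bsub>twisted_mod j\<^esub> x \<odot>\<^bsub>twisted_mod j\<^esub> v"
    by (auto simp: twisted_mod_simps pdiv Om.smult_r_distr Om.smult_l_distr pdiv_add Om.M.minus_eq Om.M.minus_add Om.M.a_ac r_distr)
next
  fix x y u assume "x \<in> carrier A" "y \<in> carrier A" "u \<in> carrier (twisted_mod j)"
  then show "(x \<otimes> y) \<odot>\<^bsub>twisted_mod j\<^esub> u = x \<odot>\<^bsub>twisted_mod j\<^esub> (y \<odot>\<^bsub>twisted_mod j\<^esub> u)"
    by (auto simp: twisted_mod_simps pdiv ring_hom_mult[OF phi_pow_hom] pdiv_dd_mult Om.smult_assoc1 Om.smult_r_distr Om.smult_r_minus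
        Om.M.minus_eq Om.M.minus_add Om.M.a_ac m_assoc)
next
  fix u assume "u \<in> carrier (twisted_mod j)"
  moreover have "pdiv j \<zero>\<^bsub>\<Omega>\<^esub> = \<zero>\<^bsub>\<Omega>\<^esub>" by (rule pdiv_eqI) simp_all
  moreover have diff0: "\<alpha> \<ominus>\<^bsub>\<Omega>\<^esub> \<zero>\<^bsub>\<Omega>\<^esub> = \<alpha>" if "\<alpha> \<in> carrier \<Omega>" for \<alpha>
    using that Om.M.minus_equality[of "\<zero>\<^bsub>\<Omega>\<^esub>" "\<zero>\<^bsub>\<Omega>\<^esub>"] by (simp add: Om.M.minus_eq)
  ultimately show "\<one> \<odot>\<^bsub>twisted_mod j\<^esub> u = u"
    by (auto simp: twisted_mod_simps ring_hom_one[OF phi_pow_hom] kaehler_d_one Om.smult_r_null diff0)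
qed

definition h_elt :: "nat \<Rightarrow> 'a \<Rightarrow> ('a \<Rightarrow> 'a) set \<times> 'a" where
  "h_elt j a = (\<ominus>\<^bsub>\<Omega>\<^esub> dd a, [(p ^ j)] \<cdot> a)"

lemma h_elt_submodule: "submodule (h_elt j ` carrier A) A (twisted_mod j)"
proof -
  interpret twisted_mod: module A "twisted_mod j" by (rule twisted_mod_module)
  have closed: "h_elt j a \<in> carrier (twisted_mod j)" if "a \<in> carrier A" for a using that by (simp add: h_elt_def twisted_mod_simps)
  have add: "h_elt j a \<oplus>\<^bsub>twisted_mod j\<^esub> h_elt j b = h_elt j (a \<oplus> b)" if "a \<in> carrier A" "b \<in> carrier A" for a b
    using that by (simp add: h_elt_def twisted_mod_simps kaehler_d_add Om.M.minus_add add.nat_pow_distrib)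
  have zero: "h_elt j \<zero> = \<zero>\<^bsub>twisted_mod j\<^esub>" by (simp add: h_elt_def twisted_mod_simps kaehler_d_zero)
  show ?thesis
  proof (rule twisted_mod.submoduleI)
    show "h_elt j ` carrier A \<subseteq> carrier (twisted_mod j)" using closed by blast
    show "\<zero>\<^bsub>twisted_mod j\<^esub> \<in> h_elt j ` carrier A" unfolding zero[symmetric] by simp
  next
    fix u assume "u \<in> h_elt j ` carrier A"
    then obtain a where a: "a \<in> carrier A" "u = h_elt j a" by blast
    have "\<ominus>\<^bsub>twisted_mod j\<^esub> u = h_elt j (\<ominus> a)"
      using a add[of "\<ominus> a" a] zero by (intro twisted_mod.M.minus_equality) (simp_all add: closed l_neg)
    then show "\<ominus>\<^bsub>twisted_mod j\<^esub> u \<in> h_elt j ` carrier A" using a by simp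
  next
    fix u v assume "u \<in> h_elt j ` carrier A" "v \<in> h_elt j ` carrier A"
    then show "u \<oplus>\<^bsub>twisted_mod j\<^esub> v \<in> h_elt j ` carrier A" using add by auto
  next
    fix x u assume "x \<in> carrier A" "u \<in> h_elt j ` carrier A"
    then obtain a where a: "a \<in> carrier A" "x \<in> carrier A" "u = h_elt j a" by blast
    \<comment> \<open>In the twisted action the second entry \<open>p^j a\<close> meets the division
      by \<open>p^j\<close>, leaving \<open>a d\<phi>^j(x)\<close>; together with
      \<open>\<phi>^j(x) da\<close> this is the differential of
      \<open>\<phi>^j(x) a\<close>.\<close>
    then have "x \<odot>\<^bsub>twisted_mod j\<^esub> u = h_elt j ((\<phi> ^^ j) x \<otimes> a)"
      by (simp add: twisted_mod_simps h_elt_def Om.smult_add_pow_left pdiv_p_pow kaehler_d_mult Om.smult_r_minus Om.M.minus_eq Om.M.minus_add add_pow_rdistr)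
    then show "x \<odot>\<^bsub>twisted_mod j\<^esub> u \<in> h_elt j ` carrier A" using a by simp
  qed
qed

definition M_quot :: "nat \<Rightarrow> ('a, (('a \<Rightarrow> 'a) set \<times> 'a) set) module" where
  "M_quot j = quot_module (twisted_mod j) (h_elt j ` carrier A)"

definition M_cls :: "nat \<Rightarrow> ('a \<Rightarrow> 'a) set \<Rightarrow> 'a \<Rightarrow> (('a \<Rightarrow> 'a) set \<times> 'a) set" where
  "M_cls j \<alpha> a = h_elt j ` carrier A +>\<^bsub>twisted_mod j\<^esub> (\<alpha>, a)"

interpretation M_quot: quot_mod A "twisted_mod j" "h_elt j ` carrier A" for j
  by (intro quot_mod.intro quot_mod_axioms.intro twisted_mod_module h_elt_submodule)

lemma M_cls_eq: "M_cls j \<alpha> a = M_quot.cl j (\<alpha>, a)" by (simp add: M_cls_def M_quot.cl_def)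

lemma M_quot_module: "module A (M_quot j)" unfolding M_quot_def by (rule M_quot.quot_module)

lemma M_cls_closed [simp]: "\<alpha> \<in> carrier \<Omega> \<Longrightarrow> a \<in> carrier A \<Longrightarrow> M_cls j \<alpha> a \<in> carrier (M_quot j)"
  unfolding M_quot_def M_cls_eq by (rule M_quot.cl_closed) (simp add: twisted_mod_simps)

lemma M_quot_ex: "C \<in> carrier (M_quot j) \<Longrightarrow> \<exists>\<alpha>\<in>carrier \<Omega>. \<exists>a\<in>carrier A. C = M_cls j \<alpha> a"
  unfolding M_quot_def M_cls_eq by (elim M_quot.quot_E) (force simp: twisted_mod_simps)

lemma M_cls_add:
  "\<alpha> \<in> carrier \<Omega> \<Longrightarrow> a \<in> carrier A \<Longrightarrow> \<beta> \<in> carrier \<Omega> \<Longrightarrow> b \<in> carrier A \<Longrightarrow>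
   M_cls j \<alpha> a \<oplus>\<^bsub>M_quot j\<^esub> M_cls j \<beta> b = M_cls j (\<alpha> \<oplus>\<^bsub>\<Omega>\<^esub> \<beta>) (a \<oplus> b)"
  unfolding M_quot_def M_cls_eq by (simp add: M_quot.cl_add twisted_mod_simps)

lemma M_cls_smult:
  "x \<in> carrier A \<Longrightarrow> \<alpha> \<in> carrier \<Omega> \<Longrightarrow> a \<in> carrier A \<Longrightarrow>
   x \<odot>\<^bsub>M_quot j\<^esub> M_cls j \<alpha> a = M_cls j ((\<phi> ^^ j) x \<odot>\<^bsub>\<Omega>\<^esub> \<alpha> \<ominus>\<^bsub>\<Omega>\<^esub> pdiv j (a \<odot>\<^bsub>\<Omega>\<^esub> dd ((\<phi> ^^ j) x))) ((\<phi> ^^ j) x \<otimes> a)"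
  unfolding M_quot_def M_cls_eq by (simp add: M_quot.cl_smult twisted_mod_simps)

lemma M_cls_zero: "\<zero>\<^bsub>M_quot j\<^esub> = M_cls j \<zero>\<^bsub>\<Omega>\<^esub> \<zero>"
  unfolding M_quot_def M_cls_eq M_quot.cl_zero[symmetric] by (simp add: twisted_mod_simps)

lemma M_cls_h:
  assumes c: "c \<in> carrier A"
  shows "M_cls j (\<ominus>\<^bsub>\<Omega>\<^esub> dd c) ([(p ^ j)] \<cdot> c) = \<zero>\<^bsub>M_quot j\<^esub>"
proof -
  have h: "h_elt j c \<in> carrier (twisted_mod j)" using c by (simp add: h_elt_def twisted_mod_simps)
  then have "h_elt j c \<ominus>\<^bsub>twisted_mod j\<^esub> \<zero>\<^bsub>twisted_mod j\<^esub> = h_elt j c" by (simp add: M_quot.M.minus_eq)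
  then show ?thesis
    using M_quot.cl_eq_iff[OF h M_quot.M.zero_closed] c by (simp add: M_cls_zero M_cls_eq h_elt_def twisted_mod_simps)
qed

lemma M_cls_mem:
  assumes "u \<in> M_cls j \<alpha> a"
  shows "\<exists>c\<in>carrier A. u = (\<ominus>\<^bsub>\<Omega>\<^esub> dd c \<oplus>\<^bsub>\<Omega>\<^esub> \<alpha>, [(p ^ j)] \<cdot> c \<oplus> a)"
  using assms by (auto simp: M_cls_def a_r_coset_def' twisted_mod_simps h_elt_def)

lemma M_cls_self: "\<alpha> \<in> carrier \<Omega> \<Longrightarrow> a \<in> carrier A \<Longrightarrow> (\<alpha>, a) \<in> M_cls j \<alpha> a"
  unfolding M_cls_def by (rule M_quot.H.a_rcos_self) (simp add: twisted_mod_simps)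

end

lemma (in abelian_monoid) finsum_closed_subset:
  assumes "finite I" "f \<in> I \<rightarrow> S" "S \<subseteq> carrier G" "\<zero> \<in> S" "\<And>x y. x \<in> S \<Longrightarrow> y \<in> S \<Longrightarrow> x \<oplus> y \<in> S"
  shows "finsum G f I \<in> S"
  using assms(1,2)
proof (induction I rule: finite_induct)
  case empty
  then show ?case using assms(4) by simp
next
  case (insert i I)
  have "finsum G f (insert i I) = f i \<oplus> finsum G f I"
    using insert assms(3) by (intro finsum_insert) auto
  moreover have "finsum G f I \<in> S" "f i \<in> S" using insert by auto
  ultimately show ?case using assms(5) by simp
qed

lemma (in abelian_monoid) finsum_remove:
  assumes "finite I" "i \<in> I" "f \<in> I \<rightarrow> carrier G"
  shows "finsum G f I = f i \<oplus> finsum G f (I - {i})"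
proof -
  have "finsum G f (insert i (I - {i})) = f i \<oplus> finsum G f (I - {i})"
    using assms by (intro finsum_insert) auto
  then show ?thesis using assms(2) by (simp add: insert_absorb)
qed

lemma (in abelian_monoid) finsum_single:
  assumes "finite I" "i \<in> I" "f i \<in> carrier G" "\<And>j. j \<in> I \<Longrightarrow> j \<noteq> i \<Longrightarrow> f j = \<zero>"
  shows "finsum G f I = f i"
proof -
  have c: "f j \<in> carrier G" if "j \<in> I" for j using assms(3,4) that by (cases "j = i") auto
  have "finsum G f (I - {i}) \<in> {\<zero>}"
    using assms by (intro finsum_closed_subset) auto
  then show ?thesis using finsum_remove[OF assms(1,2)] c assms(3) by simp
qed

context witt_deriv
begin

text \<open>The chosen representative is irrelevant since \<open>T\<close> vanishes on the image of \<open>h\<^sub>j\<close>.\<close>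

definition T_cls :: "nat \<Rightarrow> nat \<Rightarrow> (('a \<Rightarrow> 'a) set \<times> 'a) set \<Rightarrow> 'u" where
  "T_cls m j C = (let u = SOME u. u \<in> C in T m j (fst u) (snd u))"

lemma T_cls_M_cls:
  assumes a: "\<alpha> \<in> carrier \<Omega>" "a \<in> carrier A"
  shows "T_cls m j (M_cls j \<alpha> a) = T m j \<alpha> a"
proof -
  define u where "u = (SOME u. u \<in> M_cls j \<alpha> a)"
  have "u \<in> M_cls j \<alpha> a" unfolding u_def by (rule someI, rule M_cls_self[OF a])
  from M_cls_mem[OF this] obtain c where c: "c \<in> carrier A" "u = (\<ominus>\<^bsub>\<Omega>\<^esub> dd c \<oplus>\<^bsub>\<Omega>\<^esub> \<alpha>, [(p ^ j)] \<cdot> c \<oplus> a)" by blast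
  have "T m j (\<ominus>\<^bsub>\<Omega>\<^esub> dd c \<oplus>\<^bsub>\<Omega>\<^esub> \<alpha>) ([(p ^ j)] \<cdot> c \<oplus> a) = T m j (\<ominus>\<^bsub>\<Omega>\<^esub> dd c) ([(p ^ j)] \<cdot> c) \<oplus>\<^bsub>N (m + j)\<^esub> T m j \<alpha> a"
    using a c(1) by (intro T_add) simp_all
  also have "\<dots> = T m j \<alpha> a" using a c(1) by (simp add: T_h)
  finally show ?thesis unfolding T_cls_def u_def[symmetric] Let_def c(2) by simp
qed

lemma T_cls_closed: "C \<in> carrier (M_quot j) \<Longrightarrow> T_cls m j C \<in> carrier (N (m + j))"
  using M_quot_ex[of C j] by (auto simp: T_cls_M_cls)

lemma T_cls_add:
  assumes "C \<in> carrier (M_quot j)" "C' \<in> carrier (M_quot j)"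
  shows "T_cls m j (C \<oplus>\<^bsub>M_quot j\<^esub> C') = T_cls m j C \<oplus>\<^bsub>N (m + j)\<^esub> T_cls m j C'"
proof -
  obtain \<alpha> a \<beta> b where "\<alpha> \<in> carrier \<Omega>" "a \<in> carrier A" "C = M_cls j \<alpha> a" "\<beta> \<in> carrier \<Omega>" "b \<in> carrier A" "C' = M_cls j \<beta> b"
    using M_quot_ex[OF assms(1)] M_quot_ex[OF assms(2)] by blast
  then show ?thesis by (simp add: M_cls_add T_cls_M_cls T_add)
qed

lemma T_cls_smult:
  assumes "x \<in> carrier A" "C \<in> carrier (M_quot j)"
  shows "T_cls m j (x \<odot>\<^bsub>M_quot j\<^esub> C) = sec (m + j) x \<odot>\<^bsub>N (m + j)\<^esub> T_cls m j C"
proof -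
  obtain \<alpha> a where "\<alpha> \<in> carrier \<Omega>" "a \<in> carrier A" "C = M_cls j \<alpha> a"
    using M_quot_ex[OF assms(2)] by blast
  then show ?thesis using assms(1) by (simp add: M_cls_smult T_cls_M_cls T_smult pdiv)
qed

lemma T_zero: "T m j \<zero>\<^bsub>\<Omega>\<^esub> \<zero> = \<zero>\<^bsub>N (m + j)\<^esub>"
  using T_h[of \<zero> m j] Om.M.minus_equality[of "\<zero>\<^bsub>\<Omega>\<^esub>" "\<zero>\<^bsub>\<Omega>\<^esub>"] by (simp add: kaehler_d_zero)

lemma Vp_zero: "Vp m j \<zero>\<^bsub>N m\<^esub> = \<zero>\<^bsub>N (m + j)\<^esub>"
  by (induction j) (simp_all add: V1_zero)

lemma D_VW_sec_zero: "D (m + j) (VW m j (sec m \<zero>)) = \<zero>\<^bsub>N (m + j)\<^esub>"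
  using sec_add_pow[of \<zero> m 0] VW_add_pow[of "sec m \<zero>" m j 0] by (simp add: D_zero)

lemma T_left: "\<alpha> \<in> carrier \<Omega> \<Longrightarrow> T m j \<alpha> \<zero> = Vp m j (sN m \<alpha>)"
  by (simp add: T_def D_VW_sec_zero)

lemma T_right: "a \<in> carrier A \<Longrightarrow> T m j \<zero>\<^bsub>\<Omega>\<^esub> a = D (m + j) (VW m j (sec m a))"
  by (simp add: T_def sN_zero Vp_zero)

text \<open>\<open>M_0\<close> has another type than the factors with positive index, hence a pair
  rather than one product.\<close>

definition drw_source :: "nat \<Rightarrow> ('a, ('a \<Rightarrow> 'a) set \<times> (nat \<Rightarrow> (('a \<Rightarrow> 'a) set \<times> 'a) set)) module" where
  "drw_source n = pair_module \<Omega> (pi_module {1..n} M_quot)"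

definition drw_target :: "nat \<Rightarrow> ('a, 'u) module" where
  "drw_target n = pull_module (sec (Suc n)) (N (Suc n))"

text \<open>The starting level \<open>Suc n - j\<close> makes \<open>V^j\<close> end in level
  \<open>Suc n\<close>. It is positive for \<open>j\<close> up to \<open>n\<close>, which
  \<open>NN_T\<close> relies on.\<close>

definition drw_map :: "nat \<Rightarrow> ('a \<Rightarrow> 'a) set \<times> (nat \<Rightarrow> (('a \<Rightarrow> 'a) set \<times> 'a) set) \<Rightarrow> 'u" where
  "drw_map n x = sN (Suc n) (fst x) \<oplus>\<^bsub>N (Suc n)\<^esub> (\<Oplus>\<^bsub>N (Suc n)\<^esub>j\<in>{1..n}. T_cls (Suc n - j) j (snd x j))"

lemma drw_source_module: "module A (drw_source n)"
  unfolding drw_source_def by (intro pair_module_module pi_module_module kaehler_module cring_axioms M_quot_module)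

lemma drw_target_module: "module A (drw_target n)"
  unfolding drw_target_def by (intro pull_module_module[OF N_module] cring_axioms sec_hom)

lemma T_cls_closed_n: "C \<in> (\<Pi>\<^sub>E j\<in>{1..n}. carrier (M_quot j)) \<Longrightarrow> j \<in> {1..n} \<Longrightarrow> T_cls (Suc n - j) j (C j) \<in> carrier (N (Suc n))"
  using T_cls_closed[of "C j" j "Suc n - j"] by (auto dest: PiE_mem)

lemma drw_map_closed: "x \<in> carrier (drw_source n) \<Longrightarrow> drw_map n x \<in> carrier (N (Suc n))"
  unfolding drw_map_def by (rule N.M.a_closed; (rule N.M.finsum_closed)?)
    (auto simp: drw_source_def pair_module_simps pi_module_simps simp del: One_nat_def intro!: T_cls_closed_n)

lemma drw_map_add:
  assumes "x \<in> carrier (drw_source n)" "y \<in> carrier (drw_source n)"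
  shows "drw_map n (x \<oplus>\<^bsub>drw_source n\<^esub> y) = drw_map n x \<oplus>\<^bsub>N (Suc n)\<^esub> drw_map n y"
proof -
  obtain \<alpha> C \<beta> C' where x: "x = (\<alpha>, C)" "\<alpha> \<in> carrier \<Omega>" "C \<in> (\<Pi>\<^sub>E j\<in>{1..n}. carrier (M_quot j))"
    and y: "y = (\<beta>, C')" "\<beta> \<in> carrier \<Omega>" "C' \<in> (\<Pi>\<^sub>E j\<in>{1..n}. carrier (M_quot j))"
    using assms by (cases x; cases y) (auto simp: drw_source_def pair_module_simps pi_module_simps)
  let ?T = "\<lambda>C j. T_cls (Suc n - j) j (C j)"
  have T: "?T C \<in> {1..n} \<rightarrow> carrier (N (Suc n))" "?T C' \<in> {1..n} \<rightarrow> carrier (N (Suc n))"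
    using T_cls_closed_n[OF x(3)] T_cls_closed_n[OF y(3)] by blast+
  have "(\<Oplus>\<^bsub>N (Suc n)\<^esub>j\<in>{1..n}. ?T (\<lambda>j\<in>{1..n}. C j \<oplus>\<^bsub>M_quot j\<^esub> C' j) j) = (\<Oplus>\<^bsub>N (Suc n)\<^esub>j\<in>{1..n}. ?T C j \<oplus>\<^bsub>N (Suc n)\<^esub> ?T C' j)"
  proof (rule N.M.finsum_cong')
    fix j assume j: "j \<in> {1..n}"
    then have "Suc n - j + j = Suc n" by auto
    then show "?T (\<lambda>j\<in>{1..n}. C j \<oplus>\<^bsub>M_quot j\<^esub> C' j) j = ?T C j \<oplus>\<^bsub>N (Suc n)\<^esub> ?T C' j"
      using T_cls_add[OF PiE_mem[OF x(3) j] PiE_mem[OF y(3) j], of "Suc n - j"] j by simp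
  qed (use T in auto)
  also have "\<dots> = (\<Oplus>\<^bsub>N (Suc n)\<^esub>j\<in>{1..n}. ?T C j) \<oplus>\<^bsub>N (Suc n)\<^esub> (\<Oplus>\<^bsub>N (Suc n)\<^esub>j\<in>{1..n}. ?T C' j)"
    by (rule N.M.finsum_addf[OF T])
  finally show ?thesis
    using x y N.M.finsum_closed[OF T(1)] N.M.finsum_closed[OF T(2)]
    by (simp add: drw_map_def drw_source_def pair_module_simps pi_module_simps sN_add N.M.a_ac)
qed

lemma drw_map_smult:
  assumes "r \<in> carrier A" "x \<in> carrier (drw_source n)"
  shows "drw_map n (r \<odot>\<^bsub>drw_source n\<^esub> x) = sec (Suc n) r \<odot>\<^bsub>N (Suc n)\<^esub> drw_map n x"
proof -
  obtain \<alpha> C where x: "x = (\<alpha>, C)" "\<alpha> \<in> carrier \<Omega>" "C \<in> (\<Pi>\<^sub>E j\<in>{1..n}. carrier (M_quot j))"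
    using assms by (cases x) (auto simp: drw_source_def pair_module_simps pi_module_simps)
  let ?T = "\<lambda>C j. T_cls (Suc n - j) j (C j)"
  have T: "?T C \<in> {1..n} \<rightarrow> carrier (N (Suc n))" using T_cls_closed_n[OF x(3)] by blast
  have "(\<Oplus>\<^bsub>N (Suc n)\<^esub>j\<in>{1..n}. ?T (\<lambda>j\<in>{1..n}. r \<odot>\<^bsub>M_quot j\<^esub> C j) j) = (\<Oplus>\<^bsub>N (Suc n)\<^esub>j\<in>{1..n}. sec (Suc n) r \<odot>\<^bsub>N (Suc n)\<^esub> ?T C j)"
  proof (rule N.M.finsum_cong')
    fix j assume j: "j \<in> {1..n}"
    then have "Suc n - j + j = Suc n" by auto
    then show "?T (\<lambda>j\<in>{1..n}. r \<odot>\<^bsub>M_quot j\<^esub> C j) j = sec (Suc n) r \<odot>\<^bsub>N (Suc n)\<^esub> ?T C j"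
      using T_cls_smult[OF assms(1) PiE_mem[OF x(3) j], of "Suc n - j"] j by simp
  qed (use T assms(1) in auto)
  also have "\<dots> = sec (Suc n) r \<odot>\<^bsub>N (Suc n)\<^esub> (\<Oplus>\<^bsub>N (Suc n)\<^esub>j\<in>{1..n}. ?T C j)"
    using N.finsum_smult_ldistr[OF _ _ T, of "sec (Suc n) r"] assms(1) by simp
  finally show ?thesis
    using x assms(1) N.M.finsum_closed[OF T]
    by (simp add: drw_map_def drw_source_def pair_module_simps pi_module_simps sN_smult N.smult_r_distr)
qed

lemma drw_map_M_cls:
  assumes "\<alpha>0 \<in> carrier \<Omega>" "\<alpha> \<in> {1..n} \<rightarrow> carrier \<Omega>" "a \<in> {1..n} \<rightarrow> carrier A"
  shows "drw_map n (\<alpha>0, \<lambda>j\<in>{1..n}. M_cls j (\<alpha> j) (a j)) =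
    sN (Suc n) \<alpha>0 \<oplus>\<^bsub>N (Suc n)\<^esub> (\<Oplus>\<^bsub>N (Suc n)\<^esub>j\<in>{1..n}. T (Suc n - j) j (\<alpha> j) (a j))"
proof -
  have T: "T (Suc n - j) j (\<alpha> j) (a j) \<in> carrier (N (Suc n))" if "j \<in> {1..n}" for j
  proof -
    have "Suc n - j + j = Suc n" "\<alpha> j \<in> carrier \<Omega>" "a j \<in> carrier A" using that assms by auto
    then show ?thesis using T_closed[of "\<alpha> j" "a j" "Suc n - j" j] by simp
  qed
  have "(\<Oplus>\<^bsub>N (Suc n)\<^esub>j\<in>{1..n}. T_cls (Suc n - j) j ((\<lambda>j\<in>{1..n}. M_cls j (\<alpha> j) (a j)) j)) = (\<Oplus>\<^bsub>N (Suc n)\<^esub>j\<in>{1..n}. T (Suc n - j) j (\<alpha> j) (a j))"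
    using assms T by (intro N.M.finsum_cong') (auto simp: T_cls_M_cls Pi_iff)
  then show ?thesis by (simp add: drw_map_def)
qed

lemma drw_source_E:
  assumes "x \<in> carrier (drw_source n)"
  obtains \<alpha>0 \<alpha> a where "\<alpha>0 \<in> carrier \<Omega>" "\<alpha> \<in> {1..n} \<rightarrow> carrier \<Omega>" "a \<in> {1..n} \<rightarrow> carrier A"
    "x = (\<alpha>0, \<lambda>j\<in>{1..n}. M_cls j (\<alpha> j) (a j))"
proof -
  obtain \<alpha>0 C where x: "x = (\<alpha>0, C)" "\<alpha>0 \<in> carrier \<Omega>" "C \<in> (\<Pi>\<^sub>E j\<in>{1..n}. carrier (M_quot j))"
    using assms by (cases x) (auto simp: drw_source_def pair_module_simps pi_module_simps)
  have "\<forall>j\<in>{1..n}. \<exists>u. fst u \<in> carrier \<Omega> \<and> snd u \<in> carrier A \<and> C j = M_cls j (fst u) (snd u)"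
    using M_quot_ex[OF PiE_mem[OF x(3)]] by fastforce
  from bchoice[OF this] obtain u where u: "\<And>j. j \<in> {1..n} \<Longrightarrow> fst (u j) \<in> carrier \<Omega> \<and> snd (u j) \<in> carrier A \<and> C j = M_cls j (fst (u j)) (snd (u j))"
    by blast
  have "C = (\<lambda>j\<in>{1..n}. M_cls j (fst (u j)) (snd (u j)))"
    using u x(3) by (intro PiE_ext[OF x(3)]) auto
  then show thesis using u x(1,2) by (intro that[of \<alpha>0 "\<lambda>j. fst (u j)" "\<lambda>j. snd (u j)"]) auto
qed

lemma M_cls_closed_drw_source:
  "\<alpha>0 \<in> carrier \<Omega> \<Longrightarrow> \<alpha> \<in> {1..n} \<rightarrow> carrier \<Omega> \<Longrightarrow> a \<in> {1..n} \<rightarrow> carrier A \<Longrightarrow>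
   (\<alpha>0, \<lambda>j\<in>{1..n}. M_cls j (\<alpha> j) (a j)) \<in> carrier (drw_source n)"
  by (auto simp: drw_source_def pair_module_simps pi_module_simps Pi_iff)

lemma drw_map_single:
  assumes j: "j \<in> {1..n}" and a: "\<alpha> \<in> carrier \<Omega>" "a \<in> carrier A"
  shows "T (Suc n - j) j \<alpha> a \<in> drw_map n ` carrier (drw_source n)"
proof -
  let ?\<alpha> = "\<lambda>i. if i = j then \<alpha> else \<zero>\<^bsub>\<Omega>\<^esub>" and ?a = "\<lambda>i. if i = j then a else \<zero>"
  have c: "T (Suc n - j) j \<alpha> a \<in> carrier (N (Suc n))" using T_closed[OF a, of "Suc n - j" j] j by simp
  have "(\<Oplus>\<^bsub>N (Suc n)\<^esub>i\<in>{1..n}. T (Suc n - i) i (?\<alpha> i) (?a i)) = T (Suc n - j) j (?\<alpha> j) (?a j)"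
  proof (rule N.M.finsum_single)
    fix i assume "i \<in> {1..n}" "i \<noteq> j"
    then show "T (Suc n - i) i (?\<alpha> i) (?a i) = \<zero>\<^bsub>N (Suc n)\<^esub>" using T_zero[of "Suc n - i" i] by simp
  qed (use j c in auto)
  then have "drw_map n (\<zero>\<^bsub>\<Omega>\<^esub>, \<lambda>i\<in>{1..n}. M_cls i (?\<alpha> i) (?a i)) = T (Suc n - j) j \<alpha> a"
    using drw_map_M_cls[of "\<zero>\<^bsub>\<Omega>\<^esub>" ?\<alpha> n ?a] a c by (simp add: sN_zero)
  moreover have "(\<zero>\<^bsub>\<Omega>\<^esub>, \<lambda>i\<in>{1..n}. M_cls i (?\<alpha> i) (?a i)) \<in> carrier (drw_source n)"
    using a by (intro M_cls_closed_drw_source) auto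
  ultimately show ?thesis by (rule image_eqI[OF sym])
qed

lemma drw_map_fst:
  assumes a: "\<alpha> \<in> carrier \<Omega>"
  shows "sN (Suc n) \<alpha> \<in> drw_map n ` carrier (drw_source n)"
proof -
  have "(\<Oplus>\<^bsub>N (Suc n)\<^esub>i\<in>{1..n}. T (Suc n - i) i \<zero>\<^bsub>\<Omega>\<^esub> \<zero>) \<in> {\<zero>\<^bsub>N (Suc n)\<^esub>}"
  proof (rule N.M.finsum_closed_subset)
    show "(\<lambda>i. T (Suc n - i) i \<zero>\<^bsub>\<Omega>\<^esub> \<zero>) \<in> {1..n} \<rightarrow> {\<zero>\<^bsub>N (Suc n)\<^esub>}"
    proof
      fix i assume "i \<in> {1..n}"
      then show "T (Suc n - i) i \<zero>\<^bsub>\<Omega>\<^esub> \<zero> \<in> {\<zero>\<^bsub>N (Suc n)\<^esub>}" using T_zero[of "Suc n - i" i] by simp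
    qed
  qed auto
  then have "drw_map n (\<alpha>, \<lambda>i\<in>{1..n}. M_cls i \<zero>\<^bsub>\<Omega>\<^esub> \<zero>) = sN (Suc n) \<alpha>"
    using drw_map_M_cls[of \<alpha> "\<lambda>i. \<zero>\<^bsub>\<Omega>\<^esub>" n "\<lambda>i. \<zero>"] a by simp
  moreover have "(\<alpha>, \<lambda>i\<in>{1..n}. M_cls i \<zero>\<^bsub>\<Omega>\<^esub> \<zero>) \<in> carrier (drw_source n)"
    using a by (intro M_cls_closed_drw_source) auto
  ultimately show ?thesis by (rule image_eqI[OF sym])
qed

text \<open>\<open>span\<close> applied to the image of the map: the image is closed under addition
  and contains the two kinds of generators.\<close>

lemma drw_map_surj:
  assumes gen: "\<And>n H. (\<And>x y. x \<in> carrier (Wn n) \<Longrightarrow> y \<in> carrier (Wn n) \<Longrightarrow> x \<odot>\<^bsub>N n\<^esub> D n y \<in> H) \<Longrightarrow>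
      (\<And>u v. u \<in> H \<Longrightarrow> v \<in> H \<Longrightarrow> u \<in> carrier (N n) \<Longrightarrow> v \<in> carrier (N n) \<Longrightarrow> u \<oplus>\<^bsub>N n\<^esub> v \<in> H) \<Longrightarrow> carrier (N n) \<subseteq> H"
  shows "drw_map n ` carrier (drw_source n) = carrier (N (Suc n))"
proof
  show "drw_map n ` carrier (drw_source n) \<subseteq> carrier (N (Suc n))" using drw_map_closed by blast
  have zero: "\<zero>\<^bsub>N (Suc n)\<^esub> \<in> drw_map n ` carrier (drw_source n)"
    using drw_map_fst[of "\<zero>\<^bsub>\<Omega>\<^esub>" n] by (simp add: sN_zero)
  have sec0: "sec 0 a = sec 0 \<zero>" for a by (simp add: sec_def restrict_def)
  show "carrier (N (Suc n)) \<subseteq> drw_map n ` carrier (drw_source n)"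
  proof (rule span[OF gen])
    fix m j \<alpha> assume mj: "m + j = Suc n" and \<alpha>: "\<alpha> \<in> carrier \<Omega>"
    \<comment> \<open>\<open>span\<close> also produces the index \<open>j = Suc n\<close>, which
      lies outside the product. Its term starts in level 0, which is zero.\<close>
    consider "j = 0" | "m = 0" | "j \<in> {1..n}" "m = Suc n - j" using mj by fastforce
    then show "Vp m j (sN m \<alpha>) \<in> drw_map n ` carrier (drw_source n)"
    proof cases
      case 1
      then show ?thesis using drw_map_fst[OF \<alpha>, of n] mj by simp
    next
      case 2
      have "sN 0 \<alpha> = \<zero>\<^bsub>N 0\<^esub>" using sN_closed[OF \<alpha>, of 0] N_0 by simp
      then show ?thesis using Vp_zero[of 0 j] zero mj 2 by simp
    next
      case 3
      then show ?thesis using drw_map_single[OF 3(1) \<alpha> zero_closed] \<alpha> by (simp add: T_left)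
    qed
  next
    fix m j a assume mj: "m + Suc j = Suc n" and a: "a \<in> carrier A"
    show "D (Suc n) (VW m (Suc j) (sec m a)) \<in> drw_map n ` carrier (drw_source n)"
    proof (cases "m = 0")
      case True
      then show ?thesis using D_VW_sec_zero[of 0 "Suc j"] sec0[of a] zero mj by simp
    next
      case False
      then have "Suc j \<in> {1..n}" "Suc n - Suc j = m" "m + Suc j = Suc n" using mj by auto
      then show ?thesis using drw_map_single[of "Suc j" n "\<zero>\<^bsub>\<Omega>\<^esub>" a] a T_right[of a m "Suc j"] by simp
    qed
  next
    interpret S: module A "drw_source n" by (rule drw_source_module)
    fix u v assume "u \<in> drw_map n ` carrier (drw_source n)" "v \<in> drw_map n ` carrier (drw_source n)"
    then obtain x y where "x \<in> carrier (drw_source n)" "y \<in> carrier (drw_source n)" "u = drw_map n x" "v = drw_map n y" by blast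
    then show "u \<oplus>\<^bsub>N (Suc n)\<^esub> v \<in> drw_map n ` carrier (drw_source n)"
      by (intro image_eqI[of _ _ "x \<oplus>\<^bsub>drw_source n\<^esub> y"]) (simp_all add: drw_map_add)
  qed
qed

end

section \<open>Coding the test complex inside the type of \<open>E\<close>\<close>

lemma infinite_list_inj:
  assumes "infinite (UNIV :: 'u set)"
  shows "\<exists>L :: 'u list \<Rightarrow> 'u. inj L"
proof -
  have "(card_of ((UNIV :: 'u set) \<times> (UNIV :: 'u set)), card_of (UNIV :: 'u set)) \<in> ordLeq"
    using card_of_Times_same_infinite[OF assms] by (rule ordIso_imp_ordLeq)
  then obtain P :: "'u \<times> 'u \<Rightarrow> 'u" where P: "inj P" by (auto simp: card_of_ordLeq[symmetric])
  obtain c :: "nat \<Rightarrow> 'u" where c: "inj c" using infinite_countable_subset[OF assms] by blast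
  \<comment> \<open>Iterated pairing separates lists of equal length only, so the length is stored
    separately by means of \<open>c\<close>.\<close>
  define K where "K xs = foldr (\<lambda>x y. P (x, y)) xs undefined" for xs
  have K: "xs = ys" if "length xs = length ys" "K xs = K ys" for xs ys
    using that by (induction xs ys rule: list_induct2) (auto simp: K_def dest: injD[OF P])
  have "inj (\<lambda>xs. P (c (length xs), K xs))"
    by (intro injI K) (auto dest!: injD[OF P] injD[OF c])
  then show ?thesis by blast
qed

context frob_aut
begin

lemma cl_rep: "t \<in> carrier (tq m) \<Longrightarrow> cl m (rep m t) = t"
  unfolding rep_def by (rule conjunct2, rule someI_ex[of "\<lambda>a. a \<in> carrier A \<and> cl m a = t"]) (blast elim: tq_E)

text \<open>Differentials are coded by lists of pairs \<open>(a, b)\<close>, each standing for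
  \<open>a db\<close>. The type in which \<Omega> is defined consists of sets of functions and may
  be too large to embed into \<open>'u\<close>.\<close>

definition dform :: "('a \<times> 'a) list \<Rightarrow> ('a \<Rightarrow> 'a) set" where
  "dform l = foldr (\<lambda>(a, b) \<omega>. a \<odot>\<^bsub>\<Omega>\<^esub> dd b \<oplus>\<^bsub>\<Omega>\<^esub> \<omega>) l \<zero>\<^bsub>\<Omega>\<^esub>"

lemma dform_closed: "l \<in> lists (carrier A \<times> carrier A) \<Longrightarrow> dform l \<in> carrier \<Omega>"
  by (induction l) (auto simp: dform_def)

lemma dform_append:
  "l \<in> lists (carrier A \<times> carrier A) \<Longrightarrow> l' \<in> lists (carrier A \<times> carrier A) \<Longrightarrow> dform (l @ l') = dform l \<oplus>\<^bsub>\<Omega>\<^esub> dform l'"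
proof (induction l)
  case Nil
  then show ?case using dform_closed[of l'] by (simp add: dform_def)
next
  case (Cons u l)
  obtain a b where u: "u = (a, b)" by (cases u)
  have "dform ((u # l) @ l') = a \<odot>\<^bsub>\<Omega>\<^esub> dd b \<oplus>\<^bsub>\<Omega>\<^esub> dform (l @ l')" "dform (u # l) = a \<odot>\<^bsub>\<Omega>\<^esub> dd b \<oplus>\<^bsub>\<Omega>\<^esub> dform l"
    by (simp_all add: dform_def u)
  then show ?case using Cons u dform_closed[of l] dform_closed[of l'] by (simp add: Om.M.a_assoc)
qed

lemma dform_surj: "\<alpha> \<in> carrier \<Omega> \<Longrightarrow> \<exists>l\<in>lists (carrier A \<times> carrier A). dform l = \<alpha>"
proof (induction rule: kaehler_induct)
  case zero
  then show ?case by (intro bexI[of _ "[]"]) (auto simp: dform_def)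
next
  case (gen a b)
  then show ?case by (intro bexI[of _ "[(a, b)]"]) (auto simp: dform_def)
next
  case (add \<alpha> \<beta>)
  then obtain l l' where l: "l \<in> lists (carrier A \<times> carrier A)" "l' \<in> lists (carrier A \<times> carrier A)" "dform l = \<alpha>" "dform l' = \<beta>" by blast
  have "dform (l @ l') = \<alpha> \<oplus>\<^bsub>\<Omega>\<^esub> \<beta>" using dform_append[OF l(1,2)] unfolding l(3,4) .
  moreover have "l @ l' \<in> lists (carrier A \<times> carrier A)" using l(1,2) by simp
  ultimately show ?case by blast
qed

text \<open>A truncated Witt vector is a finite list of elements of \<open>A\<close>, a differential
  is a finite list of pairs, and a class modulo \<open>p^m\<close> has a representative in
  \<open>A\<close>; all of these are lists over \<open>'u\<close> up to nesting.\<close>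

lemma encodings_exist:
  assumes "infinite (UNIV :: 'u set)" and \<iota>: "inj (\<iota> :: 'a \<Rightarrow> 'u)"
  shows "\<exists>(e0 :: nat \<Rightarrow> (nat \<Rightarrow> 'a) \<Rightarrow> 'u) (e1 :: nat \<Rightarrow> _ \<Rightarrow> 'u). (\<forall>n. inj_on (e0 n) (carrier (Wn n))) \<and> (\<forall>n. inj_on (e1 n) (carrier (NN n)))"
proof -
  obtain L :: "'u list \<Rightarrow> 'u" where L: "inj L" using infinite_list_inj[OF assms(1)] by blast
  obtain s where s: "\<And>\<alpha>. \<alpha> \<in> carrier \<Omega> \<Longrightarrow> dform (s \<alpha>) = \<alpha>" using dform_surj by metis
  define c where "c \<alpha> = L (map (\<lambda>(a, b). L [\<iota> a, \<iota> b]) (s \<alpha>))" for \<alpha>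
  have pair: "inj (\<lambda>(a, b). L [\<iota> a, \<iota> b])"
    by (rule injI) (auto simp: inj_eq[OF L] inj_eq[OF \<iota>])
  have c: "\<alpha> = \<beta>" if "c \<alpha> = c \<beta>" "\<alpha> \<in> carrier \<Omega>" "\<beta> \<in> carrier \<Omega>" for \<alpha> \<beta>
  proof -
    have "s \<alpha> = s \<beta>" by (rule map_injective[OF injD[OF L that(1)[unfolded c_def]] pair])
    then have "dform (s \<alpha>) = dform (s \<beta>)" by (rule arg_cong)
    then show ?thesis unfolding s[OF that(2)] s[OF that(3)] .
  qed
  define e0 where "e0 n x = L (map (\<lambda>i. \<iota> (x i)) [0..<n])" for n and x :: "nat \<Rightarrow> 'a"
  define e1 :: "nat \<Rightarrow> _ \<Rightarrow> 'u" where "e1 n \<omega> = L (map (\<lambda>m. L [c (fst (\<omega> m)), \<iota> (rep m (snd (\<omega> m)))]) [0..<n])" for n \<omega>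
  have "inj_on (e0 n) (carrier (Wn n))" for n
  proof (rule inj_onI)
    fix x y assume x: "x \<in> carrier (Wn n)" and y: "y \<in> carrier (Wn n)" and "e0 n x = e0 n y"
    then have "map (\<lambda>i. \<iota> (x i)) [0..<n] = map (\<lambda>i. \<iota> (y i)) [0..<n]" unfolding e0_def by (intro injD[OF L])
    then have "\<forall>i<n. x i = y i" by (simp add: inj_eq[OF \<iota>])
    then show "x = y" using x y by (intro PiE_ext[of x "{..<n}" _ y]) (auto simp: witt_ring_simps)
  qed
  moreover have "inj_on (e1 n) (carrier (NN n))" for n
  proof (rule inj_onI)
    fix \<omega> \<eta> assume \<omega>: "\<omega> \<in> carrier (NN n)" and \<eta>: "\<eta> \<in> carrier (NN n)" and "e1 n \<omega> = e1 n \<eta>"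
    then have eq: "map (\<lambda>m. L [c (fst (\<omega> m)), \<iota> (rep m (snd (\<omega> m)))]) [0..<n] = map (\<lambda>m. L [c (fst (\<eta> m)), \<iota> (rep m (snd (\<eta> m)))]) [0..<n]"
      unfolding e1_def by (intro injD[OF L])
    have "\<omega> m = \<eta> m" if m: "m < n" for m
    proof -
      have mem: "fst (\<omega> m) \<in> carrier \<Omega>" "fst (\<eta> m) \<in> carrier \<Omega>" "snd (\<omega> m) \<in> carrier (tq m)" "snd (\<eta> m) \<in> carrier (tq m)"
        using PiE_mem[OF \<omega>[unfolded NN_simps], of m] PiE_mem[OF \<eta>[unfolded NN_simps], of m] m by auto
      have "L [c (fst (\<omega> m)), \<iota> (rep m (snd (\<omega> m)))] = L [c (fst (\<eta> m)), \<iota> (rep m (snd (\<eta> m)))]"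
        using eq m by simp
      from injD[OF L this] have *: "c (fst (\<omega> m)) = c (fst (\<eta> m))" "\<iota> (rep m (snd (\<omega> m))) = \<iota> (rep m (snd (\<eta> m)))" by simp_all
      have fst: "fst (\<omega> m) = fst (\<eta> m)" by (rule c[OF *(1) mem(1,2)])
      have "cl m (rep m (snd (\<omega> m))) = cl m (rep m (snd (\<eta> m)))" by (rule arg_cong[OF injD[OF \<iota> *(2)]])
      then have "snd (\<omega> m) = snd (\<eta> m)" unfolding cl_rep[OF mem(3)] cl_rep[OF mem(4)] .
      with fst show "\<omega> m = \<eta> m" by (rule prod_eqI)
    qed
    then show "\<omega> = \<eta>" by (intro PiE_ext[OF \<omega>[unfolded NN_simps] \<eta>[unfolded NN_simps]]) auto
  qed
  ultimately show ?thesis by blast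
qed

end

context frob_witt_complex
begin

text \<open>The morphism to the test complex given by initiality, restricted to degree one and freed
  from the coding.\<close>

lemma realization_exists:
  assumes drw: "is_de_rham_witt p A E"
  shows "\<exists>g. (\<forall>n. \<forall>\<omega>\<in>carrier (N n). g n \<omega> \<in> carrier (NN n)) \<and>
    (\<forall>n. \<forall>\<omega>\<in>carrier (N n). \<forall>\<eta>\<in>carrier (N n). g n (\<omega> \<oplus>\<^bsub>N n\<^esub> \<eta>) = g n \<omega> \<oplus>\<^bsub>NN n\<^esub> g n \<eta>) \<and>
    (\<forall>n. \<forall>x\<in>carrier (Wn n). \<forall>\<omega>\<in>carrier (N n). g n (x \<odot>\<^bsub>N n\<^esub> \<omega>) = x \<odot>\<^bsub>NN n\<^esub> g n \<omega>) \<and>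
    (\<forall>n. \<forall>x\<in>carrier (Wn n). g n (D n x) = DD n x) \<and>
    (\<forall>n. \<forall>\<omega>\<in>carrier (N n). g (Suc n) (ver E n 1 \<omega>) = VV n (g n \<omega>))"
proof -
  obtain \<iota> :: "'a \<Rightarrow> 'u" where "infinite (UNIV :: 'u set)" "inj \<iota>" using drw unfolding is_de_rham_witt_def by blast
  from encodings_exist[OF this] obtain e0 :: "nat \<Rightarrow> (nat \<Rightarrow> 'a) \<Rightarrow> 'u" and e1 :: "nat \<Rightarrow> _ \<Rightarrow> 'u"
    where e: "\<And>n. inj_on (e0 n) (carrier (Wn n))" "\<And>n. inj_on (e1 n) (carrier (NN n))" by blast
  interpret TR: trunc_complex A p \<phi> NN DD FF VV RR e0 e1 by (rule trunc_complex_NN[OF e])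
  obtain f where f: "witt_complex_hom p A E TR.E f"
    using drw TR.witt_complex_E unfolding is_de_rham_witt_def by blast
  have f_cl: "\<And>n q x. x \<in> elts E n q \<Longrightarrow> f n q x \<in> elts TR.E n q"
    and f_add: "\<And>n q x y. x \<in> elts E n q \<Longrightarrow> y \<in> elts E n q \<Longrightarrow> f n q (x \<oplus>\<^bsub>cmp E n q\<^esub> y) = f n q x \<oplus>\<^bsub>cmp TR.E n q\<^esub> f n q y"
    and f_mul: "\<And>n q r x y. x \<in> elts E n q \<Longrightarrow> y \<in> elts E n r \<Longrightarrow> f n (q + r) (mul E n q r x y) = mul TR.E n q r (f n q x) (f n r y)"
    and f_dif: "\<And>n q x. x \<in> elts E n q \<Longrightarrow> f n (q + 1) (dif E n q x) = dif TR.E n q (f n q x)"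
    and f_lam: "\<And>n x. x \<in> carrier (Wn n) \<Longrightarrow> f n 0 (lam E n x) = lam TR.E n x"
    and f_ver: "\<And>n q x. x \<in> elts E n q \<Longrightarrow> f (n + 1) q (ver E n q x) = ver TR.E n q (f n q x)"
    using f unfolding witt_complex_hom_def by simp_all
  define g where "g n \<omega> = TR.d1 n (f n 1 \<omega>)" for n \<omega>
  have g: "g n \<omega> \<in> carrier (NN n) \<and> f n 1 \<omega> = e1 n (g n \<omega>)" if "\<omega> \<in> carrier (N n)" for n \<omega>
    using f_cl[of \<omega> n 1] that by (auto simp: deg1_module_simps TR.elts_E g_def)
  have g_add: "g n (\<omega> \<oplus>\<^bsub>N n\<^esub> \<eta>) = g n \<omega> \<oplus>\<^bsub>NN n\<^esub> g n \<eta>" if "\<omega> \<in> carrier (N n)" "\<eta> \<in> carrier (N n)" for n \<omega> \<eta>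
  proof -
    have "f n 1 (\<omega> \<oplus>\<^bsub>N n\<^esub> \<eta>) = e1 n (g n \<omega> \<oplus>\<^bsub>NN n\<^esub> g n \<eta>)"
      using f_add[of \<omega> n 1 \<eta>] g[OF that(1)] g[OF that(2)] that by (simp add: deg1_module_simps TR.E_sel enc_ring_add e)
    then show ?thesis unfolding g_def[of n "\<omega> \<oplus>\<^bsub>N n\<^esub> \<eta>"] using g that by simp
  qed
  have g_smult: "g n (x \<odot>\<^bsub>N n\<^esub> \<omega>) = x \<odot>\<^bsub>NN n\<^esub> g n \<omega>" if "x \<in> carrier (Wn n)" "\<omega> \<in> carrier (N n)" for n x \<omega>
  proof -
    have "f n 1 (x \<odot>\<^bsub>N n\<^esub> \<omega>) = e1 n (x \<odot>\<^bsub>NN n\<^esub> g n \<omega>)"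
      using f_mul[of "lam E n x" n 0 \<omega> 1] g[OF that(2)] that f_lam[OF that(1)] lam_closed[OF that(1)]
      by (simp add: deg1_module_simps TR.E_sel)
    then show ?thesis unfolding g_def[of n "x \<odot>\<^bsub>N n\<^esub> \<omega>"] using g that by simp
  qed
  have g_D: "g n (D n x) = DD n x" if "x \<in> carrier (Wn n)" for n x
    using f_dif[of "lam E n x" n 0] f_lam[OF that] lam_closed[OF that] that by (simp add: g_def TR.E_sel)
  have g_V: "g (Suc n) (ver E n 1 \<omega>) = VV n (g n \<omega>)" if "\<omega> \<in> carrier (N n)" for n \<omega>
  proof -
    have "f (Suc n) 1 (ver E n 1 \<omega>) = e1 (Suc n) (VV n (g n \<omega>))"
      using f_ver[of \<omega> n 1] g[OF that] that by (simp add: deg1_module_simps TR.E_sel)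
    then show ?thesis unfolding g_def[of "Suc n"] using g[OF that] by simp
  qed
  show ?thesis
    by (intro exI[of _ g] conjI allI ballI; (rule g[THEN conjunct1] g_add g_smult g_D g_V; assumption))
qed

end

section \<open>Injectivity of the comparison map\<close>

context witt_deriv
begin

interpretation NN: witt_deriv A p \<phi> NN DD FF VV by (rule witt_deriv_NN)

context
  fixes g
  assumes g_closed: "\<And>n \<omega>. \<omega> \<in> carrier (N n) \<Longrightarrow> g n \<omega> \<in> carrier (NN n)"
    and g_add: "\<And>n \<omega> \<eta>. \<omega> \<in> carrier (N n) \<Longrightarrow> \<eta> \<in> carrier (N n) \<Longrightarrow> g n (\<omega> \<oplus>\<^bsub>N n\<^esub> \<eta>) = g n \<omega> \<oplus>\<^bsub>NN n\<^esub> g n \<eta>"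
    and g_smult: "\<And>n x \<omega>. x \<in> carrier (Wn n) \<Longrightarrow> \<omega> \<in> carrier (N n) \<Longrightarrow> g n (x \<odot>\<^bsub>N n\<^esub> \<omega>) = x \<odot>\<^bsub>NN n\<^esub> g n \<omega>"
    and g_D: "\<And>n x. x \<in> carrier (Wn n) \<Longrightarrow> g n (D n x) = DD n x"
    and g_V: "\<And>n \<omega>. \<omega> \<in> carrier (N n) \<Longrightarrow> g (Suc n) (V1 n \<omega>) = VV n (g n \<omega>)"
begin

lemma g_zero: "g n \<zero>\<^bsub>N n\<^esub> = \<zero>\<^bsub>NN n\<^esub>"
  using g_smult[of "\<zero>\<^bsub>Wn n\<^esub>" n "\<zero>\<^bsub>N n\<^esub>"] g_closed[of "\<zero>\<^bsub>N n\<^esub>" n] by simp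

lemma g_sN: "\<alpha> \<in> carrier \<Omega> \<Longrightarrow> g n (sN n \<alpha>) = NN.sN n \<alpha>"
proof (induction rule: kaehler_induct)
  case zero
  then show ?case by (simp only: sN_zero NN.sN_zero g_zero)
next
  case (gen a b)
  then show ?case by (simp add: sN_smult NN.sN_smult sN_d NN.sN_d g_smult g_D)
next
  case (add \<alpha> \<beta>)
  then show ?case by (simp add: sN_add NN.sN_add g_add)
qed

lemma g_Vp: "\<omega> \<in> carrier (N m) \<Longrightarrow> g (m + j) (Vp m j \<omega>) = NN.Vp m j (g m \<omega>)"
  by (induction j) (simp_all add: g_V)

lemma g_T: "\<alpha> \<in> carrier \<Omega> \<Longrightarrow> a \<in> carrier A \<Longrightarrow> g (m + j) (T m j \<alpha> a) = NN.T m j \<alpha> a"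
  by (simp add: T_def NN.T_def g_add g_Vp g_sN g_D)

text \<open>The kernel of the \<open>i\<close>-th component of the realization. As it is closed
  under addition, whole partial sums can be discarded in that component.\<close>

definition null_at :: "nat \<Rightarrow> nat \<Rightarrow> 'u set" where
  "null_at n i = {\<omega> \<in> carrier (N (Suc n)). g (Suc n) \<omega> i = (\<zero>\<^bsub>\<Omega>\<^esub>, cl i \<zero>)}"

lemma null_at_zero: "i \<le> n \<Longrightarrow> \<zero>\<^bsub>N (Suc n)\<^esub> \<in> null_at n i"
  by (simp add: null_at_def g_zero NN_simps cl_zero)

lemma null_at_add: "i \<le> n \<Longrightarrow> \<omega> \<in> null_at n i \<Longrightarrow> \<eta> \<in> null_at n i \<Longrightarrow> \<omega> \<oplus>\<^bsub>N (Suc n)\<^esub> \<eta> \<in> null_at n i"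
  by (auto simp: null_at_def g_add NN_simps cl_add)

lemma null_at_cancel:
  assumes i: "i \<le> n" and \<omega>: "\<omega> \<in> carrier (N (Suc n))" and \<eta>: "\<eta> \<in> null_at n i" and 0: "\<omega> \<oplus>\<^bsub>N (Suc n)\<^esub> \<eta> = \<zero>\<^bsub>N (Suc n)\<^esub>"
  shows "\<omega> \<in> null_at n i"
proof -
  interpret tq: module A "tq i" by (rule tq_module)
  have \<eta>': "\<eta> \<in> carrier (N (Suc n))" "g (Suc n) \<eta> i = (\<zero>\<^bsub>\<Omega>\<^esub>, cl i \<zero>)" using \<eta> by (auto simp: null_at_def)
  have mem: "fst (g (Suc n) \<omega> i) \<in> carrier \<Omega>" "snd (g (Suc n) \<omega> i) \<in> carrier (tq i)"
    using PiE_mem[OF g_closed[OF \<omega>, unfolded NN_simps], of i] i by auto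
  have "(g (Suc n) \<omega> \<oplus>\<^bsub>NN (Suc n)\<^esub> g (Suc n) \<eta>) i = \<zero>\<^bsub>NN (Suc n)\<^esub> i" using g_add[OF \<omega> \<eta>'(1)] 0 g_zero by simp
  then have "g (Suc n) \<omega> i = (\<zero>\<^bsub>\<Omega>\<^esub>, cl i \<zero>)" using mem i \<eta>'(2) by (auto simp: NN_simps simp flip: cl_zero intro!: prod_eqI)
  then show ?thesis using \<omega> by (simp add: null_at_def)
qed

text \<open>In component \<open>j\<close> the summands of larger index vanish by \<open>NN_T\<close>
  and those of smaller index are zero by induction, which isolates the pair belonging to
  \<open>j\<close>. Its second entry gives \<open>a j = p^j c\<close>, and cancelling
  \<open>p^j\<close> in the first one gives \<open>-dc\<close> for
  \<open>\<alpha> j\<close>.\<close>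

lemma drw_map_kernel:
  assumes \<alpha>0: "\<alpha>0 \<in> carrier \<Omega>" and \<alpha>: "\<alpha> \<in> {1..n} \<rightarrow> carrier \<Omega>" and a: "a \<in> {1..n} \<rightarrow> carrier A"
    and 0: "sN (Suc n) \<alpha>0 \<oplus>\<^bsub>N (Suc n)\<^esub> (\<Oplus>\<^bsub>N (Suc n)\<^esub>j\<in>{1..n}. T (Suc n - j) j (\<alpha> j) (a j)) = \<zero>\<^bsub>N (Suc n)\<^esub>"
  shows "\<alpha>0 = \<zero>\<^bsub>\<Omega>\<^esub>" and "j \<in> {1..n} \<Longrightarrow> M_cls j (\<alpha> j) (a j) = \<zero>\<^bsub>M_quot j\<^esub>"
proof -
  define t where "t j = T (Suc n - j) j (\<alpha> j) (a j)" for j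
  have mem: "\<alpha> j \<in> carrier \<Omega>" "a j \<in> carrier A" "Suc n - j + j = Suc n" "0 < Suc n - j" "0 < j" if "j \<in> {1..n}" for j
    using \<alpha> a that by auto
  have t: "t j \<in> carrier (N (Suc n))" if "j \<in> {1..n}" for j
    using T_closed[OF mem(1,2)[OF that], of "Suc n - j" j] mem(3)[OF that] by (simp add: t_def)
  have gt: "g (Suc n) (t j) = NN.T (Suc n - j) j (\<alpha> j) (a j)" if "j \<in> {1..n}" for j
    using g_T[OF mem(1,2)[OF that], of "Suc n - j" j] mem(3)[OF that] by (simp add: t_def)
  have t_null: "t j \<in> null_at n i" if "j \<in> {1..n}" "i < j" for i j
    using t[OF that(1)] NN_T(1)[OF mem(1,2,4,5)[OF that(1)] that(2)] by (simp add: null_at_def gt[OF that(1)])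
  have sub: "null_at n i \<subseteq> carrier (N (Suc n))" for i by (auto simp: null_at_def)
  have "finsum (N (Suc n)) t {1..n} \<in> null_at n 0"
    by (rule N.M.finsum_closed_subset[OF _ _ sub null_at_zero null_at_add]) (auto intro!: t_null)
  then have "sN (Suc n) \<alpha>0 \<in> null_at n 0"
    using null_at_cancel[of 0 n "sN (Suc n) \<alpha>0"] \<alpha>0 0 by (simp add: t_def[abs_def])
  then show \<alpha>0': "\<alpha>0 = \<zero>\<^bsub>\<Omega>\<^esub>" using NN_sN_0[OF \<alpha>0, of "Suc n"] \<alpha>0 by (simp add: null_at_def g_sN)
  have sum0: "finsum (N (Suc n)) t {1..n} = \<zero>\<^bsub>N (Suc n)\<^esub>"
    using 0 N.M.finsum_closed[of t "{1..n}" "Suc n"] t unfolding \<alpha>0' by (simp add: sN_zero t_def[abs_def] Pi_iff)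
  \<comment> \<open>The vanishing of \<open>t j\<close> itself is carried along, since later steps
    have to remove the earlier summands.\<close>
  have main: "M_cls j (\<alpha> j) (a j) = \<zero>\<^bsub>M_quot j\<^esub> \<and> t j = \<zero>\<^bsub>N (Suc n)\<^esub>" if "j \<in> {1..n}" for j
    using that
  proof (induction j rule: less_induct)
    case (less j)
    note m = mem[OF less.prems]
    have rest: "finsum (N (Suc n)) t ({1..n} - {j}) \<in> null_at n j"
    proof (rule N.M.finsum_closed_subset[OF _ _ sub null_at_zero null_at_add])
      show "t \<in> {1..n} - {j} \<rightarrow> null_at n j"
      proof
        fix i assume i: "i \<in> {1..n} - {j}"
        then consider "i < j" | "j < i" by fastforce
        then show "t i \<in> null_at n j"
        proof cases
          case 1
          then show ?thesis using less.IH[of i] i less.prems null_at_zero[of j n] by simp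
        next
          case 2
          then show ?thesis using t_null i by blast
        qed
      qed
    qed (use less.prems in auto)
    have "t j \<oplus>\<^bsub>N (Suc n)\<^esub> finsum (N (Suc n)) t ({1..n} - {j}) = \<zero>\<^bsub>N (Suc n)\<^esub>"
      using N.M.finsum_remove[of "{1..n}" j t "Suc n"] less.prems t sum0 by (simp add: Pi_iff)
    then have "t j \<in> null_at n j" using null_at_cancel[OF _ t[OF less.prems] rest] less.prems by simp
    then have eq: "[(p ^ j)] \<cdot>\<^bsub>\<Omega>\<^esub> \<alpha> j \<oplus>\<^bsub>\<Omega>\<^esub> dd (a j) = \<zero>\<^bsub>\<Omega>\<^esub>" and "cl j (a j) = cl j \<zero>"
      using NN_T(2)[OF m(1,2,4,5)] by (simp_all add: null_at_def gt[OF less.prems])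
    then have "pcong j (a j) \<zero>" using cl_eq_iff m(2) by simp
    then obtain c where c: "c \<in> carrier A" "a j = [(p ^ j)] \<cdot> c" by (auto simp: pcong_def)
    have "[(p ^ j)] \<cdot>\<^bsub>\<Omega>\<^esub> (\<alpha> j \<oplus>\<^bsub>\<Omega>\<^esub> dd c) = \<zero>\<^bsub>\<Omega>\<^esub>"
      using eq c m(1) by (simp add: Om.add_pow_add kaehler_d_add_pow)
    then have "\<alpha> j \<oplus>\<^bsub>\<Omega>\<^esub> dd c = \<zero>\<^bsub>\<Omega>\<^esub>" by (rule Omega_torsion_free_pow[rotated]) (use c m(1) in simp)
    then have "\<alpha> j = \<ominus>\<^bsub>\<Omega>\<^esub> dd c" using Om.M.minus_equality[of "\<alpha> j" "dd c"] c m(1) by simp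
    then show ?case using M_cls_h[OF c(1), of j] T_h[OF c(1), of "Suc n - j" j] c(2) m(3) by (simp add: t_def)
  qed
  then show "M_cls j (\<alpha> j) (a j) = \<zero>\<^bsub>M_quot j\<^esub>" if "j \<in> {1..n}" using that by blast
qed

lemma drw_map_inj: "inj_on (drw_map n) (carrier (drw_source n))"
proof (rule inj_onI)
  interpret S: module A "drw_source n" by (rule drw_source_module)
  fix x y assume x: "x \<in> carrier (drw_source n)" and y: "y \<in> carrier (drw_source n)" and eq: "drw_map n x = drw_map n y"
  define z where "z = x \<ominus>\<^bsub>drw_source n\<^esub> y"
  have z: "z \<in> carrier (drw_source n)" "z \<oplus>\<^bsub>drw_source n\<^esub> y = x" using x y by (simp_all add: z_def S.M.minus_eq S.M.a_assoc S.M.l_neg)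
  have "drw_map n z \<oplus>\<^bsub>N (Suc n)\<^esub> drw_map n y = drw_map n y" using drw_map_add[OF z(1) y] z(2) eq by simp
  then have z0: "drw_map n z = \<zero>\<^bsub>N (Suc n)\<^esub>"
    using N.M.add.r_cancel_one[OF drw_map_closed[OF y] drw_map_closed[OF z(1)]] by simp
  obtain \<alpha>0 \<alpha> a where za: "\<alpha>0 \<in> carrier \<Omega>" "\<alpha> \<in> {1..n} \<rightarrow> carrier \<Omega>" "a \<in> {1..n} \<rightarrow> carrier A"
    "z = (\<alpha>0, \<lambda>j\<in>{1..n}. M_cls j (\<alpha> j) (a j))" by (rule drw_source_E[OF z(1)])
  note k = drw_map_kernel[OF za(1-3) z0[unfolded za(4) drw_map_M_cls[OF za(1-3)]]]
  have "z = \<zero>\<^bsub>drw_source n\<^esub>"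
    unfolding za(4) drw_source_def pair_module_simps pi_module_simps using k by (auto intro!: restrict_ext)
  then show "x = y" using z y by simp
qed

end

end

lemma finsum_pull_module: "finsum (pull_module \<rho> M) f I = finsum M f I"
  by (simp add: finsum_def finprod_def pull_module_def)

section \<open>The isomorphism, and its transfer to \<open>A = W(k)\<close>\<close>

context frob_witt_complex
begin

lemma drw_map_iso:
  assumes drw: "is_de_rham_witt p A E"
  shows "module_iso A (W.drw_source n) (W.drw_target n) (W.drw_map n)"
proof -
  obtain g where g: "\<And>n \<omega>. \<omega> \<in> carrier (N n) \<Longrightarrow> g n \<omega> \<in> carrier (NN n)"
    "\<And>n \<omega> \<eta>. \<omega> \<in> carrier (N n) \<Longrightarrow> \<eta> \<in> carrier (N n) \<Longrightarrow> g n (\<omega> \<oplus>\<^bsub>N n\<^esub> \<eta>) = g n \<omega> \<oplus>\<^bsub>NN n\<^esub> g n \<eta>"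
    "\<And>n x \<omega>. x \<in> carrier (Wn n) \<Longrightarrow> \<omega> \<in> carrier (N n) \<Longrightarrow> g n (x \<odot>\<^bsub>N n\<^esub> \<omega>) = x \<odot>\<^bsub>NN n\<^esub> g n \<omega>"
    "\<And>n x. x \<in> carrier (Wn n) \<Longrightarrow> g n (D n x) = DD n x"
    "\<And>n \<omega>. \<omega> \<in> carrier (N n) \<Longrightarrow> g (Suc n) (ver E n 1 \<omega>) = VV n (g n \<omega>)"
    using realization_exists[OF drw] by (elim exE conjE) (rule that; (drule spec)+; (drule bspec, assumption)+; assumption)
  have "inj_on (W.drw_map n) (carrier (W.drw_source n))"
    by (rule W.drw_map_inj[OF g])
  moreover have "W.drw_map n ` carrier (W.drw_source n) = carrier (N (Suc n))"
    by (rule W.drw_map_surj[OF dspan_gen[OF drw]])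
  ultimately show ?thesis
    using W.drw_source_module W.drw_target_module W.drw_map_add W.drw_map_smult
    by (simp add: module_iso_def bij_betw_def W.drw_target_def pull_module_simps del: One_nat_def)
qed

lemma ver_pow_Vp: "ver_pow E m 1 j \<omega> = W.Vp m j \<omega>"
  by (induction j) (simp_all del: One_nat_def)

lemma ver_pow_lam: "x \<in> carrier (Wn m) \<Longrightarrow> ver_pow E m 0 j (lam E m x) = lam E (m + j) (VW m j x)"
proof (induction j)
  case (Suc j)
  then show ?case using E.ver_lam[of "VW m j x" "m + j"] by simp
qed simp

end

theorem corollary4p10:
  fixes p n :: nat and k :: "'k ring" and E :: "(nat \<Rightarrow> 'k, 'u) witt_data"
  assumes "prime p" and "odd p"
    and "perfect_ring p k"
    and "is_de_rham_witt p (Wk p k) E"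
    and "n \<ge> 2"
  shows "\<exists>f. module_iso (Wk p k)
               (pair_module (Wk_Omega p k) (pi_module {1..n} (M_module p k)))
               (drw1_module p k E (n + 1)) f \<and>
             (\<forall>\<alpha>0 \<in> carrier (Wk_Omega p k).
              \<forall>\<alpha> \<in> {1..n} \<rightarrow> carrier (Wk_Omega p k).
              \<forall>a \<in> {1..n} \<rightarrow> carrier (Wk p k).
                f (\<alpha>0, \<lambda>j\<in>{1..n}. M_class p k j (\<alpha> j) (a j)) =
                  s_phi_Omega p k E (n + 1) \<alpha>0 \<oplus>\<^bsub>drw1_module p k E (n + 1)\<^esub>
                  (\<Oplus>\<^bsub>drw1_module p k E (n + 1)\<^esub>j\<in>{1..n}. V_dV p k E (n + 1) j (\<alpha> j) (a j)))"
proof -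
  note Wk = frob_lift_Wk[OF assms(1-3)]
  interpret frob_witt_complex "Wk p k" p "Wk_frob p k" E
  proof (intro frob_witt_complex.intro frob_aut.intro frob_aut_axioms.intro frob_witt_complex_axioms.intro Wk)
    show "witt_complex p (Wk p k) E" using assms(4) by (simp add: is_de_rham_witt_def)
  qed
  have Om: "Wk_Omega p k = \<Omega>" by (rule Wk_Omega_def)
  have twisted_mod: "twisted_module p k j = twisted_mod j" for j by (simp add: twisted_module_def twisted_mod_def Om)
  have h: "h_map p k j = h_elt j" for j by (intro ext) (simp add: h_map_def h_elt_def Om)
  have M: "M_module p k = M_quot" by (intro ext) (simp add: M_module_def M_quot_def twisted_mod h)
  have M_cls: "M_class p k = M_cls" by (intro ext) (simp add: M_class_def M_cls_def twisted_mod h)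
  have s: "s_phi p k = sec" by (intro ext) (simp add: s_phi_def sec_def)
  have sN: "s_phi_Omega p k E = W.sN" by (intro ext) (simp add: s_phi_Omega_def W.sN_def Let_def s)
  have drw_target: "drw1_module p k E (n + 1) = W.drw_target n"
    unfolding drw1_module_def W.drw_target_def by (simp add: pull_module_def deg1_module_def s)
  \<comment> \<open>\<open>V_dV\<close> is indexed by the level \<open>n + 1\<close> of the result,
    \<open>T\<close> by the level \<open>Suc n - j\<close> at which \<open>s_phi\<close> is
    taken.\<close>
  have T: "V_dV p k E (n + 1) j \<alpha> a = W.T (Suc n - j) j \<alpha> a" if "j \<in> {1..n}" "\<alpha> \<in> carrier \<Omega>" "a \<in> carrier (Wk p k)" for j \<alpha> a
  proof -
    have "Suc n - j + j = Suc n" using that(1) by simp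
    then show ?thesis
      unfolding V_dV_def W.T_def s sN Suc_eq_plus1[symmetric] using that(3) ver_pow_lam[of "sec (Suc n - j) a" "Suc n - j" j]
      by (simp add: ver_pow_Vp deg1_module_simps del: One_nat_def)
  qed
  show ?thesis
  proof (intro exI[of _ "W.drw_map n"] conjI ballI)
    show "module_iso (Wk p k) (pair_module (Wk_Omega p k) (pi_module {1..n} (M_module p k))) (drw1_module p k E (n + 1)) (W.drw_map n)"
      using drw_map_iso[OF assms(4), of n] unfolding drw_target M Om W.drw_source_def .
  next
    fix \<alpha>0 \<alpha> a
    assume a: "\<alpha>0 \<in> carrier (Wk_Omega p k)" "\<alpha> \<in> {1..n} \<rightarrow> carrier (Wk_Omega p k)" "a \<in> {1..n} \<rightarrow> carrier (Wk p k)"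
    have "(\<Oplus>\<^bsub>N (Suc n)\<^esub>j\<in>{1..n}. W.T (Suc n - j) j (\<alpha> j) (a j)) = (\<Oplus>\<^bsub>N (Suc n)\<^esub>j\<in>{1..n}. V_dV p k E (n + 1) j (\<alpha> j) (a j))"
    proof (rule W.N.M.finsum_cong')
      fix j assume j: "j \<in> {1..n}"
      then show "W.T (Suc n - j) j (\<alpha> j) (a j) = V_dV p k E (n + 1) j (\<alpha> j) (a j)"
        using a T[OF j] by (simp add: Om Pi_iff)
    next
      show "(\<lambda>j. V_dV p k E (n + 1) j (\<alpha> j) (a j)) \<in> {1..n} \<rightarrow> carrier (N (Suc n))"
      proof
        fix j assume j: "j \<in> {1..n}"
        then have "Suc n - j + j = Suc n" "\<alpha> j \<in> carrier \<Omega>" "a j \<in> carrier (Wk p k)" using a by (auto simp: Om)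
        then show "V_dV p k E (n + 1) j (\<alpha> j) (a j) \<in> carrier (N (Suc n))"
          using T[OF j] W.T_closed[of "\<alpha> j" "a j" "Suc n - j" j] by simp
      qed
    qed simp
    then show "W.drw_map n (\<alpha>0, \<lambda>j\<in>{1..n}. M_class p k j (\<alpha> j) (a j)) =
        s_phi_Omega p k E (n + 1) \<alpha>0 \<oplus>\<^bsub>drw1_module p k E (n + 1)\<^esub>
        (\<Oplus>\<^bsub>drw1_module p k E (n + 1)\<^esub>j\<in>{1..n}. V_dV p k E (n + 1) j (\<alpha> j) (a j))"
      unfolding drw_target M_cls sN using W.drw_map_M_cls[of \<alpha>0 \<alpha> n a] a[unfolded Om]
      by (simp add: W.drw_target_def pull_module_simps finsum_pull_module)
  qed
qed

end
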